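(* Let $f\colon M\to \mathbb{R}^4$ be an oriented, umbilic-free superconformal surface with nowhere-vanishing mean curvature vector field. The following are equivalent: (i) The surface $f$ is isotropically isothermic. (ii) There exists a conformal mean-directional curvature line parametrization around every point of $M$. (iii) Locally (i.e. in a neighbourhood of every point of $M$), the surface $f$ admits a nontrivial infinitesimal isometric deformation that preserves parallelly in the normal bundle the mean curvature vector field, and preserves the holomorphicity of a Gauss lift of $f$.
   Context: **Setting.** $M$ is a connected, oriented 2-dimensional Riemannian manifold and a surface $f\colon M\to\mathbb{R}^4$ is an isometric immersion. $N_fM$ is the normal bundle with induced metric and orientation, $\nabla^\perp$ its normal connection, $\alpha$ the second fundamental form, $H=\frac12\mathrm{trace}\,\alpha$ the mean curvature vector field, $K$ the Gaussian curvature, $K_N=\langle R^\perp(e_1,e_2)e_4,e_3\rangle$ the normal curvature ($\{e_1,e_2\}$, $\{e_3,e_4\}$ positively oriented orthonormal frames of $TM$, $N_fM$), and $J$, $J^\perp$ the rotations by $+\pi/2$ in $TM$, $N_fM$. Statements with $\pm$ are for each choice of sign, taken consistently. **Pseudo-umbilic points.** The curvature ellipse at $p$ is $\mathcal{E}_f(p)=\{\alpha(X,X): X\in T_pM,\|X\|=1\}\subset N_fM(p)$. $p$ is pseudo-umbilic if $\mathcal{E}_f(p)$ is a circle (possibly a point), equivalently $\|H\|^2-K=|K_N|$ at $p$; it is umbilic if $\mathcal{E}_f(p)$ is a point. $M_0(f)$ is the set of pseudo-umbilic points and $M_0^\pm(f)=\{p\in M_0(f):\pm K_N(p)\ge 0\}$.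 $f$ is superconformal if $M_0(f)=M$. **Mixed connection forms and isotropic isothermicity.** Let $\{e_1,e_2\}$ be a positively oriented local orthonormal frame on an open subset of $M\smallsetminus M_0^\pm(f)$, $\alpha_{kl}=\alpha(e_k,e_l)$. The vector field $\frac{\alpha_{11}-\alpha_{22}}2\pm J^\perp\alpha_{12}$ is nowhere zero there; let $e_3^\pm$ be its normalization, $e_4^\pm=J^\perp e_3^\pm$, $\omega_{12}=\langle\nabla e_1,e_2\rangle$, $\omega_{34}^\pm=\langle\nabla^\perp e_3^\pm,e_4^\pm\rangle$. The 1-form $\Omega^\pm=2\omega_{12}\pm\omega_{34}^\pm$ does not depend on the frame and is globally defined on $M\smallsetminus M_0^\pm(f)$. $\star$ is the Hodge star ($\star\omega_1=\omega_2$, $\star\omega_2=-\omega_1$). $f$ is $\pm$ isotropically isothermic if $M_0^\pm(f)=\emptyset$ and $d\star\Omega^\pm=0$ on $M$; it is isotropically isothermic if this holds for at least one sign. **Mean-directional curvature lines.** A mean-directional curvature line is a curve on $M$ tangent at every point to a unit vector field $X$ such that $\alpha(X,X)$ is parallel to $H$. A conformal mean-directional curvature line parametrization is a complex chart $z=x+iy$ whose coordinate curves are mean-directional curvature lines. **Gauss lifts.** The twistor bundle of $\mathbb{R}^4$ is the set of pairs $(p,\tilde J)$, $\tilde J$ an orthogonal complex structure on $T_p\mathbb{R}^4$; its two components $\mathcal{Z}_+$, $\mathcal{Z}_-$ consist of the $\tilde J$ inducing the positive, resp. negative, orientation. The metric $g_t$ on $\mathcal{Z}_\pm$ makes $\mathcal{Z}_\pm$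 isometric to $\mathbb{R}^4\times\mathbb{S}^2(t)$. The Gauss lift $G_\pm\colon M\to\mathcal{Z}_\pm$ of $f$ is $G_\pm(p)=(f(p),\tilde J_\pm)$ with $\tilde J_\pm=f_*\circ J$ on $f_*T_pM$ and $\tilde J_\pm=\pm J^\perp$ on $N_fM(p)$. Its induced metric is $G_\pm^*(g_t)=ds^2+\frac{t^2}{4}\left((\omega_{13}\mp\omega_{24})^2+(\omega_{23}\pm\omega_{14})^2\right)$, where $\omega_{kl}$ are the connection forms of a positively oriented adapted orthonormal frame. $G_\pm$ is called holomorphic if it is holomorphic with respect to the (Atiyah–Hitchin–Singer) almost complex structure $\mathcal{J}_+$ on $\mathcal{Z}_\pm$; this is known to be equivalent to $f$ being superconformal with $\pm K_N\ge0$. (Thus for $f$ as in the claim exactly one Gauss lift is holomorphic.) For a deformation $f_t$ of $f$ with Gauss lifts $G_\pm(t)$, the deformation preserves the holomorphicity of the holomorphic Gauss lift $G_\pm$ if $\delta\, \big(G_\pm(t)^*g_1\big)=0$, with $\delta=\frac{d}{dt}|_{t=0}$. **Infinitesimal isometric deformations.** A bending field of $f$ is a section $\mathcal{T}$ of $f^*(T\mathbb{R}^4)$ with $\langle\tilde\nabla_X\mathcal{T},f_*Y\rangle+\langle f_*X,\tilde\nabla_Y\mathcal{T}\rangle=0$ for all $X,Y\in TM$. It determines the infinitesimal isometric deformation $f_t=f+t\mathcal{T}$, $t$ in a small interval $I\ni0$; $M_t$ denotes $M$ with the metric induced by $f_t$. $\mathcal{T}$ is trivial if $\mathcal{T}=Af+v$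 with $A$ a constant skew-symmetric $4\times4$ matrix and $v\in\mathbb{R}^4$ constant. The deformation is nontrivial if its bending field is nontrivial on an open dense subset, in the sense that it is not trivial on any nonempty open subset. The deformation preserves the mean curvature vector field parallelly in the normal bundle if around every point there is a local orthonormal frame field $\{e_3(t),e_4(t)\}$ of $N_{f_t}M_t$, smooth in $t$, with $\delta\omega_{34}(t)=0$ (where $\omega_{34}(t)=\langle\nabla^{\perp}e_3(t),e_4(t)\rangle$ for $f_t$) and $\delta\langle H_{f_t},e_a(t)\rangle=0$, $a=3,4$. *)

theory Defs
  imports "HOL-Analysis.Analysis"
begin

section \<open>Smooth maps and oriented smooth surfaces\<close>

abbreviation dir_deriv ::
  "('a::real_normed_vector \<Rightarrow> 'b::real_normed_vector) \<Rightarrow> 'a \<Rightarrow> 'a \<Rightarrow> 'b"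
  where "dir_deriv h u v \<equiv> frechet_derivative h (at u) v"

text \<open>Intended for open \<open>S\<close> in a finite-dimensional space, where continuity of all iterated
  directional derivatives up to order \<open>k\<close> is the usual notion of class \<open>C\<^sup>k\<close>.\<close>

primrec Ck_on :: "nat \<Rightarrow> ('a::real_normed_vector \<Rightarrow> 'b::real_normed_vector) \<Rightarrow> 'a set \<Rightarrow> bool"
  where
    "Ck_on 0 h S \<longleftrightarrow> continuous_on S h"
  | "Ck_on (Suc k) h S \<longleftrightarrow>
       (\<forall>x\<in>S. h differentiable (at x)) \<and> (\<forall>v. Ck_on k (\<lambda>x. dir_deriv h x v) S)"

definition smooth_on ::
  "'a::real_normed_vector set \<Rightarrow> ('a \<Rightarrow> 'b::real_normed_vector) \<Rightarrow> bool"
  where "smooth_on S h \<longleftrightarrow> (\<forall>k. Ck_on k h S)"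

type_synonym 'a chart = "'a set \<times> ('a \<Rightarrow> real^2)"

abbreviation cdom :: "'a chart \<Rightarrow> 'a set" where "cdom c \<equiv> fst c"
abbreviation cmap :: "'a chart \<Rightarrow> 'a \<Rightarrow> real^2" where "cmap c \<equiv> snd c"
abbreviation cinv :: "'a chart \<Rightarrow> real^2 \<Rightarrow> 'a" where "cinv c \<equiv> inv_into (cdom c) (cmap c)"

abbreviation in_chart :: "'a chart \<Rightarrow> ('a \<Rightarrow> 'b) \<Rightarrow> real^2 \<Rightarrow> 'b"
  where "in_chart c h \<equiv> (\<lambda>u. h (cinv c u))"

definition is_chart :: "'a::topological_space chart \<Rightarrow> bool"
  where "is_chart c \<longleftrightarrow>
    open (cdom c) \<and> open (cmap c ` cdom c) \<and>
    homeomorphism (cdom c) (cmap c ` cdom c) (cmap c) (cinv c)"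

definition oriented_atlas :: "'a::topological_space chart set \<Rightarrow> bool"
  where "oriented_atlas A \<longleftrightarrow>
    (\<forall>c\<in>A. is_chart c) \<and>
    (\<forall>c\<in>A. \<forall>d\<in>A.
      smooth_on (cmap c ` (cdom c \<inter> cdom d)) (in_chart c (cmap d)) \<and>
      (\<forall>u\<in>cmap c ` (cdom c \<inter> cdom d).
        0 < det (matrix (frechet_derivative (in_chart c (cmap d)) (at u)))))"

definition carrier :: "'a chart set \<Rightarrow> 'a set"
  where "carrier A = (\<Union>c\<in>A. cdom c)"

definition smooth_map_on ::
  "'a chart set \<Rightarrow> 'a set \<Rightarrow> ('a \<Rightarrow> 'b::real_normed_vector) \<Rightarrow> bool"
  where "smooth_map_on A V h \<longleftrightarrow>
    (\<forall>c\<in>A. smooth_on (cmap c ` (cdom c \<inter> V)) (in_chart c h))"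

section \<open>Extrinsic geometry of a parametrized surface\<close>

text \<open>In this section \<open>F\<close> is a coordinate representation \<open>f \<circ> \<phi>\<inverse>\<close> of an immersion into
  \<open>\<real>\<^sup>4\<close>, and \<open>u\<close> a point of the open set \<open>\<phi>(U)\<close>.  The surface carries the metric induced by
  \<open>F\<close>, so that \<open>F\<close> is isometric.  Tangent vectors of the surface are represented by their
  coordinate vectors \<open>v\<close>; thus \<open>f\<^sub>* v\<close> is \<open>dir_deriv F u v\<close>.\<close>

type_synonym psurf = "real^2 \<Rightarrow> real^4"

abbreviation dx :: "real^2" where "dx \<equiv> axis 1 1"
abbreviation dy :: "real^2" where "dy \<equiv> axis 2 1"

definition metric :: "psurf \<Rightarrow> real^2 \<Rightarrow> real^2 \<Rightarrow> real^2 \<Rightarrow> real"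
  where "metric F u v w = dir_deriv F u v \<bullet> dir_deriv F u w"

definition normal_space :: "psurf \<Rightarrow> real^2 \<Rightarrow> (real^4) set"
  where "normal_space F u = {\<xi>. \<forall>v. \<xi> \<bullet> dir_deriv F u v = 0}"

definition nproj :: "psurf \<Rightarrow> real^2 \<Rightarrow> real^4 \<Rightarrow> real^4"
  where "nproj F u y = (THE \<xi>. \<xi> \<in> normal_space F u \<and> (\<exists>v. y = dir_deriv F u v + \<xi>))"

text \<open>\<open>second_ff F u v w\<close> is the normal part of the flat derivative of the field \<open>f\<^sub>* w\<close>, \<open>w\<close> being
  extended with constant coordinates.\<close>

definition second_ff :: "psurf \<Rightarrow> real^2 \<Rightarrow> real^2 \<Rightarrow> real^2 \<Rightarrow> real^4"
  where "second_ff F u v w = nproj F u (dir_deriv (\<lambda>x. dir_deriv F x w) u v)"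

definition pos_tangent_frame :: "psurf \<Rightarrow> real^2 \<Rightarrow> real^2 \<Rightarrow> real^2 \<Rightarrow> bool"
  where "pos_tangent_frame F u e1 e2 \<longleftrightarrow>
    metric F u e1 e1 = 1 \<and> metric F u e2 e2 = 1 \<and> metric F u e1 e2 = 0 \<and>
    0 < det (vector [e1, e2] :: real^2^2)"

definition normal_frame :: "psurf \<Rightarrow> real^2 \<Rightarrow> real^4 \<Rightarrow> real^4 \<Rightarrow> bool"
  where "normal_frame F u e3 e4 \<longleftrightarrow>
    e3 \<in> normal_space F u \<and> e4 \<in> normal_space F u \<and>
    norm e3 = 1 \<and> norm e4 = 1 \<and> e3 \<bullet> e4 = 0"

text \<open>The normal bundle is oriented so that tangent followed by normal orientation is the standard
  orientation of \<open>\<real>\<^sup>4\<close>.\<close>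

definition pos_normal_frame :: "psurf \<Rightarrow> real^2 \<Rightarrow> real^4 \<Rightarrow> real^4 \<Rightarrow> bool"
  where "pos_normal_frame F u e3 e4 \<longleftrightarrow>
    normal_frame F u e3 e4 \<and>
    0 < det (vector [dir_deriv F u dx, dir_deriv F u dy, e3, e4] :: real^4^4)"

definition rotT :: "psurf \<Rightarrow> real^2 \<Rightarrow> real^2 \<Rightarrow> real^2"
  where "rotT F u v = (THE w. metric F u v w = 0 \<and> metric F u w w = metric F u v v \<and>
    0 \<le> det (vector [v, w] :: real^2^2))"

definition rotN :: "psurf \<Rightarrow> real^2 \<Rightarrow> real^4 \<Rightarrow> real^4"
  where "rotN F u \<xi> = (THE \<eta>. \<eta> \<in> normal_space F u \<and> \<xi> \<bullet> \<eta> = 0 \<and> norm \<eta> = norm \<xi> \<and>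
    0 \<le> det (vector [dir_deriv F u dx, dir_deriv F u dy, \<xi>, \<eta>] :: real^4^4))"

definition mean_curv :: "psurf \<Rightarrow> real^2 \<Rightarrow> real^4"
  where "mean_curv F u = (THE h. \<forall>e1 e2. pos_tangent_frame F u e1 e2 \<longrightarrow>
    h = (1/2) *\<^sub>R (second_ff F u e1 e1 + second_ff F u e2 e2))"

definition normal_conn :: "psurf \<Rightarrow> (real^2 \<Rightarrow> real^4) \<Rightarrow> real^2 \<Rightarrow> real^2 \<Rightarrow> real^4"
  where "normal_conn F \<xi> u v = nproj F u (dir_deriv \<xi> u v)"

text \<open>\<open>R\<^sup>\<bottom>(v, w)\<xi>\<close>; the vectors \<open>v, w\<close> are extended with constant coordinates, so the bracket term
  vanishes.\<close>

definition normal_curv_tensor ::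
  "psurf \<Rightarrow> (real^2 \<Rightarrow> real^4) \<Rightarrow> real^2 \<Rightarrow> real^2 \<Rightarrow> real^2 \<Rightarrow> real^4"
  where "normal_curv_tensor F \<xi> u v w =
    normal_conn F (\<lambda>x. normal_conn F \<xi> x w) u v - normal_conn F (\<lambda>x. normal_conn F \<xi> x v) u w"

text \<open>The normal vector \<open>e4\<close> at \<open>u\<close> is extended to the normal field \<open>\<lambda>x. nproj F x e4\<close>;
  \<open>R\<^sup>\<bottom>\<close> is tensorial, so the extension does not matter.\<close>

definition normal_curvature :: "psurf \<Rightarrow> real^2 \<Rightarrow> real"
  where "normal_curvature F u = (THE k. \<forall>e1 e2 e3 e4.
    pos_tangent_frame F u e1 e2 \<and> pos_normal_frame F u e3 e4 \<longrightarrow>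
    k = normal_curv_tensor F (\<lambda>x. nproj F x e4) u e1 e2 \<bullet> e3)"

definition curvature_ellipse :: "psurf \<Rightarrow> real^2 \<Rightarrow> (real^4) set"
  where "curvature_ellipse F u = {second_ff F u v v | v. metric F u v v = 1}"

definition pseudo_umbilic_at :: "psurf \<Rightarrow> real^2 \<Rightarrow> bool"
  where "pseudo_umbilic_at F u \<longleftrightarrow>
    (\<exists>c\<in>normal_space F u. \<exists>r\<ge>0.
      curvature_ellipse F u = {\<xi> \<in> normal_space F u. dist c \<xi> = r})"

definition umbilic_at :: "psurf \<Rightarrow> real^2 \<Rightarrow> bool"
  where "umbilic_at F u \<longleftrightarrow> (\<exists>c. curvature_ellipse F u = {c})"

section \<open>Mixed connection forms\<close>

text \<open>The sign \<open>s = 1\<close> or \<open>s = - 1\<close> is the sign in \<open>\<Omega>\<^sup>\<plusminus>\<close>, \<open>M\<^sub>0\<^sup>\<plusminus>\<close>, and so on.\<close>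

definition e3_field ::
  "psurf \<Rightarrow> real \<Rightarrow> (real^2 \<Rightarrow> real^2) \<Rightarrow> (real^2 \<Rightarrow> real^2) \<Rightarrow> real^2 \<Rightarrow> real^4"
  where "e3_field F s e1 e2 u = sgn
    ((1/2) *\<^sub>R (second_ff F u (e1 u) (e1 u) - second_ff F u (e2 u) (e2 u)) +
     s *\<^sub>R rotN F u (second_ff F u (e1 u) (e2 u)))"

text \<open>By the Gauss formula the Levi-Civita connection of the induced metric is the tangential part
  of the flat derivative.\<close>

definition omega12 ::
  "psurf \<Rightarrow> (real^2 \<Rightarrow> real^2) \<Rightarrow> (real^2 \<Rightarrow> real^2) \<Rightarrow> real^2 \<Rightarrow> real^2 \<Rightarrow> real"
  where "omega12 F e1 e2 u v = dir_deriv (\<lambda>x. dir_deriv F x (e1 x)) u v \<bullet> dir_deriv F u (e2 u)"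

definition omega34 ::
  "psurf \<Rightarrow> (real^2 \<Rightarrow> real^4) \<Rightarrow> (real^2 \<Rightarrow> real^4) \<Rightarrow> real^2 \<Rightarrow> real^2 \<Rightarrow> real"
  where "omega34 F e3 e4 u v = normal_conn F e3 u v \<bullet> e4 u"

definition mixed_form ::
  "psurf \<Rightarrow> real \<Rightarrow> (real^2 \<Rightarrow> real^2) \<Rightarrow> (real^2 \<Rightarrow> real^2) \<Rightarrow> real^2 \<Rightarrow> real^2 \<Rightarrow> real"
  where "mixed_form F s e1 e2 u v =
    2 * omega12 F e1 e2 u v +
    s * omega34 F (e3_field F s e1 e2) (\<lambda>x. rotN F x (e3_field F s e1 e2 x)) u v"

text \<open>The convention \<open>\<star>\<omega>\<^sub>1 = \<omega>\<^sub>2\<close>, \<open>\<star>\<omega>\<^sub>2 = -\<omega>\<^sub>1\<close> says \<open>\<star>\<eta> = -\<eta> \<circ> J\<close>.\<close>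

definition hodge_star ::
  "psurf \<Rightarrow> (real^2 \<Rightarrow> real^2 \<Rightarrow> real) \<Rightarrow> real^2 \<Rightarrow> real^2 \<Rightarrow> real"
  where "hodge_star F \<eta> u v = - \<eta> u (rotT F u v)"

definition ext_deriv ::
  "(real^2 \<Rightarrow> real^2 \<Rightarrow> real) \<Rightarrow> real^2 \<Rightarrow> real^2 \<Rightarrow> real^2 \<Rightarrow> real"
  where "ext_deriv \<eta> u v w = dir_deriv (\<lambda>x. \<eta> x w) u v - dir_deriv (\<lambda>x. \<eta> x v) u w"

section \<open>Gauss lifts\<close>

text \<open>The twistor bundle of \<open>\<real>\<^sup>4\<close> consists of the pairs \<open>(y, L)\<close> with \<open>L\<close> an orthogonal complex
  structure, written as a matrix; it is a subset of \<open>\<real>\<^sup>4 \<times> \<real>\<^bsup>4\<times>4\<^esup>\<close>.\<close>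

definition gauss_lift :: "psurf \<Rightarrow> real \<Rightarrow> real^2 \<Rightarrow> (real^4) \<times> (real^4^4)"
  where "gauss_lift F s u = (F u,
    THE L. (\<forall>v. L *v dir_deriv F u v = dir_deriv F u (rotT F u v)) \<and>
           (\<forall>\<xi>\<in>normal_space F u. L *v \<xi> = s *\<^sub>R rotN F u \<xi>))"

text \<open>The inner product of \<open>real^4^4\<close> is the Frobenius product, for which the orthogonal complex
  structures have norm \<open>2\<close>.  The factor is normalised so that the pullback by the Gauss lift is
  \<open>ds\<^sup>2 + t\<^sup>2/4 ((\<omega>\<^sub>1\<^sub>3 \<mp> \<omega>\<^sub>2\<^sub>4)\<^sup>2 + (\<omega>\<^sub>2\<^sub>3 \<plusminus> \<omega>\<^sub>1\<^sub>4)\<^sup>2)\<close>.\<close>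

definition twistor_metric ::
  "real \<Rightarrow> (real^4) \<times> (real^4^4) \<Rightarrow> (real^4) \<times> (real^4^4) \<Rightarrow> real"
  where "twistor_metric t X Y = fst X \<bullet> fst Y + t\<^sup>2 / 16 * (snd X \<bullet> snd Y)"

definition gauss_lift_metric :: "psurf \<Rightarrow> real \<Rightarrow> real \<Rightarrow> real^2 \<Rightarrow> real^2 \<Rightarrow> real^2 \<Rightarrow> real"
  where "gauss_lift_metric F s t u v w =
    twistor_metric t (dir_deriv (gauss_lift F s) u v) (dir_deriv (gauss_lift F s) u w)"

text \<open>The Atiyah--Hitchin--Singer structure at \<open>(y, L)\<close>: \<open>L\<close> itself on the horizontal space
  \<open>T\<^sub>y\<real>\<^sup>4\<close>, and \<open>B \<mapsto> L B\<close> on the tangent space of the fibre.\<close>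

definition AHS :: "(real^4) \<times> (real^4^4) \<Rightarrow> (real^4) \<times> (real^4^4) \<Rightarrow> (real^4) \<times> (real^4^4)"
  where "AHS z X = (snd z *v fst X, snd z ** snd X)"

definition gauss_lift_holomorphic_at :: "psurf \<Rightarrow> real \<Rightarrow> real^2 \<Rightarrow> bool"
  where "gauss_lift_holomorphic_at F s u \<longleftrightarrow>
    (\<forall>v. dir_deriv (gauss_lift F s) u (rotT F u v) =
         AHS (gauss_lift F s u) (dir_deriv (gauss_lift F s) u v))"

section \<open>Surfaces in \<open>\<real>\<^sup>4\<close>\<close>

definition immersed_surface ::
  "'a::{t2_space,second_countable_topology} chart set \<Rightarrow> ('a \<Rightarrow> real^4) \<Rightarrow> bool"
  where "immersed_surface A f \<longleftrightarrow>
    oriented_atlas A \<and> connected (carrier A) \<and>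
    smooth_map_on A (carrier A) f \<and>
    (\<forall>c\<in>A. \<forall>u\<in>cmap c ` cdom c. inj (frechet_derivative (in_chart c f) (at u)))"

definition M0 :: "'a chart set \<Rightarrow> ('a \<Rightarrow> real^4) \<Rightarrow> 'a set"
  where "M0 A f = {p. \<exists>c\<in>A. p \<in> cdom c \<and> pseudo_umbilic_at (in_chart c f) (cmap c p)}"

definition M0_signed :: "'a chart set \<Rightarrow> ('a \<Rightarrow> real^4) \<Rightarrow> real \<Rightarrow> 'a set"
  where "M0_signed A f s = {p \<in> M0 A f.
    \<exists>c\<in>A. p \<in> cdom c \<and> 0 \<le> s * normal_curvature (in_chart c f) (cmap c p)}"

definition superconformal :: "'a chart set \<Rightarrow> ('a \<Rightarrow> real^4) \<Rightarrow> bool"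
  where "superconformal A f \<longleftrightarrow> M0 A f = carrier A"

definition umbilic_free :: "'a chart set \<Rightarrow> ('a \<Rightarrow> real^4) \<Rightarrow> bool"
  where "umbilic_free A f \<longleftrightarrow>
    (\<forall>c\<in>A. \<forall>p\<in>cdom c. \<not> umbilic_at (in_chart c f) (cmap c p))"

definition isotropically_isothermic_sign :: "'a chart set \<Rightarrow> ('a \<Rightarrow> real^4) \<Rightarrow> real \<Rightarrow> bool"
  where "isotropically_isothermic_sign A f s \<longleftrightarrow>
    M0_signed A f s = {} \<and>
    (\<forall>c\<in>A. \<forall>D e1 e2. let F = in_chart c f in
      open D \<and> D \<subseteq> cmap c ` cdom c \<and> smooth_on D e1 \<and> smooth_on D e2 \<and>
      (\<forall>u\<in>D. pos_tangent_frame F u (e1 u) (e2 u)) \<longrightarrow>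
      (\<forall>u\<in>D. \<forall>v w. ext_deriv (hodge_star F (mixed_form F s e1 e2)) u v w = 0))"

definition isotropically_isothermic :: "'a chart set \<Rightarrow> ('a \<Rightarrow> real^4) \<Rightarrow> bool"
  where "isotropically_isothermic A f \<longleftrightarrow>
    isotropically_isothermic_sign A f 1 \<or> isotropically_isothermic_sign A f (- 1)"

definition mean_directional_curvature_line :: "psurf \<Rightarrow> (real \<Rightarrow> real^2) \<Rightarrow> real set \<Rightarrow> bool"
  where "mean_directional_curvature_line F \<gamma> I \<longleftrightarrow>
    (\<forall>\<tau>\<in>I. \<exists>X k. metric F (\<gamma> \<tau>) X X = 1 \<and>
      second_ff F (\<gamma> \<tau>) X X \<in> span {mean_curv F (\<gamma> \<tau>)} \<and>
      k \<noteq> 0 \<and> (\<gamma> has_vector_derivative k *\<^sub>R X) (at \<tau>))"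

text \<open>The charts of the complex structure of the surface are the conformal charts compatible with
  its oriented atlas.\<close>

definition complex_chart :: "'a::topological_space chart set \<Rightarrow> ('a \<Rightarrow> real^4) \<Rightarrow> 'a chart \<Rightarrow> bool"
  where "complex_chart A f z \<longleftrightarrow>
    cdom z \<subseteq> carrier A \<and> oriented_atlas (insert z A) \<and>
    (\<forall>u\<in>cmap z ` cdom z.
      metric (in_chart z f) u dx dx = metric (in_chart z f) u dy dy \<and>
      metric (in_chart z f) u dx dy = 0)"

definition conformal_mean_directional_parametrization ::
  "'a::topological_space chart set \<Rightarrow> ('a \<Rightarrow> real^4) \<Rightarrow> 'a chart \<Rightarrow> bool"
  where "conformal_mean_directional_parametrization A f z \<longleftrightarrow>
    complex_chart A f z \<and>
    (\<forall>u\<in>cmap z ` cdom z. \<forall>d\<in>{dx, dy}.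
      mean_directional_curvature_line (in_chart z f)
        (\<lambda>\<tau>. u + \<tau> *\<^sub>R d) {\<tau>. u + \<tau> *\<^sub>R d \<in> cmap z ` cdom z})"

section \<open>Infinitesimal isometric deformations\<close>

definition bending_field_on ::
  "'a::topological_space chart set \<Rightarrow> ('a \<Rightarrow> real^4) \<Rightarrow> 'a set \<Rightarrow> ('a \<Rightarrow> real^4) \<Rightarrow> bool"
  where "bending_field_on A f V T \<longleftrightarrow>
    smooth_map_on A V T \<and>
    (\<forall>c\<in>A. \<forall>u\<in>cmap c ` (cdom c \<inter> V). \<forall>v w.
      dir_deriv (in_chart c T) u v \<bullet> dir_deriv (in_chart c f) u w +
      dir_deriv (in_chart c f) u v \<bullet> dir_deriv (in_chart c T) u w = 0)"

definition trivial_on :: "('a \<Rightarrow> real^4) \<Rightarrow> 'a set \<Rightarrow> ('a \<Rightarrow> real^4) \<Rightarrow> bool"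
  where "trivial_on f W T \<longleftrightarrow>
    (\<exists>(B::real^4^4) b. transpose B = - B \<and> (\<forall>q\<in>W. T q = B *v f q + b))"

definition nontrivial_on :: "('a::topological_space \<Rightarrow> real^4) \<Rightarrow> 'a set \<Rightarrow> ('a \<Rightarrow> real^4) \<Rightarrow> bool"
  where "nontrivial_on f V T \<longleftrightarrow>
    (\<forall>W. open W \<and> W \<noteq> {} \<and> W \<subseteq> V \<longrightarrow> \<not> trivial_on f W T)"

text \<open>The deformation \<open>f\<^sub>t = f + t \<T>\<close>.  For a bending field \<open>|df\<^sub>t X|\<^sup>2 = |df X|\<^sup>2 + t\<^sup>2 |d\<T> X|\<^sup>2\<close>,
  so every \<open>f\<^sub>t\<close> is an immersion.\<close>

definition deform :: "('a \<Rightarrow> real^4) \<Rightarrow> ('a \<Rightarrow> real^4) \<Rightarrow> real \<Rightarrow> 'a \<Rightarrow> real^4"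
  where "deform f T t q = f q + t *\<^sub>R T q"

text \<open>The frame field is required to be jointly smooth in the parameter and the point.\<close>

definition preserves_mean_curv_parallelly ::
  "'a::topological_space chart set \<Rightarrow> ('a \<Rightarrow> real^4) \<Rightarrow> 'a set \<Rightarrow> ('a \<Rightarrow> real^4) \<Rightarrow> bool"
  where "preserves_mean_curv_parallelly A f V T \<longleftrightarrow>
    (\<forall>q\<in>V. \<exists>W. open W \<and> q \<in> W \<and> W \<subseteq> V \<and>
      (\<exists>\<epsilon>>0. \<exists>e3 e4 :: real \<Rightarrow> 'a \<Rightarrow> real^4. \<forall>c\<in>A.
        (let D = cmap c ` (cdom c \<inter> W); F = (\<lambda>t. in_chart c (deform f T t)) in
          smooth_on ({-\<epsilon><..<\<epsilon>} \<times> D) (\<lambda>(t, u). in_chart c (e3 t) u) \<and>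
          smooth_on ({-\<epsilon><..<\<epsilon>} \<times> D) (\<lambda>(t, u). in_chart c (e4 t) u) \<and>
          (\<forall>t\<in>{-\<epsilon><..<\<epsilon>}. \<forall>u\<in>D.
            normal_frame (F t) u (in_chart c (e3 t) u) (in_chart c (e4 t) u)) \<and>
          (\<forall>u\<in>D.
            (\<forall>v. ((\<lambda>t. omega34 (F t) (in_chart c (e3 t)) (in_chart c (e4 t)) u v)
                    has_real_derivative 0) (at 0)) \<and>
            ((\<lambda>t. mean_curv (F t) u \<bullet> in_chart c (e3 t) u) has_real_derivative 0) (at 0) \<and>
            ((\<lambda>t. mean_curv (F t) u \<bullet> in_chart c (e4 t) u) has_real_derivative 0) (at 0)))))"

definition gauss_lift_holomorphic :: "'a chart set \<Rightarrow> ('a \<Rightarrow> real^4) \<Rightarrow> real \<Rightarrow> bool"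
  where "gauss_lift_holomorphic A f s \<longleftrightarrow>
    (\<forall>c\<in>A. \<forall>u\<in>cmap c ` cdom c. gauss_lift_holomorphic_at (in_chart c f) s u)"

definition preserves_gauss_lift_holomorphicity ::
  "'a chart set \<Rightarrow> ('a \<Rightarrow> real^4) \<Rightarrow> 'a set \<Rightarrow> ('a \<Rightarrow> real^4) \<Rightarrow> real \<Rightarrow> bool"
  where "preserves_gauss_lift_holomorphicity A f V T s \<longleftrightarrow>
    gauss_lift_holomorphic A f s \<and>
    (\<forall>c\<in>A. \<forall>u\<in>cmap c ` (cdom c \<inter> V). \<forall>v w.
      ((\<lambda>t. gauss_lift_metric (in_chart c (deform f T t)) s 1 u v w)
         has_real_derivative 0) (at 0))"

end

theory Submission
  imports Defs
begin

text \<open>Identify \<open>\<real>\<^sup>4\<close> with the quaternions, where \<open>i j = s k\<close> and \<open>s = \<plusminus>1\<close> is the sign of \<open>K\<^sub>N\<close>.  The left normal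
  \<open>N\<close>, defined by \<open>df \<circ> J = N df\<close>, represents the Gauss lift of sign \<open>s\<close>, and superconformality says
  \<open>\<alpha>12 = N \<alpha>0\<close> with \<open>\<alpha>0 = (\<alpha>11 - \<alpha>22) / 2\<close>.  Each of the three conditions is equivalent to the local existence of a map
  \<open>l\<close> into the imaginary quaternions with \<open>df \<and> dl = 0\<close> whose derivative vanishes on no open set.

  Necessarily \<open>dl = \<c> E1 df \<c> E1 \<zeta>\<close> with \<open>E1 = df(e1)\<close> and \<open>\<zeta> = - q N \<alpha>0 / |\<alpha>0|\<close>, and closedness of this form amounts to
  \<open>dq = q \<star>\<Omega>\<close>, where \<open>\<Omega>\<close> is the mixed connection form of sign \<open>- s\<close>.  So \<open>l\<close> exists iff \<open>\<star>\<Omega>\<close> is closed.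

  In conformal mean-directional coordinates \<open>\<zeta>\<close> can be taken to be \<open>- N H\<close> divided by the conformal factor.  Conversely,
  if \<open>\<star>\<Omega>\<close> is closed, then a function of \<open>q\<close>, \<open>|H|\<close> rescales the coframe of mean-directional lines to closed forms.

  If \<open>dT = df l\<close>, then \<open>d(f + t T) = df (1 + t l)\<close>, and right multiplication by \<open>1 + t l\<close> is conformal: it fixes \<open>N\<close> and carries
  frames to frames without first order change of the normal connection and of the components of \<open>H\<close>.  Conversely,
  a bending field preserving the metric of the Gauss lift induces a variation of \<open>N\<close>; since \<open>N\<close> is a conformal
  immersion into the sphere for \<open>H \<noteq> 0\<close>, this variation is an infinitesimal rotation, and after subtracting it the
  bending field has \<open>dT = df l\<close>.\<close>

section \<open>Calculus of smooth maps\<close>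

text \<open>The system for \<open>l\<close> collapses to a scalar one for this reason. A solution of
  df \<and> dl = 0 with imaginary values is determined by the normal field
  \<open>\<zeta> = E1 \<odot> dl(e1)\<close>. The exterior derivative of the form so determined has
  a tangential part, a multiple of \<alpha>0 \<bullet> \<zeta>; without umbilics it forces \<zeta>
  onto the line of N \<alpha>0. What remains are two normal equations, and these are the two frame
  components of the equation for \<open>q\<close>. Differentiating that equation gives only q
  d\<star>\<Omega> = 0, so d\<star>\<Omega> vanishes where q does not; this is where nontriviality
  on every nonempty open set enters. The equation df \<and> dl = 0 involves no frame and is
  invariant under changes of coordinates. Hence a dual map found in a chart or frame adapted to one
  condition can be used in any other, which is how the conditions are compared. The sign
  \<open>s\<close> is built into the quaternion product: for s = - 1 it is the opposite of
  Hamilton's. Replacing s by - s exchanges the two Gauss lifts, so a single computation with left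
  multiplications covers both. The sign itself is constant because the carrier is connected and has
  no umbilics.\<close>

lemma frechet_derivative_cong_open:
  assumes "open S" "x \<in> S" "\<And>y. y \<in> S \<Longrightarrow> f y = g y"
  shows "frechet_derivative f (at x) = frechet_derivative g (at x)"
proof -
  have "(f has_derivative f') (at x) \<longleftrightarrow> (g has_derivative f') (at x)" for f'
    using assms has_derivative_transform_within_open by metis
  then show ?thesis
    unfolding frechet_derivative_def by presburger
qed

lemma dir_deriv_eq:
  "(f has_derivative f') (at x) \<Longrightarrow> dir_deriv f x v = f' v"
  using frechet_derivative_at by metis

lemma Ck_on_cong:
  assumes "open S" "\<And>x. x \<in> S \<Longrightarrow> f x = g x"
  shows "Ck_on k f S \<longleftrightarrow> Ck_on k g S"
  using assms(2)
proof (induction k arbitrary: f g)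
  case 0
  then show ?case by (auto intro: continuous_on_cong)
next
  case (Suc k)
  have "f differentiable (at x) \<longleftrightarrow> g differentiable (at x)" if "x \<in> S" for x
    using that Suc.prems assms(1) has_derivative_transform_within_open
    unfolding differentiable_def by metis
  moreover have "Ck_on k (\<lambda>x. dir_deriv f x v) S \<longleftrightarrow> Ck_on k (\<lambda>x. dir_deriv g x v) S" for v
  proof (rule Suc.IH)
    show "dir_deriv f x v = dir_deriv g x v" if "x \<in> S" for x
      using frechet_derivative_cong_open[OF assms(1) that Suc.prems] by simp
  qed
  ultimately show ?case by auto
qed

text \<open>\<open>Ck_on\<close> is phrased with the chosen derivative
  \<open>frechet_derivative\<close>. This rule accepts any explicit derivative formula instead,
  which is how the closure properties below are proved by induction on \<open>k\<close>.\<close>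

lemma Ck_on_SucI:
  assumes "open S" "\<And>x. x \<in> S \<Longrightarrow> (f has_derivative f' x) (at x)"
    and "\<And>v. Ck_on k (\<lambda>x. f' x v) S"
  shows "Ck_on (Suc k) f S"
proof -
  have "Ck_on k (\<lambda>x. dir_deriv f x v) S \<longleftrightarrow> Ck_on k (\<lambda>x. f' x v) S" for v
    using assms(1,2) by (intro Ck_on_cong) (auto simp: dir_deriv_eq)
  then show ?thesis using assms by (auto simp: differentiable_def)
qed

lemma Ck_on_Suc_has_derivative:
  "Ck_on (Suc k) f S \<Longrightarrow> x \<in> S \<Longrightarrow> (f has_derivative frechet_derivative f (at x)) (at x)"
  using frechet_derivative_works by auto

lemma Ck_on_SucD: "Ck_on (Suc k) f S \<Longrightarrow> Ck_on k f S"
proof (induction k arbitrary: f)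
  case 0
  then show ?case
    using differentiable_imp_continuous_within continuous_at_imp_continuous_on
    by (metis Ck_on.simps)
next
  case (Suc k)
  then show ?case by simp
qed

lemma Ck_on_subset: "Ck_on k f S \<Longrightarrow> T \<subseteq> S \<Longrightarrow> Ck_on k f T"
  by (induction k arbitrary: f) (auto intro: continuous_on_subset)

lemma Ck_on_const: "Ck_on k (\<lambda>x. c) S"
  by (induction k arbitrary: c) (auto simp: frechet_derivative_const)

lemma Ck_on_bounded_linear:
  assumes "bounded_linear L" "open S" "Ck_on k f S"
  shows "Ck_on k (\<lambda>x. L (f x)) S"
  using assms(3)
proof (induction k arbitrary: f)
  case 0
  then show ?case using assms(1) by (auto intro: bounded_linear.continuous_on)
next
  case (Suc k)
  show ?case
    by (rule Ck_on_SucI[OF assms(2) bounded_linear.has_derivative[OF assms(1)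
          Ck_on_Suc_has_derivative[OF Suc.prems]]])
      (use Suc in auto)
qed

lemma Ck_on_id: "open S \<Longrightarrow> Ck_on k (\<lambda>x. x) S"
  by (cases k) (auto simp: Ck_on_const intro!: continuous_on_id Ck_on_SucI[where f' = "\<lambda>x v. v"] has_derivative_ident)

lemma Ck_on_add:
  assumes "open S" "Ck_on k f S" "Ck_on k g S"
  shows "Ck_on k (\<lambda>x. f x + g x) S"
  using assms(2,3)
proof (induction k arbitrary: f g)
  case 0
  then show ?case by (auto intro: continuous_on_add)
next
  case (Suc k)
  show ?case
    by (rule Ck_on_SucI[OF assms(1) has_derivative_add[OF
          Ck_on_Suc_has_derivative[OF Suc.prems(1)] Ck_on_Suc_has_derivative[OF Suc.prems(2)]]])
      (use Suc in auto)
qed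

lemma Ck_on_sum:
  assumes "open S" "\<And>i. i \<in> I \<Longrightarrow> Ck_on k (f i) S"
  shows "Ck_on k (\<lambda>x. \<Sum>i\<in>I. f i x) S"
  using assms(2)
  by (induction I rule: infinite_finite_induct) (auto simp: Ck_on_const intro!: Ck_on_add assms(1))

lemma Ck_on_bilinear:
  assumes "bounded_bilinear B" "open S" "Ck_on k f S" "Ck_on k g S"
  shows "Ck_on k (\<lambda>x. B (f x) (g x)) S"
  using assms(3,4)
proof (induction k arbitrary: f g)
  case 0
  then show ?case using assms(1) by (auto intro: bounded_bilinear.continuous_on)
next
  case (Suc k)
  show ?case
    by (rule Ck_on_SucI[OF assms(2) bounded_bilinear.FDERIV[OF assms(1)
          Ck_on_Suc_has_derivative[OF Suc.prems(1)] Ck_on_Suc_has_derivative[OF Suc.prems(2)]]])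
      (use Suc.prems Suc.IH Ck_on_SucD[OF Suc.prems(1)] Ck_on_SucD[OF Suc.prems(2)]
        in \<open>auto intro!: Ck_on_add assms(2)\<close>)
qed

lemma Ck_on_Pair:
  assumes "open S" "Ck_on k f S" "Ck_on k g S"
  shows "Ck_on k (\<lambda>x. (f x, g x)) S"
  using assms(2,3)
proof (induction k arbitrary: f g)
  case 0
  then show ?case by (auto intro: continuous_on_Pair)
next
  case (Suc k)
  show ?case
    by (rule Ck_on_SucI[OF assms(1) has_derivative_Pair[OF
          Ck_on_Suc_has_derivative[OF Suc.prems(1)] Ck_on_Suc_has_derivative[OF Suc.prems(2)]]])
      (use Suc in auto)
qed

lemma linear_euclidean_sum:
  fixes L :: "'a::euclidean_space \<Rightarrow> 'b::real_vector"
  assumes "linear L"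
  shows "L v = (\<Sum>b\<in>Basis. (v \<bullet> b) *\<^sub>R L b)"
  by (metis (no_types, lifting) assms euclidean_representation linear_scale linear_sum sum.cong)

text \<open>The chain rule differentiates \<open>g\<close> in a direction that varies with the
  point, whereas \<open>Ck_on\<close> controls fixed directions only. Expanding the direction in the
  basis of the intermediate space removes the mismatch.\<close>

lemma Ck_on_compose:
  fixes f :: "'a::real_normed_vector \<Rightarrow> 'b::euclidean_space"
  assumes "open S" "open T" "Ck_on k f S" "Ck_on k g T" "f ` S \<subseteq> T"
  shows "Ck_on k (\<lambda>x. g (f x)) S"
  using assms(3,4,5)
proof (induction k arbitrary: g)
  case 0
  then show ?case by (auto intro: continuous_on_compose2)
next
  case (Suc k)
  have df: "(f has_derivative frechet_derivative f (at x)) (at x)" if "x \<in> S" for x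
    using Ck_on_Suc_has_derivative[OF Suc.prems(1)] that .
  have dg: "(g has_derivative frechet_derivative g (at (f x))) (at (f x))" if "x \<in> S" for x
    using Ck_on_Suc_has_derivative[OF Suc.prems(2)] that Suc.prems(3) by blast
  have "((\<lambda>x. g (f x)) has_derivative
      (\<lambda>v. \<Sum>b\<in>Basis. (frechet_derivative f (at x) v \<bullet> b) *\<^sub>R dir_deriv g (f x) b)) (at x)"
    if "x \<in> S" for x
  proof -
    have "linear (frechet_derivative g (at (f x)))"
      using dg[OF that] has_derivative_linear by blast
    then have "(\<lambda>v. \<Sum>b\<in>Basis. (frechet_derivative f (at x) v \<bullet> b) *\<^sub>R dir_deriv g (f x) b)
        = (\<lambda>v. frechet_derivative g (at (f x)) (frechet_derivative f (at x) v))"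
      using linear_euclidean_sum by metis
    then show ?thesis
      using has_derivative_compose[OF df[OF that] dg[OF that]] by simp
  qed
  then show ?case
  proof (rule Ck_on_SucI[OF assms(1)])
    fix v
    show "Ck_on k (\<lambda>x. \<Sum>b\<in>Basis. (frechet_derivative f (at x) v \<bullet> b) *\<^sub>R dir_deriv g (f x) b) S"
    proof (intro Ck_on_sum assms(1) Ck_on_bilinear[OF bounded_bilinear_scaleR])
      fix b :: 'b
      show "Ck_on k (\<lambda>x. dir_deriv f x v \<bullet> b) S"
        using Suc.prems(1) assms(1)
        by (intro Ck_on_bounded_linear[where L = "\<lambda>y. y \<bullet> b"] bounded_linear_inner_left) auto
      show "Ck_on k (\<lambda>x. dir_deriv g (f x) b) S"
        using Suc.IH[OF Ck_on_SucD[OF Suc.prems(1)] _ Suc.prems(3)] Suc.prems(2) by auto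
    qed
  qed
qed

text \<open>The derivative is again an expression in the function itself, so the induction feeds on
  its own hypothesis; \<open>sqrt\<close> and \<open>exp\<close> follow the same pattern.\<close>

lemma Ck_on_inverse: "Ck_on k (inverse :: real \<Rightarrow> real) (- {0})"
proof (induction k)
  case 0
  then show ?case by (auto intro: continuous_on_inverse)
next
  case (Suc k)
  show ?case
  proof (rule Ck_on_SucI[where f' = "\<lambda>x v. - v * (inverse x * inverse x)"])
    show "(inverse has_derivative (\<lambda>v. - v * (inverse x * inverse x))) (at x)"
      if "x \<in> - {0}" for x :: real
      using that by (auto intro!: derivative_eq_intros)
    show "Ck_on k (\<lambda>x. - v * (inverse x * inverse x)) (- {0})" for v :: real
      by (intro Ck_on_bilinear[OF bounded_bilinear_mult] Ck_on_const Suc) auto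
  qed auto
qed

lemma Ck_on_sqrt: "Ck_on k sqrt {0<..}"
proof (induction k)
  case 0
  then show ?case by (auto intro: continuous_intros)
next
  case (Suc k)
  show ?case
  proof (rule Ck_on_SucI[where f' = "\<lambda>x v. v / 2 * inverse (sqrt x)"])
    show "(sqrt has_derivative (\<lambda>v. v / 2 * inverse (sqrt x))) (at x)" if "x \<in> {0<..}" for x :: real
      using that by (auto intro!: derivative_eq_intros simp: field_simps)
    show "Ck_on k (\<lambda>x. v / 2 * inverse (sqrt x)) {0<..}" for v :: real
      by (intro Ck_on_bilinear[OF bounded_bilinear_mult] Ck_on_const
          Ck_on_compose[OF _ _ _ Ck_on_inverse] Suc) auto
  qed auto
qed

lemma Ck_on_exp: "Ck_on k (exp :: real \<Rightarrow> real) UNIV"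
proof (induction k)
  case 0
  then show ?case by (auto intro: continuous_intros)
next
  case (Suc k)
  show ?case
  proof (rule Ck_on_SucI[where f' = "\<lambda>x v. exp x * v"])
    show "(exp has_derivative (\<lambda>v. exp x * v)) (at x)" for x :: real
      by (auto intro!: derivative_eq_intros)
    show "Ck_on k (\<lambda>x. exp x * v) UNIV" for v :: real
      by (intro Ck_on_bilinear[OF bounded_bilinear_mult] Ck_on_const Suc) auto
  qed auto
qed

lemma smooth_on_cong:
  "open S \<Longrightarrow> (\<And>x. x \<in> S \<Longrightarrow> f x = g x) \<Longrightarrow> smooth_on S f \<longleftrightarrow> smooth_on S g"
  unfolding smooth_on_def using Ck_on_cong by blast

lemma smooth_on_subset: "smooth_on S f \<Longrightarrow> T \<subseteq> S \<Longrightarrow> smooth_on T f"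
  unfolding smooth_on_def using Ck_on_subset by blast

lemma smooth_on_has_derivative:
  "smooth_on S f \<Longrightarrow> x \<in> S \<Longrightarrow> (f has_derivative frechet_derivative f (at x)) (at x)"
  unfolding smooth_on_def using Ck_on_Suc_has_derivative by blast

lemma smooth_on_linear_deriv:
  "smooth_on S f \<Longrightarrow> x \<in> S \<Longrightarrow> linear (frechet_derivative f (at x))"
  using smooth_on_has_derivative has_derivative_linear by blast

lemma smooth_on_continuous: "smooth_on S f \<Longrightarrow> continuous_on S f"
  unfolding smooth_on_def by (metis Ck_on.simps(1))

lemma smooth_onI:
  assumes "open S" "\<And>x. x \<in> S \<Longrightarrow> (f has_derivative f' x) (at x)"
    and "\<And>v. smooth_on S (\<lambda>x. f' x v)"
  shows "smooth_on S f"
  unfolding smooth_on_def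
proof
  fix k
  show "Ck_on k f S"
    using Ck_on_SucD[OF Ck_on_SucI[OF assms(1,2)]] assms(3) unfolding smooth_on_def by simp
qed

lemma smooth_on_const: "smooth_on S (\<lambda>x. c)"
  unfolding smooth_on_def by (simp add: Ck_on_const)

lemma smooth_on_ident: "open S \<Longrightarrow> smooth_on S (\<lambda>x. x)"
  unfolding smooth_on_def by (simp add: Ck_on_id)

lemma smooth_on_bounded_linear:
  "bounded_linear L \<Longrightarrow> open S \<Longrightarrow> smooth_on S f \<Longrightarrow> smooth_on S (\<lambda>x. L (f x))"
  unfolding smooth_on_def using Ck_on_bounded_linear by blast

lemma smooth_on_bilinear:
  "bounded_bilinear B \<Longrightarrow> open S \<Longrightarrow> smooth_on S f \<Longrightarrow> smooth_on S g \<Longrightarrow> smooth_on S (\<lambda>x. B (f x) (g x))"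
  unfolding smooth_on_def using Ck_on_bilinear by blast

lemma smooth_on_add:
  "open S \<Longrightarrow> smooth_on S f \<Longrightarrow> smooth_on S g \<Longrightarrow> smooth_on S (\<lambda>x. f x + g x)"
  unfolding smooth_on_def using Ck_on_add by blast

lemma smooth_on_sum:
  "open S \<Longrightarrow> (\<And>i. i \<in> I \<Longrightarrow> smooth_on S (f i)) \<Longrightarrow> smooth_on S (\<lambda>x. \<Sum>i\<in>I. f i x)"
  unfolding smooth_on_def by (simp add: Ck_on_sum)

lemma smooth_on_minus:
  "open S \<Longrightarrow> smooth_on S f \<Longrightarrow> smooth_on S (\<lambda>x. - f x)"
  using smooth_on_bounded_linear[OF bounded_linear_minus[OF bounded_linear_ident]] .

lemma smooth_on_diff:
  assumes "open S" "smooth_on S f" "smooth_on S g" shows "smooth_on S (\<lambda>x. f x - g x)"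
  using smooth_on_add[OF assms(1,2) smooth_on_minus[OF assms(1,3)]] by simp

lemma smooth_on_scaleR:
  "open S \<Longrightarrow> smooth_on S f \<Longrightarrow> smooth_on S g \<Longrightarrow> smooth_on S (\<lambda>x. f x *\<^sub>R g x)"
  using smooth_on_bilinear[OF bounded_bilinear_scaleR] .

lemma smooth_on_mult:
  "open S \<Longrightarrow> smooth_on S f \<Longrightarrow> smooth_on S g \<Longrightarrow> smooth_on S (\<lambda>x. f x * g x :: real)"
  using smooth_on_bilinear[OF bounded_bilinear_mult] .

lemma smooth_on_inner:
  "open S \<Longrightarrow> smooth_on S f \<Longrightarrow> smooth_on S g \<Longrightarrow> smooth_on S (\<lambda>x. f x \<bullet> g x)"
  using smooth_on_bilinear[OF bounded_bilinear_inner] .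

lemma smooth_on_Pair:
  "open S \<Longrightarrow> smooth_on S f \<Longrightarrow> smooth_on S g \<Longrightarrow> smooth_on S (\<lambda>x. (f x, g x))"
  unfolding smooth_on_def using Ck_on_Pair by blast

lemma smooth_on_compose:
  fixes f :: "'a::real_normed_vector \<Rightarrow> 'b::euclidean_space"
  shows "open S \<Longrightarrow> open T \<Longrightarrow> smooth_on S f \<Longrightarrow> smooth_on T g \<Longrightarrow> f ` S \<subseteq> T \<Longrightarrow>
    smooth_on S (\<lambda>x. g (f x))"
  unfolding smooth_on_def using Ck_on_compose by blast

lemma smooth_on_nth:
  "open S \<Longrightarrow> smooth_on S f \<Longrightarrow> smooth_on S (\<lambda>x. (f x :: real^'n) $ i)"
  using smooth_on_bounded_linear[OF bounded_linear_vec_nth] .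

lemma smooth_on_inverse:
  "open S \<Longrightarrow> smooth_on S f \<Longrightarrow> (\<And>x. x \<in> S \<Longrightarrow> f x \<noteq> 0) \<Longrightarrow> smooth_on S (\<lambda>x. inverse (f x :: real))"
  by (rule smooth_on_compose[where T = "- {0}"]) (auto simp: smooth_on_def Ck_on_inverse)

lemma smooth_on_divide:
  assumes "open S" "smooth_on S f" "smooth_on S g" "\<And>x. x \<in> S \<Longrightarrow> g x \<noteq> 0"
  shows "smooth_on S (\<lambda>x. f x / g x :: real)"
  using smooth_on_mult[OF assms(1,2) smooth_on_inverse[OF assms(1,3,4)]] by (simp add: divide_inverse)

lemma smooth_on_sqrt:
  "open S \<Longrightarrow> smooth_on S f \<Longrightarrow> (\<And>x. x \<in> S \<Longrightarrow> 0 < f x) \<Longrightarrow> smooth_on S (\<lambda>x. sqrt (f x))"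
  by (rule smooth_on_compose[where T = "{0<..}"]) (auto simp: smooth_on_def Ck_on_sqrt)

lemma smooth_on_exp: "open S \<Longrightarrow> smooth_on S f \<Longrightarrow> smooth_on S (\<lambda>x. exp (f x :: real))"
  by (rule smooth_on_compose[where T = UNIV]) (auto simp: smooth_on_def Ck_on_exp)

lemma smooth_on_norm:
  fixes f :: "'a::real_normed_vector \<Rightarrow> 'b::real_inner"
  assumes "open S" "smooth_on S f" "\<And>x. x \<in> S \<Longrightarrow> f x \<noteq> 0"
  shows "smooth_on S (\<lambda>x. norm (f x))"
  unfolding norm_eq_sqrt_inner using assms by (intro smooth_on_sqrt smooth_on_inner) auto

lemma smooth_on_sgn:
  fixes f :: "'a::real_normed_vector \<Rightarrow> 'b::real_inner"
  assumes "open S" "smooth_on S f" "\<And>x. x \<in> S \<Longrightarrow> f x \<noteq> 0"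
  shows "smooth_on S (\<lambda>x. sgn (f x))"
  unfolding sgn_div_norm using assms
  by (intro smooth_on_scaleR smooth_on_inverse smooth_on_norm) auto

lemma smooth_on_dir_deriv: "smooth_on S f \<Longrightarrow> smooth_on S (\<lambda>x. dir_deriv f x v)"
  unfolding smooth_on_def by (metis Ck_on.simps(2))

lemma smooth_on_dir_deriv_field:
  fixes f :: "'a::euclidean_space \<Rightarrow> 'b::real_normed_vector"
  assumes "open S" "smooth_on S f" "smooth_on S e"
  shows "smooth_on S (\<lambda>x. dir_deriv f x (e x))"
proof -
  have "smooth_on S (\<lambda>x. \<Sum>b\<in>Basis. (e x \<bullet> b) *\<^sub>R dir_deriv f x b)"
    using assms by (intro smooth_on_sum smooth_on_scaleR smooth_on_inner smooth_on_dir_deriv smooth_on_const)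
  moreover have "dir_deriv f x (e x) = (\<Sum>b\<in>Basis. (e x \<bullet> b) *\<^sub>R dir_deriv f x b)" if "x \<in> S" for x
    using linear_euclidean_sum[OF smooth_on_linear_deriv[OF assms(2) that]] by blast
  ultimately show ?thesis
    using smooth_on_cong[OF assms(1)] by (metis (no_types, lifting))
qed

lemma smooth_on_vec2:
  assumes "open S" "smooth_on S f" "smooth_on S g"
  shows "smooth_on S (\<lambda>x. vector [f x, g x] :: real^2)"
proof -
  have "(vector [f x, g x] :: real^2) = f x *\<^sub>R axis 1 1 + g x *\<^sub>R axis 2 1" for x
    by (simp add: vec_eq_iff forall_2 axis_def)
  then show ?thesis
    using assms by (simp add: smooth_on_add smooth_on_scaleR smooth_on_const)
qed

lemmas smooth_intros = smooth_on_const smooth_on_ident smooth_on_add smooth_on_diff smooth_on_minus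
  smooth_on_scaleR smooth_on_mult smooth_on_inner smooth_on_nth smooth_on_dir_deriv_field smooth_on_Pair

lemma dir_deriv_eqI_open:
  assumes "open S" "x \<in> S" "\<And>y. y \<in> S \<Longrightarrow> f y = g y"
  shows "dir_deriv f x v = dir_deriv g x v"
  using frechet_derivative_cong_open[OF assms] by simp

lemma dir_deriv_bilinear:
  assumes "bounded_bilinear B" "smooth_on S f" "smooth_on S g" "x \<in> S"
  shows "dir_deriv (\<lambda>y. B (f y) (g y)) x v = B (f x) (dir_deriv g x v) + B (dir_deriv f x v) (g x)"
  by (rule dir_deriv_eq[OF bounded_bilinear.FDERIV[OF assms(1) smooth_on_has_derivative[OF assms(2,4)]
        smooth_on_has_derivative[OF assms(3,4)]]])

lemma dir_deriv_bounded_linear: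
  assumes "bounded_linear L" "smooth_on S f" "x \<in> S"
  shows "dir_deriv (\<lambda>y. L (f y)) x v = L (dir_deriv f x v)"
  by (rule dir_deriv_eq[OF bounded_linear.has_derivative[OF assms(1) smooth_on_has_derivative[OF assms(2,3)]]])

lemma dir_deriv_compose:
  assumes "smooth_on S f" "smooth_on T g" "x \<in> S" "f x \<in> T"
  shows "dir_deriv (\<lambda>y. g (f y)) x v = dir_deriv g (f x) (dir_deriv f x v)"
  by (rule dir_deriv_eq[OF has_derivative_compose[OF smooth_on_has_derivative[OF assms(1,3)]
        smooth_on_has_derivative[OF assms(2,4)]]])

lemma dir_deriv_add:
  assumes "smooth_on S f" "smooth_on S g" "x \<in> S"
  shows "dir_deriv (\<lambda>y. f y + g y) x v = dir_deriv f x v + dir_deriv g x v"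
  by (rule dir_deriv_eq[OF has_derivative_add[OF smooth_on_has_derivative[OF assms(1,3)]
        smooth_on_has_derivative[OF assms(2,3)]]])

lemma dir_deriv_diff:
  assumes "smooth_on S f" "smooth_on S g" "x \<in> S"
  shows "dir_deriv (\<lambda>y. f y - g y) x v = dir_deriv f x v - dir_deriv g x v"
  by (rule dir_deriv_eq[OF has_derivative_diff[OF smooth_on_has_derivative[OF assms(1,3)]
        smooth_on_has_derivative[OF assms(2,3)]]])

section \<open>Symmetry of second derivatives and the Poincare lemma\<close>

lemma mixed_difference_mean_value:
  fixes h :: "'a::real_normed_vector \<Rightarrow> real"
  assumes "open S" "smooth_on S h" "a > 0"
    and S: "\<And>r q. 0 \<le> r \<Longrightarrow> r \<le> a \<Longrightarrow> 0 \<le> q \<Longrightarrow> q \<le> a \<Longrightarrow> u + r *\<^sub>R v + q *\<^sub>R w \<in> S"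
  shows "\<exists>r q. 0 \<le> r \<and> r \<le> a \<and> 0 \<le> q \<and> q \<le> a \<and>
    h (u + a *\<^sub>R v + a *\<^sub>R w) - h (u + a *\<^sub>R v) - h (u + a *\<^sub>R w) + h u =
    a * a * dir_deriv (\<lambda>x. dir_deriv h x v) (u + r *\<^sub>R v + q *\<^sub>R w) w"
proof -
  \<comment> \<open>The second difference of \<open>h\<close> is the increment of \<open>g\<close>
    over the interval from 0 to \<open>a\<close>. The mean value theorem, applied along
    \<open>v\<close> and then along \<open>w\<close>, turns it into a mixed derivative.\<close>
  define g where "g r = h (u + r *\<^sub>R v + a *\<^sub>R w) - h (u + r *\<^sub>R v + 0 *\<^sub>R w)" for r
  have der: "((\<lambda>r. k (u + r *\<^sub>R v + q *\<^sub>R w)) has_real_derivative dir_deriv k (u + r *\<^sub>R v + q *\<^sub>R w) v) (at r)"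
    "((\<lambda>q. k (u + r *\<^sub>R v + q *\<^sub>R w)) has_real_derivative dir_deriv k (u + r *\<^sub>R v + q *\<^sub>R w) w) (at q)"
    if k: "smooth_on S k" and r: "0 \<le> r" "r \<le> a" "0 \<le> q" "q \<le> a" for k :: "'a \<Rightarrow> real" and r q
  proof -
    let ?p = "u + r *\<^sub>R v + q *\<^sub>R w"
    have d: "(k has_derivative frechet_derivative k (at ?p)) (at ?p)" and l: "linear (frechet_derivative k (at ?p))"
      using smooth_on_has_derivative[OF k S[OF r]] smooth_on_linear_deriv[OF k S[OF r]] by auto
    have "((\<lambda>r. k (u + r *\<^sub>R v + q *\<^sub>R w)) has_derivative (\<lambda>t. frechet_derivative k (at ?p) (t *\<^sub>R v))) (at r)"
      by (rule has_derivative_compose[where f = "\<lambda>r. u + r *\<^sub>R v + q *\<^sub>R w", OF _ d])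
        (auto intro!: derivative_eq_intros)
    then show "((\<lambda>r. k (u + r *\<^sub>R v + q *\<^sub>R w)) has_real_derivative dir_deriv k ?p v) (at r)"
      by (simp add: has_field_derivative_def linear_scale[OF l] mult_commute_abs)
    have "((\<lambda>q. k (u + r *\<^sub>R v + q *\<^sub>R w)) has_derivative (\<lambda>t. frechet_derivative k (at ?p) (t *\<^sub>R w))) (at q)"
      by (rule has_derivative_compose[where f = "\<lambda>q. u + r *\<^sub>R v + q *\<^sub>R w", OF _ d])
        (auto intro!: derivative_eq_intros)
    then show "((\<lambda>q. k (u + r *\<^sub>R v + q *\<^sub>R w)) has_real_derivative dir_deriv k ?p w) (at q)"
      by (simp add: has_field_derivative_def linear_scale[OF l] mult_commute_abs)
  qed
  have "\<exists>r. 0 < r \<and> r < a \<and> g a - g 0 = (a - 0) *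
     (dir_deriv h (u + r *\<^sub>R v + a *\<^sub>R w) v - dir_deriv h (u + r *\<^sub>R v + 0 *\<^sub>R w) v)"
    unfolding g_def
    by (rule MVT2) (use assms in \<open>auto intro!: DERIV_diff der(1)[OF assms(2)] simp del: scaleR_zero_left\<close>)
  then obtain r where r: "0 < r" "r < a" "g a - g 0 = a *
     (dir_deriv h (u + r *\<^sub>R v + a *\<^sub>R w) v - dir_deriv h (u + r *\<^sub>R v + 0 *\<^sub>R w) v)"
    by auto
  have "\<exists>q. 0 < q \<and> q < a \<and>
     dir_deriv h (u + r *\<^sub>R v + a *\<^sub>R w) v - dir_deriv h (u + r *\<^sub>R v + 0 *\<^sub>R w) v =
     (a - 0) * dir_deriv (\<lambda>x. dir_deriv h x v) (u + r *\<^sub>R v + q *\<^sub>R w) w"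
    by (rule MVT2) (use assms r in \<open>auto intro!: der(2) smooth_on_dir_deriv simp del: scaleR_zero_left\<close>)
  then obtain q where q: "0 < q" "q < a"
     "dir_deriv h (u + r *\<^sub>R v + a *\<^sub>R w) v - dir_deriv h (u + r *\<^sub>R v + 0 *\<^sub>R w) v =
     a * dir_deriv (\<lambda>x. dir_deriv h x v) (u + r *\<^sub>R v + q *\<^sub>R w) w"
    by auto
  then show ?thesis
    using r q(1,2) by (intro exI[of _ r] exI[of _ q]) (auto simp: g_def)
qed

text \<open>Both mixed derivatives are limits of the same second difference quotient.\<close>

lemma mixed_derivatives_commute_real:
  fixes h :: "'a::real_normed_vector \<Rightarrow> real"
  assumes "open S" "smooth_on S h" "u \<in> S"
  shows "dir_deriv (\<lambda>x. dir_deriv h x v) u w = dir_deriv (\<lambda>x. dir_deriv h x w) u v" (is "?P u = ?Q u")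
proof (rule ccontr)
  assume ne: "?P u \<noteq> ?Q u"
  define e where "e = \<bar>?P u - ?Q u\<bar> / 2"
  have "e > 0" using ne by (simp add: e_def)
  have "continuous (at u) ?P" "continuous (at u) ?Q"
    using smooth_on_continuous[OF smooth_on_dir_deriv[OF smooth_on_dir_deriv[OF assms(2)]]] assms
    by (simp_all add: continuous_on_eq_continuous_at)
  then obtain d1 d2 where d: "d1 > 0" "\<And>x. dist x u < d1 \<Longrightarrow> dist (?P x) (?P u) < e"
    "d2 > 0" "\<And>x. dist x u < d2 \<Longrightarrow> dist (?Q x) (?Q u) < e"
    unfolding continuous_at_eps_delta using \<open>e > 0\<close> by metis
  obtain d3 where d3: "d3 > 0" "ball u d3 \<subseteq> S"
    using assms openE by blast
  \<comment> \<open>The factor 2 and the summand 1 keep the whole parallelogram strictly inside all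
    three radii, also when \<open>v\<close> and \<open>w\<close> vanish.\<close>
  define a where "a = min d1 (min d2 d3) / (2 * (norm v + norm w + 1))"
  have a: "a > 0" using d d3 by (simp add: a_def add_nonneg_pos)
  have near: "norm (r *\<^sub>R v + q *\<^sub>R w) < min d1 (min d2 d3)"
    if "0 \<le> r" "r \<le> a" "0 \<le> q" "q \<le> a" for r q
  proof -
    have "norm (r *\<^sub>R v + q *\<^sub>R w) \<le> r * norm v + q * norm w"
      using norm_triangle_ineq[of "r *\<^sub>R v" "q *\<^sub>R w"] that by simp
    also have "\<dots> \<le> a * norm v + a * norm w"
      using that by (intro add_mono mult_right_mono) auto
    also have "\<dots> < a * (2 * (norm v + norm w + 1))"
    proof -
      have "0 \<le> a * norm v" "0 \<le> a * norm w" using a by simp_all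
      then show ?thesis using a unfolding distrib_left by linarith
    qed
    also have "\<dots> = min d1 (min d2 d3)"
      using norm_ge_zero[of v] norm_ge_zero[of w] unfolding a_def by (simp add: field_simps add_nonneg_eq_0_iff)
    finally show ?thesis .
  qed
  have near1: "dist (u + r *\<^sub>R v + q *\<^sub>R w) u < min d1 (min d2 d3)"
    if "0 \<le> r" "r \<le> a" "0 \<le> q" "q \<le> a" for r q
    using near[OF that] by (simp add: dist_norm add.assoc)
  have near2: "dist (u + r *\<^sub>R w + q *\<^sub>R v) u < min d1 (min d2 d3)"
    if "0 \<le> r" "r \<le> a" "0 \<le> q" "q \<le> a" for r q
    using near[OF that(3,4,1,2)] by (simp add: dist_norm add_ac)
  have S1: "u + r *\<^sub>R v + q *\<^sub>R w \<in> S" if "0 \<le> r" "r \<le> a" "0 \<le> q" "q \<le> a" for r q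
    using near1[OF that] d3(2) by (auto simp: dist_commute subset_iff)
  have S2: "u + r *\<^sub>R w + q *\<^sub>R v \<in> S" if "0 \<le> r" "r \<le> a" "0 \<le> q" "q \<le> a" for r q
    using near2[OF that] d3(2) by (auto simp: dist_commute subset_iff)
  obtain r q where 1: "0 \<le> r" "r \<le> a" "0 \<le> q" "q \<le> a"
    "h (u + a *\<^sub>R v + a *\<^sub>R w) - h (u + a *\<^sub>R v) - h (u + a *\<^sub>R w) + h u = a * a * ?P (u + r *\<^sub>R v + q *\<^sub>R w)"
    using mixed_difference_mean_value[OF assms(1,2) a S1] by blast
  obtain r' q' where 2: "0 \<le> r'" "r' \<le> a" "0 \<le> q'" "q' \<le> a"
    "h (u + a *\<^sub>R w + a *\<^sub>R v) - h (u + a *\<^sub>R w) - h (u + a *\<^sub>R v) + h u = a * a * ?Q (u + r' *\<^sub>R w + q' *\<^sub>R v)"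
    using mixed_difference_mean_value[OF assms(1,2) a S2] by blast
  have "h (u + a *\<^sub>R v + a *\<^sub>R w) = h (u + a *\<^sub>R w + a *\<^sub>R v)" by (simp add: add_ac)
  then have "a * a * ?P (u + r *\<^sub>R v + q *\<^sub>R w) = a * a * ?Q (u + r' *\<^sub>R w + q' *\<^sub>R v)"
    using 1(5) 2(5) by linarith
  then have "?P (u + r *\<^sub>R v + q *\<^sub>R w) = ?Q (u + r' *\<^sub>R w + q' *\<^sub>R v)" using a by simp
  moreover have "dist (?P (u + r *\<^sub>R v + q *\<^sub>R w)) (?P u) < e" "dist (?Q (u + r' *\<^sub>R w + q' *\<^sub>R v)) (?Q u) < e"
    using d near1[OF 1(1-4)] near2[OF 2(1-4)] by auto
  ultimately show False
    using e_def by (simp add: dist_real_def abs_if split: if_splits)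
qed

lemma mixed_derivatives_commute:
  fixes h :: "'a::real_normed_vector \<Rightarrow> 'b::euclidean_space"
  assumes "open S" "smooth_on S h" "u \<in> S"
  shows "dir_deriv (\<lambda>x. dir_deriv h x v) u w = dir_deriv (\<lambda>x. dir_deriv h x w) u v"
proof (rule euclidean_eqI)
  fix b :: 'b assume "b \<in> Basis"
  have bl: "bounded_linear (\<lambda>y. y \<bullet> b)" by (rule bounded_linear_inner_left)
  have sm: "smooth_on S (\<lambda>x. h x \<bullet> b)"
    using smooth_on_bounded_linear[OF bl assms(1,2)] .
  have *: "dir_deriv (\<lambda>x. dir_deriv h x v) u w \<bullet> b = dir_deriv (\<lambda>x. dir_deriv (\<lambda>x. h x \<bullet> b) x v) u w" for v w
  proof -
    have "dir_deriv (\<lambda>x. dir_deriv (\<lambda>x. h x \<bullet> b) x v) u w = dir_deriv (\<lambda>x. dir_deriv h x v \<bullet> b) u w"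
      by (rule dir_deriv_eqI_open[OF assms(1,3)]) (rule dir_deriv_bounded_linear[OF bl assms(2)])
    also have "\<dots> = dir_deriv (\<lambda>x. dir_deriv h x v) u w \<bullet> b"
      by (rule dir_deriv_bounded_linear[OF bl smooth_on_dir_deriv[OF assms(2)] assms(3)])
    finally show ?thesis by simp
  qed
  show "dir_deriv (\<lambda>x. dir_deriv h x v) u w \<bullet> b = dir_deriv (\<lambda>x. dir_deriv h x w) u v \<bullet> b"
    unfolding * using mixed_derivatives_commute_real[OF assms(1) sm assms(3)] .
qed

text \<open>The primitive is the integral of \<eta> along the segment from \<open>c\<close> to
  \<open>x\<close>. It is differentiated under the integral sign; closedness turns the integrand
  into the derivative in \<open>t\<close> of \<open>t *\<^sub>R \<eta> (p x t) v\<close>, so the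
  integral evaluates to \<open>\<eta> x v\<close>.\<close>

lemma poincare_lemma:
  fixes \<eta> :: "'a::euclidean_space \<Rightarrow> 'a \<Rightarrow> 'b::euclidean_space"
  assumes S: "open S" "convex S" "c \<in> S"
    and lin: "\<And>x. x \<in> S \<Longrightarrow> linear (\<eta> x)"
    and sm: "\<And>v. smooth_on S (\<lambda>x. \<eta> x v)"
    and closed: "\<And>x v w. x \<in> S \<Longrightarrow> dir_deriv (\<lambda>x. \<eta> x w) x v = dir_deriv (\<lambda>x. \<eta> x v) x w"
  obtains h where "smooth_on S h" "\<And>x. x \<in> S \<Longrightarrow> (h has_derivative \<eta> x) (at x)"
proof -
  define p where "p x t = c + t *\<^sub>R (x - c)" for x and t :: real
  define E where "E b x = dir_deriv (\<lambda>x. \<eta> x b) x" for b x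
  define f where "f x t = (\<Sum>b\<in>Basis. ((x - c) \<bullet> b) *\<^sub>R \<eta> (p x t) b)" for x t
  define fx' where "fx' x t v = (\<Sum>b\<in>Basis. ((x - c) \<bullet> b) *\<^sub>R (t *\<^sub>R E b (p x t) v) + (v \<bullet> b) *\<^sub>R \<eta> (p x t) b)"
    for x t v
  \<comment> \<open>\<open>fx'\<close> is the derivative of the integrand \<open>f x t\<close> in
    \<open>x\<close>; it is packaged as a bounded linear map because \<open>leibniz_rule\<close>
    expects one.\<close>
  define fx where "fx x t = Blinfun (fx' x t)" for x t
  define h where "h x = integral (cbox 0 1) (f x)" for x
  have pS: "p x t \<in> S" if "x \<in> S" "t \<in> {0..1}" for x t
  proof -
    have "(1 - t) *\<^sub>R c + t *\<^sub>R x \<in> S"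
      using that S by (intro convexD) auto
    then show ?thesis unfolding p_def by (simp add: algebra_simps)
  qed
  have derE: "((\<lambda>x. \<eta> x b) has_derivative E b x) (at x)" if "x \<in> S" for b x
    unfolding E_def using smooth_on_has_derivative[OF sm that] .
  have linE: "linear (E b x)" if "x \<in> S" for b x
    using derE[OF that] has_derivative_linear by blast
  have linfx: "linear (fx' x t)" if "x \<in> S" "t \<in> {0..1}" for x t
    unfolding fx'_def using linE[OF pS[OF that]]
    by (intro linearI) (simp_all add: linear_add linear_scale scaleR_add_right scaleR_add_left
        inner_add_left sum.distrib scaleR_sum_right mult_ac)
  have fx_app: "blinfun_apply (fx x t) = fx' x t" if "x \<in> S" "t \<in> {0..1}" for x t
    unfolding fx_def using linfx[OF that] linear_conv_bounded_linear bounded_linear_Blinfun_apply by blast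
  have derp: "((\<lambda>x. p x t) has_derivative (\<lambda>v. t *\<^sub>R v)) (at x)" for x t
    unfolding p_def by (auto intro!: derivative_eq_intros)
  have contp: "continuous_on X (\<lambda>z. p (fst z) (snd z))" for X
    unfolding p_def by (intro continuous_intros)
  have cont: "continuous_on (S \<times> cbox 0 1) (\<lambda>(x,t). fx x t)"
  proof (rule continuous_on_blinfun_componentwise)
    fix i :: 'a
    have c1: "continuous_on (S \<times> cbox 0 1) (\<lambda>z. E b (p (fst z) (snd z)) i)" for b
      unfolding E_def
      by (rule continuous_on_compose2[OF smooth_on_continuous[OF smooth_on_dir_deriv[OF sm]] contp])
        (use pS in auto)
    have c2: "continuous_on (S \<times> cbox 0 1) (\<lambda>z. \<eta> (p (fst z) (snd z)) b)" for b
      by (rule continuous_on_compose2[OF smooth_on_continuous[OF sm] contp]) (use pS in auto)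
    have "continuous_on (S \<times> cbox 0 1) (\<lambda>z. fx' (fst z) (snd z) i)"
      unfolding fx'_def by (intro continuous_intros c1 c2)
    then show "continuous_on (S \<times> cbox 0 1) (\<lambda>x. blinfun_apply (case x of (x, t) \<Rightarrow> fx x t) i)"
      by (rule continuous_on_eq) (auto simp: fx_app)
  qed
  have derf: "((\<lambda>x. f x t) has_derivative blinfun_apply (fx x t)) (at x within S)"
    if x: "x \<in> S" "t \<in> cbox 0 1" for x t
  proof -
    have t: "t \<in> {0..1}" using x by simp
    have *: "((\<lambda>x. \<eta> (p x t) b) has_derivative (\<lambda>v. E b (p x t) (t *\<^sub>R v))) (at x)" for b
      by (rule has_derivative_compose[where f = "\<lambda>x. p x t", OF derp derE[OF pS[OF x(1) t]]])
    have "((\<lambda>x. f x t) has_derivative fx' x t) (at x)"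
      unfolding f_def
      by (auto intro!: derivative_eq_intros * simp: fx'_def[abs_def] linear_scale[OF linE[OF pS[OF x(1) t]]])
    then show ?thesis
      unfolding fx_app[OF x(1) t] by (rule has_derivative_at_withinI)
  qed
  have contf: "continuous_on {0..1} (f x)" if "x \<in> S" for x
  proof -
    have "continuous_on {0..1} (\<lambda>t. \<eta> (p x t) b)" for b
      by (rule continuous_on_compose2[OF smooth_on_continuous[OF sm]])
        (use pS[OF that] in \<open>auto simp: p_def intro!: continuous_intros\<close>)
    then show ?thesis unfolding f_def by (intro continuous_intros)
  qed
  have int: "f x integrable_on cbox 0 1" if "x \<in> S" for x
    using integrable_continuous_real[OF contf[OF that]] by simp
  have derh: "(h has_derivative \<eta> x) (at x)" if x: "x \<in> S" for x
  proof -
    have "(h has_derivative integral (cbox 0 1) (fx x)) (at x within S)"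
      unfolding h_def by (rule leibniz_rule[OF derf int cont x S(2)])
    moreover have "blinfun_apply (integral (cbox 0 1) (fx x)) v = \<eta> x v" for v
    proof -
      have cfx: "continuous_on (cbox 0 1) (fx x)"
      proof -
        have "continuous_on (cbox 0 1) (\<lambda>t. (\<lambda>(x,t). fx x t) (x, t))"
          by (rule continuous_on_compose2[OF cont]) (use x in \<open>auto intro!: continuous_intros\<close>)
        then show ?thesis by simp
      qed
      have "blinfun_apply (integral (cbox 0 1) (fx x)) v = integral (cbox 0 1) (\<lambda>t. fx x t v)"
        by (rule blinfun_apply_integral[OF integrable_continuous[OF cfx]])
      also have "\<dots> = integral {0..1} (\<lambda>t. t *\<^sub>R E v (p x t) (x - c) + \<eta> (p x t) v)"
      proof (subst cbox_interval, rule integral_cong)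
        fix t :: real assume t: "t \<in> {0..1}"
        have "fx x t v = (\<Sum>b\<in>Basis. ((x - c) \<bullet> b) *\<^sub>R (t *\<^sub>R E v (p x t) b)) + (\<Sum>b\<in>Basis. (v \<bullet> b) *\<^sub>R \<eta> (p x t) b)"
          unfolding fx_app[OF x t] fx'_def sum.distrib E_def using closed[OF pS[OF x t]] by simp
        also have "\<dots> = t *\<^sub>R E v (p x t) (x - c) + \<eta> (p x t) v"
          unfolding linear_euclidean_sum[OF linE[OF pS[OF x t]], of v "x - c"]
            linear_euclidean_sum[OF lin[OF pS[OF x t]], of v]
          by (simp add: scaleR_sum_right mult.commute)
        finally show "fx x t v = t *\<^sub>R E v (p x t) (x - c) + \<eta> (p x t) v" .
      qed
      also have "\<dots> = 1 *\<^sub>R \<eta> (p x 1) v - 0 *\<^sub>R \<eta> (p x 0) v"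
      proof (rule integral_unique[OF fundamental_theorem_of_calculus])
        fix t :: real assume t: "t \<in> {0..1}"
        have "((\<lambda>t. p x t) has_derivative (\<lambda>s. s *\<^sub>R (x - c))) (at t)"
          unfolding p_def by (auto intro!: derivative_eq_intros)
        then have "((\<lambda>t. \<eta> (p x t) v) has_derivative (\<lambda>s. E v (p x t) (s *\<^sub>R (x - c)))) (at t)"
          by (rule has_derivative_compose[where f = "\<lambda>t. p x t"]) (rule derE[OF pS[OF x t]])
        then have "((\<lambda>t. \<eta> (p x t) v) has_vector_derivative E v (p x t) (x - c)) (at t)"
          by (simp add: has_vector_derivative_def linear_scale[OF linE[OF pS[OF x t]]])
        then show "((\<lambda>t. t *\<^sub>R \<eta> (p x t) v) has_vector_derivative t *\<^sub>R E v (p x t) (x - c) + \<eta> (p x t) v) (at t within {0..1})"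
          by (auto intro!: derivative_eq_intros intro: has_vector_derivative_at_within)
      qed simp
      finally show ?thesis by (simp add: p_def)
    qed
    ultimately have "(h has_derivative \<eta> x) (at x within S)"
      using has_derivative_eq_rhs by blast
    then show ?thesis using at_within_open[OF x S(1)] by simp
  qed
  show ?thesis
    by (rule that[OF smooth_onI[OF S(1) derh sm] derh])
qed

section \<open>Linear algebra of the plane and smooth inverse functions\<close>

lemma det_2_rows: "det (vector [v, w] :: real^2^2) = v$1 * w$2 - v$2 * w$1"
  by (simp add: det_2 mult.commute)

lemma vec2_expand: "v = v$1 *\<^sub>R dx + v$2 *\<^sub>R dy" for v :: "real^2"
  by (simp add: vec_eq_iff forall_2 axis_def)

lemma linear_vec2:
  fixes L :: "real^2 \<Rightarrow> 'b::real_vector"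
  assumes "linear L"
  shows "L v = v$1 *\<^sub>R L dx + v$2 *\<^sub>R L dy"
proof -
  have "L v = L (v$1 *\<^sub>R dx + v$2 *\<^sub>R dy)" using vec2_expand[of v] by simp
  then show ?thesis by (simp add: linear_add[OF assms] linear_scale[OF assms])
qed

text \<open>Bootstrapping: Cramer's rule writes the derivative of \<open>g\<close> as a smooth
  function \<open>\<Phi> v\<close> composed with \<open>g\<close> itself, so class \<open>k\<close>
  of \<open>g\<close> gives class \<open>k\<close> of its derivative.\<close>

lemma smooth_on_inverse_map:
  fixes \<psi> :: "real^2 \<Rightarrow> real^2"
  assumes "open U" "open V" "smooth_on U \<psi>" "homeomorphism U V \<psi> g"
    and dg: "\<And>y. y \<in> V \<Longrightarrow> (g has_derivative g' y) (at y)"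
    and inv: "\<And>y v. y \<in> V \<Longrightarrow> dir_deriv \<psi> (g y) (g' y v) = v"
  shows "smooth_on V g"
proof -
  define d where "d x = dir_deriv \<psi> x dx $ 1 * dir_deriv \<psi> x dy $ 2 - dir_deriv \<psi> x dx $ 2 * dir_deriv \<psi> x dy $ 1" for x
  define \<Phi> where "\<Phi> v x = (vector [(v$1 * dir_deriv \<psi> x dy $ 2 - v$2 * dir_deriv \<psi> x dy $ 1) / d x,
      (v$2 * dir_deriv \<psi> x dx $ 1 - v$1 * dir_deriv \<psi> x dx $ 2) / d x] :: real^2)" for v :: "real^2" and x
  have gU: "g y \<in> U" if "y \<in> V" for y
    using assms(4) that unfolding homeomorphism_def by blast
  have im: "g ` V = U" using assms(4) unfolding homeomorphism_def by blast
  have solve: "d (g y) \<noteq> 0 \<and> g' y v = \<Phi> v (g y)" if "y \<in> V" for y v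
  proof -
    define L where "L = dir_deriv \<psi> (g y)"
    have "linear L" unfolding L_def using smooth_on_linear_deriv[OF assms(3) gU[OF that]] .
    then have L: "L w = w$1 *\<^sub>R L dx + w$2 *\<^sub>R L dy" for w by (rule linear_vec2)
    have e: "w$1 = (g' y w)$1 * (L dx)$1 + (g' y w)$2 * (L dy)$1"
      "w$2 = (g' y w)$1 * (L dx)$2 + (g' y w)$2 * (L dy)$2" for w
      using inv[OF that, of w] L[of "g' y w"] unfolding L_def by (auto simp: vec_eq_iff)
    have det: "((g' y dx)$1 * (g' y dy)$2 - (g' y dx)$2 * (g' y dy)$1) * d (g y) = 1"
    proof -
      have "((g' y dx)$1 * (g' y dy)$2 - (g' y dx)$2 * (g' y dy)$1) *
          ((L dx)$1 * (L dy)$2 - (L dx)$2 * (L dy)$1) = dx$1 * dy$2 - dx$2 * dy$1"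
        unfolding e[of dx] e[of dy] by algebra
      then show ?thesis by (simp add: d_def L_def axis_def)
    qed
    then have nz: "d (g y) \<noteq> 0" by auto
    have "d (g y) * (g' y v)$1 = v$1 * (L dy)$2 - v$2 * (L dy)$1"
      "d (g y) * (g' y v)$2 = v$2 * (L dx)$1 - v$1 * (L dx)$2"
      unfolding e[of v] d_def L_def by algebra+
    then show ?thesis
      using nz by (simp add: vec_eq_iff forall_2 \<Phi>_def L_def nonzero_eq_divide_eq mult.commute)
  qed
  have sd: "smooth_on U d" unfolding d_def using assms(1,3) by (intro smooth_intros)
  have d0: "d x \<noteq> 0" if "x \<in> U" for x using solve im that by blast
  have s\<Phi>: "smooth_on U (\<Phi> v)" for v
    unfolding \<Phi>_def using assms(1,3) sd d0 by (intro smooth_on_vec2 smooth_on_divide smooth_intros)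
  have "Ck_on k g V" for k
  proof (induction k)
    case 0
    then show ?case using assms(4) by (simp add: homeomorphism_def)
  next
    case (Suc k)
    show ?case
    proof (rule Ck_on_SucI[OF assms(2)])
      show "(g has_derivative (\<lambda>v. \<Phi> v (g y))) (at y)" if "y \<in> V" for y
        using dg[OF that] solve[OF that] by (metis (no_types, lifting) ext)
      show "Ck_on k (\<lambda>y. \<Phi> v (g y)) V" for v
        by (rule Ck_on_compose[OF assms(2,1) Suc]) (use s\<Phi> im in \<open>auto simp: smooth_on_def\<close>)
    qed
  qed
  then show ?thesis unfolding smooth_on_def by blast
qed

lemma smooth_inverse_function_theorem:
  fixes \<psi> :: "real^2 \<Rightarrow> real^2"
  assumes "open S" "smooth_on S \<psi>" "u \<in> S"
    and nz: "det (vector [dir_deriv \<psi> u dx, dir_deriv \<psi> u dy] :: real^2^2) \<noteq> 0"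
  obtains U V g where "open U" "u \<in> U" "U \<subseteq> S" "open V" "homeomorphism U V \<psi> g" "smooth_on V g"
proof -
  define D where "D x = Blinfun (dir_deriv \<psi> x)" for x
  have Dapp: "blinfun_apply (D x) = dir_deriv \<psi> x" if "x \<in> S" for x
    unfolding D_def using smooth_on_linear_deriv[OF assms(2) that]
      linear_conv_bounded_linear bounded_linear_Blinfun_apply by blast
  have der: "(\<psi> has_derivative blinfun_apply (D x)) (at x)" if "x \<in> S" for x
    unfolding Dapp[OF that] by (rule smooth_on_has_derivative[OF assms(2) that])
  have cont: "continuous_on S D"
  proof (rule continuous_on_blinfun_componentwise)
    fix i :: "real^2"
    show "continuous_on S (\<lambda>x. blinfun_apply (D x) i)"
      using smooth_on_continuous[OF smooth_on_dir_deriv[OF assms(2), of i]]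
      by (rule continuous_on_eq) (auto simp: Dapp)
  qed
  define L where "L = dir_deriv \<psi> u"
  have "linear L" unfolding L_def using smooth_on_linear_deriv[OF assms(2,3)] .
  then have Lv: "L w = w$1 *\<^sub>R L dx + w$2 *\<^sub>R L dy" for w by (rule linear_vec2)
  define \<delta> where "\<delta> = (L dx)$1 * (L dy)$2 - (L dx)$2 * (L dy)$1"
  have \<delta>: "\<delta> \<noteq> 0" using nz unfolding L_def[symmetric] \<delta>_def det_2_rows by simp
  \<comment> \<open>The left inverse of \<open>L\<close> by Cramer's rule, in the form required by
    \<open>inverse_function_theorem\<close>.\<close>
  define M where "M v = (vector [(v$1 * (L dy)$2 - v$2 * (L dy)$1) / \<delta>, (v$2 * (L dx)$1 - v$1 * (L dx)$2) / \<delta>] :: real^2)"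
    for v :: "real^2"
  have "linear M" unfolding M_def
    using \<delta> by (intro linearI) (simp_all add: vec_eq_iff forall_2 divide_simps, simp_all add: algebra_simps)
  then have Mb: "blinfun_apply (Blinfun M) = M"
    using linear_conv_bounded_linear bounded_linear_Blinfun_apply by blast
  have "M (L v) = v" for v
    using \<delta> unfolding Lv[of v] M_def
    by (simp add: vec_eq_iff forall_2 field_simps) (simp add: \<delta>_def algebra_simps)
  then have inv: "Blinfun M o\<^sub>L D u = id_blinfun"
    using Dapp[OF assms(3)] Mb by (auto intro!: blinfun_eqI simp: L_def)
  obtain U V g g' where o: "open U" "U \<subseteq> S" "u \<in> U" "open V" "\<psi> u \<in> V" "homeomorphism U V \<psi> g"
    "\<And>y. y \<in> V \<Longrightarrow> (g has_derivative (g' y)) (at y)"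
    "\<And>y. y \<in> V \<Longrightarrow> g' y = inv (blinfun_apply (D (g y)))"
    "\<And>y. y \<in> V \<Longrightarrow> bij (blinfun_apply (D (g y)))"
    using inverse_function_theorem[OF assms(1) der cont assms(3) inv] by metis
  have "smooth_on V g"
  proof (rule smooth_on_inverse_map[OF o(1,4) smooth_on_subset[OF assms(2) o(2)] o(6,7)])
    fix y v assume "y \<in> V"
    then have "g y \<in> S" using o(2,6) unfolding homeomorphism_def by blast
    then show "dir_deriv \<psi> (g y) (g' y v) = v"
      using o(8,9)[OF \<open>y \<in> V\<close>] Dapp by (metis bij_inv_eq_iff)
  qed
  then show ?thesis using that o by blast
qed

lemma dir_deriv_zero_constant:
  fixes h :: "'a::real_normed_vector \<Rightarrow> 'b::real_normed_vector"
  assumes "open S" "convex S" "smooth_on S h" "\<And>x v. x \<in> S \<Longrightarrow> dir_deriv h x v = 0"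
  shows "\<exists>c. \<forall>x\<in>S. h x = c"
proof -
  have "(h has_derivative (\<lambda>h. 0)) (at x within S)" if "x \<in> S" for x
    using smooth_on_has_derivative[OF assms(3) that] assms(4)[OF that]
    by (metis (no_types, lifting) ext has_derivative_at_withinI)
  then show ?thesis using has_derivative_zero_constant[OF assms(2)] by blast
qed

section \<open>Quaternions\<close>

lemma vector_4 [simp]:
  "(vector [a, b, c, d] :: 'a::zero^4) $ 1 = a"
  "(vector [a, b, c, d] :: 'a::zero^4) $ 2 = b"
  "(vector [a, b, c, d] :: 'a::zero^4) $ 3 = c"
  "(vector [a, b, c, d] :: 'a::zero^4) $ 4 = d"
  unfolding vector_def by simp_all

lemma det_4:
  "det (A :: real^4^4) =
    A$1$1 * (A$2$2 * (A$3$3 * A$4$4 - A$3$4 * A$4$3) - A$2$3 * (A$3$2 * A$4$4 - A$3$4 * A$4$2)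
      + A$2$4 * (A$3$2 * A$4$3 - A$3$3 * A$4$2))
    - A$1$2 * (A$2$1 * (A$3$3 * A$4$4 - A$3$4 * A$4$3) - A$2$3 * (A$3$1 * A$4$4 - A$3$4 * A$4$1)
      + A$2$4 * (A$3$1 * A$4$3 - A$3$3 * A$4$1))
    + A$1$3 * (A$2$1 * (A$3$2 * A$4$4 - A$3$4 * A$4$2) - A$2$2 * (A$3$1 * A$4$4 - A$3$4 * A$4$1)
      + A$2$4 * (A$3$1 * A$4$2 - A$3$2 * A$4$1))
    - A$1$4 * (A$2$1 * (A$3$2 * A$4$3 - A$3$3 * A$4$2) - A$2$2 * (A$3$1 * A$4$3 - A$3$3 * A$4$1)
      + A$2$3 * (A$3$1 * A$4$2 - A$3$2 * A$4$1))"
proof -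
  have f1234: "finite {2::4, 3, 4}" "1 \<notin> {2::4, 3, 4}" by auto
  have f34: "finite {3::4, 4}" "2 \<notin> {3::4, 4}" by auto
  have f4: "finite {4::4}" "3 \<notin> {4::4}" by auto
  show ?thesis
    unfolding det_def UNIV_4
    unfolding sum_over_permutations_insert[OF f1234]
    unfolding sum_over_permutations_insert[OF f34]
    unfolding sum_over_permutations_insert[OF f4]
    unfolding permutes_sing
    by (simp add: sign_swap_id permutation_swap_id sign_compose sign_id transpose_eq_iff Transposition.transpose_def algebra_simps
      permutation_compose)
qed

text \<open>Hamilton's product for s = 1 and the opposite product for s = - 1. Left multiplications
  by imaginary units thereby give the orthogonal complex structures of one orientation or of the
  other, and one computation serves both signs.\<close>

definition quat_mult :: "real \<Rightarrow> real^4 \<Rightarrow> real^4 \<Rightarrow> real^4"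
  where "quat_mult s a b = vector
    [a$1 * b$1 - a$2 * b$2 - a$3 * b$3 - a$4 * b$4,
     a$1 * b$2 + a$2 * b$1 + s * (a$3 * b$4 - a$4 * b$3),
     a$1 * b$3 + a$3 * b$1 + s * (a$4 * b$2 - a$2 * b$4),
     a$1 * b$4 + a$4 * b$1 + s * (a$2 * b$3 - a$3 * b$2)]"

definition quat_conj :: "real^4 \<Rightarrow> real^4"
  where "quat_conj a = vector [a$1, - a$2, - a$3, - a$4]"

abbreviation quat_one :: "real^4" where "quat_one \<equiv> axis 1 1"

locale quat =
  fixes s :: real
  assumes s: "s * s = 1"
begin

abbreviation prod :: "real^4 \<Rightarrow> real^4 \<Rightarrow> real^4" (infixr "\<odot>" 72)
  where "a \<odot> b \<equiv> quat_mult s a b"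

abbreviation conj ("\<c>") where "\<c> \<equiv> quat_conj"

lemmas quat_defs = quat_mult_def quat_conj_def vec_eq_iff forall_4 inner_vec_def sum_4 axis_def

lemma bilinear: "bounded_bilinear (\<odot>)"
proof (rule bilinear_conv_bounded_bilinear[THEN iffD1])
  show "bilinear (\<odot>)"
    unfolding bilinear_def by (auto intro!: linearI simp: quat_defs algebra_simps)
qed

lemma conj_bounded_linear: "bounded_linear \<c>"
  by (rule linear_conv_bounded_linear[THEN iffD1]) (auto intro!: linearI simp: quat_defs)

lemma assoc: "(a \<odot> b) \<odot> c = a \<odot> b \<odot> c"
proof -
  have e1: "((a \<odot> b) \<odot> c)$1 = (a \<odot> b \<odot> c)$1"
    unfolding quat_mult_def vector_4 by algebra
  have e2: "((a \<odot> b) \<odot> c)$2 = (a \<odot> b \<odot> c)$2"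
    unfolding quat_mult_def vector_4 using s by algebra
  have e3: "((a \<odot> b) \<odot> c)$3 = (a \<odot> b \<odot> c)$3"
    unfolding quat_mult_def vector_4 using s by algebra
  have e4: "((a \<odot> b) \<odot> c)$4 = (a \<odot> b \<odot> c)$4"
    unfolding quat_mult_def vector_4 using s by algebra
  show ?thesis by (simp only: vec_eq_iff forall_4 e1 e2 e3 e4 simp_thms)
qed

lemma simps:
  "quat_one \<odot> a = a" "a \<odot> quat_one = a" "\<c> (\<c> a) = a"
  "(a + b) \<odot> c = a \<odot> c + b \<odot> c" "a \<odot> (b + c) = a \<odot> b + a \<odot> c"
  "(a - b) \<odot> c = a \<odot> c - b \<odot> c" "a \<odot> (b - c) = a \<odot> b - a \<odot> c"
  "(k *\<^sub>R a) \<odot> b = k *\<^sub>R (a \<odot> b)" "a \<odot> (k *\<^sub>R b) = k *\<^sub>R (a \<odot> b)"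
  "(- a) \<odot> b = - (a \<odot> b)" "a \<odot> (- b) = - (a \<odot> b)" "0 \<odot> a = 0" "a \<odot> 0 = 0"
  "\<c> (a + b) = \<c> a + \<c> b" "\<c> (a - b) = \<c> a - \<c> b" "\<c> (k *\<^sub>R a) = k *\<^sub>R \<c> a" "\<c> (- a) = - \<c> a"
  "\<c> (a \<odot> b) = \<c> b \<odot> \<c> a" "\<c> 0 = 0" "\<c> quat_one = quat_one"
  by (auto simp: quat_defs algebra_simps)

lemma mult_conj: "a \<odot> \<c> a = (a \<bullet> a) *\<^sub>R quat_one" "\<c> a \<odot> a = (a \<bullet> a) *\<^sub>R quat_one"
  by (auto simp: quat_defs algebra_simps)

text \<open>Polarization of the two norm identities \<open>mult_conj\<close>.\<close>

lemma mult_conj_swap: "a \<odot> \<c> b = (2 * (a \<bullet> b)) *\<^sub>R quat_one - b \<odot> \<c> a"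
  "\<c> a \<odot> b = (2 * (a \<bullet> b)) *\<^sub>R quat_one - \<c> b \<odot> a"
  by (auto simp: quat_defs algebra_simps)

lemma inner_left: "(a \<odot> b) \<bullet> c = b \<bullet> (\<c> a \<odot> c)"
  by (simp add: quat_defs algebra_simps)

lemma inner_right: "(a \<odot> b) \<bullet> c = a \<bullet> (c \<odot> \<c> b)"
  by (simp add: quat_defs algebra_simps)

lemma inner_conj: "\<c> a \<bullet> \<c> b = a \<bullet> b" "a \<bullet> \<c> b = \<c> a \<bullet> b"
  by (simp_all add: quat_defs)

lemma inner_mult_mult: "(c \<odot> a) \<bullet> (c \<odot> b) = (c \<bullet> c) * (a \<bullet> b)" "(a \<odot> c) \<bullet> (b \<odot> c) = (c \<bullet> c) * (a \<bullet> b)"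
proof -
  show "(c \<odot> a) \<bullet> (c \<odot> b) = (c \<bullet> c) * (a \<bullet> b)"
    unfolding inner_left assoc[symmetric] mult_conj by (simp add: simps)
  show "(a \<odot> c) \<bullet> (b \<odot> c) = (c \<bullet> c) * (a \<bullet> b)"
    unfolding inner_right assoc mult_conj by (simp add: simps)
qed

lemma conj_imag: "\<c> a = - a \<longleftrightarrow> a \<bullet> quat_one = 0"
  by (auto simp: quat_defs)

text \<open>This ties \<open>s\<close> to the orientation of the ambient space. For a unit imaginary
  \<open>n\<close>, and nonzero \<open>a\<close> and \<open>x\<close> with \<open>x\<close>
  perpendicular to \<open>a\<close> and \<open>n \<odot> a\<close>, the right side has the sign of
  \<open>s\<close>; hence the positive rotation of a normal plane is \<open>s\<close> times left
  multiplication by the left normal.\<close>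

lemma det_mult:
  assumes "n \<bullet> quat_one = 0"
  shows "det (vector [a, n \<odot> a, x, n \<odot> x] :: real^4^4) =
    s * ((n \<bullet> n) * ((a \<bullet> a) * (x \<bullet> x) - (a \<bullet> x)\<^sup>2) - ((n \<odot> a) \<bullet> x)\<^sup>2)"
proof -
  have n1: "n $ 1 = 0" using assms by (simp add: inner_axis)
  show ?thesis
    unfolding det_4 vector_4 quat_mult_def inner_vec_def sum_4 inner_real_def n1 using s by algebra
qed

lemma inner_mult_conj: "(a \<odot> \<c> b) \<bullet> quat_one = a \<bullet> b" "(\<c> a \<odot> b) \<bullet> quat_one = a \<bullet> b"
  by (simp_all add: quat_defs)

lemma imag_anticommute:
  assumes "p \<bullet> quat_one = 0" "q \<bullet> quat_one = 0" "p \<bullet> q = 0"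
  shows "p \<odot> q = - (q \<odot> p)"
  using mult_conj_swap(1)[of p q] assms by (simp add: simps conj_imag[THEN iffD2]) (metis minus_minus)

lemma imag_square: "p \<bullet> quat_one = 0 \<Longrightarrow> p \<odot> p = - (p \<bullet> p) *\<^sub>R quat_one"
  using mult_conj(1)[of p] by (metis conj_imag minus_equation_iff scaleR_minus_left simps(11))

lemma norm_mult_sq: "(a \<odot> b) \<bullet> (a \<odot> b) = (a \<bullet> a) * (b \<bullet> b)"
  by (rule inner_mult_mult)

lemma mult_eq_0: "a \<odot> b = 0 \<longleftrightarrow> a = 0 \<or> b = 0"
  using norm_mult_sq[of a b] by (metis inner_eq_zero_iff mult_eq_0_iff)

end

text \<open>Dimension count: with a nonzero \<open>y\<close> there would be five independent
  vectors. It allows vector identities to be checked against four explicit orthogonal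
  directions.\<close>

lemma orthogonal_4_zero:
  fixes y :: "real^4"
  assumes "a \<noteq> 0" "b \<noteq> 0" "c \<noteq> 0" "d \<noteq> 0"
    and "a \<bullet> b = 0" "a \<bullet> c = 0" "a \<bullet> d = 0" "b \<bullet> c = 0" "b \<bullet> d = 0" "c \<bullet> d = 0"
    and "y \<bullet> a = 0" "y \<bullet> b = 0" "y \<bullet> c = 0" "y \<bullet> d = 0"
  shows "y = 0"
proof (rule ccontr)
  assume y: "y \<noteq> 0"
  have "independent {a, b, c, d, y}"
    by (rule pairwise_orthogonal_independent)
      (use assms y in \<open>auto simp: pairwise_def orthogonal_def inner_commute\<close>)
  moreover have "card {a, b, c, d, y} = 5"
    using assms y by (auto simp: card_insert_if)
  ultimately show False using independent_bound[of "{a, b, c, d, y}"] by simp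
qed

text \<open>\<open>E1\<close> is a unit vector of an oriented plane with left normal \<open>N\<close>: rotation of the plane by \<open>\<pi>/2\<close> is
  left multiplication by \<open>N\<close>.\<close>

locale quat_plane = quat +
  fixes E1 N :: "real^4"
  assumes E1: "E1 \<bullet> E1 = 1" and N1: "N \<bullet> quat_one = 0" and NN: "N \<bullet> N = 1"
begin

abbreviation "E2 \<equiv> N \<odot> E1"

definition normal :: "real^4 \<Rightarrow> bool" where "normal x \<longleftrightarrow> x \<bullet> E1 = 0 \<and> x \<bullet> E2 = 0"

lemma cN: "\<c> N = - N" using N1 conj_imag by blast

lemma NNx: "N \<odot> N \<odot> x = - x"
  using imag_square[OF N1] by (simp add: NN assoc[symmetric] simps)

lemma cE1: "\<c> E1 \<odot> E1 \<odot> x = x" "E1 \<odot> \<c> E1 \<odot> x = x" "E1 \<odot> \<c> E1 = quat_one" "\<c> E1 \<odot> E1 = quat_one"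
  by (simp_all add: assoc[symmetric] mult_conj E1 simps)

lemma N_skew: "(N \<odot> x) \<bullet> y = - (x \<bullet> (N \<odot> y))"
  by (simp add: inner_left cN simps)

lemma N_isometry: "(N \<odot> x) \<bullet> (N \<odot> y) = x \<bullet> y"
  by (simp add: inner_mult_mult NN)

lemma N_perp: "x \<bullet> (N \<odot> x) = 0" "(N \<odot> x) \<bullet> x = 0"
  using N_skew[of x x] by (simp_all add: inner_commute)

lemma E12: "E1 \<bullet> E2 = 0" "E2 \<bullet> E1 = 0" "E2 \<bullet> E2 = 1"
  by (simp_all add: N_perp N_isometry E1)

lemma normal_N: "normal x \<Longrightarrow> normal (N \<odot> x)"
  unfolding normal_def by (simp add: N_skew NNx)

lemma normal_lin: "normal x \<Longrightarrow> normal y \<Longrightarrow> normal (x + y)" "normal x \<Longrightarrow> normal y \<Longrightarrow> normal (x - y)"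
  "normal x \<Longrightarrow> normal (k *\<^sub>R x)" "normal x \<Longrightarrow> normal (- x)"
  unfolding normal_def by (simp_all add: inner_add_left inner_diff_left)

lemma E1_conj_swap: "x \<bullet> E1 = 0 \<Longrightarrow> E1 \<odot> \<c> x \<odot> y = - (x \<odot> \<c> E1 \<odot> y)"
  using mult_conj_swap(1)[of E1 x] by (simp add: assoc[symmetric] simps inner_commute)

text \<open>\<open>x \<odot> \<c> E1\<close> is imaginary because \<open>x\<close> is perpendicular
  to \<open>E1\<close>, and perpendicular to \<open>N\<close> because \<open>x\<close> is
  perpendicular to \<open>E2\<close>; orthogonal imaginary quaternions anticommute.\<close>

lemma normal_anticommute: "normal x \<Longrightarrow> x \<odot> \<c> E1 \<odot> N = - (N \<odot> x \<odot> \<c> E1)"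
  using imag_anticommute[OF _ N1, of "x \<odot> \<c> E1"]
  by (simp add: normal_def inner_mult_conj inner_right simps assoc)

lemma normal_anticommute': "normal x \<Longrightarrow> x \<odot> \<c> E1 \<odot> N \<odot> y = - (N \<odot> x \<odot> \<c> E1 \<odot> y)"
  using normal_anticommute[of x] by (metis assoc simps(10))

text \<open>\<open>E1\<close>, \<open>E2\<close>, \<open>x\<close> and \<open>N \<odot> x\<close>
  are pairwise orthogonal. Clearing the denominator \<open>x \<bullet> x\<close> keeps the expansion
  valid for \<open>x = 0\<close>.\<close>

lemma normal_expand:
  assumes "normal x" "normal y"
  shows "(x \<bullet> x) *\<^sub>R y = (y \<bullet> x) *\<^sub>R x + (y \<bullet> (N \<odot> x)) *\<^sub>R (N \<odot> x)"
proof (cases "x = 0")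
  case False
  have nz: "E1 \<noteq> 0" "E2 \<noteq> 0" "N \<odot> x \<noteq> 0"
    using E1 NN E12(3) False by (auto simp: mult_eq_0)
  have "(x \<bullet> x) *\<^sub>R y - ((y \<bullet> x) *\<^sub>R x + (y \<bullet> (N \<odot> x)) *\<^sub>R (N \<odot> x)) = 0"
    by (rule orthogonal_4_zero[of E1 E2 x "N \<odot> x"])
      (use nz False assms normal_N[OF assms(1)] in \<open>auto simp: normal_def E12 N_perp N_isometry
        inner_diff_left inner_add_left inner_commute[of E1 x] inner_commute[of E2 x]
        inner_commute[of E1 "N \<odot> x"] inner_commute[of E2 "N \<odot> x"]\<close>)
  then show ?thesis by simp
qed (simp add: simps)

text \<open>By \<open>normal_expand\<close> it is enough to know the cases \<open>y = x\<close> and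
  \<open>y = N \<odot> x\<close>, which follow from anticommutation. That the product is tangent
  later removes the first order change of the normal connection under a dual deformation.\<close>

lemma normal_triple:
  assumes "normal x" "normal y"
  shows "x \<odot> \<c> E1 \<odot> y = - (x \<bullet> y) *\<^sub>R E1 + ((N \<odot> x) \<bullet> y) *\<^sub>R E2"
proof (cases "x = 0")
  case False
  have xx: "x \<odot> \<c> E1 \<odot> x = - (x \<bullet> x) *\<^sub>R E1"
  proof -
    have "\<c> E1 \<odot> x = - (\<c> x \<odot> E1)"
      using mult_conj_swap(2)[of E1 x] assms by (simp add: normal_def inner_commute)
    then have "x \<odot> \<c> E1 \<odot> x = - ((x \<odot> \<c> x) \<odot> E1)" by (simp add: simps assoc)
    then show ?thesis by (simp add: mult_conj simps)
  qed
  then have xNx: "x \<odot> \<c> E1 \<odot> N \<odot> x = (x \<bullet> x) *\<^sub>R E2"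
    using normal_anticommute'[OF assms(1)] by (simp add: simps)
  have "(x \<bullet> x) *\<^sub>R (x \<odot> \<c> E1 \<odot> y) = x \<odot> \<c> E1 \<odot> ((x \<bullet> x) *\<^sub>R y)" by (simp add: simps)
  also have "\<dots> = (x \<bullet> x) *\<^sub>R (- (x \<bullet> y) *\<^sub>R E1 + ((N \<odot> x) \<bullet> y) *\<^sub>R E2)"
    unfolding normal_expand[OF assms] simps xx xNx by (simp add: algebra_simps inner_commute)
  finally show ?thesis using False by simp
qed (simp add: simps)

text \<open>The exterior derivative of \<open>v \<mapsto> \<c> E1 \<odot> df(v) \<odot> \<c> E1 \<odot> \<zeta>\<close> on the pair \<open>(e1, e2)\<close>.  Here \<open>Ai\<close>, \<open>Zi\<close> are
  the derivatives of \<open>E1\<close>, \<open>\<zeta>\<close> in direction \<open>ei\<close>; the second derivatives of \<open>f\<close> cancel.\<close>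

lemma closedness_identity:
  assumes n: "normal \<zeta>" "normal \<alpha>11" "normal \<alpha>12" "normal \<alpha>22"
    and A: "A1 = a1 *\<^sub>R E2 + \<alpha>11" "A2 = a2 *\<^sub>R E2 + \<alpha>12"
    and Z: "Z1 = - (\<zeta> \<bullet> \<alpha>11) *\<^sub>R E1 - (\<zeta> \<bullet> \<alpha>12) *\<^sub>R E2 + z1"
      "Z2 = - (\<zeta> \<bullet> \<alpha>12) *\<^sub>R E1 - (\<zeta> \<bullet> \<alpha>22) *\<^sub>R E2 + z2"
    and sc: "\<alpha>12 = N \<odot> ((1/2) *\<^sub>R (\<alpha>11 - \<alpha>22))"
  shows "E1 \<odot> (\<c> A1 \<odot> E2 \<odot> \<c> E1 \<odot> \<zeta> + \<c> E1 \<odot> E2 \<odot> (\<c> A1 \<odot> \<zeta> + \<c> E1 \<odot> Z1)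
      - (\<c> A2 \<odot> E1 \<odot> \<c> E1 \<odot> \<zeta> + \<c> E1 \<odot> E1 \<odot> (\<c> A2 \<odot> \<zeta> + \<c> E1 \<odot> Z2))) =
    (2 * a1) *\<^sub>R \<zeta> + (2 * a2) *\<^sub>R (N \<odot> \<zeta>) + N \<odot> z1 - z2 - (2 * ((\<alpha>11 - \<alpha>22) \<bullet> \<zeta>)) *\<^sub>R E2"
proof -
  have perp: "A1 \<bullet> E1 = 0" "A2 \<bullet> E1 = 0"
    using n by (auto simp: A inner_add_left E12 normal_def)
  have t1: "E1 \<odot> \<c> A1 \<odot> E2 \<odot> \<c> E1 \<odot> \<zeta> = a1 *\<^sub>R \<zeta> + N \<odot> \<alpha>11 \<odot> \<c> E1 \<odot> \<zeta>"
    unfolding E1_conj_swap[OF perp(1)] assoc cE1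
    by (simp add: A simps assoc cE1 NNx normal_anticommute'[OF n(2)])
  \<comment> \<open>The term with \<open>\<alpha>11\<close> has the sign opposite to that in
    \<open>t1\<close>, so \<open>\<alpha>11\<close> drops out of the sum of the two.\<close>
  have t2: "E1 \<odot> \<c> E1 \<odot> E2 \<odot> \<c> A1 \<odot> \<zeta> = a1 *\<^sub>R \<zeta> - N \<odot> \<alpha>11 \<odot> \<c> E1 \<odot> \<zeta>"
    unfolding assoc cE1 E1_conj_swap[OF perp(1)]
    by (simp add: A simps assoc cE1 NNx)
  have t3: "E1 \<odot> \<c> A2 \<odot> \<zeta> = - (a2 *\<^sub>R (N \<odot> \<zeta>) + \<alpha>12 \<odot> \<c> E1 \<odot> \<zeta>)"
    unfolding E1_conj_swap[OF perp(2)] by (simp add: A simps assoc cE1)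
  \<comment> \<open>Superconformality enters here, turning \<open>N \<odot> \<alpha>12\<close> into
    minus half of \<open>\<alpha>11 - \<alpha>22\<close>. In the total the \<open>E1\<close> part
    cancels against those of \<open>N \<odot> Z1\<close> and \<open>Z2\<close>, while the
    \<open>E2\<close> parts reinforce each other and form the obstruction in the conclusion.\<close>
  have t4: "\<alpha>12 \<odot> \<c> E1 \<odot> \<zeta> = - (\<alpha>12 \<bullet> \<zeta>) *\<^sub>R E1 - ((1/2) * ((\<alpha>11 - \<alpha>22) \<bullet> \<zeta>)) *\<^sub>R E2"
    unfolding normal_triple[OF n(3,1)] by (simp add: sc NNx)
  have t5: "N \<odot> Z1 = - (\<zeta> \<bullet> \<alpha>11) *\<^sub>R E2 + (\<zeta> \<bullet> \<alpha>12) *\<^sub>R E1 + N \<odot> z1"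
    by (simp add: Z simps NNx)
  have "E1 \<odot> (\<c> A1 \<odot> E2 \<odot> \<c> E1 \<odot> \<zeta> + \<c> E1 \<odot> E2 \<odot> (\<c> A1 \<odot> \<zeta> + \<c> E1 \<odot> Z1)
      - (\<c> A2 \<odot> E1 \<odot> \<c> E1 \<odot> \<zeta> + \<c> E1 \<odot> E1 \<odot> (\<c> A2 \<odot> \<zeta> + \<c> E1 \<odot> Z2))) =
    E1 \<odot> \<c> A1 \<odot> E2 \<odot> \<c> E1 \<odot> \<zeta> + E1 \<odot> \<c> E1 \<odot> E2 \<odot> \<c> A1 \<odot> \<zeta> + N \<odot> Z1
      - E1 \<odot> \<c> A2 \<odot> \<zeta> - E1 \<odot> \<c> A2 \<odot> \<zeta> - Z2"
    unfolding simps assoc cE1 by (simp add: algebra_simps)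
  also have "\<dots> = (2 * a1) *\<^sub>R \<zeta> + (2 * a2) *\<^sub>R (N \<odot> \<zeta>) + 2 *\<^sub>R (\<alpha>12 \<odot> \<c> E1 \<odot> \<zeta>) + N \<odot> Z1 - Z2"
    unfolding t1 t2 t3 by (simp add: vec_eq_iff)
  also have "\<dots> = (2 * a1) *\<^sub>R \<zeta> + (2 * a2) *\<^sub>R (N \<odot> \<zeta>) + N \<odot> z1 - z2 - (2 * ((\<alpha>11 - \<alpha>22) \<bullet> \<zeta>)) *\<^sub>R E2"
    unfolding t4 t5 Z(2) by (simp add: vec_eq_iff inner_commute[of \<zeta>] inner_diff_left) (simp add: algebra_simps)
  finally show ?thesis .
qed

text \<open>The normal part of the exterior derivative of \<open>v \<mapsto> \<chi> \<odot> \<c> (df v)\<close>, where \<open>Xi\<close> is the derivative of \<open>\<chi>\<close>.\<close>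

lemma normal_part_identity:
  assumes "X1 \<odot> \<c> E2 = X2 \<odot> \<c> E1" "normal \<nu>"
  shows "X2 \<bullet> \<nu> = - (X1 \<bullet> (N \<odot> \<nu>))"
proof -
  have "X2 = (X1 \<odot> \<c> E2) \<odot> E1" unfolding assms(1) assoc by (simp add: cE1 simps)
  then have "X2 \<bullet> \<nu> = X1 \<bullet> ((\<nu> \<odot> \<c> E1) \<odot> E2)" by (simp add: inner_right simps)
  also have "(\<nu> \<odot> \<c> E1) \<odot> E2 = - (N \<odot> \<nu>)"
    unfolding assoc normal_anticommute'[OF assms(2)] by (simp add: cE1 simps)
  finally show ?thesis by simp
qed

end

section \<open>Pointwise geometry in an orthonormal frame\<close>

text \<open>One positive orthonormal frame at one point is what it takes to evaluate the definite
  descriptions \<open>nproj\<close> and \<open>rotT\<close>.\<close>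

locale tangent_frame =
  fixes F :: psurf and u :: "real^2" and e1 e2 :: "real^2"
  assumes lin: "linear (frechet_derivative F (at u))"
    and frame: "pos_tangent_frame F u e1 e2"
begin

abbreviation "df \<equiv> dir_deriv F u"

lemma orthonormal:
  "df e1 \<bullet> df e1 = 1" "df e2 \<bullet> df e2 = 1" "df e1 \<bullet> df e2 = 0" "df e2 \<bullet> df e1 = 0"
  using frame by (auto simp: pos_tangent_frame_def metric_def inner_commute)

lemma det_pos: "0 < e1$1 * e2$2 - e1$2 * e2$1"
  using frame by (simp add: pos_tangent_frame_def det_2_rows)

lemma df_lin [simp]: "df (v + w) = df v + df w" "df (v - w) = df v - df w" "df (k *\<^sub>R v) = k *\<^sub>R df v"
  "df (- v) = - df v" "df 0 = 0"
  using lin by (simp_all add: linear_add linear_diff linear_scale linear_neg linear_0)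

lemma expand: "v = (df v \<bullet> df e1) *\<^sub>R e1 + (df v \<bullet> df e2) *\<^sub>R e2"
proof -
  define d where "d = e1$1 * e2$2 - e1$2 * e2$1"
  define a where "a = (v$1 * e2$2 - v$2 * e2$1) / d"
  define b where "b = (e1$1 * v$2 - e1$2 * v$1) / d"
  have "d \<noteq> 0" using det_pos d_def by simp
  have "v$1 * d = (v$1 * e2$2 - v$2 * e2$1) * e1$1 + (e1$1 * v$2 - e1$2 * v$1) * e2$1"
    "v$2 * d = (v$1 * e2$2 - v$2 * e2$1) * e1$2 + (e1$1 * v$2 - e1$2 * v$1) * e2$2"
    unfolding d_def by algebra+
  then have v: "v = a *\<^sub>R e1 + b *\<^sub>R e2"
    using \<open>d \<noteq> 0\<close> by (simp add: vec_eq_iff forall_2 a_def b_def nonzero_eq_divide_eq flip: add_divide_distrib)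
  have "df v = a *\<^sub>R df e1 + b *\<^sub>R df e2" by (subst v) simp
  then have "df v \<bullet> df e1 = a" "df v \<bullet> df e2 = b"
    by (simp_all add: inner_add_left orthonormal)
  then show ?thesis using v by simp
qed

lemma df_expand: "df v = (df v \<bullet> df e1) *\<^sub>R df e1 + (df v \<bullet> df e2) *\<^sub>R df e2"
  by (subst expand[of v]) simp

lemma df_eq_0: "df v = 0 \<longleftrightarrow> v = 0"
  using expand[of v] by auto

lemma normal_space: "x \<in> normal_space F u \<longleftrightarrow> x \<bullet> df e1 = 0 \<and> x \<bullet> df e2 = 0"
  unfolding normal_space_def using df_expand by (auto simp: inner_add_right) (metis (no_types, lifting) add_0 inner_add_right inner_scaleR_right mult_zero_right)

lemma nproj: "nproj F u y = y - (y \<bullet> df e1) *\<^sub>R df e1 - (y \<bullet> df e2) *\<^sub>R df e2"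
  unfolding nproj_def
proof (rule the_equality)
  show "y - (y \<bullet> df e1) *\<^sub>R df e1 - (y \<bullet> df e2) *\<^sub>R df e2 \<in> normal_space F u \<and>
    (\<exists>v. y = df v + (y - (y \<bullet> df e1) *\<^sub>R df e1 - (y \<bullet> df e2) *\<^sub>R df e2))"
    by (auto simp: normal_space inner_diff_left orthonormal
        intro!: exI[of _ "(y \<bullet> df e1) *\<^sub>R e1 + (y \<bullet> df e2) *\<^sub>R e2"])
next
  fix x assume "x \<in> normal_space F u \<and> (\<exists>v. y = df v + x)"
  then obtain v where x: "x \<bullet> df e1 = 0" "x \<bullet> df e2 = 0" and y: "y = df v + x"
    by (auto simp: normal_space)
  have "y \<bullet> df e1 = df v \<bullet> df e1" "y \<bullet> df e2 = df v \<bullet> df e2"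
    using x by (simp_all add: y inner_add_left)
  then show "x = y - (y \<bullet> df e1) *\<^sub>R df e1 - (y \<bullet> df e2) *\<^sub>R df e2"
    using df_expand[of v] y by (simp add: algebra_simps)
qed

lemma nproj_normal: "nproj F u y \<in> normal_space F u"
  by (simp add: nproj normal_space inner_diff_left orthonormal)

lemma nproj_lin: "nproj F u (x + y) = nproj F u x + nproj F u y" "nproj F u (k *\<^sub>R x) = k *\<^sub>R nproj F u x"
  by (simp_all add: nproj vec_eq_iff inner_add_left algebra_simps)

lemma nproj_inner: "x \<in> normal_space F u \<Longrightarrow> nproj F u y \<bullet> x = y \<bullet> x"
  by (simp add: nproj normal_space inner_diff_left inner_commute[of "df e1" x] inner_commute[of "df e2" x])

lemma nproj_id: "x \<in> normal_space F u \<Longrightarrow> nproj F u x = x"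
  by (simp add: nproj normal_space)

lemma nproj_df: "nproj F u (df v) = 0"
  by (simp add: nproj diff_diff_eq flip: df_expand)

lemma rotT: "rotT F u v = (df v \<bullet> df e1) *\<^sub>R e2 - (df v \<bullet> df e2) *\<^sub>R e1"
  unfolding rotT_def
proof (rule the_equality)
  define a b where "a = df v \<bullet> df e1" and "b = df v \<bullet> df e2"
  have v: "v = a *\<^sub>R e1 + b *\<^sub>R e2" unfolding a_def b_def by (rule expand)
  have dt: "det (vector [v, c *\<^sub>R e1 + d *\<^sub>R e2] :: real^2^2) = (a * d - b * c) * (e1$1 * e2$2 - e1$2 * e2$1)" for c d
    unfolding det_2_rows v by (simp add: algebra_simps)
  have m: "metric F u (c *\<^sub>R e1 + d *\<^sub>R e2) (c' *\<^sub>R e1 + d' *\<^sub>R e2) = c * c' + d * d'" for c d c' d'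
    by (simp add: metric_def inner_add_left inner_add_right orthonormal)
  have "(df v \<bullet> df e1) *\<^sub>R e2 - (df v \<bullet> df e2) *\<^sub>R e1 = (- b) *\<^sub>R e1 + a *\<^sub>R e2"
    by (simp add: a_def b_def)
  moreover have "metric F u v ((- b) *\<^sub>R e1 + a *\<^sub>R e2) = 0"
    "metric F u ((- b) *\<^sub>R e1 + a *\<^sub>R e2) ((- b) *\<^sub>R e1 + a *\<^sub>R e2) = metric F u v v"
    using m[of a b "- b" a] m[of "- b" a "- b" a] m[of a b a b] by (simp_all add: v)
  moreover have "0 \<le> det (vector [v, (- b) *\<^sub>R e1 + a *\<^sub>R e2] :: real^2^2)"
    unfolding dt using det_pos by (simp add: zero_le_mult_iff)
  ultimately show "metric F u v ((df v \<bullet> df e1) *\<^sub>R e2 - (df v \<bullet> df e2) *\<^sub>R e1) = 0 \<and>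
    metric F u ((df v \<bullet> df e1) *\<^sub>R e2 - (df v \<bullet> df e2) *\<^sub>R e1) ((df v \<bullet> df e1) *\<^sub>R e2 - (df v \<bullet> df e2) *\<^sub>R e1) = metric F u v v \<and>
    0 \<le> det (vector [v, (df v \<bullet> df e1) *\<^sub>R e2 - (df v \<bullet> df e2) *\<^sub>R e1] :: real^2^2)"
    by simp
  fix w assume w: "metric F u v w = 0 \<and> metric F u w w = metric F u v v \<and> 0 \<le> det (vector [v, w] :: real^2^2)"
  obtain c d where wcd: "w = c *\<^sub>R e1 + d *\<^sub>R e2" using expand by blast
  have 1: "a * c + b * d = 0" "c * c + d * d = a * a + b * b" "0 \<le> a * d - b * c"
    using w det_pos unfolding wcd dt by (auto simp: v m zero_le_mult_iff)
  \<comment> \<open>Lagrange's identity: for orthogonal vectors of equal length the determinant has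
    the largest possible modulus. Together with its sign this pins down \<open>w\<close>.\<close>
  have "(a * d - b * c)\<^sup>2 = (a * a + b * b)\<^sup>2"
  proof -
    have "(a * d - b * c)\<^sup>2 = (a * a + b * b) * (c * c + d * d) - (a * c + b * d)\<^sup>2" by algebra
    then show ?thesis unfolding 1(1,2) by (simp add: power2_eq_square)
  qed
  then have "a * d - b * c = a * a + b * b"
    using 1(3) by (simp add: power2_eq_iff_nonneg)
  then have "(c + b)\<^sup>2 + (d - a)\<^sup>2 = 0"
    using 1(2) by (simp add: power2_eq_square algebra_simps)
  then have "c = - b" "d = a" by (simp_all add: sum_power2_eq_zero_iff)
  then show "w = (df v \<bullet> df e1) *\<^sub>R e2 - (df v \<bullet> df e2) *\<^sub>R e1"
    by (simp add: wcd a_def b_def)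
qed

lemma frame_rotation:
  assumes "pos_tangent_frame F u a b"
  obtains c d where "c * c + d * d = 1" "a = c *\<^sub>R e1 + d *\<^sub>R e2" "b = (- d) *\<^sub>R e1 + c *\<^sub>R e2"
proof -
  interpret A: tangent_frame F u a b using lin assms by (simp add: tangent_frame_def)
  define c d where "c = df a \<bullet> df e1" and "d = df a \<bullet> df e2"
  have a: "a = c *\<^sub>R e1 + d *\<^sub>R e2" unfolding c_def d_def by (rule expand)
  have b: "b = (- d) *\<^sub>R e1 + c *\<^sub>R e2"
    using A.rotT[of a] rotT[of a] A.orthonormal by (simp add: c_def d_def)
  have "df a \<bullet> df a = c * c + d * d"
    by (simp add: a inner_add_left inner_add_right orthonormal)
  then show ?thesis using that a b A.orthonormal(1) by simp
qed

lemma rotated_frame: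
  assumes "c * c + d * d = 1"
  shows "pos_tangent_frame F u (c *\<^sub>R e1 + d *\<^sub>R e2) ((- d) *\<^sub>R e1 + c *\<^sub>R e2)"
proof -
  have "det (vector [c *\<^sub>R e1 + d *\<^sub>R e2, (- d) *\<^sub>R e1 + c *\<^sub>R e2] :: real^2^2)
      = (c * c + d * d) * (e1$1 * e2$2 - e1$2 * e2$1)"
    unfolding det_2_rows by (simp add: algebra_simps)
  then show ?thesis
    using assms det_pos
    by (simp add: pos_tangent_frame_def metric_def inner_add_left inner_add_right inner_diff_left
        inner_diff_right orthonormal add.commute)
qed

end

locale quat_frame = quat + tangent_frame
begin

definition N :: "real^4" where "N = df e2 \<odot> \<c> (df e1)"

lemma N_E1: "N \<odot> df e1 = df e2"
  by (simp add: N_def assoc mult_conj orthonormal simps)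

sublocale quat_plane s "df e1" N
  by unfold_locales (simp_all add: N_def inner_mult_conj orthonormal norm_mult_sq inner_conj(1))

lemma N_E2: "N \<odot> df e2 = - df e1"
  using NNx[of "df e1"] by (simp add: N_E1)

lemma normal_iff: "normal x \<longleftrightarrow> x \<in> normal_space F u"
  by (simp add: normal_def normal_space N_E1)

lemma N_df: "N \<odot> df v = df (rotT F u v)"
  by (subst df_expand) (simp add: rotT simps N_E1 N_E2)

text \<open>Expansion along the first two rows: they enter only through their 2 by 2 minors, all of
  which acquire the same factor when the tangent basis is changed. This yields
  \<open>det_frame\<close>.\<close>

lemma det_4_laplace:
  "det (vector [a, b, x, y] :: real^4^4) =
    (a$1 * b$2 - a$2 * b$1) * (x$3 * y$4 - x$4 * y$3) - (a$1 * b$3 - a$3 * b$1) * (x$2 * y$4 - x$4 * y$2)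
    + (a$1 * b$4 - a$4 * b$1) * (x$2 * y$3 - x$3 * y$2) + (a$2 * b$3 - a$3 * b$2) * (x$1 * y$4 - x$4 * y$1)
    - (a$2 * b$4 - a$4 * b$2) * (x$1 * y$3 - x$3 * y$1) + (a$3 * b$4 - a$4 * b$3) * (x$1 * y$2 - x$2 * y$1)"
  unfolding det_4 vector_4 by (simp add: algebra_simps)

lemma det_frame: "det (vector [df e1, df e2, x, y] :: real^4^4) =
  (e1$1 * e2$2 - e1$2 * e2$1) * det (vector [df dx, df dy, x, y] :: real^4^4)"
proof -
  have e: "df e1 = e1$1 *\<^sub>R df dx + e1$2 *\<^sub>R df dy" "df e2 = e2$1 *\<^sub>R df dx + e2$2 *\<^sub>R df dy"
    by (rule linear_vec2[OF lin])+
  have minor: "(p * a + q * b) * (r * c + t * d) - (p * c + q * d) * (r * a + t * b) = (p * t - q * r) * (a * d - c * b)"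
    for p q r t a b c d :: real by (simp add: algebra_simps)
  define k where "k = e1$1 * e2$2 - e1$2 * e2$1"
  show ?thesis
    unfolding e det_4_laplace vector_add_component vector_scaleR_component real_scaleR_def minor
      k_def[symmetric]
    by (simp add: algebra_simps)
qed

lemma det_normal:
  assumes "normal x"
  shows "det (vector [df e1, df e2, x, N \<odot> x] :: real^4^4) = s * (x \<bullet> x)"
  using det_mult[OF N1, of "df e1" x] assms
  by (simp add: N_E1 NN orthonormal normal_def inner_commute)

text \<open>\<open>normal_expand\<close> leaves a multiple \<open>k\<close> of
  \<open>N \<odot> x\<close>; the norm fixes the square of \<open>k\<close> and the determinant its
  sign. It is kept apart from \<open>rotN\<close> because the second vector of a positive normal
  frame satisfies the same conditions.\<close>

lemma rotN_unique:
  assumes "x \<in> normal_space F u"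
    and y: "y \<in> normal_space F u \<and> x \<bullet> y = 0 \<and> norm y = norm x \<and>
      0 \<le> det (vector [df dx, df dy, x, y] :: real^4^4)"
  shows "y = s *\<^sub>R (N \<odot> x)"
proof -
  have nx: "normal x" using assms(1) normal_iff by blast
  have scl: "det (vector [df e1, df e2, x, k *\<^sub>R y] :: real^4^4) = k * det (vector [df e1, df e2, x, y] :: real^4^4)" for k y
    unfolding det_4 by (simp add: algebra_simps)
  have sgn: "0 \<le> det (vector [df dx, df dy, x, y] :: real^4^4) \<longleftrightarrow> 0 \<le> det (vector [df e1, df e2, x, y] :: real^4^4)" for y
    unfolding det_frame using det_pos by (simp add: zero_le_mult_iff)
  show ?thesis
  proof (cases "x = 0")
    case False
    define k where "k = y \<bullet> (N \<odot> x)"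
    have ny: "normal y" using y normal_iff by blast
    have ex: "(x \<bullet> x) *\<^sub>R y = k *\<^sub>R (N \<odot> x)"
      using normal_expand[OF nx ny] y by (simp add: k_def inner_commute)
    have xx: "0 < x \<bullet> x" using False by simp
    have "0 \<le> det (vector [df e1, df e2, x, (x \<bullet> x) *\<^sub>R y] :: real^4^4)"
      using y xx unfolding scl sgn by simp
    then have "0 \<le> (s * k) * (x \<bullet> x)"
      unfolding ex scl det_normal[OF nx] by (simp add: mult_ac)
    then have sk: "0 \<le> s * k" using xx by (simp add: zero_le_mult_iff)
    have "((x \<bullet> x) *\<^sub>R y) \<bullet> ((x \<bullet> x) *\<^sub>R y) = (x \<bullet> x) * (x \<bullet> x) * (x \<bullet> x)"
      using y by (simp add: norm_eq)
    then have "k * k * (x \<bullet> x) = (x \<bullet> x) * (x \<bullet> x) * (x \<bullet> x)"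
      unfolding ex by (simp add: N_isometry)
    then have "k * k = (x \<bullet> x) * (x \<bullet> x)" using xx by simp
    then have "(s * k)\<^sup>2 = (x \<bullet> x)\<^sup>2" using s by (simp add: power2_eq_square mult_ac)
    then have "s * k = x \<bullet> x" using sk xx by (simp add: power2_eq_iff_nonneg)
    then have "k = s * (x \<bullet> x)" using s by (metis mult.assoc mult.left_neutral)
    then have "(x \<bullet> x) *\<^sub>R y = (x \<bullet> x) *\<^sub>R (s *\<^sub>R (N \<odot> x))" using ex by (simp add: mult.commute)
    then show ?thesis using scaleR_left_imp_eq xx by (metis less_irrefl)
  qed (use y in \<open>simp add: simps\<close>)
qed

lemma rotN:
  assumes "x \<in> normal_space F u"
  shows "rotN F u x = s *\<^sub>R (N \<odot> x)"
  unfolding rotN_def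
proof (rule the_equality)
  have nx: "normal x" using assms normal_iff by blast
  have scl: "det (vector [df e1, df e2, x, k *\<^sub>R y] :: real^4^4) = k * det (vector [df e1, df e2, x, y] :: real^4^4)" for k y
    unfolding det_4 by (simp add: algebra_simps)
  have sgn: "0 \<le> det (vector [df dx, df dy, x, y] :: real^4^4) \<longleftrightarrow> 0 \<le> det (vector [df e1, df e2, x, y] :: real^4^4)" for y
    unfolding det_frame using det_pos by (simp add: zero_le_mult_iff)
  have "norm (s *\<^sub>R (N \<odot> x)) = norm x"
    using s N_isometry[of x x] by (simp add: norm_eq_sqrt_inner mult.assoc[symmetric])
  moreover have "0 \<le> det (vector [df dx, df dy, x, s *\<^sub>R (N \<odot> x)] :: real^4^4)"
    unfolding sgn scl det_normal[OF nx] using s by (simp add: mult.assoc[symmetric])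
  ultimately show "s *\<^sub>R (N \<odot> x) \<in> normal_space F u \<and> x \<bullet> (s *\<^sub>R (N \<odot> x)) = 0 \<and>
      norm (s *\<^sub>R (N \<odot> x)) = norm x \<and> 0 \<le> det (vector [df dx, df dy, x, s *\<^sub>R (N \<odot> x)] :: real^4^4)"
    using normal_lin(3)[OF normal_N[OF nx]] normal_iff by (simp add: N_perp)
qed (use rotN_unique[OF assms] in blast)

lemma matrix_mult: "matrix (\<lambda>x. q \<odot> x) *v y = q \<odot> y"
  by (rule matrix_works) (simp add: linear_matrix_vector_mul_eq linear_conv_bounded_linear bounded_bilinear.bounded_linear_right[OF bilinear])

text \<open>On normal vectors the two signs \<open>s\<close> cancel: \<open>s\<close> times
  \<open>rotN\<close> is left multiplication by \<open>N\<close>, the same formula that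
  \<open>N_df\<close> gives on tangent vectors.\<close>

lemma gauss_lift: "gauss_lift F s u = (F u, matrix (\<lambda>x. N \<odot> x))"
proof -
  have "(THE L. (\<forall>v. L *v dir_deriv F u v = dir_deriv F u (rotT F u v)) \<and>
           (\<forall>\<xi>\<in>normal_space F u. L *v \<xi> = s *\<^sub>R rotN F u \<xi>)) = matrix (\<lambda>x. N \<odot> x)"
  proof (rule the_equality)
    have ss: "s *\<^sub>R s *\<^sub>R x = x" for x :: "real^4" using s by simp
    show "(\<forall>v. matrix (\<lambda>x. N \<odot> x) *v dir_deriv F u v = dir_deriv F u (rotT F u v)) \<and>
           (\<forall>\<xi>\<in>normal_space F u. matrix (\<lambda>x. N \<odot> x) *v \<xi> = s *\<^sub>R rotN F u \<xi>)"
      unfolding matrix_mult N_df by (simp add: rotN ss del: scaleR_scaleR)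
    fix L assume L: "(\<forall>v. L *v dir_deriv F u v = dir_deriv F u (rotT F u v)) \<and>
           (\<forall>\<xi>\<in>normal_space F u. L *v \<xi> = s *\<^sub>R rotN F u \<xi>)"
    have "L *v y = matrix (\<lambda>x. N \<odot> x) *v y" for y
    proof -
      have y: "y = df ((y \<bullet> df e1) *\<^sub>R e1 + (y \<bullet> df e2) *\<^sub>R e2) + nproj F u y"
        by (simp add: nproj)
      have "L *v y = df (rotT F u ((y \<bullet> df e1) *\<^sub>R e1 + (y \<bullet> df e2) *\<^sub>R e2)) + s *\<^sub>R rotN F u (nproj F u y)"
        using L nproj_normal by (subst y) (simp only: matrix_vector_right_distrib)
      also have "\<dots> = N \<odot> y"
        unfolding N_df[symmetric] rotN[OF nproj_normal] ss by (subst (3) y) (simp only: simps)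
      finally show ?thesis by (simp add: matrix_mult)
    qed
    then show "L = matrix (\<lambda>x. N \<odot> x)" by (simp add: matrix_eq)
  qed
  then show ?thesis by (simp add: gauss_lift_def)
qed

end

section \<open>The second fundamental form\<close>

definition hess :: "psurf \<Rightarrow> real^2 \<Rightarrow> real^2 \<Rightarrow> real^2 \<Rightarrow> real^4"
  where "hess F u v w = dir_deriv (\<lambda>x. dir_deriv F x w) u v"

locale smooth_surf =
  fixes F :: psurf and D :: "(real^2) set"
  assumes open_D: "open D" and smooth_F: "smooth_on D F"
begin

lemma lin_df: "u \<in> D \<Longrightarrow> linear (frechet_derivative F (at u))"
  using smooth_on_linear_deriv[OF smooth_F] .

lemma hess_lin1: "u \<in> D \<Longrightarrow> hess F u (v + v') w = hess F u v w + hess F u v' w"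
  "u \<in> D \<Longrightarrow> hess F u (k *\<^sub>R v) w = k *\<^sub>R hess F u v w"
  unfolding hess_def
  by (simp_all add: linear_add linear_scale smooth_on_linear_deriv[OF smooth_on_dir_deriv[OF smooth_F]])

lemma hess_sym: "u \<in> D \<Longrightarrow> hess F u v w = hess F u w v"
  unfolding hess_def by (rule mixed_derivatives_commute[OF open_D smooth_F])

lemma second_ff_hess: "second_ff F u v w = nproj F u (hess F u v w)"
  by (simp add: second_ff_def hess_def)

lemma second_ff_sym: "u \<in> D \<Longrightarrow> second_ff F u v w = second_ff F u w v"
  unfolding second_ff_hess using hess_sym by simp

lemma deriv_df_field:
  assumes "u \<in> D" "smooth_on D e"
  shows "dir_deriv (\<lambda>x. dir_deriv F x (e x)) u v = hess F u v (e u) + dir_deriv F u (dir_deriv e u v)"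
proof -
  have comp: "dir_deriv (\<lambda>x. e x $ i *\<^sub>R dir_deriv F x w) u v = e u $ i *\<^sub>R hess F u v w + dir_deriv e u v $ i *\<^sub>R dir_deriv F u w" for i w
    unfolding hess_def
    using dir_deriv_bilinear[OF bounded_bilinear_scaleR smooth_on_nth[OF open_D assms(2)] smooth_on_dir_deriv[OF smooth_F] assms(1)]
      dir_deriv_bounded_linear[OF bounded_linear_vec_nth assms(2,1)] by simp
  have "dir_deriv (\<lambda>x. dir_deriv F x (e x)) u v = dir_deriv (\<lambda>x. e x $ 1 *\<^sub>R dir_deriv F x dx + e x $ 2 *\<^sub>R dir_deriv F x dy) u v"
    by (rule dir_deriv_eqI_open[OF open_D assms(1)]) (rule linear_vec2[OF lin_df])
  also have "\<dots> = dir_deriv (\<lambda>x. e x $ 1 *\<^sub>R dir_deriv F x dx) u v + dir_deriv (\<lambda>x. e x $ 2 *\<^sub>R dir_deriv F x dy) u v"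
    using open_D smooth_F assms by (intro dir_deriv_add[of D] smooth_intros)
  also have "\<dots> = e u $ 1 *\<^sub>R hess F u v dx + dir_deriv e u v $ 1 *\<^sub>R dir_deriv F u dx +
      (e u $ 2 *\<^sub>R hess F u v dy + dir_deriv e u v $ 2 *\<^sub>R dir_deriv F u dy)"
    unfolding comp ..
  also have "\<dots> =
      hess F u v (e u) + dir_deriv F u (dir_deriv e u v)"
  proof -
    have "hess F u v (e u) = e u $ 1 *\<^sub>R hess F u v dx + e u $ 2 *\<^sub>R hess F u v dy"
      unfolding hess_sym[OF assms(1), of v]
      by (rule linear_vec2) (auto intro!: linearI simp: hess_lin1[OF assms(1)])
    then show ?thesis
      using linear_vec2[OF lin_df[OF assms(1)], of "dir_deriv e u v"] by (simp add: algebra_simps)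
  qed
  finally show ?thesis .
qed

end

locale surf_frame_at = smooth_surf F D + tangent_frame F u e1 e2 for F D u e1 e2 +
  assumes u: "u \<in> D"
begin

lemma second_ff_lin1: "second_ff F u (v + v') w = second_ff F u v w + second_ff F u v' w"
  "second_ff F u (k *\<^sub>R v) w = k *\<^sub>R second_ff F u v w"
  unfolding second_ff_hess hess_lin1[OF u] nproj_lin by simp_all

lemma second_ff_lin2: "second_ff F u w (v + v') = second_ff F u w v + second_ff F u w v'"
  "second_ff F u w (k *\<^sub>R v) = k *\<^sub>R second_ff F u w v"
  unfolding second_ff_sym[OF u, of w] by (rule second_ff_lin1)+

lemmas second_ff_lin = second_ff_lin1 second_ff_lin2

abbreviation "\<alpha>11 \<equiv> second_ff F u e1 e1"
abbreviation "\<alpha>12 \<equiv> second_ff F u e1 e2"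
abbreviation "\<alpha>22 \<equiv> second_ff F u e2 e2"
abbreviation "\<alpha>0 \<equiv> (1/2) *\<^sub>R (\<alpha>11 - \<alpha>22)"

lemma \<alpha>21: "second_ff F u e2 e1 = \<alpha>12"
  by (rule second_ff_sym[OF u])

lemma second_ff_normal: "second_ff F u v w \<in> normal_space F u"
  unfolding second_ff_hess by (rule nproj_normal)

text \<open>When \<open>c\<close> and \<open>d\<close> are the cosine and sine of an angle, the sum
  of the two diagonal values is unchanged and the pair \<alpha>0, \<alpha>12 turns by the double
  angle.\<close>

lemma second_ff_rotated:
  assumes "a = c *\<^sub>R e1 + d *\<^sub>R e2" "b = (- d) *\<^sub>R e1 + c *\<^sub>R e2"
  shows "second_ff F u a a = (c * c) *\<^sub>R \<alpha>11 + (2 * c * d) *\<^sub>R \<alpha>12 + (d * d) *\<^sub>R \<alpha>22"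
    "second_ff F u a b = (c * c - d * d) *\<^sub>R \<alpha>12 - (c * d) *\<^sub>R (\<alpha>11 - \<alpha>22)"
    "second_ff F u b b = (d * d) *\<^sub>R \<alpha>11 - (2 * c * d) *\<^sub>R \<alpha>12 + (c * c) *\<^sub>R \<alpha>22"
  unfolding assms second_ff_lin \<alpha>21 by (simp_all add: vec_eq_iff algebra_simps)

lemma mean_curv: "mean_curv F u = (1/2) *\<^sub>R (\<alpha>11 + \<alpha>22)"
  unfolding mean_curv_def
proof (rule the_equality)
  show "\<forall>a b. pos_tangent_frame F u a b \<longrightarrow>
    (1/2) *\<^sub>R (\<alpha>11 + \<alpha>22) = (1/2) *\<^sub>R (second_ff F u a a + second_ff F u b b)"
  proof (intro allI impI)
    fix a b assume "pos_tangent_frame F u a b"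
    then obtain c d where cd: "c * c + d * d = 1" and ab: "a = c *\<^sub>R e1 + d *\<^sub>R e2" "b = (- d) *\<^sub>R e1 + c *\<^sub>R e2"
      using frame_rotation by blast
    have "second_ff F u a a + second_ff F u b b = (c * c + d * d) *\<^sub>R (\<alpha>11 + \<alpha>22)"
      unfolding second_ff_rotated[OF ab] by (simp add: vec_eq_iff algebra_simps)
    then show "(1/2) *\<^sub>R (\<alpha>11 + \<alpha>22) = (1/2) *\<^sub>R (second_ff F u a a + second_ff F u b b)"
      by (simp add: cd)
  qed
next
  fix h assume "\<forall>a b. pos_tangent_frame F u a b \<longrightarrow> h = (1/2) *\<^sub>R (second_ff F u a a + second_ff F u b b)"
  then show "h = (1/2) *\<^sub>R (\<alpha>11 + \<alpha>22)" using frame by blast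
qed

lemma mean_curv_normal: "mean_curv F u \<in> normal_space F u"
  unfolding mean_curv normal_space using second_ff_normal normal_space
  by (simp add: inner_add_left)

end

section \<open>Moving frames\<close>

locale surf_quat_at = surf_frame_at F D u e1 e2 + quat_frame s F u e1 e2 for s F D u e1 e2

context quat
begin

definition Lmat :: "real^4 \<Rightarrow> real^4^4" where "Lmat q = matrix (\<lambda>x. q \<odot> x)"

lemma Lmat_works: "Lmat q *v x = q \<odot> x"
  unfolding Lmat_def
  by (rule matrix_works) (simp add: linear_matrix_vector_mul_eq linear_conv_bounded_linear bounded_bilinear.bounded_linear_right[OF bilinear])

lemma Lmat_bounded_linear: "bounded_linear Lmat"
  unfolding linear_conv_bounded_linear[symmetric]
proof (rule linearI)
  show "Lmat (p + q) = Lmat p + Lmat q" for p q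
    unfolding matrix_eq matrix_vector_mult_add_rdistrib Lmat_works simps by simp
  show "Lmat (k *\<^sub>R p) = k *\<^sub>R Lmat p" for k p
    unfolding matrix_eq scaleR_matrix_vector_assoc[symmetric] Lmat_works simps by simp
qed

lemma Lmat_inj: "Lmat p = Lmat q \<longleftrightarrow> p = q"
  by (metis Lmat_works simps(2))

lemma Lmat_mult: "Lmat p ** Lmat q = Lmat (p \<odot> q)"
  by (simp add: matrix_eq matrix_vector_mul_assoc[symmetric] Lmat_works assoc)

text \<open>Multiplication by \<open>p\<close> carries an orthonormal basis to four vectors of the
  length of \<open>p\<close>. The factor 4 converts the 1/16 of \<open>twistor_metric\<close> into
  the 1/4 of \<open>gauss_lift_metric_eq\<close>.\<close>

lemma Lmat_inner: "Lmat p \<bullet> Lmat q = 4 * (p \<bullet> q)"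
proof -
  have "Lmat p \<bullet> Lmat q = (\<Sum>j\<in>UNIV. (p \<odot> axis j 1) \<bullet> (q \<odot> axis j 1))"
    unfolding Lmat_def matrix_def inner_vec_def by (simp add: sum_4)
  then show ?thesis by (simp add: inner_mult_mult sum_4 inner_axis_axis)
qed

end

locale framed_surf = quat s + smooth_surf F D for s F D +
  fixes e1 e2 :: "real^2 \<Rightarrow> real^2"
  assumes smooth_e: "smooth_on D e1" "smooth_on D e2"
    and frames: "u \<in> D \<Longrightarrow> pos_tangent_frame F u (e1 u) (e2 u)"
begin

abbreviation "E1 u \<equiv> dir_deriv F u (e1 u)"
abbreviation "E2 u \<equiv> dir_deriv F u (e2 u)"
abbreviation "\<omega>12 \<equiv> omega12 F e1 e2"
abbreviation "nrm u x \<equiv> x \<in> normal_space F u"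

definition Nf :: "real^2 \<Rightarrow> real^4" where "Nf u = E2 u \<odot> \<c> (E1 u)"

lemma at: "u \<in> D \<Longrightarrow> surf_quat_at s F D u (e1 u) (e2 u)"
  using frames[of u] lin_df[of u] s open_D smooth_F
  by (intro surf_quat_at.intro surf_frame_at.intro quat_frame.intro tangent_frame.intro smooth_surf.intro
      surf_frame_at_axioms.intro quat.intro) auto

lemma at': "u \<in> D \<Longrightarrow> surf_frame_at F D u (e1 u) (e2 u)" "u \<in> D \<Longrightarrow> quat_frame s F u (e1 u) (e2 u)"
  "u \<in> D \<Longrightarrow> tangent_frame F u (e1 u) (e2 u)"
  using at[of u] by (simp_all add: surf_quat_at_def surf_frame_at_def)

lemma Nf: "u \<in> D \<Longrightarrow> Nf u = quat_frame.N s F u (e1 u) (e2 u)"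
  by (simp add: Nf_def quat_frame.N_def[OF at'(2)])

lemma smooth_E: "smooth_on D E1" "smooth_on D E2"
  by (intro smooth_on_dir_deriv_field open_D smooth_F smooth_e)+

lemmas smooth = smooth_E smooth_e smooth_F open_D smooth_intros

lemma smooth_conj: "smooth_on D f \<Longrightarrow> smooth_on D (\<lambda>x. \<c> (f x))"
  using smooth_on_bounded_linear[OF conj_bounded_linear open_D] .

lemma smooth_prod: "smooth_on D f \<Longrightarrow> smooth_on D g \<Longrightarrow> smooth_on D (\<lambda>x. f x \<odot> g x)"
  using smooth_on_bilinear[OF bilinear open_D] .

lemma smooth_Nf: "smooth_on D Nf"
  unfolding Nf_def[abs_def] by (intro smooth_prod smooth_conj smooth_E)

lemma deriv_prod:
  assumes "smooth_on D f" "smooth_on D g" "u \<in> D"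
  shows "dir_deriv (\<lambda>x. f x \<odot> g x) u v = f u \<odot> dir_deriv g u v + dir_deriv f u v \<odot> g u"
  by (rule dir_deriv_bilinear[OF bilinear assms])

lemma deriv_conj: "smooth_on D f \<Longrightarrow> u \<in> D \<Longrightarrow> dir_deriv (\<lambda>x. \<c> (f x)) u v = \<c> (dir_deriv f u v)"
  by (rule dir_deriv_bounded_linear[OF conj_bounded_linear])

lemma deriv_inner:
  assumes "smooth_on D f" "smooth_on D g" "u \<in> D"
  shows "dir_deriv (\<lambda>x. f x \<bullet> g x) u v = f u \<bullet> dir_deriv g u v + dir_deriv f u v \<bullet> (g u :: real^4)"
  by (rule dir_deriv_bilinear[OF bounded_bilinear_inner assms])

lemma deriv_inner_const:
  assumes "smooth_on D f" "smooth_on D g" "u \<in> D" "\<And>x. x \<in> D \<Longrightarrow> f x \<bullet> (g x :: real^4) = k"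
  shows "dir_deriv f u v \<bullet> g u = - (f u \<bullet> dir_deriv g u v)"
proof -
  have "dir_deriv (\<lambda>x. f x \<bullet> g x) u v = dir_deriv (\<lambda>x. k) u v"
    by (rule dir_deriv_eqI_open[OF open_D assms(3)]) (rule assms(4))
  then show ?thesis
    using deriv_inner[OF assms(1-3)] by (simp add: frechet_derivative_const)
qed

lemma second_ff_E:
  assumes "u \<in> D"
  shows "second_ff F u v (e1 u) = nproj F u (dir_deriv E1 u v)"
    "second_ff F u v (e2 u) = nproj F u (dir_deriv E2 u v)"
proof -
  interpret P: surf_quat_at s F D u "e1 u" "e2 u" by (rule at[OF assms])
  show "second_ff F u v (e1 u) = nproj F u (dir_deriv E1 u v)"
    "second_ff F u v (e2 u) = nproj F u (dir_deriv E2 u v)"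
    unfolding second_ff_hess deriv_df_field[OF assms smooth_e(1)] deriv_df_field[OF assms smooth_e(2)]
    by (simp_all add: P.nproj_lin P.nproj_df)
qed

lemma frame_inner:
  assumes "u \<in> D"
  shows "E1 u \<bullet> E1 u = 1" "E2 u \<bullet> E2 u = 1" "E1 u \<bullet> E2 u = 0" "E2 u \<bullet> E1 u = 0"
  using frames[OF assms] by (auto simp: pos_tangent_frame_def metric_def inner_commute)

lemma deriv_E:
  assumes "u \<in> D"
  shows "dir_deriv E1 u v = \<omega>12 u v *\<^sub>R E2 u + second_ff F u v (e1 u)"
    "dir_deriv E2 u v = - \<omega>12 u v *\<^sub>R E1 u + second_ff F u v (e2 u)"
proof -
  interpret P: surf_quat_at s F D u "e1 u" "e2 u" by (rule at[OF assms])
  have "dir_deriv E1 u v \<bullet> E1 u = 0" "dir_deriv E2 u v \<bullet> E2 u = 0"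
    using deriv_inner_const[OF smooth_E(1) smooth_E(1) assms, of 1 v] deriv_inner_const[OF smooth_E(2) smooth_E(2) assms, of 1 v]
      frame_inner by (simp_all add: inner_commute)
  moreover have "dir_deriv E2 u v \<bullet> E1 u = - \<omega>12 u v"
    using deriv_inner_const[OF smooth_E(2) smooth_E(1) assms, of 0 v] frame_inner
    by (simp add: omega12_def inner_commute)
  moreover have "dir_deriv E1 u v \<bullet> E2 u = \<omega>12 u v" by (simp add: omega12_def)
  ultimately show "dir_deriv E1 u v = \<omega>12 u v *\<^sub>R E2 u + second_ff F u v (e1 u)"
    "dir_deriv E2 u v = - \<omega>12 u v *\<^sub>R E1 u + second_ff F u v (e2 u)"
    unfolding second_ff_E[OF assms] P.nproj by simp_all
qed

lemma smooth_nproj: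
  assumes "smooth_on D f" shows "smooth_on D (\<lambda>x. nproj F x (f x))"
proof -
  have "smooth_on D (\<lambda>x. f x - (f x \<bullet> E1 x) *\<^sub>R E1 x - (f x \<bullet> E2 x) *\<^sub>R E2 x)"
    by (intro assms smooth)
  moreover have "nproj F x (f x) = f x - (f x \<bullet> E1 x) *\<^sub>R E1 x - (f x \<bullet> E2 x) *\<^sub>R E2 x" if "x \<in> D" for x
    by (rule tangent_frame.nproj[OF at'(3)[OF that]])
  ultimately show ?thesis
    by (simp add: smooth_on_cong[OF open_D, of "\<lambda>x. nproj F x (f x)"])
qed

lemma smooth_second_ff:
  assumes "smooth_on D a"
  shows "smooth_on D (\<lambda>x. second_ff F x (a x) (e1 x))" "smooth_on D (\<lambda>x. second_ff F x (a x) (e2 x))"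
proof -
  have "smooth_on D (\<lambda>x. nproj F x (dir_deriv E1 x (a x)))" "smooth_on D (\<lambda>x. nproj F x (dir_deriv E2 x (a x)))"
    by (intro smooth_nproj smooth_on_dir_deriv_field open_D smooth_E assms)+
  then show "smooth_on D (\<lambda>x. second_ff F x (a x) (e1 x))" "smooth_on D (\<lambda>x. second_ff F x (a x) (e2 x))"
    using smooth_on_cong[OF open_D, of "\<lambda>x. second_ff F x (a x) (e1 x)"]
      smooth_on_cong[OF open_D, of "\<lambda>x. second_ff F x (a x) (e2 x)"] by (simp_all add: second_ff_E)
qed

abbreviation "\<alpha>11 u \<equiv> second_ff F u (e1 u) (e1 u)"
abbreviation "\<alpha>12 u \<equiv> second_ff F u (e1 u) (e2 u)"
abbreviation "\<alpha>22 u \<equiv> second_ff F u (e2 u) (e2 u)"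
abbreviation "\<alpha>0 u \<equiv> (1/2) *\<^sub>R (\<alpha>11 u - \<alpha>22 u)"

lemma smooth_\<alpha>: "smooth_on D \<alpha>11" "smooth_on D \<alpha>12" "smooth_on D \<alpha>22" "smooth_on D \<alpha>0"
  by (intro smooth_second_ff smooth)+

lemma mean_curv_eq: "u \<in> D \<Longrightarrow> mean_curv F u = (1/2) *\<^sub>R (\<alpha>11 u + \<alpha>22 u)"
  by (rule surf_frame_at.mean_curv[OF at'(1)])

lemma smooth_mean_curv: "smooth_on D (mean_curv F)"
proof -
  have "smooth_on D (\<lambda>u. (1/2) *\<^sub>R (\<alpha>11 u + \<alpha>22 u))"
    by (intro smooth_\<alpha> smooth)
  then show ?thesis by (simp add: smooth_on_cong[OF open_D, of "mean_curv F"] mean_curv_eq)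
qed

text \<open>Each factor of \<open>Nf\<close> contributes the connection form once, with opposite
  signs, so only the second fundamental form survives.\<close>

lemma deriv_Nf:
  assumes "u \<in> D"
  shows "dir_deriv Nf u v = (second_ff F u v (e2 u) - Nf u \<odot> second_ff F u v (e1 u)) \<odot> \<c> (E1 u)"
proof -
  interpret P: surf_quat_at s F D u "e1 u" "e2 u" by (rule at[OF assms])
  let ?a1 = "second_ff F u v (e1 u)" and ?a2 = "second_ff F u v (e2 u)"
  have n1: "?a1 \<bullet> E1 u = 0" using P.second_ff_normal[of v "e1 u"] P.normal_space by blast
  have "dir_deriv Nf u v = E2 u \<odot> \<c> (dir_deriv E1 u v) + dir_deriv E2 u v \<odot> \<c> (E1 u)"
    unfolding Nf_def[abs_def] by (simp add: deriv_prod smooth_E smooth_conj assms deriv_conj)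
  also have "E2 u \<odot> \<c> (dir_deriv E1 u v) = \<omega>12 u v *\<^sub>R quat_one - (Nf u \<odot> ?a1) \<odot> \<c> (E1 u)"
  proof -
    have "E2 u \<odot> \<c> ?a1 = Nf u \<odot> E1 u \<odot> \<c> ?a1" by (simp add: assoc[symmetric] P.N_E1 Nf[OF assms])
    also have "E1 u \<odot> \<c> ?a1 = - (?a1 \<odot> \<c> (E1 u))"
      using P.E1_conj_swap[OF n1, of quat_one] by (simp add: simps)
    finally show ?thesis
      unfolding deriv_E[OF assms] by (simp add: simps mult_conj P.orthonormal assoc)
  qed
  also have "dir_deriv E2 u v \<odot> \<c> (E1 u) = - \<omega>12 u v *\<^sub>R quat_one + ?a2 \<odot> \<c> (E1 u)"
    unfolding deriv_E[OF assms] by (simp add: simps P.cE1)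
  finally show ?thesis by (simp add: Nf[OF assms] simps)
qed

lemma Nf_imag: "u \<in> D \<Longrightarrow> Nf u \<bullet> quat_one = 0" "u \<in> D \<Longrightarrow> Nf u \<bullet> Nf u = 1"
  unfolding Nf_def by (simp_all add: inner_mult_conj frame_inner norm_mult_sq inner_conj(1))

lemma gauss_lift_eq: "u \<in> D \<Longrightarrow> gauss_lift F s u = (F u, Lmat (Nf u))"
  using quat_frame.gauss_lift[OF at'(2)] Nf[of u] by (simp add: Lmat_def)

lemma deriv_gauss_lift:
  assumes "u \<in> D"
  shows "dir_deriv (gauss_lift F s) u v = (dir_deriv F u v, Lmat (dir_deriv Nf u v))"
proof -
  have "dir_deriv (gauss_lift F s) u v = dir_deriv (\<lambda>x. (F x, Lmat (Nf x))) u v"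
    by (rule dir_deriv_eqI_open[OF open_D assms]) (rule gauss_lift_eq)
  also have "\<dots> = (dir_deriv F u v, Lmat (dir_deriv Nf u v))"
    by (rule dir_deriv_eq[OF has_derivative_Pair[OF smooth_on_has_derivative[OF smooth_F assms]
          bounded_linear.has_derivative[OF Lmat_bounded_linear smooth_on_has_derivative[OF smooth_Nf assms]]]])
  finally show ?thesis .
qed

lemma gauss_lift_metric_eq:
  assumes "u \<in> D"
  shows "gauss_lift_metric F s 1 u v w = metric F u v w + (dir_deriv Nf u v \<bullet> dir_deriv Nf u w) / 4"
  unfolding gauss_lift_metric_def twistor_metric_def deriv_gauss_lift[OF assms]
  by (simp add: metric_def Lmat_inner)

lemma holomorphic_iff_Nf:
  assumes "u \<in> D"
  shows "gauss_lift_holomorphic_at F s u \<longleftrightarrow>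
    (\<forall>v. dir_deriv Nf u (rotT F u v) = Nf u \<odot> dir_deriv Nf u v)"
proof -
  interpret P: surf_quat_at s F D u "e1 u" "e2 u" by (rule at[OF assms])
  show ?thesis
    unfolding gauss_lift_holomorphic_at_def deriv_gauss_lift[OF assms] AHS_def gauss_lift_eq[OF assms]
    by (simp add: Lmat_works Lmat_mult Lmat_inj P.N_df[symmetric] Nf[OF assms])
qed

text \<open>By linearity and N squared = - 1, holomorphicity need only be tested on
  \<open>e1\<close>. Cancelling the right factor \<open>\<c> (E1 u)\<close> in
  \<open>deriv_Nf\<close> leaves \<open>Nf u \<odot> \<alpha>12 u = - \<alpha>0 u\<close>.\<close>

lemma holomorphic_iff:
  assumes "u \<in> D"
  shows "gauss_lift_holomorphic_at F s u \<longleftrightarrow> \<alpha>12 u = Nf u \<odot> \<alpha>0 u"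
proof -
  interpret P: surf_quat_at s F D u "e1 u" "e2 u" by (rule at[OF assms])
  have N: "P.N = Nf u" by (simp add: Nf[OF assms])
  let ?d = "dir_deriv Nf u"
  have lin: "linear ?d" by (rule smooth_on_linear_deriv[OF smooth_Nf assms])
  have d1: "?d (e1 u) = (\<alpha>12 u - Nf u \<odot> \<alpha>11 u) \<odot> \<c> (E1 u)"
    and d2: "?d (e2 u) = (\<alpha>22 u - Nf u \<odot> \<alpha>12 u) \<odot> \<c> (E1 u)"
    unfolding deriv_Nf[OF assms] P.\<alpha>21 by simp_all
  have NN: "Nf u \<odot> Nf u \<odot> x = - x" for x using P.NNx N by simp
  have "gauss_lift_holomorphic_at F s u \<longleftrightarrow> ?d (e2 u) = Nf u \<odot> ?d (e1 u)"
  proof -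
    have rot: "rotT F u v = (dir_deriv F u v \<bullet> E1 u) *\<^sub>R e2 u - (dir_deriv F u v \<bullet> E2 u) *\<^sub>R e1 u" for v
      by (rule P.rotT)
    show ?thesis unfolding holomorphic_iff_Nf[OF assms]
    proof
      assume "\<forall>v. ?d (rotT F u v) = Nf u \<odot> ?d v"
      then have "?d (rotT F u (e1 u)) = Nf u \<odot> ?d (e1 u)" by blast
      then show "?d (e2 u) = Nf u \<odot> ?d (e1 u)" by (simp add: rot P.orthonormal)
    next
      assume e: "?d (e2 u) = Nf u \<odot> ?d (e1 u)"
      have e': "Nf u \<odot> ?d (e2 u) = - ?d (e1 u)" by (simp add: e NN)
      have "?d (rotT F u v) = Nf u \<odot> ?d ((dir_deriv F u v \<bullet> E1 u) *\<^sub>R e1 u + (dir_deriv F u v \<bullet> E2 u) *\<^sub>R e2 u)" for v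
        unfolding rot by (simp add: linear_add[OF lin] linear_diff[OF lin] linear_scale[OF lin] simps e[symmetric] e')
      then show "\<forall>v. ?d (rotT F u v) = Nf u \<odot> ?d v"
        using P.expand by metis
    qed
  qed
  also have "\<dots> \<longleftrightarrow> (\<alpha>22 u - Nf u \<odot> \<alpha>12 u) \<odot> \<c> (E1 u) = (Nf u \<odot> (\<alpha>12 u - Nf u \<odot> \<alpha>11 u)) \<odot> \<c> (E1 u)"
    unfolding d1 d2 by (simp add: assoc)
  also have "\<dots> \<longleftrightarrow> \<alpha>22 u - Nf u \<odot> \<alpha>12 u = Nf u \<odot> (\<alpha>12 u - Nf u \<odot> \<alpha>11 u)" (is "?x \<odot> _ = ?y \<odot> _ \<longleftrightarrow> _")
  proof
    assume "?x \<odot> \<c> (E1 u) = ?y \<odot> \<c> (E1 u)"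
    then have "(?x \<odot> \<c> (E1 u)) \<odot> E1 u = (?y \<odot> \<c> (E1 u)) \<odot> E1 u" by simp
    then show "?x = ?y" unfolding assoc P.cE1 by (simp add: simps)
  qed simp
  also have "\<dots> \<longleftrightarrow> \<alpha>12 u = Nf u \<odot> \<alpha>0 u"
  proof -
    have "Nf u \<odot> \<alpha>12 u = - \<alpha>0 u \<longleftrightarrow> \<alpha>12 u = Nf u \<odot> \<alpha>0 u"
    proof
      assume "Nf u \<odot> \<alpha>12 u = - \<alpha>0 u"
      then have "Nf u \<odot> Nf u \<odot> \<alpha>12 u = Nf u \<odot> (- \<alpha>0 u)" by simp
      then show "\<alpha>12 u = Nf u \<odot> \<alpha>0 u" unfolding NN by (simp add: simps)
    next
      assume "\<alpha>12 u = Nf u \<odot> \<alpha>0 u"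
      then show "Nf u \<odot> \<alpha>12 u = - \<alpha>0 u" using NN by metis
    qed
    moreover have "\<alpha>22 u - Nf u \<odot> \<alpha>12 u = Nf u \<odot> (\<alpha>12 u - Nf u \<odot> \<alpha>11 u) \<longleftrightarrow> Nf u \<odot> \<alpha>12 u = - \<alpha>0 u"
      unfolding simps NN by (auto simp: vec_eq_iff field_simps)
    ultimately show ?thesis by blast
  qed
  finally show ?thesis .
qed

text \<open>Rotation by a constant angle preserves smoothness, so every positive frame at a single
  point is the value of a smooth frame on all of \<open>D\<close>. It serves where a definition
  ranges over the frames at one point.\<close>

lemma rotate_frame:
  assumes "u \<in> D" "pos_tangent_frame F u a b"
  obtains e1' e2' where "framed_surf s F D e1' e2'" "e1' u = a" "e2' u = b"
proof -
  interpret P: surf_quat_at s F D u "e1 u" "e2 u" by (rule at[OF assms(1)])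
  obtain c d where cd: "c * c + d * d = 1" and ab: "a = c *\<^sub>R e1 u + d *\<^sub>R e2 u" "b = (- d) *\<^sub>R e1 u + c *\<^sub>R e2 u"
    using P.frame_rotation[OF assms(2)] by blast
  have "framed_surf s F D (\<lambda>x. c *\<^sub>R e1 x + d *\<^sub>R e2 x) (\<lambda>x. (- d) *\<^sub>R e1 x + c *\<^sub>R e2 x)"
  proof
    show "smooth_on D (\<lambda>x. c *\<^sub>R e1 x + d *\<^sub>R e2 x)" "smooth_on D (\<lambda>x. (- d) *\<^sub>R e1 x + c *\<^sub>R e2 x)"
      by (intro smooth)+
    show "pos_tangent_frame F x (c *\<^sub>R e1 x + d *\<^sub>R e2 x) ((- d) *\<^sub>R e1 x + c *\<^sub>R e2 x)" if "x \<in> D" for x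
      by (rule tangent_frame.rotated_frame[OF at'(3)[OF that] cd])
  qed
  then show ?thesis by (rule that) (simp_all add: ab)
qed

text \<open>The Ricci equation in flat space. The second derivatives of the extended normal field
  cancel by symmetry, and what remains comes from differentiating the projection onto the normal
  plane.\<close>

lemma normal_curv_tensor_eq:
  assumes u: "u \<in> D" and n: "nrm u x3" "nrm u x4"
  shows "normal_curv_tensor F (\<lambda>x. nproj F x x4) u a b \<bullet> x3 =
    (x4 \<bullet> second_ff F u b (e1 u)) * (second_ff F u a (e1 u) \<bullet> x3)
    + (x4 \<bullet> second_ff F u b (e2 u)) * (second_ff F u a (e2 u) \<bullet> x3)
    - (x4 \<bullet> second_ff F u a (e1 u)) * (second_ff F u b (e1 u) \<bullet> x3)
    - (x4 \<bullet> second_ff F u a (e2 u)) * (second_ff F u b (e2 u) \<bullet> x3)"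
proof -
  interpret P: surf_quat_at s F D u "e1 u" "e2 u" by (rule at[OF u])
  define \<xi> where "\<xi> x = nproj F x x4" for x
  have sm: "smooth_on D \<xi>" unfolding \<xi>_def by (intro smooth_nproj smooth_on_const)
  have \<xi>u: "\<xi> u = x4" unfolding \<xi>_def by (rule P.nproj_id[OF n(2)])
  have perp: "E1 u \<bullet> x3 = 0" "E2 u \<bullet> x3 = 0" "x3 \<bullet> E1 u = 0" "x3 \<bullet> E2 u = 0"
    using n(1) P.normal_space by (auto simp: inner_commute)
  have perp4: "x4 \<bullet> E1 u = 0" "x4 \<bullet> E2 u = 0" using n(2) P.normal_space by auto
  have \<xi>E: "\<xi> x \<bullet> E1 x = 0" "\<xi> x \<bullet> E2 x = 0" if "x \<in> D" for x
  proof -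
    interpret Q: surf_quat_at s F D x "e1 x" "e2 x" by (rule at[OF that])
    show "\<xi> x \<bullet> E1 x = 0" "\<xi> x \<bullet> E2 x = 0" unfolding \<xi>_def using Q.nproj_normal Q.normal_space by blast+
  qed
  have d\<xi>: "dir_deriv \<xi> u v \<bullet> E1 u = - (x4 \<bullet> second_ff F u v (e1 u))"
    "dir_deriv \<xi> u v \<bullet> E2 u = - (x4 \<bullet> second_ff F u v (e2 u))" for v
    using deriv_inner_const[OF sm smooth_E(1) u \<xi>E(1), of v] deriv_inner_const[OF sm smooth_E(2) u \<xi>E(2), of v]
    unfolding deriv_E[OF u] \<xi>u by (simp_all add: inner_add_right inner_diff_right perp4)
  have ff: "dir_deriv E1 u v \<bullet> x3 = second_ff F u v (e1 u) \<bullet> x3"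
    "dir_deriv E2 u v \<bullet> x3 = second_ff F u v (e2 u) \<bullet> x3" for v
    unfolding deriv_E[OF u] by (simp_all add: inner_add_left inner_diff_left perp)
  \<comment> \<open>Terms in which \<open>E1\<close> or \<open>E2\<close> stays undifferentiated
    vanish against the normal vector \<open>x3\<close>.\<close>
  have main: "normal_conn F (\<lambda>x. normal_conn F \<xi> x w) u v \<bullet> x3 = dir_deriv (\<lambda>x. dir_deriv \<xi> x w) u v \<bullet> x3
      + (x4 \<bullet> second_ff F u w (e1 u)) * (second_ff F u v (e1 u) \<bullet> x3)
      + (x4 \<bullet> second_ff F u w (e2 u)) * (second_ff F u v (e2 u) \<bullet> x3)" for v w
  proof -
    let ?d = "\<lambda>x. dir_deriv \<xi> x w"
    have sd: "smooth_on D ?d" by (rule smooth_on_dir_deriv[OF sm])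
    have "dir_deriv (\<lambda>x. nproj F x (?d x)) u v =
        dir_deriv (\<lambda>x. ?d x - (?d x \<bullet> E1 x) *\<^sub>R E1 x - (?d x \<bullet> E2 x) *\<^sub>R E2 x) u v"
    proof (rule dir_deriv_eqI_open[OF open_D u])
      fix x assume "x \<in> D"
      then interpret Q: surf_quat_at s F D x "e1 x" "e2 x" by (rule at)
      show "nproj F x (?d x) = ?d x - (?d x \<bullet> E1 x) *\<^sub>R E1 x - (?d x \<bullet> E2 x) *\<^sub>R E2 x" by (rule Q.nproj)
    qed
    also have "\<dots> = dir_deriv ?d u v - dir_deriv (\<lambda>x. (?d x \<bullet> E1 x) *\<^sub>R E1 x) u v - dir_deriv (\<lambda>x. (?d x \<bullet> E2 x) *\<^sub>R E2 x) u v"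
    proof -
      have s1: "smooth_on D (\<lambda>x. (?d x \<bullet> E1 x) *\<^sub>R E1 x)" "smooth_on D (\<lambda>x. (?d x \<bullet> E2 x) *\<^sub>R E2 x)"
        by (intro sd smooth)+
      show ?thesis
        using dir_deriv_diff[OF smooth_on_diff[OF open_D sd s1(1)] s1(2) u] dir_deriv_diff[OF sd s1(1) u] by simp
    qed
    finally have "dir_deriv (\<lambda>x. nproj F x (?d x)) u v \<bullet> x3 = dir_deriv ?d u v \<bullet> x3
        - (?d u \<bullet> E1 u) * (dir_deriv E1 u v \<bullet> x3) - (?d u \<bullet> E2 u) * (dir_deriv E2 u v \<bullet> x3)"
      using dir_deriv_bilinear[OF bounded_bilinear_scaleR smooth_on_inner[OF open_D sd smooth_E(1)] smooth_E(1) u, of v]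
        dir_deriv_bilinear[OF bounded_bilinear_scaleR smooth_on_inner[OF open_D sd smooth_E(2)] smooth_E(2) u, of v]
      by (simp add: inner_diff_left inner_add_left perp)
    then show ?thesis
      unfolding normal_conn_def using n(1) by (simp add: P.nproj_inner d\<xi> ff)
  qed
  have "dir_deriv (\<lambda>x. dir_deriv \<xi> x b) u a = dir_deriv (\<lambda>x. dir_deriv \<xi> x a) u b"
    by (rule mixed_derivatives_commute[OF open_D sm u])
  then show ?thesis
    unfolding normal_curv_tensor_def \<xi>_def[symmetric] inner_diff_left main by simp
qed

end

section \<open>Surfaces whose curvature ellipse is a circle\<close>

context framed_surf
begin

lemma plane: "u \<in> D \<Longrightarrow> quat_plane s (E1 u) (Nf u)"
  by (intro quat_plane.intro quat.intro s quat_plane_axioms.intro) (simp_all add: frame_inner Nf_imag)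

lemma E2_eq: "u \<in> D \<Longrightarrow> Nf u \<odot> E1 u = E2 u"
  unfolding Nf_def by (simp add: assoc mult_conj frame_inner simps)

lemma nrm_iff: "u \<in> D \<Longrightarrow> nrm u x \<longleftrightarrow> x \<bullet> E1 u = 0 \<and> x \<bullet> E2 u = 0"
  by (rule tangent_frame.normal_space[OF at'(3)])

lemma normal_iff: "u \<in> D \<Longrightarrow> quat_plane.normal s (E1 u) (Nf u) x \<longleftrightarrow> nrm u x"
  using quat_plane.normal_def[OF plane, of u x] by (simp add: nrm_iff E2_eq)

lemma nrm_lin: "u \<in> D \<Longrightarrow> nrm u x \<Longrightarrow> nrm u y \<Longrightarrow> nrm u (x + y)" "u \<in> D \<Longrightarrow> nrm u x \<Longrightarrow> nrm u y \<Longrightarrow> nrm u (x - y)"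
  "u \<in> D \<Longrightarrow> nrm u x \<Longrightarrow> nrm u (k *\<^sub>R x)" "u \<in> D \<Longrightarrow> nrm u x \<Longrightarrow> nrm u (- x)" "u \<in> D \<Longrightarrow> nrm u x \<Longrightarrow> nrm u (Nf u \<odot> x)"
  using quat_plane.normal_lin[OF plane] quat_plane.normal_N[OF plane] normal_iff by metis+

lemma ff_nrm: "u \<in> D \<Longrightarrow> nrm u (second_ff F u v w)"
  by (rule surf_frame_at.second_ff_normal[OF at'(1)])

lemma \<alpha>0_nrm: "u \<in> D \<Longrightarrow> nrm u (\<alpha>0 u)"
  by (intro nrm_lin ff_nrm)

lemma H_nrm: "u \<in> D \<Longrightarrow> nrm u (mean_curv F u)"
  by (rule surf_frame_at.mean_curv_normal[OF at'(1)])

lemma expand: "u \<in> D \<Longrightarrow> v = (dir_deriv F u v \<bullet> E1 u) *\<^sub>R e1 u + (dir_deriv F u v \<bullet> E2 u) *\<^sub>R e2 u"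
  by (rule tangent_frame.expand[OF at'(3)])

lemma rotT_eq: "u \<in> D \<Longrightarrow> rotT F u v = (dir_deriv F u v \<bullet> E1 u) *\<^sub>R e2 u - (dir_deriv F u v \<bullet> E2 u) *\<^sub>R e1 u"
  by (rule tangent_frame.rotT[OF at'(3)])

lemma \<alpha>_H: "u \<in> D \<Longrightarrow> \<alpha>11 u = mean_curv F u + \<alpha>0 u" "u \<in> D \<Longrightarrow> \<alpha>22 u = mean_curv F u - \<alpha>0 u"
  unfolding mean_curv_eq by (simp_all add: vec_eq_iff field_simps)

lemma restrict:
  assumes "open D0" "D0 \<subseteq> D" shows "framed_surf s F D0 e1 e2"
  using assms smooth_F smooth_e frames s smooth_on_subset
  by (intro framed_surf.intro quat.intro smooth_surf.intro framed_surf_axioms.intro) (auto intro: smooth_on_subset)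

end

text \<open>By \<open>holomorphic_iff\<close> and \<open>umbilic_iff\<close> the first two
  conditions say that the Gauss lift of sign \<open>s\<close> is holomorphic and that there are no
  umbilics on \<open>D\<close>.\<close>

locale iso_surf = framed_surf +
  assumes iso: "u \<in> D \<Longrightarrow> \<alpha>12 u = Nf u \<odot> \<alpha>0 u"
    and nonumbilic: "u \<in> D \<Longrightarrow> \<alpha>0 u \<noteq> 0"
    and H0: "u \<in> D \<Longrightarrow> mean_curv F u \<noteq> 0"
begin

abbreviation "H \<equiv> mean_curv F"

lemma iso_restrict:
  assumes "open D0" "D0 \<subseteq> D" shows "iso_surf s F D0 e1 e2"
proof -
  interpret R: framed_surf s F D0 e1 e2 by (rule restrict[OF assms])
  show ?thesis
  proof
    fix u assume "u \<in> D0"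
    then have u: "u \<in> D" using assms by blast
    show "\<alpha>12 u = R.Nf u \<odot> \<alpha>0 u" using iso[OF u] by (simp only: R.Nf_def Nf_def)
    show "\<alpha>0 u \<noteq> 0" "mean_curv F u \<noteq> 0" by (rule nonumbilic[OF u], rule H0[OF u])
  qed
qed

text \<open>Superconformality cancels the trace-free part \<alpha>0 from \<open>deriv_Nf\<close>.
  Consequently \<open>Nf\<close> is conformal with factor |H|^2, and an immersion where
  \<open>H\<close> does not vanish.\<close>

lemma deriv_Nf_H:
  assumes u: "u \<in> D"
  shows "dir_deriv Nf u v = - ((Nf u \<odot> H u) \<odot> \<c> (dir_deriv F u v))"
proof -
  interpret P: surf_frame_at F D u "e1 u" "e2 u" by (rule at'(1)[OF u])
  interpret Q: quat_plane s "E1 u" "Nf u" by (rule plane[OF u])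
  define p q where "p = dir_deriv F u v \<bullet> E1 u" and "q = dir_deriv F u v \<bullet> E2 u"
  have v: "v = p *\<^sub>R e1 u + q *\<^sub>R e2 u" unfolding p_def q_def by (rule expand[OF u])
  have dv: "dir_deriv F u v = p *\<^sub>R E1 u + q *\<^sub>R E2 u" by (subst v) simp
  obtain a where a: "\<alpha>11 u = H u + a" "\<alpha>22 u = H u - a" "\<alpha>12 u = Nf u \<odot> a"
    using \<alpha>_H[OF u] iso[OF u] by blast
  have ff: "second_ff F u v (e1 u) = p *\<^sub>R (H u + a) + q *\<^sub>R (Nf u \<odot> a)"
    "second_ff F u v (e2 u) = p *\<^sub>R (Nf u \<odot> a) + q *\<^sub>R (H u - a)"
    by (subst v, simp only: P.second_ff_lin P.\<alpha>21 a)+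
  have "Q.normal (Nf u \<odot> H u)" using nrm_lin(5)[OF u H_nrm[OF u]] normal_iff[OF u] by blast
  then have c2: "(Nf u \<odot> H u) \<odot> \<c> (E2 u) = - (H u \<odot> \<c> (E1 u))"
    unfolding E2_eq[OF u, symmetric] using Q.normal_anticommute[of "Nf u \<odot> H u"]
    by (simp add: simps Q.cN assoc Q.NNx)
  have sub: "second_ff F u v (e2 u) - Nf u \<odot> second_ff F u v (e1 u) = q *\<^sub>R H u - p *\<^sub>R (Nf u \<odot> H u)"
    unfolding ff simps Q.NNx by (simp add: vec_eq_iff algebra_simps)
  show ?thesis
    unfolding deriv_Nf[OF u] sub dv by (simp add: simps c2)
qed

lemma deriv_Nf_norm:
  assumes u: "u \<in> D"
  shows "dir_deriv Nf u v \<bullet> dir_deriv Nf u w = (H u \<bullet> H u) * metric F u v w"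
  unfolding deriv_Nf_H[OF u] by (simp add: inner_mult_mult Nf_imag[OF u] norm_mult_sq inner_conj(1) metric_def)

definition E3 :: "real^2 \<Rightarrow> real^4" where "E3 u = sgn (\<alpha>0 u)"

lemma E3:
  assumes "u \<in> D"
  shows "E3 u \<bullet> E3 u = 1" "nrm u (E3 u)" "E3 u \<bullet> (Nf u \<odot> E3 u) = 0" "(Nf u \<odot> E3 u) \<bullet> E3 u = 0"
    "(Nf u \<odot> E3 u) \<bullet> (Nf u \<odot> E3 u) = 1"
proof -
  interpret Q: quat_plane s "E1 u" "Nf u" by (rule plane[OF assms])
  show 1: "E3 u \<bullet> E3 u = 1"
    using nonumbilic[OF assms] norm_sgn[of "\<alpha>0 u"] by (simp add: E3_def dot_square_norm split: if_splits)
  show "nrm u (E3 u)" unfolding E3_def sgn_div_norm by (intro nrm_lin \<alpha>0_nrm assms)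
  show "E3 u \<bullet> (Nf u \<odot> E3 u) = 0" "(Nf u \<odot> E3 u) \<bullet> E3 u = 0" by (rule Q.N_perp)+
  show "(Nf u \<odot> E3 u) \<bullet> (Nf u \<odot> E3 u) = 1" by (simp add: Q.N_isometry 1)
qed

lemma \<alpha>0_E3: "\<alpha>0 u = norm (\<alpha>0 u) *\<^sub>R E3 u"
  unfolding E3_def by (simp add: sgn_div_norm)

lemma smooth_E3: "smooth_on D E3"
  unfolding E3_def[abs_def] by (intro smooth_on_sgn open_D smooth_\<alpha> nonumbilic)

text \<open>\<open>\<Omega>\<close> is the mixed connection form of the sign opposite to \<open>s\<close>; its field \<open>e3\<close> is \<open>E3\<close>.\<close>

definition \<Omega> :: "real^2 \<Rightarrow> real^2 \<Rightarrow> real"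
  where "\<Omega> u v = 2 * \<omega>12 u v - dir_deriv E3 u v \<bullet> (Nf u \<odot> E3 u)"

text \<open>With the sign opposite to \<open>s\<close> the two summands add up to twice \<alpha>0;
  with the sign \<open>s\<close> they would cancel.\<close>

lemma e3_field_eq:
  assumes u: "u \<in> D" shows "e3_field F (- s) e1 e2 u = E3 u"
proof -
  interpret Q: quat_plane s "E1 u" "Nf u" by (rule plane[OF u])
  have "rotN F u (\<alpha>12 u) = s *\<^sub>R (Nf u \<odot> \<alpha>12 u)"
    using quat_frame.rotN[OF at'(2)[OF u] ff_nrm[OF u]] by (simp add: Nf[OF u])
  then have "(- s) *\<^sub>R rotN F u (\<alpha>12 u) = (s * s) *\<^sub>R \<alpha>0 u"
    unfolding iso[OF u] Q.NNx by simp
  then have "(1/2) *\<^sub>R (\<alpha>11 u - \<alpha>22 u) + (- s) *\<^sub>R rotN F u (\<alpha>12 u) = 2 *\<^sub>R \<alpha>0 u"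
    unfolding s by (simp only: scaleR_2 scaleR_one)
  then show ?thesis unfolding e3_field_def E3_def by (simp only: sgn_scaleR) simp
qed

lemma mixed_form_eq:
  assumes u: "u \<in> D" shows "mixed_form F (- s) e1 e2 u v = \<Omega> u v"
proof -
  have 1: "dir_deriv (e3_field F (- s) e1 e2) u v = dir_deriv E3 u v"
    by (rule dir_deriv_eqI_open[OF open_D u e3_field_eq])
  have 2: "rotN F u (E3 u) = s *\<^sub>R (Nf u \<odot> E3 u)"
    using quat_frame.rotN[OF at'(2)[OF u] E3(2)[OF u]] by (simp add: Nf[OF u])
  have 3: "nrm u (s *\<^sub>R (Nf u \<odot> E3 u))" by (intro nrm_lin E3 u)
  show ?thesis
    unfolding mixed_form_def \<Omega>_def omega34_def normal_conn_def e3_field_eq[OF u] 1 2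
      tangent_frame.nproj_inner[OF at'(3)[OF u] 3]
    using s by (simp flip: mult.assoc)
qed

lemma \<Omega>_lin:
  assumes "u \<in> D" shows "linear (\<Omega> u)"
  unfolding \<Omega>_def omega12_def
  using smooth_on_linear_deriv[OF smooth_E(1) assms] smooth_on_linear_deriv[OF smooth_E3 assms]
  by (intro linearI) (simp_all add: linear_add linear_scale inner_add_left algebra_simps)

lemma smooth_\<Omega>: "smooth_on D a \<Longrightarrow> smooth_on D (\<lambda>u. \<Omega> u (a u))"
  unfolding \<Omega>_def[abs_def] omega12_def[abs_def]
  by (intro smooth_on_diff smooth_on_mult smooth_on_const smooth_on_inner smooth_on_dir_deriv_field smooth_prod
      smooth_E smooth_E3 smooth_Nf open_D)

text \<open>The Hodge star with the rotation written out in the frame, so that linearity and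
  smoothness are visible without the definite description \<open>rotT\<close>.\<close>

definition star\<Omega> :: "real^2 \<Rightarrow> real^2 \<Rightarrow> real"
  where "star\<Omega> u v = - \<Omega> u ((dir_deriv F u v \<bullet> E1 u) *\<^sub>R e2 u - (dir_deriv F u v \<bullet> E2 u) *\<^sub>R e1 u)"

lemma hodge_star_eq: "u \<in> D \<Longrightarrow> hodge_star F (mixed_form F (- s) e1 e2) u v = star\<Omega> u v"
  unfolding hodge_star_def star\<Omega>_def by (simp add: mixed_form_eq rotT_eq)

lemma star\<Omega>_expand:
  assumes "u \<in> D"
  shows "star\<Omega> u v = (dir_deriv F u v \<bullet> E2 u) * \<Omega> u (e1 u) - (dir_deriv F u v \<bullet> E1 u) * \<Omega> u (e2 u)"
  unfolding star\<Omega>_def using \<Omega>_lin[OF assms] by (simp add: linear_diff linear_scale)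

lemma star\<Omega>_lin: assumes "u \<in> D" shows "linear (star\<Omega> u)"
  using smooth_on_linear_deriv[OF smooth_F assms]
  by (intro linearI) (simp_all add: star\<Omega>_expand[OF assms] linear_add linear_scale inner_add_left algebra_simps)

lemma smooth_star\<Omega>: "smooth_on D (\<lambda>u. star\<Omega> u v)"
proof -
  have "smooth_on D (\<lambda>u. (dir_deriv F u v \<bullet> E2 u) * \<Omega> u (e1 u) - (dir_deriv F u v \<bullet> E1 u) * \<Omega> u (e2 u))"
    by (intro smooth_on_diff smooth_on_mult smooth_on_inner smooth_\<Omega> smooth_E smooth_e smooth_on_dir_deriv smooth_F open_D)
  then show ?thesis by (simp add: smooth_on_cong[OF open_D, of "\<lambda>u. star\<Omega> u v"] star\<Omega>_expand)
qed

lemma ext_deriv_eq: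
  assumes u: "u \<in> D"
  shows "ext_deriv (hodge_star F (mixed_form F (- s) e1 e2)) u v w = ext_deriv star\<Omega> u v w"
proof -
  have "dir_deriv (\<lambda>x. hodge_star F (mixed_form F (- s) e1 e2) x w) u v = dir_deriv (\<lambda>x. star\<Omega> x w) u v" for v w
    by (rule dir_deriv_eqI_open[OF open_D u]) (rule hodge_star_eq)
  then show ?thesis unfolding ext_deriv_def by simp
qed

subsection \<open>Closedness of the forms \<open>\<c> E1 \<odot> df \<odot> \<c> E1 \<odot> \<zeta>\<close>\<close>

definition form :: "(real^2 \<Rightarrow> real^4) \<Rightarrow> real^2 \<Rightarrow> real^2 \<Rightarrow> real^4"
  where "form \<zeta> u v = \<c> (E1 u) \<odot> dir_deriv F u v \<odot> \<c> (E1 u) \<odot> \<zeta> u"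

text \<open>For normal \<zeta> this is \<open>E1\<close> times the exterior derivative of
  \<open>form \<zeta>\<close> on the pair \<open>e1\<close>, \<open>e2\<close>, as computed in
  \<open>closedness_identity\<close>. The last summand is its tangential part.\<close>

definition dform :: "(real^2 \<Rightarrow> real^4) \<Rightarrow> real^2 \<Rightarrow> real^4"
  where "dform \<zeta> u = (2 * \<omega>12 u (e1 u)) *\<^sub>R \<zeta> u + (2 * \<omega>12 u (e2 u)) *\<^sub>R (Nf u \<odot> \<zeta> u)
    + Nf u \<odot> nproj F u (dir_deriv \<zeta> u (e1 u)) - nproj F u (dir_deriv \<zeta> u (e2 u)) - (4 * (\<alpha>0 u \<bullet> \<zeta> u)) *\<^sub>R E2 u"

lemma form_lin: "u \<in> D \<Longrightarrow> linear (form \<zeta> u)"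
  unfolding form_def using smooth_on_linear_deriv[OF smooth_F]
  by (intro linearI) (simp_all add: linear_add linear_scale simps)

lemma smooth_form: "smooth_on D \<zeta> \<Longrightarrow> smooth_on D (\<lambda>u. form \<zeta> u v)"
  unfolding form_def by (intro smooth_prod smooth_conj smooth_E smooth_on_dir_deriv smooth_F)

lemma form_e:
  assumes "u \<in> D"
  shows "E1 u \<odot> form \<zeta> u (e1 u) = \<zeta> u" "E1 u \<odot> form \<zeta> u (e2 u) = Nf u \<odot> \<zeta> u"
proof -
  interpret Q: quat_plane s "E1 u" "Nf u" by (rule plane[OF assms])
  show "E1 u \<odot> form \<zeta> u (e1 u) = \<zeta> u" "E1 u \<odot> form \<zeta> u (e2 u) = Nf u \<odot> \<zeta> u"
    unfolding form_def Q.cE1 E2_eq[OF assms, symmetric] assoc Q.cE1 by simp_all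
qed

lemma alternating_det:
  fixes T :: "real^2 \<Rightarrow> real^2 \<Rightarrow> 'c::real_vector"
  assumes "\<And>v. linear (T v)" "\<And>w. linear (\<lambda>v. T v w)"
    "v = p *\<^sub>R a + q *\<^sub>R b" "w = r *\<^sub>R a + t *\<^sub>R b"
  shows "T v w - T w v = (p * t - q * r) *\<^sub>R (T a b - T b a)"
  unfolding assms(3,4)
  by (simp add: linear_add[OF assms(1)] linear_scale[OF assms(1)] linear_add[OF assms(2)] linear_scale[OF assms(2)])
    (simp add: algebra_simps)

lemma deriv_normal_field:
  assumes u: "u \<in> D" and sm: "smooth_on D \<zeta>" and nz: "\<And>x. x \<in> D \<Longrightarrow> nrm x (\<zeta> x)"
  shows "dir_deriv \<zeta> u v = - (\<zeta> u \<bullet> second_ff F u v (e1 u)) *\<^sub>R E1 u - (\<zeta> u \<bullet> second_ff F u v (e2 u)) *\<^sub>R E2 u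
    + nproj F u (dir_deriv \<zeta> u v)"
proof -
  have "dir_deriv \<zeta> u v \<bullet> E1 u = - (\<zeta> u \<bullet> second_ff F u v (e1 u))"
    "dir_deriv \<zeta> u v \<bullet> E2 u = - (\<zeta> u \<bullet> second_ff F u v (e2 u))"
    using deriv_inner_const[OF sm smooth_E(1) u, of 0 v] deriv_inner_const[OF sm smooth_E(2) u, of 0 v] nz[OF u] nz
    by (auto simp: nrm_iff u deriv_E inner_add_right inner_diff_right)
  then show ?thesis
    unfolding tangent_frame.nproj[OF at'(3)[OF u]] by (simp add: vec_eq_iff)
qed

text \<open>The second derivatives of \<open>F\<close> enter symmetrically and drop out. The rest is
  bilinear in the two directions, so its alternation is a determinant times the value on the
  frame.\<close>

lemma deriv_form:
  assumes u: "u \<in> D" and sm: "smooth_on D \<zeta>" and nz: "\<And>x. x \<in> D \<Longrightarrow> nrm x (\<zeta> x)"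
  shows "dir_deriv (\<lambda>x. form \<zeta> x w) u v - dir_deriv (\<lambda>x. form \<zeta> x v) u w =
    ((dir_deriv F u v \<bullet> E1 u) * (dir_deriv F u w \<bullet> E2 u) - (dir_deriv F u v \<bullet> E2 u) * (dir_deriv F u w \<bullet> E1 u))
      *\<^sub>R (\<c> (E1 u) \<odot> dform \<zeta> u)"
proof -
  interpret P: surf_frame_at F D u "e1 u" "e2 u" by (rule at'(1)[OF u])
  interpret Q: quat_plane s "E1 u" "Nf u" by (rule plane[OF u])
  define T where "T v w = \<c> (dir_deriv E1 u v) \<odot> dir_deriv F u w \<odot> \<c> (E1 u) \<odot> \<zeta> u
     + \<c> (E1 u) \<odot> dir_deriv F u w \<odot> (\<c> (dir_deriv E1 u v) \<odot> \<zeta> u + \<c> (E1 u) \<odot> dir_deriv \<zeta> u v)" for v w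
  have sF: "smooth_on D (\<lambda>x. dir_deriv F x w)" for w by (rule smooth_on_dir_deriv[OF smooth_F])
  have D: "dir_deriv (\<lambda>x. form \<zeta> x w) u v = T v w + \<c> (E1 u) \<odot> hess F u v w \<odot> \<c> (E1 u) \<odot> \<zeta> u" for v w
    unfolding form_def T_def hess_def
    by (simp add: deriv_prod smooth_prod smooth_conj smooth_E sF sm u deriv_conj simps add_ac)
  have lE: "linear (dir_deriv E1 u)" "linear (dir_deriv \<zeta> u)"
    using smooth_on_linear_deriv[OF smooth_E(1) u] smooth_on_linear_deriv[OF sm u] .
  have lin: "linear (T v)" "linear (\<lambda>v. T v w)" for v w
    unfolding T_def by (intro linearI; simp add: linear_add[OF lE(1)] linear_scale[OF lE(1)]
      linear_add[OF lE(2)] linear_scale[OF lE(2)] simps algebra_simps)+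
  have "T (e1 u) (e2 u) - T (e2 u) (e1 u) = \<c> (E1 u) \<odot> dform \<zeta> u"
  proof -
    have ff: "second_ff F u (e2 u) (e1 u) = \<alpha>12 u" by (rule P.\<alpha>21)
    have n: "Q.normal (\<zeta> u)" "Q.normal (\<alpha>11 u)" "Q.normal (\<alpha>12 u)" "Q.normal (\<alpha>22 u)"
      using normal_iff[OF u] nz[OF u] ff_nrm[OF u] by blast+
    have A: "dir_deriv E1 u (e1 u) = \<omega>12 u (e1 u) *\<^sub>R (Nf u \<odot> E1 u) + \<alpha>11 u"
      "dir_deriv E1 u (e2 u) = \<omega>12 u (e2 u) *\<^sub>R (Nf u \<odot> E1 u) + \<alpha>12 u"
      unfolding E2_eq[OF u] deriv_E[OF u] ff by simp_all
    have Z: "dir_deriv \<zeta> u (e1 u) = - (\<zeta> u \<bullet> \<alpha>11 u) *\<^sub>R E1 u - (\<zeta> u \<bullet> \<alpha>12 u) *\<^sub>R (Nf u \<odot> E1 u) + nproj F u (dir_deriv \<zeta> u (e1 u))"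
      "dir_deriv \<zeta> u (e2 u) = - (\<zeta> u \<bullet> \<alpha>12 u) *\<^sub>R E1 u - (\<zeta> u \<bullet> \<alpha>22 u) *\<^sub>R (Nf u \<odot> E1 u) + nproj F u (dir_deriv \<zeta> u (e2 u))"
      unfolding E2_eq[OF u] using deriv_normal_field[OF u sm nz, of "e1 u"] deriv_normal_field[OF u sm nz, of "e2 u"] ff
      by simp_all
    have "E1 u \<odot> (T (e1 u) (e2 u) - T (e2 u) (e1 u)) = dform \<zeta> u"
      using Q.closedness_identity[OF n A Z iso[OF u]] unfolding T_def dform_def E2_eq[OF u]
      by (simp add: inner_diff_left)
    then have "\<c> (E1 u) \<odot> E1 u \<odot> (T (e1 u) (e2 u) - T (e2 u) (e1 u)) = \<c> (E1 u) \<odot> dform \<zeta> u" by simp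
    then show ?thesis unfolding Q.cE1 .
  qed
  then show ?thesis
    unfolding D hess_sym[OF u, of w v] using alternating_det[OF lin expand[OF u] expand[OF u], of v w] by simp
qed

text \<open>A form of the Codazzi equation for \<open>H\<close>. By \<open>deriv_Nf_H\<close> the
  derivative of \<open>Nf\<close> is minus \<open>N \<odot> H\<close> times the conjugate of df;
  symmetry of the second derivatives of \<open>Nf\<close> and of \<open>F\<close> then relates the
  derivatives of \<open>N \<odot> H\<close> along \<open>e1\<close> and \<open>e2\<close>.\<close>

lemma normal_part_commute:
  assumes u: "u \<in> D" and n: "nrm u \<nu>"
  shows "dir_deriv (\<lambda>x. Nf x \<odot> H x) u (e2 u) \<bullet> \<nu> = - (dir_deriv (\<lambda>x. Nf x \<odot> H x) u (e1 u) \<bullet> (Nf u \<odot> \<nu>))"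
proof -
  interpret Q: quat_plane s "E1 u" "Nf u" by (rule plane[OF u])
  define chi where "chi x = Nf x \<odot> H x" for x
  have sm: "smooth_on D chi" unfolding chi_def by (intro smooth_prod smooth_Nf smooth_mean_curv)
  have sF: "smooth_on D (\<lambda>x. dir_deriv F x w)" for w by (rule smooth_on_dir_deriv[OF smooth_F])
  have "dir_deriv (\<lambda>x. dir_deriv Nf x w) u v = - (dir_deriv chi u v \<odot> \<c> (dir_deriv F u w) + chi u \<odot> \<c> (hess F u v w))" for v w
  proof -
    have "dir_deriv (\<lambda>x. dir_deriv Nf x w) u v = dir_deriv (\<lambda>x. - (chi x \<odot> \<c> (dir_deriv F x w))) u v"
      by (rule dir_deriv_eqI_open[OF open_D u]) (simp add: deriv_Nf_H chi_def)
    also have "\<dots> = - dir_deriv (\<lambda>x. chi x \<odot> \<c> (dir_deriv F x w)) u v"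
      by (rule dir_deriv_bounded_linear[OF bounded_linear_minus[OF bounded_linear_ident] _ u])
        (intro smooth_prod sm smooth_conj sF)
    finally show ?thesis by (simp add: deriv_prod sm smooth_conj sF u deriv_conj hess_def)
  qed
  then have "dir_deriv chi u (e1 u) \<odot> \<c> (E2 u) = dir_deriv chi u (e2 u) \<odot> \<c> (E1 u)"
    using mixed_derivatives_commute[OF open_D smooth_Nf u, of "e1 u" "e2 u"] hess_sym[OF u, of "e1 u" "e2 u"] by simp
  then have "dir_deriv chi u (e2 u) \<bullet> \<nu> = - (dir_deriv chi u (e1 u) \<bullet> (Nf u \<odot> \<nu>))"
    using Q.normal_part_identity normal_iff[OF u] n E2_eq[OF u] by metis
  then show ?thesis unfolding chi_def[abs_def] .
qed

end

section \<open>Normal curvature of a superconformal surface, and dual maps\<close>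

context framed_surf
begin

lemma linear_eq_on_frame:
  assumes "u \<in> D" "linear f" "linear g" "f (e1 u) = g (e1 u)" "f (e2 u) = g (e2 u)"
  shows "f v = g v"
proof -
  have "f v = f ((dir_deriv F u v \<bullet> E1 u) *\<^sub>R e1 u + (dir_deriv F u v \<bullet> E2 u) *\<^sub>R e2 u)"
    using expand[OF assms(1), of v] by simp
  also have "\<dots> = g ((dir_deriv F u v \<bullet> E1 u) *\<^sub>R e1 u + (dir_deriv F u v \<bullet> E2 u) *\<^sub>R e2 u)"
    by (simp add: assms linear_add[OF assms(2)] linear_scale[OF assms(2)] linear_add[OF assms(3)] linear_scale[OF assms(3)])
  also have "\<dots> = g v" using expand[OF assms(1), of v] by simp
  finally show ?thesis .
qed

text \<open>The Ricci equation expresses the curvature by \<alpha>12 and \<alpha>11 - \<alpha>22.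
  With \<alpha>12 = N \<alpha>0 it becomes a sum of two squares, the squared length of \<alpha>0 in
  the orthonormal basis \<open>x3\<close>, N \<open>x3\<close>.\<close>

lemma normal_curvature_holomorphic:
  assumes u: "u \<in> D" and hol: "gauss_lift_holomorphic_at F s u"
  shows "normal_curvature F u = 2 * s * (\<alpha>0 u \<bullet> \<alpha>0 u)"
  unfolding normal_curvature_def
proof (rule the_equality)
  show main: "\<forall>a b x3 x4. pos_tangent_frame F u a b \<and> pos_normal_frame F u x3 x4 \<longrightarrow>
    2 * s * (\<alpha>0 u \<bullet> \<alpha>0 u) = normal_curv_tensor F (\<lambda>x. nproj F x x4) u a b \<bullet> x3"
  proof (intro allI impI, elim conjE)
    fix a b x3 x4 assume ab: "pos_tangent_frame F u a b" and x: "pos_normal_frame F u x3 x4"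
    obtain e1' e2' where fr: "framed_surf s F D e1' e2'" and e': "e1' u = a" "e2' u = b"
      using rotate_frame[OF u ab] .
    interpret R: framed_surf s F D e1' e2' by (rule fr)
    interpret P: surf_frame_at F D u "e1 u" "e2 u" by (rule at'(1)[OF u])
    interpret Q: quat_plane s "R.E1 u" "R.Nf u" by (rule R.plane[OF u])
    have n: "nrm u x3" "nrm u x4" and x34: "x3 \<bullet> x4 = 0" "norm x3 = 1" "norm x4 = 1"
      and dt: "0 < det (vector [dir_deriv F u dx, dir_deriv F u dy, x3, x4] :: real^4^4)"
      using x by (auto simp: pos_normal_frame_def normal_frame_def)
    have x4: "x4 = s *\<^sub>R (R.Nf u \<odot> x3)"
      using quat_frame.rotN_unique[OF R.at'(2)[OF u] n(1), of x4] n(2) x34 dt R.Nf[OF u] by simp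
    have i12: "R.\<alpha>12 u = R.Nf u \<odot> R.\<alpha>0 u" using R.holomorphic_iff[OF u] hol by blast
    have i12': "\<alpha>12 u = Nf u \<odot> \<alpha>0 u" using holomorphic_iff[OF u] hol by blast
    define A where "A = R.\<alpha>0 u"
    have nA: "nrm u A" unfolding A_def by (rule R.\<alpha>0_nrm[OF u])
    have A: "R.\<alpha>11 u - R.\<alpha>22 u = 2 *\<^sub>R A" by (simp add: A_def)
    have "normal_curv_tensor F (\<lambda>x. nproj F x x4) u a b \<bullet> x3 =
      (x4 \<bullet> R.\<alpha>12 u) * ((R.\<alpha>11 u - R.\<alpha>22 u) \<bullet> x3) - (x4 \<bullet> (R.\<alpha>11 u - R.\<alpha>22 u)) * (R.\<alpha>12 u \<bullet> x3)"
      using R.normal_curv_tensor_eq[OF u n, of a b] second_ff_sym[OF u, of b a]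
      by (simp add: e' inner_diff_left inner_diff_right algebra_simps)
    also have "\<dots> = 2 * s * ((x3 \<bullet> A)\<^sup>2 + ((R.Nf u \<odot> x3) \<bullet> A)\<^sup>2)"
      unfolding A i12 A_def[symmetric] x4 using Q.N_isometry[of x3 A] Q.N_skew[of A x3]
      by (simp add: power2_eq_square inner_commute algebra_simps)
    also have "(x3 \<bullet> A)\<^sup>2 + ((R.Nf u \<odot> x3) \<bullet> A)\<^sup>2 = A \<bullet> A"
    proof -
      have "A = (A \<bullet> x3) *\<^sub>R x3 + (A \<bullet> (R.Nf u \<odot> x3)) *\<^sub>R (R.Nf u \<odot> x3)"
        using Q.normal_expand[of x3 A] n nA R.normal_iff[OF u] x34(2) by (simp add: dot_square_norm)
      then have "A \<bullet> A = A \<bullet> ((A \<bullet> x3) *\<^sub>R x3 + (A \<bullet> (R.Nf u \<odot> x3)) *\<^sub>R (R.Nf u \<odot> x3))" by simp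
      then show ?thesis by (simp add: inner_add_right power2_eq_square inner_commute)
    qed
    \<comment> \<open>A change of frame turns \<alpha>0 by the double angle towards N \<alpha>0, a
      vector of equal length perpendicular to it, so the length of \<alpha>0 is the same for all
      frames.\<close>
    also have "A \<bullet> A = \<alpha>0 u \<bullet> \<alpha>0 u"
    proof -
      interpret Q': quat_plane s "E1 u" "Nf u" by (rule plane[OF u])
      obtain c d where cd: "c * c + d * d = 1" and a: "a = c *\<^sub>R e1 u + d *\<^sub>R e2 u" "b = (- d) *\<^sub>R e1 u + c *\<^sub>R e2 u"
        using P.frame_rotation[OF ab] .
      define B where "B = \<alpha>0 u"
      have A2: "A = (c * c - d * d) *\<^sub>R B + (2 * c * d) *\<^sub>R \<alpha>12 u"
        unfolding A_def B_def e' P.second_ff_rotated(1,3)[OF a] by (simp add: vec_eq_iff field_simps)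
      have "A \<bullet> A = ((c * c - d * d)\<^sup>2 + (2 * c * d)\<^sup>2) * (B \<bullet> B)"
        unfolding A2 i12' B_def[symmetric]
        by (simp add: inner_add_left inner_add_right Q'.N_perp Q'.N_isometry power2_eq_square algebra_simps)
      also have "(c * c - d * d)\<^sup>2 + (2 * c * d)\<^sup>2 = (c * c + d * d)\<^sup>2" by (simp add: power2_eq_square algebra_simps)
      finally show ?thesis by (simp add: cd B_def)
    qed
    finally show "2 * s * (\<alpha>0 u \<bullet> \<alpha>0 u) = normal_curv_tensor F (\<lambda>x. nproj F x x4) u a b \<bullet> x3" by simp
  qed
  \<comment> \<open>A definite description over all frames determines a value only if some positive
    normal frame exists. A unit normal vector and its rotation provide one.\<close>
  obtain x3 where x3: "nrm u x3" "norm x3 = 1"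
  proof -
    interpret P: tangent_frame F u "e1 u" "e2 u" by (rule at'(3)[OF u])
    have "dim {E1 u, E2 u} \<le> card {E1 u, E2 u}" by (rule dim_le_card') simp
    also have "\<dots> \<le> 2" by (simp add: card_insert_if)
    also have "\<dots> < DIM(real^4)" by simp
    finally obtain y where "y \<noteq> 0" "\<And>x. x \<in> span {E1 u, E2 u} \<Longrightarrow> orthogonal y x"
      using orthogonal_to_subspace_exists by blast
    then have y: "y \<noteq> 0" "y \<bullet> E1 u = 0" "y \<bullet> E2 u = 0"
      by (auto simp: orthogonal_def span_base)
    then have "nrm u (sgn y)" "norm (sgn y) = 1"
      by (auto simp: P.normal_space sgn_div_norm norm_sgn)
    then show ?thesis by (rule that)
  qed
  fix k assume k: "\<forall>a b x3 x4. pos_tangent_frame F u a b \<and> pos_normal_frame F u x3 x4 \<longrightarrow>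
    k = normal_curv_tensor F (\<lambda>x. nproj F x x4) u a b \<bullet> x3"
  interpret P: quat_frame s F u "e1 u" "e2 u" by (rule at'(2)[OF u])
  have "pos_normal_frame F u x3 (s *\<^sub>R (P.N \<odot> x3))"
  proof -
    have nx: "P.normal x3" using x3 P.normal_iff by blast
    have scl: "det (vector [E1 u, E2 u, x3, k *\<^sub>R y] :: real^4^4) = k * det (vector [E1 u, E2 u, x3, y] :: real^4^4)" for k y
      unfolding det_4 by (simp add: algebra_simps)
    have "x3 \<bullet> x3 = 1" using x3 by (simp add: dot_square_norm)
    then have "det (vector [E1 u, E2 u, x3, s *\<^sub>R (P.N \<odot> x3)] :: real^4^4) = 1"
      unfolding scl P.det_normal[OF nx] using s by simp
    then have "0 < (e1 u $ 1 * e2 u $ 2 - e1 u $ 2 * e2 u $ 1) *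
        det (vector [dir_deriv F u dx, dir_deriv F u dy, x3, s *\<^sub>R (P.N \<odot> x3)] :: real^4^4)"
      unfolding P.det_frame[symmetric] by simp
    then have "0 < det (vector [dir_deriv F u dx, dir_deriv F u dy, x3, s *\<^sub>R (P.N \<odot> x3)] :: real^4^4)"
      by (rule zero_less_mult_pos[OF _ P.det_pos])
    moreover have "norm (s *\<^sub>R (P.N \<odot> x3)) = 1"
      using s \<open>x3 \<bullet> x3 = 1\<close> by (simp add: norm_eq_sqrt_inner P.N_isometry mult.assoc[symmetric])
    moreover have "nrm u (s *\<^sub>R (P.N \<odot> x3))" using P.normal_lin(3)[OF P.normal_N[OF nx]] P.normal_iff by blast
    ultimately show ?thesis using x3 by (simp add: pos_normal_frame_def normal_frame_def P.N_perp)
  qed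
  then show "k = 2 * s * (\<alpha>0 u \<bullet> \<alpha>0 u)"
    using k main frames[OF u] by metis
qed

text \<open>The last condition is \<open>df \<and> dl = 0\<close>.\<close>

definition dual_map :: "(real^2 \<Rightarrow> real^4) \<Rightarrow> bool"
  where "dual_map l \<longleftrightarrow> smooth_on D l \<and> (\<forall>u\<in>D. l u \<bullet> quat_one = 0) \<and>
    (\<forall>u\<in>D. \<forall>v w. dir_deriv F u v \<odot> dir_deriv l u w = dir_deriv F u w \<odot> dir_deriv l u v)"

text \<open>An imaginary dl makes \<open>E1 \<odot> dl\<close> perpendicular to \<open>E1\<close>.
  Applied to \<open>e2\<close>, where the dual relation inserts a factor \<open>Nf u\<close>, the
  same remark gives perpendicularity to \<open>E2\<close>.\<close>

lemma dual_map_pointwise: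
  assumes l: "dual_map l" and u: "u \<in> D"
  shows "dir_deriv l u v \<bullet> quat_one = 0" "nrm u (E1 u \<odot> dir_deriv l u (e1 u))"
    "E1 u \<odot> dir_deriv l u (e2 u) = Nf u \<odot> E1 u \<odot> dir_deriv l u (e1 u)"
proof -
  interpret Q: quat_plane s "E1 u" "Nf u" by (rule plane[OF u])
  show 1: "dir_deriv l u v \<bullet> quat_one = 0" for v
    using deriv_inner_const[of l "\<lambda>_. quat_one" u 0 v] l u
    by (simp add: dual_map_def smooth_on_const frechet_derivative_const)
  show 2: "E1 u \<odot> dir_deriv l u (e2 u) = Nf u \<odot> E1 u \<odot> dir_deriv l u (e1 u)"
    using l u E2_eq[OF u] unfolding dual_map_def by (metis assoc)
  have a: "(E1 u \<odot> dir_deriv l u v) \<bullet> E1 u = 0" for v using 1[of v] by (simp add: inner_left Q.cE1)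
  have "(E1 u \<odot> dir_deriv l u (e1 u)) \<bullet> E2 u = 0" using a[of "e2 u"] unfolding 2 Q.N_skew E2_eq[OF u] by simp
  with a show "nrm u (E1 u \<odot> dir_deriv l u (e1 u))" by (simp add: nrm_iff[OF u])
qed

end

section \<open>Dual maps as solutions of a scalar equation\<close>

context iso_surf
begin

lemma normal_expand_E3:
  assumes "u \<in> D" "nrm u x"
  shows "x = (x \<bullet> E3 u) *\<^sub>R E3 u + (x \<bullet> (Nf u \<odot> E3 u)) *\<^sub>R (Nf u \<odot> E3 u)"
  using quat_plane.normal_expand[OF plane[OF assms(1)], of "E3 u" x] normal_iff[OF assms(1)] E3(1,2)[OF assms(1)] assms(2)
  by simp

lemma normal_zero:
  assumes "u \<in> D" "nrm u x" "x \<bullet> E3 u = 0" "x \<bullet> (Nf u \<odot> E3 u) = 0" shows "x = 0"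
  using normal_expand_E3[OF assms(1,2)] assms(3,4) by simp

definition n3 :: "real^2 \<Rightarrow> real^4" where "n3 u = Nf u \<odot> E3 u"

lemma smooth_n3: "smooth_on D n3"
  unfolding n3_def[abs_def] by (intro smooth_prod smooth_Nf smooth_E3)

lemma n3:
  assumes "u \<in> D"
  shows "nrm u (n3 u)" "n3 u \<bullet> n3 u = 1" "n3 u \<bullet> E3 u = 0" "E3 u \<bullet> n3 u = 0" "Nf u \<odot> n3 u = - E3 u"
  using E3[OF assms] nrm_lin(5)[OF assms] quat_plane.NNx[OF plane[OF assms]] by (simp_all add: n3_def)

lemma deriv_n3:
  assumes "u \<in> D"
  shows "dir_deriv n3 u v \<bullet> n3 u = 0" "dir_deriv n3 u v \<bullet> E3 u = - (dir_deriv E3 u v \<bullet> n3 u)"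
    "dir_deriv E3 u v \<bullet> E3 u = 0"
  using deriv_inner_const[OF smooth_n3 smooth_n3 assms n3(2), of v] deriv_inner_const[OF smooth_n3 smooth_E3 assms n3(3), of v]
    deriv_inner_const[OF smooth_E3 smooth_E3 assms E3(1), of v]
  by (simp_all add: inner_commute)

lemma deriv_scale:
  assumes "smooth_on D q" "smooth_on D f" "u \<in> D"
  shows "dir_deriv (\<lambda>x. q x *\<^sub>R f x) u v = q u *\<^sub>R dir_deriv f u v + dir_deriv q u v *\<^sub>R (f u :: real^4)"
  by (rule dir_deriv_bilinear[OF bounded_bilinear_scaleR assms])

lemma dform_normal:
  assumes u: "u \<in> D" and n: "nrm u (\<zeta> u)" and t: "\<alpha>0 u \<bullet> \<zeta> u = 0"
  shows "nrm u (dform \<zeta> u)"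
  unfolding dform_def t using tangent_frame.nproj_normal[OF at'(3)[OF u]] n
  by (simp, intro nrm_lin(1,2,3,5) u)

lemma dform_inner:
  assumes u: "u \<in> D" and n: "nrm u \<nu>"
  shows "dform \<zeta> u \<bullet> \<nu> = 2 * \<omega>12 u (e1 u) * (\<zeta> u \<bullet> \<nu>) - 2 * \<omega>12 u (e2 u) * (\<zeta> u \<bullet> (Nf u \<odot> \<nu>))
    - dir_deriv \<zeta> u (e1 u) \<bullet> (Nf u \<odot> \<nu>) - dir_deriv \<zeta> u (e2 u) \<bullet> \<nu>"
proof -
  interpret Q: quat_plane s "E1 u" "Nf u" by (rule plane[OF u])
  have "E2 u \<bullet> \<nu> = 0" using n nrm_iff[OF u] by (simp add: inner_commute)
  then show ?thesis
    unfolding dform_def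
    by (simp add: inner_add_left inner_diff_left Q.N_skew tangent_frame.nproj_inner[OF at'(3)[OF u]] n nrm_lin(5)[OF u n])
qed

lemma star\<Omega>_iff:
  assumes u: "u \<in> D" and lin: "linear l"
  shows "(\<forall>v. l v = k * star\<Omega> u v) \<longleftrightarrow> l (e1 u) = - k * \<Omega> u (e2 u) \<and> l (e2 u) = k * \<Omega> u (e1 u)"
proof
  assume "\<forall>v. l v = k * star\<Omega> u v"
  then show "l (e1 u) = - k * \<Omega> u (e2 u) \<and> l (e2 u) = k * \<Omega> u (e1 u)"
    by (simp add: star\<Omega>_expand[OF u] frame_inner[OF u])
next
  assume e: "l (e1 u) = - k * \<Omega> u (e2 u) \<and> l (e2 u) = k * \<Omega> u (e1 u)"
  show "\<forall>v. l v = k * star\<Omega> u v"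
  proof
    fix v
    have "l v = l ((dir_deriv F u v \<bullet> E1 u) *\<^sub>R e1 u + (dir_deriv F u v \<bullet> E2 u) *\<^sub>R e2 u)"
      using expand[OF u, of v] by simp
    then show "l v = k * star\<Omega> u v"
      using e by (simp add: linear_add[OF lin] linear_scale[OF lin] star\<Omega>_expand[OF u] algebra_simps)
  qed
qed

text \<open>Along \<open>n3\<close> the tangential obstruction vanishes, and the components of
  \<open>dform\<close> along \<open>E3\<close> and \<open>n3\<close> are the values of dq - q
  \<star>\<Omega> on \<open>e1\<close> and \<open>e2\<close>.\<close>

lemma dform_scaled_n3:
  assumes q: "smooth_on D q" and u: "u \<in> D"
  shows "dform (\<lambda>x. - q x *\<^sub>R n3 x) u = 0 \<longleftrightarrow> (\<forall>v. dir_deriv q u v = q u * star\<Omega> u v)"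
proof -
  define \<zeta> where "\<zeta> x = - q x *\<^sub>R n3 x" for x
  have d: "dir_deriv \<zeta> u v = - (q u *\<^sub>R dir_deriv n3 u v) - dir_deriv q u v *\<^sub>R n3 u" for v
  proof -
    have "dir_deriv (\<lambda>x. - q x) u v = - dir_deriv q u v"
      by (rule dir_deriv_bounded_linear[OF bounded_linear_minus[OF bounded_linear_ident] q u])
    then show ?thesis
      unfolding \<zeta>_def using deriv_scale[OF smooth_on_minus[OF open_D q] smooth_n3 u, of v] by simp
  qed
  have t: "\<alpha>0 u \<bullet> \<zeta> u = 0"
    by (subst \<alpha>0_E3) (simp add: \<zeta>_def n3[OF u])
  have nz: "nrm u (\<zeta> u)" unfolding \<zeta>_def by (intro nrm_lin n3 u)
  have 3: "dform \<zeta> u \<bullet> E3 u = dir_deriv q u (e1 u) + q u * \<Omega> u (e2 u)"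
    unfolding dform_inner[OF u E3(2)[OF u]] d \<Omega>_def n3_def[symmetric]
    by (simp add: inner_diff_left deriv_n3[OF u] n3[OF u] \<zeta>_def algebra_simps)
  have 4: "dform \<zeta> u \<bullet> n3 u = dir_deriv q u (e2 u) - q u * \<Omega> u (e1 u)"
    unfolding dform_inner[OF u n3(1)[OF u]] d \<Omega>_def n3_def[symmetric] n3(5)[OF u]
    by (simp add: inner_diff_left deriv_n3[OF u] n3[OF u] \<zeta>_def algebra_simps)
  have "dform \<zeta> u = 0 \<longleftrightarrow> dform \<zeta> u \<bullet> E3 u = 0 \<and> dform \<zeta> u \<bullet> n3 u = 0"
    using normal_zero[OF u dform_normal[of u \<zeta>, OF u nz t]] by (auto simp: n3_def)
  also have "\<dots> \<longleftrightarrow> dir_deriv q u (e1 u) = - q u * \<Omega> u (e2 u) \<and> dir_deriv q u (e2 u) = q u * \<Omega> u (e1 u)"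
    unfolding 3 4 by auto
  also have "\<dots> \<longleftrightarrow> (\<forall>v. dir_deriv q u v = q u * star\<Omega> u v)"
    using star\<Omega>_iff[OF u smooth_on_linear_deriv[OF q u], of "q u"] by blast
  finally show ?thesis unfolding \<zeta>_def .
qed

text \<open>The \<open>E2\<close> component of closedness is a multiple of \<alpha>0 \<bullet>
  \<zeta>. As \<alpha>0 has no zeros, \<zeta> lies on the line of \<open>n3\<close>, and
  \<open>- q\<close> is the coefficient.\<close>

lemma dual_map_imp_q:
  assumes "dual_map l"
  obtains q where "smooth_on D q" "\<And>u v. u \<in> D \<Longrightarrow> dir_deriv q u v = q u * star\<Omega> u v"
    "\<And>u v. u \<in> D \<Longrightarrow> q u = 0 \<Longrightarrow> dir_deriv l u v = 0"
proof -
  have l: "smooth_on D l" and im: "\<And>u. u \<in> D \<Longrightarrow> l u \<bullet> quat_one = 0"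
    and rel: "\<And>u v w. u \<in> D \<Longrightarrow> dir_deriv F u v \<odot> dir_deriv l u w = dir_deriv F u w \<odot> dir_deriv l u v"
    using assms by (auto simp: dual_map_def)
  define \<zeta> where "\<zeta> x = E1 x \<odot> dir_deriv l x (e1 x)" for x
  have sm: "smooth_on D \<zeta>" unfolding \<zeta>_def
    by (intro smooth_prod smooth_E smooth_on_dir_deriv_field l smooth_e open_D)
  have rel12: "E1 u \<odot> dir_deriv l u (e2 u) = Nf u \<odot> \<zeta> u" and nz: "nrm u (\<zeta> u)" if "u \<in> D" for u
    unfolding \<zeta>_def using dual_map_pointwise[OF assms that] by blast+
  have dl: "dir_deriv l u v = form \<zeta> u v" if "u \<in> D" for u v
  proof -
    interpret Q: quat_plane s "E1 u" "Nf u" by (rule plane[OF that])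
    have c: "x = y" if "E1 u \<odot> x = E1 u \<odot> y" for x y using that Q.cE1 by metis
    have 1: "dir_deriv l u (e1 u) = form \<zeta> u (e1 u)"
      by (rule c) (simp add: form_e[OF that] \<zeta>_def)
    have 2: "dir_deriv l u (e2 u) = form \<zeta> u (e2 u)"
      by (rule c) (simp add: form_e[OF that] rel12[OF that])
    show ?thesis
      by (rule linear_eq_on_frame[OF that smooth_on_linear_deriv[OF l that] form_lin[OF that] 1 2])
  qed
  have d0: "dform \<zeta> u = 0" if u: "u \<in> D" for u
  proof -
    interpret Q: quat_plane s "E1 u" "Nf u" by (rule plane[OF u])
    have "dir_deriv (\<lambda>x. form \<zeta> x w) u v = dir_deriv (\<lambda>x. dir_deriv l x w) u v" for v w
      by (rule dir_deriv_eqI_open[OF open_D u]) (simp add: dl)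
    then have "\<c> (E1 u) \<odot> dform \<zeta> u = 0"
      using deriv_form[OF u sm nz, of "e2 u" "e1 u"] mixed_derivatives_commute[OF open_D l u, of "e1 u" "e2 u"]
      by (simp add: frame_inner[OF u])
    then show ?thesis using Q.cE1(2) by (metis simps(13))
  qed
  have perp: "\<zeta> u \<bullet> E3 u = 0" if u: "u \<in> D" for u
  proof -
    have e: "\<zeta> u \<bullet> E2 u = 0" "(Nf u \<odot> \<zeta> u) \<bullet> E2 u = 0" "nproj F u x \<bullet> E2 u = 0" "(Nf u \<odot> nproj F u x) \<bullet> E2 u = 0" for x
      using nz[OF u] nrm_lin(5)[OF u] tangent_frame.nproj_normal[OF at'(3)[OF u]] nrm_iff[OF u] by blast+
    have "dform \<zeta> u \<bullet> E2 u = - 4 * (\<alpha>0 u \<bullet> \<zeta> u)"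
      unfolding dform_def by (simp add: inner_add_left inner_diff_left e frame_inner[OF u] field_simps)
    then have "\<alpha>0 u \<bullet> \<zeta> u = 0" by (simp add: d0[OF u])
    then show ?thesis using nonumbilic[OF u] by (subst (asm) \<alpha>0_E3) (simp add: inner_commute)
  qed
  define q where "q x = - (\<zeta> x \<bullet> n3 x)" for x
  have q: "smooth_on D q" unfolding q_def by (intro smooth_on_minus smooth_on_inner sm smooth_n3 open_D)
  have zq: "\<zeta> u = - q u *\<^sub>R n3 u" if "u \<in> D" for u
    using normal_expand_E3[OF that nz[OF that]] perp[OF that] by (simp add: q_def n3_def)
  have "dir_deriv q u v = q u * star\<Omega> u v" if u: "u \<in> D" for u v
  proof -
    have "dform (\<lambda>x. - q x *\<^sub>R n3 x) u = dform \<zeta> u"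
      unfolding dform_def using zq[OF u] dir_deriv_eqI_open[OF open_D u zq] by simp
    then show ?thesis using dform_scaled_n3[OF q u] d0[OF u] by simp
  qed
  moreover have "dir_deriv l u v = 0" if "u \<in> D" "q u = 0" for u v
    unfolding dl[OF that(1)] form_def zq[OF that(1)] that(2) by (simp add: simps)
  ultimately show ?thesis using that q by blast
qed

lemma dual_map_exists:
  assumes "convex D" "c \<in> D" and sm: "smooth_on D \<zeta>" and nz: "\<And>u. u \<in> D \<Longrightarrow> nrm u (\<zeta> u)"
    and d0: "\<And>u. u \<in> D \<Longrightarrow> dform \<zeta> u = 0"
  obtains l where "dual_map l" "\<And>u v. u \<in> D \<Longrightarrow> dir_deriv l u v = form \<zeta> u v"
proof -
  have closed: "dir_deriv (\<lambda>x. form \<zeta> x w) u v = dir_deriv (\<lambda>x. form \<zeta> x v) u w" if "u \<in> D" for u v w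
    using deriv_form[OF that sm nz, of w v] d0[OF that] by (simp add: simps)
  obtain h where h: "smooth_on D h" "\<And>u. u \<in> D \<Longrightarrow> (h has_derivative form \<zeta> u) (at u)"
    using poincare_lemma[OF open_D assms(1,2) form_lin smooth_form[OF sm] closed] by blast
  have im: "form \<zeta> u v \<bullet> quat_one = 0" if u: "u \<in> D" for u v
  proof -
    interpret Q: quat_plane s "E1 u" "Nf u" by (rule plane[OF u])
    have "form \<zeta> u (e1 u) \<bullet> quat_one = (E1 u \<odot> form \<zeta> u (e1 u)) \<bullet> E1 u"
      "form \<zeta> u (e2 u) \<bullet> quat_one = (E1 u \<odot> form \<zeta> u (e2 u)) \<bullet> E1 u"
      by (simp_all add: inner_left Q.cE1)
    then have 0: "form \<zeta> u (e1 u) \<bullet> quat_one = 0" "form \<zeta> u (e2 u) \<bullet> quat_one = 0"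
      unfolding form_e[OF u] using nz[OF u] nrm_lin(5)[OF u nz[OF u]] nrm_iff[OF u] by auto
    have "linear (\<lambda>v. form \<zeta> u v \<bullet> quat_one)"
      using form_lin[OF u, of \<zeta>] by (intro linearI) (simp_all add: linear_add linear_scale inner_add_left)
    from linear_eq_on_frame[OF u this linear_zero 0] show ?thesis .
  qed
  \<comment> \<open>The primitive \<open>h\<close> need not be imaginary. Subtracting its real part
    does not change the derivative, because the form has imaginary values.\<close>
  define l where "l u = h u - (h u \<bullet> quat_one) *\<^sub>R quat_one" for u
  have der: "(l has_derivative form \<zeta> u) (at u)" if "u \<in> D" for u
  proof -
    have "(l has_derivative (\<lambda>v. form \<zeta> u v - (form \<zeta> u v \<bullet> quat_one) *\<^sub>R quat_one)) (at u)"
      unfolding l_def by (auto intro!: derivative_eq_intros h(2)[OF that])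
    then show ?thesis by (simp add: im[OF that])
  qed
  have dl: "dir_deriv l u v = form \<zeta> u v" if "u \<in> D" for u v
    by (rule dir_deriv_eq[OF der[OF that]])
  have "dual_map l" unfolding dual_map_def
  proof (intro conjI ballI allI)
    show "smooth_on D l" unfolding l_def by (intro smooth_on_diff smooth_on_scaleR smooth_on_inner smooth_on_const h open_D)
    show "l u \<bullet> quat_one = 0" if "u \<in> D" for u by (simp add: l_def inner_diff_left inner_axis_axis)
    fix u v w assume u: "u \<in> D"
    interpret Q: quat_plane s "E1 u" "Nf u" by (rule plane[OF u])
    define T where "T v w = dir_deriv F u v \<odot> form \<zeta> u w" for v w
    have lF: "linear (dir_deriv F u)" by (rule lin_df[OF u])
    have lin: "linear (T v)" "linear (\<lambda>v. T v w)" for v w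
      unfolding T_def by (intro linearI; simp add: linear_add[OF lF] linear_scale[OF lF]
        linear_add[OF form_lin[OF u]] linear_scale[OF form_lin[OF u]] simps)+
    have "T (e1 u) (e2 u) = T (e2 u) (e1 u)"
      unfolding T_def form_e[OF u] using form_e(1)[OF u, of \<zeta>] by (simp add: E2_eq[OF u, symmetric] assoc)
    then have "T v w = T w v"
      using alternating_det[OF lin expand[OF u] expand[OF u], of v w] by simp
    then show "dir_deriv F u v \<odot> dir_deriv l u w = dir_deriv F u w \<odot> dir_deriv l u v"
      by (simp add: T_def dl[OF u])
  qed
  then show ?thesis using that dl by blast
qed

lemma form_eq_0:
  assumes u: "u \<in> D" and "\<And>v. form \<zeta> u v = 0" shows "\<zeta> u = 0"
  using form_e(1)[OF u, of \<zeta>] assms(2) by (simp add: simps)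

end

text \<open>Gram-Schmidt on the coordinate fields. The field \<open>w\<close> has second coordinate
  1, so it never vanishes and the frame is positive.\<close>

lemma immersion_frame:
  assumes "open D" "smooth_on D F" "\<And>u. u \<in> D \<Longrightarrow> inj (frechet_derivative F (at u))" "s * s = 1"
  obtains e1 e2 where "framed_surf s F D e1 e2"
proof -
  let ?X = "\<lambda>u. dir_deriv F u dx" and ?Y = "\<lambda>u. dir_deriv F u dy"
  have lin: "linear (frechet_derivative F (at u))" if "u \<in> D" for u
    by (rule smooth_on_linear_deriv[OF assms(2) that])
  have nz: "dir_deriv F u v \<noteq> 0" if "u \<in> D" "v \<noteq> 0" for u v
    using assms(3)[OF that(1)] lin[OF that(1)] that(2) linear_injective_0 by blast
  have X0: "?X u \<noteq> 0" if "u \<in> D" for u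
    by (rule nz[OF that]) (simp add: axis_eq_0_iff)
  define w where "w u = dy - ((?X u \<bullet> ?Y u) / (?X u \<bullet> ?X u)) *\<^sub>R dx" for u
  have w0: "w u \<noteq> 0" for u
  proof -
    have "w u $ 2 = 1" by (simp add: w_def axis_def)
    then show ?thesis by auto
  qed
  have W0: "dir_deriv F u (w u) \<noteq> 0" if "u \<in> D" for u by (rule nz[OF that w0])
  have sX: "smooth_on D ?X" "smooth_on D ?Y" by (intro smooth_on_dir_deriv assms)+
  have sw: "smooth_on D w" unfolding w_def
    by (intro smooth_on_diff smooth_on_const smooth_on_scaleR smooth_on_divide smooth_on_inner sX assms) (simp add: X0)
  have sW: "smooth_on D (\<lambda>u. dir_deriv F u (w u))" by (intro smooth_on_dir_deriv_field assms sw)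
  define e1 where "e1 u = inverse (norm (?X u)) *\<^sub>R dx" for u
  define e2 where "e2 u = inverse (norm (dir_deriv F u (w u))) *\<^sub>R w u" for u
  have s1: "smooth_on D e1" unfolding e1_def
    by (intro smooth_on_scaleR smooth_on_inverse smooth_on_norm smooth_on_const sX assms) (simp_all add: X0)
  have s2: "smooth_on D e2" unfolding e2_def
    by (intro smooth_on_scaleR smooth_on_inverse smooth_on_norm sw sW assms) (simp_all add: W0)
  have "pos_tangent_frame F u (e1 u) (e2 u)" if u: "u \<in> D" for u
  proof -
    have d1: "dir_deriv F u (e1 u) = inverse (norm (?X u)) *\<^sub>R ?X u"
      and d2: "dir_deriv F u (e2 u) = inverse (norm (dir_deriv F u (w u))) *\<^sub>R dir_deriv F u (w u)"
      by (simp_all add: e1_def e2_def linear_scale[OF lin[OF u]])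
    have "?X u \<bullet> dir_deriv F u (w u) = 0"
      using X0[OF u] by (simp add: w_def linear_diff[OF lin[OF u]] linear_scale[OF lin[OF u]] inner_diff_right)
    moreover have "det (vector [e1 u, e2 u] :: real^2^2) = inverse (norm (?X u)) * inverse (norm (dir_deriv F u (w u)))"
      by (simp add: det_2_rows e1_def e2_def w_def axis_def)
    ultimately show ?thesis
      using X0[OF u] W0[OF u] unfolding pos_tangent_frame_def metric_def d1 d2
      by (simp add: dot_square_norm power2_eq_square)
  qed
  then have "framed_surf s F D e1 e2"
    using assms s1 s2 by (intro framed_surf.intro quat.intro smooth_surf.intro framed_surf_axioms.intro) auto
  then show ?thesis by (rule that)
qed

section \<open>Potentials, existence of dual maps, and mean-directional coordinates\<close>

context iso_surf
begin

text \<open>\<open>q\<close> is the exponential of a primitive of \<star>\<Omega>. Its positivity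
  keeps the resulting dual map free of stationary points and later permits a square root.\<close>

lemma potential_exists:
  assumes "convex D" "c \<in> D" and closed: "\<And>u v w. u \<in> D \<Longrightarrow> ext_deriv star\<Omega> u v w = 0"
  obtains q where "smooth_on D q" "\<And>u. q u > 0" "\<And>u v. u \<in> D \<Longrightarrow> dir_deriv q u v = q u * star\<Omega> u v"
proof -
  have "dir_deriv (\<lambda>x. star\<Omega> x w) u v = dir_deriv (\<lambda>x. star\<Omega> x v) u w" if "u \<in> D" for u v w
    using closed[OF that, of v w] by (simp add: ext_deriv_def)
  then obtain h where h: "smooth_on D h" "\<And>u. u \<in> D \<Longrightarrow> (h has_derivative star\<Omega> u) (at u)"
    using poincare_lemma[OF open_D assms(1,2) star\<Omega>_lin smooth_star\<Omega>] by blast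
  have "dir_deriv (\<lambda>x. exp (h x)) u v = exp (h u) * star\<Omega> u v" if "u \<in> D" for u v
    by (rule dir_deriv_eq) (auto intro!: derivative_eq_intros h(2)[OF that])
  then show ?thesis
    by (intro that[of "\<lambda>x. exp (h x)"] smooth_on_exp open_D h) auto
qed

text \<open>Differentiating dq = q \<star>\<Omega> gives q d\<star>\<Omega> = 0. If d\<star>\<Omega>
  were nonzero somewhere, q and with it dl would vanish on a nonempty open set.\<close>

lemma dual_map_imp_closed:
  assumes l: "dual_map l"
    and dense: "\<And>W. open W \<Longrightarrow> W \<noteq> {} \<Longrightarrow> W \<subseteq> D \<Longrightarrow> \<exists>u\<in>W. \<exists>v. dir_deriv l u v \<noteq> 0"
    and u: "u \<in> D"
  shows "ext_deriv star\<Omega> u v w = 0"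
proof (rule ccontr)
  assume ne: "ext_deriv star\<Omega> u v w \<noteq> 0"
  obtain q where q: "smooth_on D q" "\<And>u v. u \<in> D \<Longrightarrow> dir_deriv q u v = q u * star\<Omega> u v"
    "\<And>u v. u \<in> D \<Longrightarrow> q u = 0 \<Longrightarrow> dir_deriv l u v = 0"
    using dual_map_imp_q[OF l] by blast
  have q0: "q x * ext_deriv star\<Omega> x v w = 0" if x: "x \<in> D" for x
  proof -
    have "dir_deriv (\<lambda>y. dir_deriv q y w) x v = dir_deriv (\<lambda>y. q y * star\<Omega> y w) x v" for v w
      by (rule dir_deriv_eqI_open[OF open_D x]) (rule q(2))
    then have "dir_deriv (\<lambda>y. dir_deriv q y w) x v = q x * dir_deriv (\<lambda>y. star\<Omega> y w) x v + q x * star\<Omega> x v * star\<Omega> x w" for v w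
      using dir_deriv_bilinear[OF bounded_bilinear_mult q(1) smooth_star\<Omega> x] q(2)[OF x] by simp
    then show ?thesis
      using mixed_derivatives_commute[OF open_D q(1) x, of w v] unfolding ext_deriv_def by (simp add: algebra_simps)
  qed
  have "smooth_on D (\<lambda>x. ext_deriv star\<Omega> x v w)"
    unfolding ext_deriv_def by (intro smooth_on_diff smooth_on_dir_deriv smooth_star\<Omega> open_D)
  then have "continuous_on D (\<lambda>x. ext_deriv star\<Omega> x v w)" by (rule smooth_on_continuous)
  then have "open (D \<inter> (\<lambda>x. ext_deriv star\<Omega> x v w) -` (- {0}))"
    using continuous_open_preimage[OF _ open_D, of "\<lambda>x. ext_deriv star\<Omega> x v w" "- {0}"] by auto
  then obtain x v' where x: "x \<in> D" "ext_deriv star\<Omega> x v w \<noteq> 0" "dir_deriv l x v' \<noteq> 0"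
    using dense[of "D \<inter> (\<lambda>x. ext_deriv star\<Omega> x v w) -` (- {0})"] ne u by auto
  then show False using q0[OF x(1)] q(3)[OF x(1)] by auto
qed

lemma dual_map_of_potential:
  assumes "convex D" "c \<in> D" "smooth_on D q" "\<And>u v. u \<in> D \<Longrightarrow> dir_deriv q u v = q u * star\<Omega> u v"
    "\<And>u. q u > 0"
  obtains l where "dual_map l" "\<And>u. u \<in> D \<Longrightarrow> \<exists>v. dir_deriv l u v \<noteq> 0"
proof -
  define \<zeta> where "\<zeta> x = - q x *\<^sub>R n3 x" for x
  have sm: "smooth_on D \<zeta>" unfolding \<zeta>_def by (intro smooth_on_scaleR smooth_on_minus assms smooth_n3 open_D)
  have nz: "nrm u (\<zeta> u)" if "u \<in> D" for u unfolding \<zeta>_def by (intro nrm_lin n3 that)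
  have d0: "dform \<zeta> u = 0" if "u \<in> D" for u
    using dform_scaled_n3[OF assms(3) that] assms(4)[OF that] unfolding \<zeta>_def by blast
  obtain l where l: "dual_map l" "\<And>u v. u \<in> D \<Longrightarrow> dir_deriv l u v = form \<zeta> u v"
    using dual_map_exists[OF assms(1,2) sm nz d0] by blast
  have "\<exists>v. dir_deriv l u v \<noteq> 0" if "u \<in> D" for u
  proof (rule ccontr)
    assume "\<nexists>v. dir_deriv l u v \<noteq> 0"
    then have "\<zeta> u = 0" using form_eq_0[OF that, of \<zeta>] l(2)[OF that] by simp
    then show False using assms(5)[of u] n3(2)[OF that] by (auto simp: \<zeta>_def)
  qed
  then show ?thesis using that l(1) by blast
qed

lemma tangent_deriv_inner:
  assumes "u \<in> D"
  shows "dir_deriv E1 u v \<bullet> E1 u = 0" "dir_deriv E1 u v \<bullet> E2 u = \<omega>12 u v"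
    "dir_deriv E2 u v \<bullet> E1 u = - \<omega>12 u v" "dir_deriv E2 u v \<bullet> E2 u = 0"
  using ff_nrm[OF assms, of v "e1 u"] ff_nrm[OF assms, of v "e2 u"]
  unfolding deriv_E[OF assms] by (simp_all add: nrm_iff[OF assms] inner_add_left inner_diff_left frame_inner[OF assms])

text \<open>In a conformal mean-directional parametrization the dual map is explicit: \<open>\<zeta>\<close> is \<open>N \<odot> H\<close> divided by
  the conformal factor.\<close>

lemma dual_map_of_mean_directional:
  assumes "convex D" "c \<in> D" and \<kappa>: "smooth_on D \<kappa>" "\<And>u. u \<in> D \<Longrightarrow> \<kappa> u > 0"
    and e: "\<And>u. u \<in> D \<Longrightarrow> e1 u = \<kappa> u *\<^sub>R dx" "\<And>u. u \<in> D \<Longrightarrow> e2 u = \<kappa> u *\<^sub>R dy"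
    and par: "\<And>u. u \<in> D \<Longrightarrow> \<exists>k. \<alpha>0 u = k *\<^sub>R H u"
  obtains l where "dual_map l" "\<And>u. u \<in> D \<Longrightarrow> \<exists>v. dir_deriv l u v \<noteq> 0"
proof -
  define chi where "chi x = Nf x \<odot> H x" for x
  define \<mu> where "\<mu> x = \<kappa> x * \<kappa> x" for x
  define \<zeta> where "\<zeta> x = \<mu> x *\<^sub>R chi x" for x
  have schi: "smooth_on D chi" unfolding chi_def by (intro smooth_prod smooth_Nf smooth_mean_curv)
  have s\<mu>: "smooth_on D \<mu>" unfolding \<mu>_def by (intro smooth_on_mult \<kappa> open_D)
  have s\<zeta>: "smooth_on D \<zeta>" unfolding \<zeta>_def by (intro smooth_on_scaleR s\<mu> schi open_D)
  have nchi: "nrm u (chi u)" if "u \<in> D" for u unfolding chi_def by (intro nrm_lin H_nrm that)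
  have n\<zeta>: "nrm u (\<zeta> u)" if "u \<in> D" for u unfolding \<zeta>_def by (intro nrm_lin nchi that)
  have d0: "dform \<zeta> u = 0" if u: "u \<in> D" for u
  proof -
    interpret Q: quat_plane s "E1 u" "Nf u" by (rule plane[OF u])
    define X Y where "X = (\<lambda>x. dir_deriv F x dx)" and "Y = (\<lambda>x. dir_deriv F x dy)"
    have sX: "smooth_on D X" "smooth_on D Y" unfolding X_def Y_def by (intro smooth_on_dir_deriv smooth_F)+
    have lF: "linear (dir_deriv F x)" if "x \<in> D" for x by (rule lin_df[OF that])
    have E: "E1 x = \<kappa> x *\<^sub>R X x" "E2 x = \<kappa> x *\<^sub>R Y x" if "x \<in> D" for x
      using e[OF that] by (simp_all add: X_def Y_def linear_scale[OF lF[OF that]])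
    have k0: "\<kappa> u \<noteq> 0" using \<kappa>(2)[OF u] by simp
    have dE: "dir_deriv E1 u v = \<kappa> u *\<^sub>R dir_deriv X u v + dir_deriv \<kappa> u v *\<^sub>R X u"
      "dir_deriv E2 u v = \<kappa> u *\<^sub>R dir_deriv Y u v + dir_deriv \<kappa> u v *\<^sub>R Y u" for v
      unfolding deriv_scale[OF \<kappa>(1) sX(1) u, symmetric] deriv_scale[OF \<kappa>(1) sX(2) u, symmetric]
      by (rule dir_deriv_eqI_open[OF open_D u E(1)], assumption, rule dir_deriv_eqI_open[OF open_D u E(2)])
    \<comment> \<open>Together with \<open>i1\<close> this expresses d\<kappa> through the
      connection form: for a frame obtained by scaling conformal coordinate fields, d log \<kappa> =
      \<star>\<omega>12.\<close>
    have sym: "dir_deriv X u dy = dir_deriv Y u dx"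
      unfolding X_def Y_def by (rule mixed_derivatives_commute[OF open_D smooth_F u])
    have XY: "\<kappa> u * \<kappa> u * (X u \<bullet> X u) = 1" "\<kappa> u * \<kappa> u * (Y u \<bullet> Y u) = 1" "X u \<bullet> Y u = 0" "Y u \<bullet> X u = 0"
      using frame_inner[OF u] k0 by (simp_all add: E[OF u] mult.assoc)
    have i1: "\<kappa> u * \<kappa> u * (dir_deriv X u v \<bullet> X u) + dir_deriv \<kappa> u v * (\<kappa> u * (X u \<bullet> X u)) = 0"
      "\<kappa> u * \<kappa> u * (dir_deriv X u v \<bullet> Y u) = \<omega>12 u v"
      "\<kappa> u * \<kappa> u * (dir_deriv Y u v \<bullet> X u) = - \<omega>12 u v"
      "\<kappa> u * \<kappa> u * (dir_deriv Y u v \<bullet> Y u) + dir_deriv \<kappa> u v * (\<kappa> u * (Y u \<bullet> Y u)) = 0" for v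
      using tangent_deriv_inner[OF u, of v] unfolding dE unfolding E[OF u]
      by (simp_all add: inner_add_left XY algebra_simps)
    have k1: "- \<omega>12 u dx * \<kappa> u + dir_deriv \<kappa> u dy = 0"
    proof -
      have "\<kappa> u * (\<kappa> u * \<kappa> u * (dir_deriv X u dy \<bullet> X u) + dir_deriv \<kappa> u dy * (\<kappa> u * (X u \<bullet> X u)))
        = - \<omega>12 u dx * \<kappa> u + dir_deriv \<kappa> u dy * (\<kappa> u * \<kappa> u * (X u \<bullet> X u))"
        unfolding sym i1(3)[of dx, symmetric] by (simp add: algebra_simps)
      then show ?thesis unfolding i1(1) XY by simp
    qed
    have k2: "\<omega>12 u dy * \<kappa> u + dir_deriv \<kappa> u dx = 0"
    proof -
      have "\<kappa> u * (\<kappa> u * \<kappa> u * (dir_deriv Y u dx \<bullet> Y u) + dir_deriv \<kappa> u dx * (\<kappa> u * (Y u \<bullet> Y u)))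
        = \<omega>12 u dy * \<kappa> u + dir_deriv \<kappa> u dx * (\<kappa> u * \<kappa> u * (Y u \<bullet> Y u))"
        unfolding sym[symmetric] i1(2)[of dy, symmetric] by (simp add: algebra_simps)
      then show ?thesis unfolding i1(4) XY by simp
    qed
    have lin\<omega>: "\<omega>12 u (k *\<^sub>R v) = k * \<omega>12 u v" "dir_deriv \<kappa> u (k *\<^sub>R v) = k * dir_deriv \<kappa> u v" for k v
      using smooth_on_linear_deriv[OF smooth_E(1) u] smooth_on_linear_deriv[OF \<kappa>(1) u]
      by (simp_all add: omega12_def linear_scale)
    have "dir_deriv \<kappa> u dy = \<omega>12 u dx * \<kappa> u" "dir_deriv \<kappa> u dx = - \<omega>12 u dy * \<kappa> u"
      using k1 k2 by linarith+
    then have d\<kappa>: "dir_deriv \<kappa> u (e2 u) = \<kappa> u * \<omega>12 u (e1 u)" "dir_deriv \<kappa> u (e1 u) = - \<kappa> u * \<omega>12 u (e2 u)"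
      unfolding e[OF u] lin\<omega> by (simp_all add: algebra_simps)
    have d\<mu>: "dir_deriv \<mu> u v = 2 * \<kappa> u * dir_deriv \<kappa> u v" for v
      unfolding \<mu>_def using dir_deriv_bilinear[OF bounded_bilinear_mult \<kappa>(1) \<kappa>(1) u] by simp
    have d\<zeta>: "dir_deriv \<zeta> u v = \<mu> u *\<^sub>R dir_deriv chi u v + dir_deriv \<mu> u v *\<^sub>R chi u" for v
      unfolding \<zeta>_def by (rule deriv_scale[OF s\<mu> schi u])
    obtain k where k: "\<alpha>0 u = k *\<^sub>R H u" using par[OF u] by blast
    have t: "\<alpha>0 u \<bullet> \<zeta> u = 0" unfolding k \<zeta>_def chi_def by (simp add: Q.N_perp)
    \<comment> \<open>The Codazzi equation disposes of the derivatives of \<open>chi\<close>. The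
      terms from d\<mu> cancel the two connection terms of \<open>dform\<close>; their factor 2 is
      the reason for taking \<mu> to be the square of \<kappa>.\<close>
    have inner0: "dform \<zeta> u \<bullet> \<nu> = 0" if n: "nrm u \<nu>" for \<nu>
    proof -
      have c: "dir_deriv chi u (e2 u) \<bullet> \<nu> = - (dir_deriv chi u (e1 u) \<bullet> (Nf u \<odot> \<nu>))"
        using normal_part_commute[OF u n] unfolding chi_def[abs_def] .
      show ?thesis
        unfolding dform_inner[OF u n] d\<zeta> d\<mu> d\<kappa> inner_add_left inner_scaleR_left c
        by (simp add: \<zeta>_def \<mu>_def algebra_simps)
    qed
    show ?thesis
      by (rule normal_zero[OF u dform_normal[of u \<zeta>, OF u n\<zeta>[OF u] t]]) (intro inner0 E3 n3[unfolded n3_def] u)+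
  qed
  obtain l where l: "dual_map l" "\<And>u v. u \<in> D \<Longrightarrow> dir_deriv l u v = form \<zeta> u v"
    using dual_map_exists[OF assms(1,2) s\<zeta> n\<zeta> d0] by blast
  have "\<exists>v. dir_deriv l u v \<noteq> 0" if u: "u \<in> D" for u
  proof (rule ccontr)
    assume "\<nexists>v. dir_deriv l u v \<noteq> 0"
    then have "\<zeta> u = 0" using form_eq_0[OF u, of \<zeta>] l(2)[OF u] by simp
    then have "chi u = 0" using \<kappa>(2)[OF u] by (simp add: \<zeta>_def \<mu>_def)
    then show False using H0[OF u] Nf_imag(2)[OF u] unfolding chi_def mult_eq_0 by auto
  qed
  then show ?thesis using that l(1) by blast
qed

text \<open>With \<alpha>0 parallel to \<open>H\<close>, Codazzi says d log |H| = - \<star>b, where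
  b is the normal connection form of \<open>E3\<close>. Since d log q = 2 \<star>\<omega>12 -
  \<star>b, the choice \<kappa>^2 = q / |H| gives d log \<kappa> = \<star>\<omega>12. This is
  precisely closedness of \<kappa> times each form of the coframe, and the Poincare lemma integrates
  both to the coordinates \<psi>.\<close>

lemma mean_directional_coordinates:
  assumes "convex D" "c \<in> D" and q: "smooth_on D q" "\<And>u v. u \<in> D \<Longrightarrow> dir_deriv q u v = q u * star\<Omega> u v"
    "\<And>u. q u > 0"
    and par: "\<And>u. u \<in> D \<Longrightarrow> \<exists>k. \<alpha>0 u = k *\<^sub>R H u"
  obtains \<psi> \<kappa> where "smooth_on D (\<psi> :: real^2 \<Rightarrow> real^2)" "\<And>u. u \<in> D \<Longrightarrow> \<kappa> u > 0"
    "\<And>u v. u \<in> D \<Longrightarrow> dir_deriv \<psi> u v = \<kappa> u *\<^sub>R vector [dir_deriv F u v \<bullet> E1 u, dir_deriv F u v \<bullet> E2 u]"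
proof -
  define m where "m u = norm (H u)" for u
  \<comment> \<open>\<open>E3\<close> may point along \<open>H\<close> or against it, so
    \<open>h\<close> is a signed length with modulus \<open>m\<close>. Codazzi controls
    \<open>h\<close>; the result is carried over to \<open>m\<close> by comparing squares.\<close>
  define h where "h u = H u \<bullet> E3 u" for u
  define b where "b u v = dir_deriv E3 u v \<bullet> n3 u" for u v
  have m0: "m u > 0" if "u \<in> D" for u using H0[OF that] by (simp add: m_def)
  have sm: "smooth_on D m" unfolding m_def by (intro smooth_on_norm smooth_mean_curv open_D H0)
  have sh: "smooth_on D h" unfolding h_def by (intro smooth_on_inner smooth_mean_curv smooth_E3 open_D)
  have H: "H u = h u *\<^sub>R E3 u" if u: "u \<in> D" for u
  proof -
    obtain k where k: "\<alpha>0 u = k *\<^sub>R H u" using par[OF u] by blast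
    have "k \<noteq> 0" using nonumbilic[OF u] by (metis k scaleR_zero_left)
    have "k *\<^sub>R H u = norm (\<alpha>0 u) *\<^sub>R E3 u" by (rule trans[OF k[symmetric] \<alpha>0_E3])
    then have "inverse k *\<^sub>R (k *\<^sub>R H u) = inverse k *\<^sub>R (norm (\<alpha>0 u) *\<^sub>R E3 u)" by simp
    then have "H u = (inverse k * norm (\<alpha>0 u)) *\<^sub>R E3 u" using \<open>k \<noteq> 0\<close> by (simp only: scaleR_scaleR) simp
    then show ?thesis unfolding h_def using E3(1)[OF u] by simp
  qed
  have dm: "dir_deriv m u (e1 u) = m u * b u (e2 u)" "dir_deriv m u (e2 u) = - m u * b u (e1 u)" if u: "u \<in> D" for u
  proof -
    have chi: "Nf x \<odot> H x = h x *\<^sub>R n3 x" if "x \<in> D" for x using H[OF that] by (simp add: n3_def simps)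
    have dchi: "dir_deriv (\<lambda>x. Nf x \<odot> H x) u v = h u *\<^sub>R dir_deriv n3 u v + dir_deriv h u v *\<^sub>R n3 u" for v
      using dir_deriv_eqI_open[OF open_D u chi, where v = v] deriv_scale[OF sh smooth_n3 u, of v] by simp
    have "- h u * b u (e2 u) = - dir_deriv h u (e1 u)"
      using normal_part_commute[OF u E3(2)[OF u]] unfolding dchi n3_def[of u, symmetric]
      by (simp add: inner_add_left deriv_n3[OF u] n3[OF u] b_def)
    moreover have "dir_deriv h u (e2 u) = - h u * b u (e1 u)"
      using normal_part_commute[OF u n3(1)[OF u]] unfolding dchi n3(5)[OF u]
      by (simp add: inner_add_left deriv_n3[OF u] n3[OF u] b_def)
    moreover have mm: "m x * m x = h x * h x" if "x \<in> D" for x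
      unfolding m_def using H[OF that] E3(1)[OF that] by (metis inner_scaleR_left inner_scaleR_right mult.right_neutral power2_eq_square power2_norm_eq_inner)
    have "dir_deriv (\<lambda>x. m x * m x) u v = dir_deriv (\<lambda>x. h x * h x) u v" for v
      by (rule dir_deriv_eqI_open[OF open_D u mm])
    then have mh: "m u * dir_deriv m u v = h u * dir_deriv h u v" for v
      using dir_deriv_bilinear[OF bounded_bilinear_mult sm sm u, of v] dir_deriv_bilinear[OF bounded_bilinear_mult sh sh u, of v] by simp
    ultimately have "m u * dir_deriv m u (e1 u) = m u * (m u * b u (e2 u))" "m u * dir_deriv m u (e2 u) = m u * (- m u * b u (e1 u))"
      unfolding mh using mm[OF u] by (simp_all flip: mult.assoc)
    moreover have "m u \<noteq> 0" using m0[OF u] by simp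
    ultimately show "dir_deriv m u (e1 u) = m u * b u (e2 u)" "dir_deriv m u (e2 u) = - m u * b u (e1 u)"
      using mult_left_cancel by blast+
  qed
  define \<kappa> where "\<kappa> u = sqrt (q u / m u)" for u
  have \<kappa>0: "\<kappa> u > 0" if "u \<in> D" for u using q(3) m0[OF that] by (simp add: \<kappa>_def)
  have s\<kappa>: "smooth_on D \<kappa>" unfolding \<kappa>_def
  proof (intro smooth_on_sqrt smooth_on_divide q sm open_D)
    show "m x \<noteq> 0" "0 < q x / m x" if "x \<in> D" for x using m0[OF that] q(3)[of x] by auto
  qed
  have d\<kappa>: "dir_deriv \<kappa> u (e1 u) = - \<omega>12 u (e2 u) * \<kappa> u" "dir_deriv \<kappa> u (e2 u) = \<omega>12 u (e1 u) * \<kappa> u" if u: "u \<in> D" for u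
  proof -
    have e: "m x * (\<kappa> x * \<kappa> x) = q x" if "x \<in> D" for x
      using q(3)[of x] m0[OF that] by (simp add: \<kappa>_def real_sqrt_mult_self less_imp_le)
    have "dir_deriv (\<lambda>x. m x * (\<kappa> x * \<kappa> x)) u v = dir_deriv q u v" for v
      by (rule dir_deriv_eqI_open[OF open_D u e])
    then have d: "m u * (2 * \<kappa> u * dir_deriv \<kappa> u v) + dir_deriv m u v * (\<kappa> u * \<kappa> u) = q u * star\<Omega> u v" for v
      using dir_deriv_bilinear[OF bounded_bilinear_mult sm smooth_on_mult[OF open_D s\<kappa> s\<kappa>] u, of v]
        dir_deriv_bilinear[OF bounded_bilinear_mult s\<kappa> s\<kappa> u, of v] q(2)[OF u, of v] by (simp add: algebra_simps)
    have st: "star\<Omega> u (e1 u) = - (2 * \<omega>12 u (e2 u) - b u (e2 u))" "star\<Omega> u (e2 u) = 2 * \<omega>12 u (e1 u) - b u (e1 u)"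
      unfolding star\<Omega>_expand[OF u] \<Omega>_def b_def n3_def by (simp_all add: frame_inner[OF u])
    have "(2 * m u * \<kappa> u) * dir_deriv \<kappa> u (e1 u) = (2 * m u * \<kappa> u) * (- \<omega>12 u (e2 u) * \<kappa> u)"
      using d[of "e1 u"] unfolding dm[OF u] st e[OF u, symmetric] by algebra
    moreover have "(2 * m u * \<kappa> u) * dir_deriv \<kappa> u (e2 u) = (2 * m u * \<kappa> u) * (\<omega>12 u (e1 u) * \<kappa> u)"
      using d[of "e2 u"] unfolding dm[OF u] st e[OF u, symmetric] by algebra
    moreover have "2 * m u * \<kappa> u \<noteq> 0" using m0[OF u] \<kappa>0[OF u] by simp
    ultimately show "dir_deriv \<kappa> u (e1 u) = - \<omega>12 u (e2 u) * \<kappa> u" "dir_deriv \<kappa> u (e2 u) = \<omega>12 u (e1 u) * \<kappa> u"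
      using mult_left_cancel by blast+
  qed
  define \<eta> where "\<eta> u v = \<kappa> u *\<^sub>R (vector [dir_deriv F u v \<bullet> E1 u, dir_deriv F u v \<bullet> E2 u] :: real^2)" for u v
  have lin: "linear (\<eta> u)" if "u \<in> D" for u
    unfolding \<eta>_def using lin_df[OF that]
    by (intro linearI) (simp_all add: linear_add linear_scale vec_eq_iff forall_2 inner_add_left algebra_simps)
  have s\<eta>: "smooth_on D (\<lambda>u. \<eta> u v)" for v
    unfolding \<eta>_def by (intro smooth_on_scaleR smooth_on_vec2 smooth_on_inner smooth_on_dir_deriv smooth_F smooth_E s\<kappa> open_D)
  have cl: "dir_deriv (\<lambda>x. \<eta> x w) u v = dir_deriv (\<lambda>x. \<eta> x v) u w" if u: "u \<in> D" for u v w
  proof -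
    define T where "T j v w = dir_deriv \<kappa> u v * (dir_deriv F u w \<bullet> (if j = (1::2) then E1 u else E2 u))
      + \<kappa> u * (dir_deriv F u w \<bullet> dir_deriv (if j = 1 then E1 else E2) u v)" for j v w
    have sF: "smooth_on D (\<lambda>x. dir_deriv F x w)" for w by (rule smooth_on_dir_deriv[OF smooth_F])
    have dT: "dir_deriv (\<lambda>x. \<eta> x w) u v $ j = T j v w + \<kappa> u * (hess F u v w \<bullet> (if j = 1 then E1 u else E2 u))" for v w j
    proof -
      let ?E = "if j = 1 then E1 else E2"
      have sE: "smooth_on D ?E" using smooth_E by simp
      have "dir_deriv (\<lambda>x. \<eta> x w) u v $ j = dir_deriv (\<lambda>x. \<eta> x w $ j) u v"
        by (rule dir_deriv_bounded_linear[OF bounded_linear_vec_nth s\<eta> u, symmetric])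
      also have "\<dots> = dir_deriv (\<lambda>x. \<kappa> x * (dir_deriv F x w \<bullet> ?E x)) u v"
        using exhaust_2[of j] by (auto simp: \<eta>_def)
      also have "\<dots> = T j v w + \<kappa> u * (hess F u v w \<bullet> (if j = 1 then E1 u else E2 u))"
        using dir_deriv_bilinear[OF bounded_bilinear_mult s\<kappa> smooth_on_inner[OF open_D sF[of w] sE] u, of v]
          deriv_inner[OF sF[of w] sE u, of v]
        by (simp add: T_def hess_def algebra_simps split: if_splits)
      finally show ?thesis .
    qed
    have lF: "linear (dir_deriv F u)" by (rule lin_df[OF u])
    have lk: "linear (dir_deriv \<kappa> u)" by (rule smooth_on_linear_deriv[OF s\<kappa> u])
    have lE: "linear (dir_deriv (if j = 1 then E1 else E2) u)" for j :: 2
      using smooth_on_linear_deriv[OF smooth_E(1) u] smooth_on_linear_deriv[OF smooth_E(2) u] by simp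
    have lT: "linear (T j v)" "linear (\<lambda>v. T j v w)" for j v w
      unfolding T_def by (intro linearI; simp only: linear_add[OF lF] linear_scale[OF lF] linear_add[OF lk] linear_scale[OF lk]
        linear_add[OF lE] linear_scale[OF lE] inner_add_left inner_add_right inner_scaleR_left inner_scaleR_right;
        simp add: algebra_simps)+
    have "T j (e1 u) (e2 u) = T j (e2 u) (e1 u)" for j
    proof -
      have i: "E1 u \<bullet> dir_deriv E1 u v = 0" "E2 u \<bullet> dir_deriv E1 u v = \<omega>12 u v"
        "E1 u \<bullet> dir_deriv E2 u v = - \<omega>12 u v" "E2 u \<bullet> dir_deriv E2 u v = 0" for v
        using tangent_deriv_inner[OF u, of v] by (simp_all add: inner_commute)
      show ?thesis unfolding T_def using exhaust_2[of j]
        by (auto simp: frame_inner[OF u] i d\<kappa>[OF u])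
    qed
    then have "T j v w = T j w v" for j
      using alternating_det[OF lT(1)[of j] lT(2)[of j] expand[OF u, of v] expand[OF u, of w]] by simp
    then show ?thesis by (simp add: vec_eq_iff dT hess_sym[OF u, of v w])
  qed
  obtain \<psi> where \<psi>: "smooth_on D \<psi>" "\<And>u. u \<in> D \<Longrightarrow> (\<psi> has_derivative \<eta> u) (at u)"
    using poincare_lemma[OF open_D assms(1,2) lin s\<eta> cl] by blast
  show ?thesis
    by (rule that[OF \<psi>(1) \<kappa>0]) (use dir_deriv_eq[OF \<psi>(2)] in \<open>auto simp: \<eta>_def\<close>)
qed

end

section \<open>Infinitesimal isometric deformations\<close>

lemma partial_derivatives:
  fixes G :: "real \<times> 'a::real_normed_vector \<Rightarrow> 'b::real_normed_vector"
  assumes G: "smooth_on (UNIV \<times> D) G" and x: "x \<in> D"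
  shows "((\<lambda>\<tau>. G (\<tau>, x)) has_vector_derivative dir_deriv G (t, x) (1, 0)) (at t)"
    "dir_deriv (\<lambda>y. G (t, y)) x v = dir_deriv G (t, x) (0, v)"
proof -
  have dG: "(G has_derivative frechet_derivative G (at (t, x))) (at (t, x))"
    by (rule smooth_on_has_derivative[OF G]) (simp add: x)
  have lin: "linear (frechet_derivative G (at (t, x)))" using dG has_derivative_linear by blast
  have d: "((\<lambda>\<tau>. G (\<tau>, x)) has_derivative (\<lambda>h. frechet_derivative G (at (t, x)) (h, 0))) (at t)"
    by (rule has_derivative_compose[where f = "\<lambda>\<tau>. (\<tau>, x)", OF _ dG])
      (intro has_derivative_Pair has_derivative_ident has_derivative_const)
  have "frechet_derivative G (at (t, x)) (h, 0) = h *\<^sub>R dir_deriv G (t, x) (1, 0)" for h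
    using linear_scale[OF lin, of h "(1, 0)"] by simp
  then show "((\<lambda>\<tau>. G (\<tau>, x)) has_vector_derivative dir_deriv G (t, x) (1, 0)) (at t)"
    unfolding has_vector_derivative_def by (intro has_derivative_eq_rhs[OF d] ext)
  have "((\<lambda>y. G (t, y)) has_derivative (\<lambda>h. frechet_derivative G (at (t, x)) (0, h))) (at x)"
    by (rule has_derivative_compose[where f = "\<lambda>y. (t, y)", OF _ dG])
      (intro has_derivative_Pair has_derivative_ident has_derivative_const)
  then show "dir_deriv (\<lambda>y. G (t, y)) x v = dir_deriv G (t, x) (0, v)"
    by (rule dir_deriv_eq)
qed

lemma smooth_on_snd:
  fixes D :: "'b::euclidean_space set"
  assumes "open (A :: real set)" "open D" "smooth_on D f"
  shows "smooth_on (A \<times> D) (\<lambda>z. f (snd z))"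
proof (rule smooth_on_compose[OF open_Times[OF assms(1,2)] assms(2) _ assms(3)])
  show "smooth_on (A \<times> D) (snd :: real \<times> 'b \<Rightarrow> 'b)"
    using smooth_on_bounded_linear[OF bounded_linear_snd open_Times[OF assms(1,2)] smooth_on_ident[OF open_Times[OF assms(1,2)]]] .
qed auto

lemma smooth_on_fst:
  fixes D :: "'b::euclidean_space set"
  assumes "open (A :: real set)" "open D"
  shows "smooth_on (A \<times> D) (\<lambda>z. fst z)"
  using smooth_on_bounded_linear[OF bounded_linear_fst open_Times[OF assms(1,2)] smooth_on_ident[OF open_Times[OF assms(1,2)]]] .

section \<open>Imaginary quaternions as a cross product algebra\<close>

context quat
begin

text \<open>The imaginary part of \<open>b \<odot> \<c> a\<close>. On the coordinate fields it is a
  positive multiple of the left normal, with the area of the parallelogram as its length. It is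
  polynomial in its arguments, hence polynomial in \<open>t\<close> along a deformation.\<close>

definition gauss_bivector :: "real^4 \<Rightarrow> real^4 \<Rightarrow> real^4"
  where "gauss_bivector a b = b \<odot> \<c> a - (a \<bullet> b) *\<^sub>R quat_one"

lemma gauss_bivector_norm: "gauss_bivector a b \<bullet> gauss_bivector a b = (a \<bullet> a) * (b \<bullet> b) - (a \<bullet> b) * (a \<bullet> b)"
proof -
  have i: "quat_one \<bullet> (b \<odot> \<c> a) = a \<bullet> b" "(b \<odot> \<c> a) \<bullet> quat_one = a \<bullet> b"
    using inner_mult_conj(1)[of b a] by (simp_all add: inner_commute)
  show ?thesis
    unfolding gauss_bivector_def by (simp add: inner_diff_left inner_diff_right i norm_mult_sq inner_conj(1) inner_axis_axis)
qed

lemma gauss_bivector_imag: "gauss_bivector a b \<bullet> quat_one = 0"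
  unfolding gauss_bivector_def inner_diff_left inner_mult_conj by (simp add: inner_axis_axis inner_commute)

lemma imag_mult_one: "p \<bullet> quat_one = 0 \<Longrightarrow> (p \<odot> q) \<bullet> quat_one = - (p \<bullet> q)"
  using inner_mult_conj(2)[of p q] by (simp add: conj_imag[THEN iffD2] simps)

text \<open>For imaginary arguments the real part of the product is removed, which leaves the cross
  product up to the sign \<open>s\<close>.\<close>

definition bracket :: "real^4 \<Rightarrow> real^4 \<Rightarrow> real^4"
  where "bracket p q = p \<odot> q + (p \<bullet> q) *\<^sub>R quat_one"

lemma bracket_lin: "bracket (p + p') q = bracket p q + bracket p' q" "bracket p (q + q') = bracket p q + bracket p q'"
  "bracket (k *\<^sub>R p) q = k *\<^sub>R bracket p q" "bracket p (k *\<^sub>R q) = k *\<^sub>R bracket p q"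
  by (simp_all add: bracket_def simps inner_add_left inner_add_right algebra_simps)

lemma bracket_one: "p \<bullet> quat_one = 0 \<Longrightarrow> bracket p q \<bullet> quat_one = 0"
  by (simp add: bracket_def inner_add_left imag_mult_one inner_axis_axis)

lemma bracket_inner: "x \<bullet> quat_one = 0 \<Longrightarrow> bracket p q \<bullet> x = (p \<odot> q) \<bullet> x"
  by (simp add: bracket_def inner_add_left inner_commute[of quat_one])

lemma commutator_bracket:
  assumes "p \<bullet> quat_one = 0" "q \<bullet> quat_one = 0"
  shows "p \<odot> q - q \<odot> p = 2 *\<^sub>R bracket p q"
proof -
  have "\<c> p = - p" "\<c> q = - q" using assms conj_imag by blast+
  then have e: "- (p \<odot> q) = (2 * (p \<bullet> q)) *\<^sub>R quat_one + q \<odot> p"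
    using mult_conj_swap(1)[of p q] by (simp add: simps)
  have "q \<odot> p = ((2 * (p \<bullet> q)) *\<^sub>R quat_one + q \<odot> p) - (2 * (p \<bullet> q)) *\<^sub>R quat_one" by simp
  also have "\<dots> = - (p \<odot> q) - (2 * (p \<bullet> q)) *\<^sub>R quat_one" unfolding e ..
  finally show ?thesis by (simp add: bracket_def vec_eq_iff)
qed

end

context framed_surf
begin

lemma gauss_bivector_eq:
  assumes u: "u \<in> D"
  obtains k where "k > 0" "gauss_bivector (dir_deriv F u dx) (dir_deriv F u dy) = k *\<^sub>R Nf u"
proof -
  interpret P: tangent_frame F u "e1 u" "e2 u" by (rule at'(3)[OF u])
  interpret Q: quat_plane s "E1 u" "Nf u" by (rule plane[OF u])
  obtain p q where x: "dx = p *\<^sub>R e1 u + q *\<^sub>R e2 u" using expand[OF u] by blast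
  obtain r t where y: "dy = r *\<^sub>R e1 u + t *\<^sub>R e2 u" using expand[OF u] by blast
  have "dx$1 * dy$2 - dx$2 * dy$1 = (p * t - q * r) * (e1 u $ 1 * e2 u $ 2 - e1 u $ 2 * e2 u $ 1)"
    unfolding x y by (simp add: algebra_simps)
  then have "0 < (e1 u $ 1 * e2 u $ 2 - e1 u $ 2 * e2 u $ 1) * (p * t - q * r)"
    by (simp add: axis_def mult.commute)
  then have k: "p * t - q * r > 0" using P.det_pos by (rule zero_less_mult_pos)
  have X: "dir_deriv F u dx = p *\<^sub>R E1 u + q *\<^sub>R E2 u" "dir_deriv F u dy = r *\<^sub>R E1 u + t *\<^sub>R E2 u"
    unfolding x y by simp_all
  have m: "E1 u \<odot> \<c> (E1 u) = quat_one" "E2 u \<odot> \<c> (E2 u) = quat_one" "E2 u \<odot> \<c> (E1 u) = Nf u" "E1 u \<odot> \<c> (E2 u) = - Nf u"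
    using Q.cN unfolding Nf_def by (simp_all add: mult_conj frame_inner[OF u] simps)
  have "gauss_bivector (dir_deriv F u dx) (dir_deriv F u dy) = (p * t - q * r) *\<^sub>R Nf u"
    unfolding X gauss_bivector_def
    by (simp add: simps m inner_add_left inner_add_right frame_inner[OF u]) (simp add: algebra_simps)
  then show ?thesis using that k by blast
qed

lemma Nf_sgn: "u \<in> D \<Longrightarrow> Nf u = sgn (gauss_bivector (dir_deriv F u dx) (dir_deriv F u dy))"
  by (rule gauss_bivector_eq[of u]) (auto simp: sgn_scaleR sgn_div_norm norm_eq_sqrt_inner Nf_imag)

end

context iso_surf
begin

lemma deriv_Nf_e2:
  assumes u: "u \<in> D" shows "dir_deriv Nf u (e2 u) = Nf u \<odot> dir_deriv Nf u (e1 u)"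
proof -
  interpret Q: quat_plane s "E1 u" "Nf u" by (rule plane[OF u])
  have n: "Q.normal (H u)" using H_nrm[OF u] normal_iff[OF u] by blast
  show ?thesis
    unfolding deriv_Nf_H[OF u] E2_eq[OF u, symmetric]
    using Q.normal_anticommute[OF n] by (simp add: simps Q.cN assoc)
qed

text \<open>\<open>Nf\<close> is a conformal immersion into the unit sphere, so a variation \<open>X\<close> of \<open>Nf\<close> preserving the induced
  metric to first order is a rotation field.\<close>

lemma infinitesimal_rotation:
  assumes "convex D" and X: "smooth_on D X" "\<And>u. u \<in> D \<Longrightarrow> X u \<bullet> Nf u = 0" "\<And>u. u \<in> D \<Longrightarrow> X u \<bullet> quat_one = 0"
    and skew: "\<And>u v w. u \<in> D \<Longrightarrow> dir_deriv X u v \<bullet> dir_deriv Nf u w + dir_deriv Nf u v \<bullet> dir_deriv X u w = 0"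
  obtains w0 where "w0 \<bullet> quat_one = 0" "\<And>u. u \<in> D \<Longrightarrow> X u = bracket w0 (Nf u)"
proof -
  \<comment> \<open>\<open>Nf \<odot> X\<close> alone already solves X =
    \<open>bracket w Nf\<close>. The added multiple \<open>g\<close> of \<open>Nf\<close> is an
    infinitesimal rotation within the tangent plane of the sphere, chosen so that dX =
    \<open>bracket w dNf\<close> holds as well.\<close>
  define g where "g u = (dir_deriv X u (e1 u) \<bullet> dir_deriv Nf u (e2 u)) / (H u \<bullet> H u)" for u
  define w where "w u = Nf u \<odot> X u + g u *\<^sub>R Nf u" for u
  have sdX: "smooth_on D (\<lambda>u. dir_deriv X u (e1 u))" by (intro smooth_on_dir_deriv_field X smooth_e open_D)
  have sdN: "smooth_on D (\<lambda>u. dir_deriv Nf u (e u))" if "smooth_on D e" for e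
    by (intro smooth_on_dir_deriv_field smooth_Nf that open_D)
  have sg: "smooth_on D g" unfolding g_def
    by (intro smooth_on_divide smooth_on_inner sdX sdN smooth_e smooth_mean_curv open_D) (simp add: H0)
  have sw: "smooth_on D w" unfolding w_def by (intro smooth_on_add smooth_on_scaleR smooth_prod smooth_Nf X sg open_D)
  have wim: "w u \<bullet> quat_one = 0" if u: "u \<in> D" for u
    unfolding w_def using X(2)[OF u] Nf_imag[OF u] imag_mult_one[of "Nf u" "X u"] by (simp add: inner_add_left inner_commute[of "Nf u" "X u"])
  have Xw: "X u = bracket (w u) (Nf u)" if u: "u \<in> D" for u
  proof -
    have "Nf u \<odot> X u \<odot> Nf u = X u"
    proof -
      interpret Q: quat_plane s "E1 u" "Nf u" by (rule plane[OF u])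
      have "X u \<odot> Nf u = - (Nf u \<odot> X u)" by (rule imag_anticommute) (use X Nf_imag u in auto)
      then show ?thesis by (simp add: simps Q.NNx)
    qed
    moreover have "(Nf u \<odot> X u) \<bullet> Nf u = 0"
      using X(3)[OF u] Nf_imag[OF u] inner_mult_mult(1)[of "Nf u" "X u" quat_one] by (simp add: simps)
    moreover have "Nf u \<odot> Nf u = - quat_one" using imag_square[of "Nf u"] Nf_imag[OF u] by simp
    ultimately show ?thesis
      unfolding w_def bracket_lin by (simp add: bracket_def assoc Nf_imag[OF u])
  qed
  have dN1: "dir_deriv Nf u v \<bullet> quat_one = 0" "dir_deriv X u v \<bullet> quat_one = 0" "dir_deriv Nf u v \<bullet> Nf u = 0"
    "dir_deriv X u v \<bullet> Nf u = - (X u \<bullet> dir_deriv Nf u v)" if u: "u \<in> D" for u v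
    using deriv_inner_const[OF smooth_Nf smooth_on_const u, of quat_one 0 v] Nf_imag
      deriv_inner_const[OF X(1) smooth_on_const u, of quat_one 0 v] X
      deriv_inner_const[OF smooth_Nf smooth_Nf u, of 1 v] deriv_inner_const[OF X(1) smooth_Nf u X(2), of v]
    by (simp_all add: frechet_derivative_const inner_commute)
  have hh: "H u \<bullet> H u > 0" if "u \<in> D" for u using H0[OF that] by simp
  have dNe: "dir_deriv Nf u (e1 u) \<bullet> dir_deriv Nf u (e1 u) = H u \<bullet> H u" "dir_deriv Nf u (e2 u) \<bullet> dir_deriv Nf u (e2 u) = H u \<bullet> H u"
    "dir_deriv Nf u (e1 u) \<bullet> dir_deriv Nf u (e2 u) = 0" "dir_deriv Nf u (e2 u) \<bullet> dir_deriv Nf u (e1 u) = 0" if u: "u \<in> D" for u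
    unfolding deriv_Nf_norm[OF u] by (simp_all add: metric_def frame_inner[OF u])
  have dXw: "dir_deriv X u v = bracket (w u) (dir_deriv Nf u v)" if u: "u \<in> D" for u v
  proof -
    interpret Q: quat_plane s "E1 u" "Nf u" by (rule plane[OF u])
    define n1 n2 where "n1 = dir_deriv Nf u (e1 u)" and "n2 = dir_deriv Nf u (e2 u)"
    have n2: "n2 = Nf u \<odot> n1" unfolding n1_def n2_def by (rule deriv_Nf_e2[OF u])
    have Nn2: "Nf u \<odot> n2 = - n1" unfolding n2 by (rule Q.NNx)
    note im = dN1[OF u, of "e1 u"] dN1[OF u, of "e2 u"]
    note im = im[folded n1_def n2_def]
    note nn = dNe[OF u, folded n1_def n2_def]
    have ceq: "dir_deriv X u (e1 u) \<bullet> n2 = g u * (H u \<bullet> H u)" using hh[OF u] by (simp add: g_def n2_def)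
    have sk: "dir_deriv X u (e1 u) \<bullet> n1 = 0" "dir_deriv X u (e2 u) \<bullet> n2 = 0"
      "dir_deriv X u (e2 u) \<bullet> n1 = - (g u * (H u \<bullet> H u))"
      using skew[OF u, of "e1 u" "e1 u"] skew[OF u, of "e2 u" "e2 u"] skew[OF u, of "e1 u" "e2 u"] ceq
      by (simp_all add: n1_def[symmetric] n2_def[symmetric] inner_commute)
    have key: "dir_deriv X u (e u) = bracket (w u) m"
      if m: "m \<bullet> quat_one = 0" "dir_deriv X u (e u) \<bullet> Nf u = - (X u \<bullet> m)"
        "m \<bullet> Nf u = 0"
        "dir_deriv X u (e u) \<bullet> n1 = g u * ((Nf u \<odot> m) \<bullet> n1)" "dir_deriv X u (e u) \<bullet> n2 = g u * ((Nf u \<odot> m) \<bullet> n2)"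
        "m = n1 \<or> m = n2" for e m
    proof -
      have one: "Nf u = Nf u \<odot> quat_one" by (simp add: simps)
      have XN: "(Nf u \<odot> X u) \<bullet> quat_one = 0" "X u \<bullet> quat_one = 0"
        using X(2,3)[OF u] imag_mult_one[of "Nf u" "X u"] Nf_imag[OF u] by (simp_all add: inner_commute)
      have p: "(w u \<odot> m) \<bullet> x = (Nf u \<odot> X u \<odot> m) \<bullet> x + g u * ((Nf u \<odot> m) \<bullet> x)" for x
        unfolding w_def by (simp add: simps assoc inner_add_left)
      have a1: "(Nf u \<odot> X u \<odot> m) \<bullet> Nf u = - (X u \<bullet> m)"
        by (subst (2) one) (simp add: Q.N_isometry imag_mult_one XN)
      have a1': "(Nf u \<odot> m) \<bullet> Nf u = 0" by (subst (2) one) (simp add: Q.N_isometry m)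
      have mm: "(X u \<odot> m) \<bullet> m = 0" "(Nf u \<odot> X u \<odot> m) \<bullet> m = 0"
        unfolding assoc[symmetric] inner_right[of _ m m] mult_conj by (simp_all add: XN)
      have a2: "(Nf u \<odot> X u \<odot> m) \<bullet> n1 = 0" "(Nf u \<odot> X u \<odot> m) \<bullet> n2 = 0"
        using m(6) mm Q.N_skew[of "X u \<odot> m" n1] Q.N_skew[of "X u \<odot> m" n2] by (auto simp: Nn2 n2[symmetric])
      have "dir_deriv X u (e u) - bracket (w u) m = 0"
      proof (rule orthogonal_4_zero[of quat_one "Nf u" n1 n2])
        show "quat_one \<noteq> (0::real^4)" by (simp add: axis_eq_0_iff)
        show "Nf u \<noteq> 0" using Nf_imag[OF u] by auto
        show "n1 \<noteq> 0" "n2 \<noteq> 0" using nn hh[OF u] by auto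
        show "(dir_deriv X u (e u) - bracket (w u) m) \<bullet> quat_one = 0"
          using bracket_one[OF wim[OF u]] dN1(2)[OF u] by (simp add: inner_diff_left)
        show "(dir_deriv X u (e u) - bracket (w u) m) \<bullet> Nf u = 0"
          unfolding inner_diff_left bracket_inner[OF Nf_imag(1)[OF u]] p a1 a1' m(2) by simp
        show "(dir_deriv X u (e u) - bracket (w u) m) \<bullet> n1 = 0"
          unfolding inner_diff_left bracket_inner[OF im(1)] p a2 m(4) by simp
        show "(dir_deriv X u (e u) - bracket (w u) m) \<bullet> n2 = 0"
          unfolding inner_diff_left bracket_inner[OF im(5)] p a2 m(5) by simp
      qed (use im nn Nf_imag[OF u] in \<open>simp_all add: inner_commute\<close>)
      then show ?thesis by simp
    qed
    have "dir_deriv X u (e1 u) = bracket (w u) n1"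
      by (rule key) (use im sk ceq nn n2 in \<open>simp_all add: n1_def\<close>)
    moreover have "dir_deriv X u (e2 u) = bracket (w u) n2"
      by (rule key) (use im sk ceq nn Nn2 in \<open>simp_all add: n2_def\<close>)
    moreover have "linear (\<lambda>v. bracket (w u) (dir_deriv Nf u v))"
      using smooth_on_linear_deriv[OF smooth_Nf u] by (intro linearI) (simp_all add: linear_add linear_scale bracket_lin)
    ultimately show ?thesis
      using linear_eq_on_frame[OF u smooth_on_linear_deriv[OF X(1) u]] unfolding n1_def n2_def by blast
  qed
  \<comment> \<open>Differentiating X = \<open>bracket w Nf\<close> and comparing with
    \<open>dXw\<close> shows that the bracket of dw and \<open>Nf\<close> vanishes, so dw is
    parallel to \<open>Nf\<close>.\<close>
  have dw: "dir_deriv w u v = (dir_deriv w u v \<bullet> Nf u) *\<^sub>R Nf u" if u: "u \<in> D" for u v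
  proof -
    interpret Q: quat_plane s "E1 u" "Nf u" by (rule plane[OF u])
    have dwim: "dir_deriv w u v \<bullet> quat_one = 0"
      using deriv_inner_const[OF sw smooth_on_const u, of quat_one 0 v] wim by (simp add: frechet_derivative_const)
    have "dir_deriv X u v = dir_deriv (\<lambda>x. bracket (w x) (Nf x)) u v"
      by (rule dir_deriv_eqI_open[OF open_D u Xw])
    also have "\<dots> = bracket (w u) (dir_deriv Nf u v) + bracket (dir_deriv w u v) (Nf u)"
      unfolding bracket_def
      using dir_deriv_add[OF smooth_prod[OF sw smooth_Nf] smooth_on_scaleR[OF open_D smooth_on_inner[OF open_D sw smooth_Nf] smooth_on_const] u]
        deriv_prod[OF sw smooth_Nf u] deriv_inner[OF sw smooth_Nf u]
        dir_deriv_bilinear[OF bounded_bilinear_scaleR smooth_on_inner[OF open_D sw smooth_Nf] smooth_on_const u]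
      by (simp add: frechet_derivative_const algebra_simps)
    finally have "bracket (dir_deriv w u v) (Nf u) = 0" using dXw[OF u] by simp
    then have "dir_deriv w u v \<odot> Nf u = - (dir_deriv w u v \<bullet> Nf u) *\<^sub>R quat_one"
      by (simp add: bracket_def eq_neg_iff_add_eq_0)
    then have "(dir_deriv w u v \<odot> Nf u) \<odot> Nf u = - (dir_deriv w u v \<bullet> Nf u) *\<^sub>R Nf u" by (simp add: simps)
    moreover have "(dir_deriv w u v \<odot> Nf u) \<odot> Nf u = - dir_deriv w u v"
      using imag_square[of "Nf u"] Nf_imag[OF u] by (simp add: assoc simps)
    ultimately show ?thesis by simp
  qed
  \<comment> \<open>Symmetry of the second derivatives of \<open>w\<close>: as the derivatives of
    \<open>Nf\<close> along \<open>e1\<close> and \<open>e2\<close> are orthogonal and nonzero, the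
    coefficients in dw = \<kappa> \<open>Nf\<close> must vanish.\<close>
  have "dir_deriv w u v = 0" if u: "u \<in> D" for u v
  proof -
    define \<kappa> where "\<kappa> v x = dir_deriv w x v \<bullet> Nf x" for v x
    have s\<kappa>: "smooth_on D (\<kappa> v)" for v unfolding \<kappa>_def by (intro smooth_on_inner smooth_on_dir_deriv sw smooth_Nf open_D)
    have dd: "dir_deriv (\<lambda>x. dir_deriv w x b) u a = \<kappa> b u *\<^sub>R dir_deriv Nf u a + dir_deriv (\<kappa> b) u a *\<^sub>R Nf u" for a b
    proof -
      have "dir_deriv (\<lambda>x. dir_deriv w x b) u a = dir_deriv (\<lambda>x. \<kappa> b x *\<^sub>R Nf x) u a"
        by (rule dir_deriv_eqI_open[OF open_D u]) (simp add: \<kappa>_def dw[symmetric])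
      then show ?thesis using deriv_scale[OF s\<kappa> smooth_Nf u] by simp
    qed
    have sym: "\<kappa> b u *\<^sub>R dir_deriv Nf u a + dir_deriv (\<kappa> b) u a *\<^sub>R Nf u = \<kappa> a u *\<^sub>R dir_deriv Nf u b + dir_deriv (\<kappa> a) u b *\<^sub>R Nf u" for a b
      unfolding dd[symmetric] by (rule mixed_derivatives_commute[OF open_D sw u])
    have e: "\<kappa> b u * (dir_deriv Nf u a \<bullet> dir_deriv Nf u c) = \<kappa> a u * (dir_deriv Nf u b \<bullet> dir_deriv Nf u c)" for a b c
    proof -
      have "Nf u \<bullet> dir_deriv Nf u c = 0" using dN1(3)[OF u] by (simp add: inner_commute)
      then show ?thesis using arg_cong[OF sym[of b a], of "\<lambda>y. y \<bullet> dir_deriv Nf u c"] by (simp add: inner_add_left)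
    qed
    have "\<kappa> (e2 u) u = 0" "\<kappa> (e1 u) u = 0"
      using e[of "e2 u" "e1 u" "e1 u"] e[of "e2 u" "e1 u" "e2 u"] hh[OF u] by (simp_all add: dNe[OF u])
    then have "dir_deriv w u (e1 u) = 0" "dir_deriv w u (e2 u) = 0"
      using dw[OF u, of "e1 u"] dw[OF u, of "e2 u"] by (simp_all add: \<kappa>_def)
    then show ?thesis
      using linear_eq_on_frame[OF u smooth_on_linear_deriv[OF sw u] linear_zero] by blast
  qed
  then obtain w0 where w0: "\<And>u. u \<in> D \<Longrightarrow> w u = w0"
    using dir_deriv_zero_constant[OF open_D assms(1) sw] by blast
  show ?thesis
  proof (cases "D = {}")
    case True
    then show ?thesis using that[of 0] by simp
  next
    case False
    then have "w0 \<bullet> quat_one = 0" using w0 wim by fastforce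
    then show ?thesis using that Xw w0 by metis
  qed
qed

text \<open>The left normals of f + t T vary at t = 0 by a field V along the sphere. The bending
  condition and the Gauss lift condition together make V preserve the metric pulled back by
  \<open>Nf\<close>, hence V = \<open>bracket w Nf\<close>. Left multiplication by w / 2 causes the
  same variation, so what is left of dT does not move the left normal to first order, and this means
  that it is df followed by right multiplication by some \<open>l\<close>.\<close>

lemma bending_rotation:
  assumes "convex D" and T: "smooth_on D T"
    and bend: "\<And>u v w. u \<in> D \<Longrightarrow> dir_deriv T u v \<bullet> dir_deriv F u w + dir_deriv F u v \<bullet> dir_deriv T u w = 0"
    and gl: "\<And>u v w. u \<in> D \<Longrightarrow> ((\<lambda>t. gauss_lift_metric (\<lambda>x. F x + t *\<^sub>R T x) s 1 u v w) has_real_derivative 0) (at 0)"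
  obtains w0 l where "dual_map l" "w0 \<bullet> quat_one = 0"
    "\<And>u v. u \<in> D \<Longrightarrow> dir_deriv T u v = w0 \<odot> dir_deriv F u v + dir_deriv F u v \<odot> l u"
proof -
  define Ft where "Ft t x = F x + t *\<^sub>R T x" for t x
  have sFt: "smooth_on D (Ft t)" for t
    unfolding Ft_def by (intro smooth_on_add smooth_on_scaleR smooth_on_const T smooth_F open_D)
  have dFt: "dir_deriv (Ft t) u v = dir_deriv F u v + t *\<^sub>R dir_deriv T u v" if "u \<in> D" for t u v
    unfolding Ft_def
    by (rule dir_deriv_eq) (auto intro!: derivative_eq_intros smooth_on_has_derivative[OF smooth_F that] smooth_on_has_derivative[OF T that])
  have mFt: "metric (Ft t) u v w = metric F u v w + t\<^sup>2 * (dir_deriv T u v \<bullet> dir_deriv T u w)" if u: "u \<in> D" for t u v w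
  proof -
    have "t * (dir_deriv T u v \<bullet> dir_deriv F u w + dir_deriv F u v \<bullet> dir_deriv T u w) = 0" using bend[OF u] by simp
    then show ?thesis unfolding metric_def dFt[OF u]
      by (simp add: inner_add_left inner_add_right power2_eq_square algebra_simps)
  qed
  have inj: "inj (frechet_derivative (Ft t) (at u))" if u: "u \<in> D" for t u
  proof -
    have "v = 0" if "dir_deriv (Ft t) u v = 0" for v
    proof -
      have "metric F u v v + t\<^sup>2 * (dir_deriv T u v \<bullet> dir_deriv T u v) = 0"
        using mFt[OF u, of t v v] that by (simp add: metric_def)
      then have "metric F u v v = 0"
        unfolding metric_def by (metis add_nonneg_eq_0_iff inner_ge_zero mult_nonneg_nonneg zero_le_power2)
      then show "v = 0" using tangent_frame.df_eq_0[OF at'(3)[OF u]] by (simp add: metric_def)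
    qed
    then show ?thesis
      using smooth_on_linear_deriv[OF sFt u] linear_injective_0 by blast
  qed
  define X Y Tx Ty where "X x = dir_deriv F x dx" and "Y x = dir_deriv F x dy"
    and "Tx x = dir_deriv T x dx" and "Ty x = dir_deriv T x dy" for x
  have sXY: "smooth_on D X" "smooth_on D Y" "smooth_on D Tx" "smooth_on D Ty"
    unfolding X_def Y_def Tx_def Ty_def by (intro smooth_on_dir_deriv smooth_F T)+
  \<comment> \<open>This describes the left normals of all \<open>Ft t\<close> at once and is
    jointly smooth in \<open>t\<close> and the point, whereas the frames of
    \<open>immersion_frame\<close> are obtained separately for each \<open>t\<close>.\<close>
  define M where "M z = gauss_bivector (X (snd z) + fst z *\<^sub>R Tx (snd z)) (Y (snd z) + fst z *\<^sub>R Ty (snd z))" for z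
  let ?P = "UNIV \<times> D"
  have oP: "open ?P" using open_D by (simp add: open_Times)
  have sM: "smooth_on ?P M"
    unfolding M_def gauss_bivector_def
    by (intro smooth_on_diff smooth_on_scaleR smooth_on_const smooth_on_inner smooth_on_add smooth_on_bilinear[OF bilinear]
        smooth_on_bounded_linear[OF conj_bounded_linear] smooth_on_snd smooth_on_fst sXY open_D oP open_UNIV)
  have M_frame: "\<exists>k e1' e2'. framed_surf s (Ft t) D e1' e2' \<and> k > 0 \<and> M (t, u) = k *\<^sub>R framed_surf.Nf s (Ft t) e1' e2' u"
    if u: "u \<in> D" for t u
  proof -
    obtain e1' e2' where fr: "framed_surf s (Ft t) D e1' e2'" using immersion_frame[OF open_D sFt inj s] .
    interpret R: framed_surf s "Ft t" D e1' e2' by (rule fr)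
    obtain k where "k > 0" "gauss_bivector (dir_deriv (Ft t) u dx) (dir_deriv (Ft t) u dy) = k *\<^sub>R R.Nf u"
      using R.gauss_bivector_eq[OF u] .
    then show ?thesis using fr unfolding M_def by (auto simp: dFt[OF u] X_def Y_def Tx_def Ty_def)
  qed
  have M0: "M z \<noteq> 0" if z: "z \<in> ?P" for z
  proof -
    obtain t u where tu: "z = (t, u)" "u \<in> D" using z by auto
    obtain k e1' e2' where fr: "framed_surf s (Ft t) D e1' e2'" "k > 0" "M (t, u) = k *\<^sub>R framed_surf.Nf s (Ft t) e1' e2' u"
      using M_frame[OF tu(2)] by blast
    interpret R: framed_surf s "Ft t" D e1' e2' by (rule fr)
    show ?thesis using fr R.Nf_imag[OF tu(2)] tu by auto
  qed
  define n where "n z = sgn (M z)" for z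
  have sn: "smooth_on ?P n" unfolding n_def by (intro smooth_on_sgn sM oP M0)
  have gl_eq: "gauss_lift_metric (Ft t) s 1 u v w = metric (Ft t) u v w + (dir_deriv n (t, u) (0, v) \<bullet> dir_deriv n (t, u) (0, w)) / 4"
    if u: "u \<in> D" for t u v w
  proof -
    obtain e1' e2' where fr: "framed_surf s (Ft t) D e1' e2'" using immersion_frame[OF open_D sFt inj s] .
    interpret R: framed_surf s "Ft t" D e1' e2' by (rule fr)
    have "R.Nf x = n (t, x)" if "x \<in> D" for x
      unfolding n_def M_def R.Nf_sgn[OF that] by (simp add: dFt[OF that] X_def Y_def Tx_def Ty_def)
    then have "dir_deriv R.Nf u v = dir_deriv (\<lambda>x. n (t, x)) u v" for v
      by (rule dir_deriv_eqI_open[OF open_D u])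
    then show ?thesis
      unfolding R.gauss_lift_metric_eq[OF u] partial_derivatives(2)[OF sn u] by simp
  qed
  have n0: "n (0, x) = Nf x" if "x \<in> D" for x
    unfolding n_def M_def Nf_sgn[OF that] by (simp add: X_def Y_def)
  have dn0: "dir_deriv n (0, u) (0, v) = dir_deriv Nf u v" if u: "u \<in> D" for u v
    unfolding partial_derivatives(2)[OF sn u, symmetric] by (rule dir_deriv_eqI_open[OF open_D u n0])
  define V where "V x = dir_deriv n (0, x) (1, 0)" for x
  have sV: "smooth_on D V"
  proof -
    have "smooth_on D (\<lambda>x. (0::real, x))" by (intro smooth_on_Pair smooth_on_const smooth_on_ident open_D)
    then show ?thesis
      unfolding V_def by (rule smooth_on_compose[OF open_D oP _ smooth_on_dir_deriv[OF sn]]) auto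
  qed
  have dV: "((\<lambda>t. dir_deriv n (t, u) (0, v)) has_vector_derivative dir_deriv V u v) (at 0)" if u: "u \<in> D" for u v
  proof -
    have "dir_deriv (\<lambda>z. dir_deriv n z (0, v)) (0, u) (1, 0) = dir_deriv (\<lambda>z. dir_deriv n z (1, 0)) (0, u) (0, v)"
      by (rule mixed_derivatives_commute[OF oP sn]) (simp add: u)
    also have "\<dots> = dir_deriv V u v"
      unfolding V_def partial_derivatives(2)[OF smooth_on_dir_deriv[OF sn] u, symmetric] ..
    finally show ?thesis
      using partial_derivatives(1)[OF smooth_on_dir_deriv[OF sn] u, of "(0, v)" 0] by simp
  qed
  \<comment> \<open>The induced metric of \<open>Ft t\<close> is stationary at t = 0, so the
    hypothesis on the Gauss lift concerns only the summand with the derivatives of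
    \<open>n\<close>.\<close>
  have skew: "dir_deriv V u v \<bullet> dir_deriv Nf u w + dir_deriv Nf u v \<bullet> dir_deriv V u w = 0" if u: "u \<in> D" for u v w
  proof -
    note d = dV[OF u, of v] dV[OF u, of w]
    have "((\<lambda>t. gauss_lift_metric (Ft t) s 1 u v w) has_real_derivative
      (dir_deriv n (0, u) (0, v) \<bullet> dir_deriv V u w + dir_deriv V u v \<bullet> dir_deriv n (0, u) (0, w)) / 4) (at 0)"
      unfolding gl_eq[OF u] mFt[OF u]
      by (auto intro!: derivative_eq_intros bounded_bilinear.has_vector_derivative[OF bounded_bilinear_inner d]
          simp: has_real_derivative_iff_has_vector_derivative[of "\<lambda>t. dir_deriv n (t, u) (0, v) \<bullet> dir_deriv n (t, u) (0, w)"])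
    moreover have "((\<lambda>t. gauss_lift_metric (Ft t) s 1 u v w) has_real_derivative 0) (at 0)"
      using gl[OF u, of v w] unfolding Ft_def[abs_def] .
    ultimately show ?thesis
      using DERIV_unique dn0[OF u] by fastforce
  qed
  note dn = partial_derivatives(1)[OF sn, of _ 0, folded V_def]
  have Vn: "V u \<bullet> Nf u = 0" and V1: "V u \<bullet> quat_one = 0" if u: "u \<in> D" for u
  proof -
    have 1: "n (t, u) \<bullet> n (t, u) = 1" for t
      using M0[of "(t, u)"] u norm_sgn[of "M (t, u)"] by (simp add: n_def dot_square_norm)
    have 2: "n (t, u) \<bullet> quat_one = 0" for t
      unfolding n_def sgn_div_norm M_def by (simp add: gauss_bivector_imag)
    have "((\<lambda>t. n (t, u) \<bullet> n (t, u)) has_vector_derivative n (0, u) \<bullet> V u + V u \<bullet> n (0, u)) (at 0)"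
      by (rule bounded_bilinear.has_vector_derivative[OF bounded_bilinear_inner dn[OF u] dn[OF u]])
    then have "n (0, u) \<bullet> V u + V u \<bullet> n (0, u) = 0"
      unfolding 1 using vector_derivative_unique_at has_vector_derivative_const by blast
    then show "V u \<bullet> Nf u = 0" using n0[OF u] by (simp add: inner_commute)
    have "((\<lambda>t. n (t, u) \<bullet> quat_one) has_vector_derivative V u \<bullet> quat_one) (at 0)"
      using bounded_linear.has_vector_derivative[OF bounded_linear_inner_left dn[OF u]] .
    then show "V u \<bullet> quat_one = 0"
      unfolding 2 using vector_derivative_unique_at has_vector_derivative_const by blast
  qed
  obtain w where w: "w \<bullet> quat_one = 0" "\<And>u. u \<in> D \<Longrightarrow> V u = bracket w (Nf u)"
    using infinitesimal_rotation[OF assms(1) sV Vn V1 skew] by blast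
  \<comment> \<open>The half appears because left multiplication by \<open>w0\<close> moves the left
    normal by a commutator, which is twice the \<open>bracket\<close> by
    \<open>commutator_bracket\<close>.\<close>
  define w0 where "w0 = (1/2) *\<^sub>R w"
  have w0: "w0 \<bullet> quat_one = 0" and cw0: "\<c> w0 = - w0" using w(1) conj_imag[of w0] by (simp_all add: w0_def)
  have perp: "X u \<bullet> Tx u = 0" "Y u \<bullet> Ty u = 0" "X u \<bullet> Ty u + Tx u \<bullet> Y u = 0" if u: "u \<in> D" for u
    using bend[OF u, of dx dx] bend[OF u, of dy dy] bend[OF u, of dx dy]
    by (simp_all add: X_def Y_def Tx_def Ty_def inner_commute)
  \<comment> \<open>The length of \<open>M\<close> is the area element of the induced metric and
    thus stationary at t = 0, so \<open>M\<close> varies through its direction only.\<close>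
  have M1: "Ty u \<odot> \<c> (X u) + Y u \<odot> \<c> (Tx u) = bracket w (M (0, u))" if u: "u \<in> D" for u
  proof -
    let ?M1 = "Ty u \<odot> \<c> (X u) + Y u \<odot> \<c> (Tx u)"
    have Mt: "M (t, u) = gauss_bivector (X u) (Y u) + t *\<^sub>R ?M1 + t\<^sup>2 *\<^sub>R (Ty u \<odot> \<c> (Tx u) - (Tx u \<bullet> Ty u) *\<^sub>R quat_one)" for t
    proof -
      have "t * (X u \<bullet> Ty u + Tx u \<bullet> Y u) = 0" using perp[OF u] by simp
      then have i: "(X u + t *\<^sub>R Tx u) \<bullet> (Y u + t *\<^sub>R Ty u) = X u \<bullet> Y u + t\<^sup>2 * (Tx u \<bullet> Ty u)"
        by (simp add: inner_add_left inner_add_right power2_eq_square algebra_simps)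
      show ?thesis
        unfolding M_def fst_conv snd_conv gauss_bivector_def i
        by (simp add: simps power2_eq_square) (simp add: algebra_simps)
    qed
    have "((\<lambda>t. gauss_bivector (X u) (Y u) + t *\<^sub>R ?M1 + t\<^sup>2 *\<^sub>R (Ty u \<odot> \<c> (Tx u) - (Tx u \<bullet> Ty u) *\<^sub>R quat_one))
        has_vector_derivative ?M1) (at 0)"
      by (auto intro!: derivative_eq_intros)
    then have dM: "((\<lambda>t. M (t, u)) has_vector_derivative ?M1) (at 0)" unfolding Mt .
    have "M (t, u) \<bullet> M (t, u) = (X u \<bullet> X u + t\<^sup>2 * (Tx u \<bullet> Tx u)) * (Y u \<bullet> Y u + t\<^sup>2 * (Ty u \<bullet> Ty u))
        - (X u \<bullet> Y u + t\<^sup>2 * (Tx u \<bullet> Ty u)) * (X u \<bullet> Y u + t\<^sup>2 * (Tx u \<bullet> Ty u))" for t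
    proof -
      have i: "(X u + t *\<^sub>R Tx u) \<bullet> (Y u + t *\<^sub>R Ty u) = X u \<bullet> Y u + t\<^sup>2 * (Tx u \<bullet> Ty u)"
        "(X u + t *\<^sub>R Tx u) \<bullet> (X u + t *\<^sub>R Tx u) = X u \<bullet> X u + t\<^sup>2 * (Tx u \<bullet> Tx u)"
        "(Y u + t *\<^sub>R Ty u) \<bullet> (Y u + t *\<^sub>R Ty u) = Y u \<bullet> Y u + t\<^sup>2 * (Ty u \<bullet> Ty u)"
        using mFt[OF u, of t dx dy] mFt[OF u, of t dx dx] mFt[OF u, of t dy dy]
        unfolding metric_def dFt[OF u] by (simp_all add: X_def Y_def Tx_def Ty_def)
      show ?thesis unfolding M_def fst_conv snd_conv gauss_bivector_norm i ..
    qed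
    moreover have "((\<lambda>t. (X u \<bullet> X u + t\<^sup>2 * (Tx u \<bullet> Tx u)) * (Y u \<bullet> Y u + t\<^sup>2 * (Ty u \<bullet> Ty u))
        - (X u \<bullet> Y u + t\<^sup>2 * (Tx u \<bullet> Ty u)) * (X u \<bullet> Y u + t\<^sup>2 * (Tx u \<bullet> Ty u))) has_real_derivative 0) (at 0)"
      by (auto intro!: derivative_eq_intros)
    ultimately have "((\<lambda>t. M (t, u) \<bullet> M (t, u)) has_vector_derivative 0) (at 0)"
      by (simp add: has_real_derivative_iff_has_vector_derivative)
    moreover have "((\<lambda>t. M (t, u) \<bullet> M (t, u)) has_vector_derivative M (0, u) \<bullet> ?M1 + ?M1 \<bullet> M (0, u)) (at 0)"
      by (rule bounded_bilinear.has_vector_derivative[OF bounded_bilinear_inner dM dM])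
    ultimately have "M (0, u) \<bullet> ?M1 + ?M1 \<bullet> M (0, u) = 0"
      using vector_derivative_unique_at by blast
    then have MM1: "?M1 \<bullet> M (0, u) = 0" by (simp add: inner_commute)
    have Mn: "M z = norm (M z) *\<^sub>R n z" for z
      by (cases "M z = 0") (simp_all add: n_def sgn_div_norm)
    have snM: "smooth_on ?P (\<lambda>z. norm (M z))" by (intro smooth_on_norm sM oP M0)
    obtain m' where m': "((\<lambda>t. norm (M (t, u))) has_vector_derivative m') (at 0)"
      using partial_derivatives(1)[OF snM u] by blast
    have "((\<lambda>t. norm (M (t, u)) *\<^sub>R n (t, u)) has_vector_derivative norm (M (0, u)) *\<^sub>R V u + m' *\<^sub>R n (0, u)) (at 0)"
      by (rule bounded_bilinear.has_vector_derivative[OF bounded_bilinear_scaleR m' dn[OF u]])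
    then have e: "?M1 = norm (M (0, u)) *\<^sub>R V u + m' *\<^sub>R Nf u"
      using dM vector_derivative_unique_at n0[OF u] unfolding Mn[symmetric] by metis
    have MN: "M (0, u) = norm (M (0, u)) *\<^sub>R Nf u" using Mn[of "(0, u)"] n0[OF u] by simp
    have "norm (M (0, u)) \<noteq> 0" using M0 u by simp
    then have "?M1 \<bullet> Nf u = 0" using MM1 by (subst (asm) MN) simp
    then have "m' = 0" using Vn[OF u] Nf_imag[OF u] unfolding e by (simp add: inner_add_left)
    then have "?M1 = bracket w (norm (M (0, u)) *\<^sub>R Nf u)" using e w(2)[OF u] by (simp add: bracket_lin)
    then show ?thesis using MN by simp
  qed
  define Sx Sy where "Sx u = Tx u - w0 \<odot> X u" and "Sy u = Ty u - w0 \<odot> Y u" for u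
  define l where "l u = inverse (X u \<bullet> X u) *\<^sub>R (\<c> (X u) \<odot> Sx u)" for u
  have X0: "X u \<bullet> X u \<noteq> 0" if u: "u \<in> D" for u
    using tangent_frame.df_eq_0[OF at'(3)[OF u], of dx] by (simp add: X_def axis_eq_0_iff)
  have sl: "smooth_on D l" unfolding l_def Sx_def
    by (intro smooth_on_scaleR smooth_on_inverse smooth_on_inner smooth_prod smooth_conj smooth_on_diff smooth_on_const sXY open_D X0)
  have w0X: "(w0 \<odot> x) \<bullet> x = 0" for x
    using inner_left[of w0 x x] cw0 by (simp add: simps inner_commute)
  have lim: "l u \<bullet> quat_one = 0" if u: "u \<in> D" for u
    unfolding l_def inner_scaleR_left inner_mult_conj Sx_def
    using perp(1)[OF u] w0X[of "X u"] by (simp add: inner_diff_right inner_commute)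
  have lx: "X u \<odot> l u = Sx u" if u: "u \<in> D" for u
    using X0[OF u] by (simp add: l_def simps assoc[symmetric] mult_conj)
  \<comment> \<open>\<open>l\<close> is defined from the derivative along \<open>dx\<close>. That it
    also fits the derivative along \<open>dy\<close> is the content of \<open>M1\<close> once the
    rotation \<open>w0\<close> has been subtracted.\<close>
  have ly: "Y u \<odot> l u = Sy u" if u: "u \<in> D" for u
  proof -
    define B where "B = Y u \<odot> \<c> (X u)"
    have B: "B = M (0, u) + (X u \<bullet> Y u) *\<^sub>R quat_one" by (simp add: B_def M_def gauss_bivector_def)
    have M1': "M (0, u) \<bullet> quat_one = 0"
      by (simp add: M_def gauss_bivector_imag)
    have "Sy u \<odot> \<c> (X u) + Y u \<odot> \<c> (Sx u) = bracket w (M (0, u)) - (w0 \<odot> B - B \<odot> w0)"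
      unfolding Sx_def Sy_def M1[OF u, symmetric] B_def by (simp add: simps cw0 assoc)
    also have "w0 \<odot> B - B \<odot> w0 = w0 \<odot> M (0, u) - M (0, u) \<odot> w0" unfolding B by (simp add: simps)
    also have "\<dots> = bracket w (M (0, u))"
      unfolding commutator_bracket[OF w0 M1'] by (simp add: w0_def bracket_lin)
    finally have "Sy u \<odot> \<c> (X u) = - (Y u \<odot> \<c> (Sx u))" by (simp add: eq_neg_iff_add_eq_0)
    also have "\<c> (Sx u) = - (l u \<odot> \<c> (X u))"
      unfolding lx[OF u, symmetric] using lim[OF u] conj_imag[of "l u"] by (simp add: simps)
    finally have "Sy u \<odot> \<c> (X u) = (Y u \<odot> l u) \<odot> \<c> (X u)" by (simp add: simps assoc)
    then have "(Sy u \<odot> \<c> (X u)) \<odot> X u = ((Y u \<odot> l u) \<odot> \<c> (X u)) \<odot> X u" by simp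
    then have "(X u \<bullet> X u) *\<^sub>R Sy u = (X u \<bullet> X u) *\<^sub>R (Y u \<odot> l u)"
      unfolding assoc mult_conj by (simp add: simps)
    then show ?thesis using X0[OF u] by simp
  qed
  have dT: "dir_deriv T u v = w0 \<odot> dir_deriv F u v + dir_deriv F u v \<odot> l u" if u: "u \<in> D" for u v
  proof -
    have "dir_deriv T u v = v$1 *\<^sub>R Tx u + v$2 *\<^sub>R Ty u" unfolding Tx_def Ty_def
      by (rule linear_vec2[OF smooth_on_linear_deriv[OF T u]])
    moreover have "dir_deriv F u v = v$1 *\<^sub>R X u + v$2 *\<^sub>R Y u" unfolding X_def Y_def
      by (rule linear_vec2[OF lin_df[OF u]])
    moreover have "Tx u = w0 \<odot> X u + X u \<odot> l u" "Ty u = w0 \<odot> Y u + Y u \<odot> l u"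
      unfolding lx[OF u] ly[OF u] Sx_def Sy_def by simp_all
    ultimately show ?thesis by (simp add: simps) (simp add: algebra_simps)
  qed
  have "dual_map l" unfolding dual_map_def
  proof (intro conjI ballI allI sl lim)
    fix u v w assume u: "u \<in> D"
    have sF: "smooth_on D (\<lambda>x. dir_deriv F x v)" for v by (rule smooth_on_dir_deriv[OF smooth_F])
    have "dir_deriv (\<lambda>x. dir_deriv T x b) u a = w0 \<odot> hess F u a b + hess F u a b \<odot> l u + dir_deriv F u b \<odot> dir_deriv l u a" for a b
    proof -
      have "dir_deriv (\<lambda>x. dir_deriv T x b) u a = dir_deriv (\<lambda>x. w0 \<odot> dir_deriv F x b + dir_deriv F x b \<odot> l x) u a"
        by (rule dir_deriv_eqI_open[OF open_D u dT])
      also have "\<dots> = dir_deriv (\<lambda>x. w0 \<odot> dir_deriv F x b) u a + dir_deriv (\<lambda>x. dir_deriv F x b \<odot> l x) u a"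
        by (rule dir_deriv_add[OF smooth_prod[OF smooth_on_const sF] smooth_prod[OF sF sl] u])
      finally show ?thesis
        unfolding deriv_prod[OF smooth_on_const sF u] deriv_prod[OF sF sl u] hess_def
        by (simp add: frechet_derivative_const simps)
    qed
    then show "dir_deriv F u v \<odot> dir_deriv l u w = dir_deriv F u w \<odot> dir_deriv l u v"
      using mixed_derivatives_commute[OF open_D T u, of v w] hess_sym[OF u, of v w] by simp
  qed
  then show ?thesis using that w0 dT by blast
qed

text \<open>Where dl vanishes, \<open>l\<close> is a constant \<open>l0\<close>; the map taking y to
  \<open>w0 \<odot> y + y \<odot> l0\<close> is skew-symmetric because both quaternions are
  imaginary.\<close>

lemma bending_trivial:
  assumes W: "open W" "convex W" "W \<subseteq> D" and T: "smooth_on D T" and l: "smooth_on D l" "\<And>u. u \<in> D \<Longrightarrow> l u \<bullet> quat_one = 0"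
    and w0: "w0 \<bullet> quat_one = 0"
    and dT: "\<And>u v. u \<in> D \<Longrightarrow> dir_deriv T u v = w0 \<odot> dir_deriv F u v + dir_deriv F u v \<odot> l u"
    and dl: "\<And>u v. u \<in> W \<Longrightarrow> dir_deriv l u v = 0"
  shows "\<exists>(B::real^4^4) b. transpose B = - B \<and> (\<forall>x\<in>W. T x = B *v F x + b)"
proof (cases "W = {}")
  case True
  then show ?thesis by (intro exI[of _ 0] exI[of _ 0]) (simp add: transpose_def vec_eq_iff)
next
  case False
  obtain l0 where l0: "\<And>u. u \<in> W \<Longrightarrow> l u = l0"
    using dir_deriv_zero_constant[OF W(1,2) smooth_on_subset[OF l(1) W(3)] dl] by blast
  have im: "\<c> w0 = - w0" "\<c> l0 = - l0" using w0 l(2) l0 False W(3) conj_imag by (blast, fastforce)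
  define L where "L y = w0 \<odot> y + y \<odot> l0" for y
  have "bounded_linear L"
    unfolding L_def by (intro bounded_linear_add bounded_bilinear.bounded_linear_right[OF bilinear] bounded_bilinear.bounded_linear_left[OF bilinear])
  then have linL: "linear L" using linear_conv_bounded_linear by blast
  have B: "matrix L *v y = L y" for y
    by (rule matrix_works) (simp add: linear_matrix_vector_mul_eq linL)
  have skew: "L x \<bullet> y = - (x \<bullet> L y)" for x y
    unfolding L_def inner_add_left inner_left[of w0] inner_right[of x l0] im
    by (simp add: simps inner_add_right)
  have "transpose (matrix L) = - matrix L"
    unfolding vec_eq_iff
  proof (intro allI)
    fix i j
    show "transpose (matrix L) $ i $ j = (- matrix L) $ i $ j"
      using skew[of "axis i 1" "axis j 1"] by (simp add: transpose_def matrix_def inner_axis inner_commute[of "axis i 1"])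
  qed
  moreover have "\<exists>b. \<forall>x\<in>W. T x - L (F x) = b"
  proof (rule dir_deriv_zero_constant[OF W(1,2)])
    have sLF: "smooth_on D (\<lambda>x. L (F x))" using smooth_on_bounded_linear[OF \<open>bounded_linear L\<close> open_D smooth_F] .
    show "smooth_on W (\<lambda>x. T x - L (F x))"
      by (rule smooth_on_subset[OF smooth_on_diff[OF open_D T sLF] W(3)])
    fix x v assume x: "x \<in> W"
    then have xD: "x \<in> D" using W(3) by blast
    have "dir_deriv (\<lambda>x. T x - L (F x)) x v = dir_deriv T x v - L (dir_deriv F x v)"
      unfolding dir_deriv_diff[OF T sLF xD] dir_deriv_bounded_linear[OF \<open>bounded_linear L\<close> smooth_F xD] ..
    then show "dir_deriv (\<lambda>x. T x - L (F x)) x v = 0" by (simp add: dT[OF xD] L_def l0[OF x])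
  qed
  ultimately show ?thesis
    by (intro exI[of _ "matrix L"]) (auto simp: B algebra_simps)
qed

end

text \<open>If \<open>dT = df \<odot> l\<close> with \<open>l\<close> imaginary, then \<open>d(f + t T) = df \<odot> (1 + t l)\<close>, and right multiplication by
  \<open>1 + t l\<close> is conformal.  It maps orthonormal tangent and normal frames of \<open>f\<close> to those of \<open>f + t T\<close> up to a common factor, and leaves
  the left normal unchanged.\<close>

locale dual_deformation = framed_surf +
  fixes l T :: "real^2 \<Rightarrow> real^4"
  assumes dual: "dual_map l" and smooth_T: "smooth_on D T"
    and deriv_T: "u \<in> D \<Longrightarrow> dir_deriv T u v = dir_deriv F u v \<odot> l u"
begin

lemma smooth_l: "smooth_on D l" and imag_l: "u \<in> D \<Longrightarrow> l u \<bullet> quat_one = 0"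
  using dual by (auto simp: dual_map_def)

definition m :: "real \<Rightarrow> real^2 \<Rightarrow> real^4" where "m t u = quat_one + t *\<^sub>R l u"
definition \<rho> :: "real \<Rightarrow> real^2 \<Rightarrow> real" where "\<rho> t u = inverse (sqrt (1 + t\<^sup>2 * (l u \<bullet> l u)))"
definition Ft :: "real \<Rightarrow> psurf" where "Ft t u = F u + t *\<^sub>R T u"

lemma m_norm: "u \<in> D \<Longrightarrow> m t u \<bullet> m t u = 1 + t\<^sup>2 * (l u \<bullet> l u)"
  unfolding m_def using imag_l[of u]
  by (simp add: inner_add_left inner_add_right inner_commute[of quat_one] inner_axis_axis power2_eq_square)

lemma pos: "1 + t\<^sup>2 * (l u \<bullet> l u) > 0"
  by (rule add_pos_nonneg) auto

lemma \<rho>: "\<rho> t u > 0" "\<rho> t u * \<rho> t u * (1 + t\<^sup>2 * (l u \<bullet> l u)) = 1"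
proof -
  show "\<rho> t u > 0" using pos[of t u] by (simp add: \<rho>_def)
  have "\<rho> t u * \<rho> t u = inverse (sqrt (1 + t\<^sup>2 * (l u \<bullet> l u)) * sqrt (1 + t\<^sup>2 * (l u \<bullet> l u)))"
    unfolding \<rho>_def by (simp only: inverse_mult_distrib)
  also have "\<dots> = inverse (1 + t\<^sup>2 * (l u \<bullet> l u))" using pos[of t u] by (simp only: real_sqrt_mult_self abs_of_pos)
  finally show "\<rho> t u * \<rho> t u * (1 + t\<^sup>2 * (l u \<bullet> l u)) = 1"
    using pos[of t u] by simp
qed

lemma smooth_m: "smooth_on D (m t)"
  unfolding m_def by (intro smooth_on_add smooth_on_scaleR smooth_on_const smooth_l open_D)

lemma smooth_\<rho>: "smooth_on D (\<rho> t)"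
  unfolding \<rho>_def
proof (intro smooth_on_inverse smooth_on_sqrt smooth_on_add smooth_on_mult smooth_on_const smooth_on_inner smooth_l open_D pos)
  show "sqrt (1 + t\<^sup>2 * (l x \<bullet> l x)) \<noteq> 0" for x using pos[of t x] by simp
qed

lemma smooth_Ft: "smooth_on D (Ft t)"
  unfolding Ft_def by (intro smooth_on_add smooth_on_scaleR smooth_on_const smooth_T smooth_F open_D)

lemma deriv_Ft: "u \<in> D \<Longrightarrow> dir_deriv (Ft t) u v = dir_deriv F u v \<odot> m t u"
proof -
  assume u: "u \<in> D"
  have "dir_deriv (Ft t) u v = dir_deriv F u v + t *\<^sub>R dir_deriv T u v"
    unfolding Ft_def
    by (rule dir_deriv_eq) (auto intro!: derivative_eq_intros smooth_on_has_derivative[OF smooth_F u] smooth_on_has_derivative[OF smooth_T u])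
  then show ?thesis by (simp add: deriv_T[OF u] m_def simps)
qed

lemma metric_Ft: "u \<in> D \<Longrightarrow> metric (Ft t) u v w = (1 + t\<^sup>2 * (l u \<bullet> l u)) * metric F u v w"
  unfolding metric_def deriv_Ft by (simp add: inner_mult_mult m_norm)

lemma framed_Ft: "framed_surf s (Ft t) D (\<lambda>u. \<rho> t u *\<^sub>R e1 u) (\<lambda>u. \<rho> t u *\<^sub>R e2 u)"
proof (intro framed_surf.intro quat.intro smooth_surf.intro framed_surf_axioms.intro s open_D smooth_Ft)
  show "smooth_on D (\<lambda>u. \<rho> t u *\<^sub>R e1 u)" "smooth_on D (\<lambda>u. \<rho> t u *\<^sub>R e2 u)"
    by (intro smooth_on_scaleR smooth_\<rho> smooth_e open_D)+
  fix u assume u: "u \<in> D"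
  have dt: "det (vector [\<rho> t u *\<^sub>R e1 u, \<rho> t u *\<^sub>R e2 u] :: real^2^2) = (\<rho> t u * \<rho> t u) * det (vector [e1 u, e2 u] :: real^2^2)"
    by (simp add: det_2_rows algebra_simps)
  have mm: "metric (Ft t) u (\<rho> t u *\<^sub>R v) (\<rho> t u *\<^sub>R w) = \<rho> t u * \<rho> t u * (1 + t\<^sup>2 * (l u \<bullet> l u)) * metric F u v w" for v w
    unfolding metric_Ft[OF u] by (simp add: metric_def linear_scale[OF lin_df[OF u]])
  show "pos_tangent_frame (Ft t) u (\<rho> t u *\<^sub>R e1 u) (\<rho> t u *\<^sub>R e2 u)"
    using frames[OF u] \<rho>[of t u] unfolding pos_tangent_frame_def mm dt by simp
qed

lemma normal_Ft:
  assumes u: "u \<in> D" and x: "nrm u x" shows "x \<odot> m t u \<in> normal_space (Ft t) u"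
proof -
  have "x \<bullet> dir_deriv F u v = 0" for v using x by (simp add: normal_space_def)
  then show ?thesis by (simp add: normal_space_def deriv_Ft[OF u] inner_mult_mult)
qed

text \<open>The part of the pulled back metric that comes from the left normal is constant in
  \<open>t\<close>; the conformal factor of the remaining part is even in \<open>t\<close>.\<close>

lemma gauss_lift_metric_variation:
  assumes u: "u \<in> D"
  shows "((\<lambda>t. gauss_lift_metric (Ft t) s 1 u v w) has_real_derivative 0) (at 0)"
proof -
  have "gauss_lift_metric (Ft t) s 1 u v w = (1 + t\<^sup>2 * (l u \<bullet> l u)) * metric F u v w + (dir_deriv Nf u v \<bullet> dir_deriv Nf u w) / 4" for t
  proof -
    interpret R: framed_surf s "Ft t" D "\<lambda>u. \<rho> t u *\<^sub>R e1 u" "\<lambda>u. \<rho> t u *\<^sub>R e2 u" by (rule framed_Ft)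
    have "R.Nf x = Nf x" if x: "x \<in> D" for x
    proof -
      have "R.Nf x = (\<rho> t x * \<rho> t x) *\<^sub>R (E2 x \<odot> (m t x \<odot> \<c> (m t x)) \<odot> \<c> (E1 x))"
        unfolding R.Nf_def deriv_Ft[OF x] by (simp add: linear_scale[OF lin_df[OF x]] simps assoc)
      also have "\<dots> = Nf x" using \<rho>(2)[of t x] by (simp add: mult_conj m_norm[OF x] simps Nf_def)
      finally show ?thesis .
    qed
    then have "dir_deriv R.Nf u v = dir_deriv Nf u v" for v
      by (rule dir_deriv_eqI_open[OF open_D u])
    then show ?thesis unfolding R.gauss_lift_metric_eq[OF u] metric_Ft[OF u] by simp
  qed
  moreover have "((\<lambda>t. (1 + t\<^sup>2 * (l u \<bullet> l u)) * metric F u v w + (dir_deriv Nf u v \<bullet> dir_deriv Nf u w) / 4) has_real_derivative 0) (at 0)"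
    by (auto intro!: derivative_eq_intros)
  ultimately show ?thesis by simp
qed

lemma bending: "u \<in> D \<Longrightarrow> dir_deriv T u v \<bullet> dir_deriv F u w + dir_deriv F u v \<bullet> dir_deriv T u w = 0"
proof -
  assume u: "u \<in> D"
  have "\<c> (l u) = - l u" using imag_l[OF u] conj_imag by blast
  then show ?thesis
    unfolding deriv_T[OF u] inner_right[of "dir_deriv F u v" "l u"] by (simp add: simps)
qed

definition moved :: "(real^2 \<Rightarrow> real^4) \<Rightarrow> real \<Rightarrow> real^2 \<Rightarrow> real^4"
  where "moved x t u = \<rho> t u *\<^sub>R (x u \<odot> m t u)"

lemma smooth_moved:
  assumes "smooth_on D x" "open I"
  shows "smooth_on (I \<times> D) (\<lambda>(t, u). moved x t u)"
proof -
  have o: "open (I \<times> D)" using assms(2) open_D by (rule open_Times)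
  have l: "smooth_on (I \<times> D) (\<lambda>z. l (snd z))" "smooth_on (I \<times> D) (\<lambda>z. x (snd z))" "smooth_on (I \<times> D) fst"
    by (intro smooth_on_snd smooth_l assms open_D smooth_on_fst)+
  have "smooth_on (I \<times> D) (\<lambda>z. moved x (fst z) (snd z))"
    unfolding moved_def \<rho>_def m_def power2_eq_square
  proof (intro smooth_on_scaleR smooth_on_bilinear[OF bilinear] smooth_on_add smooth_on_const l o
      smooth_on_inverse smooth_on_sqrt smooth_on_mult smooth_on_inner)
    show "0 < 1 + fst z * fst z * (l (snd z) \<bullet> l (snd z))" "sqrt (1 + fst z * fst z * (l (snd z) \<bullet> l (snd z))) \<noteq> 0" for z
      using pos[of "fst z" "snd z"] by (simp_all add: power2_eq_square)
  qed
  then show ?thesis unfolding case_prod_unfold .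
qed

lemma normal_frame_moved:
  assumes u: "u \<in> D" and x: "normal_frame F u (x3 u) (x4 u)"
  shows "normal_frame (Ft t) u (moved x3 t u) (moved x4 t u)"
proof -
  interpret R: framed_surf s "Ft t" D "\<lambda>u. \<rho> t u *\<^sub>R e1 u" "\<lambda>u. \<rho> t u *\<^sub>R e2 u" by (rule framed_Ft)
  have i: "(\<rho> t u *\<^sub>R (a \<odot> m t u)) \<bullet> (\<rho> t u *\<^sub>R (b \<odot> m t u)) = a \<bullet> b" for a b
  proof -
    have "(\<rho> t u *\<^sub>R (a \<odot> m t u)) \<bullet> (\<rho> t u *\<^sub>R (b \<odot> m t u)) = (\<rho> t u * \<rho> t u * (1 + t\<^sup>2 * (l u \<bullet> l u))) * (a \<bullet> b)"
      by (simp add: inner_mult_mult m_norm[OF u])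
    then show ?thesis unfolding \<rho>(2) by simp
  qed
  show ?thesis
    unfolding normal_frame_def moved_def norm_eq_sqrt_inner i
    using x R.nrm_lin(3)[OF u normal_Ft[OF u]] by (auto simp: normal_frame_def norm_eq_sqrt_inner)
qed

text \<open>dl on the frame is the conjugate of \<open>E1\<close> times a normal vector, so the
  product has the shape treated in \<open>normal_triple\<close> and is tangent.\<close>

lemma tangent_of_normal:
  assumes u: "u \<in> D" and x: "nrm u x" "nrm u y"
  shows "(x \<odot> dir_deriv l u v) \<bullet> y = 0"
proof -
  interpret Q: quat_plane s "E1 u" "Nf u" by (rule plane[OF u])
  define \<zeta> where "\<zeta> = E1 u \<odot> dir_deriv l u (e1 u)"
  note dl = dual_map_pointwise[OF dual u, folded \<zeta>_def]
  have d: "dir_deriv l u (e1 u) = \<c> (E1 u) \<odot> \<zeta>" by (simp add: \<zeta>_def Q.cE1)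
  have "\<c> (E1 u) \<odot> E1 u \<odot> dir_deriv l u (e2 u) = \<c> (E1 u) \<odot> Nf u \<odot> \<zeta>" unfolding dl(3) ..
  then have d2: "dir_deriv l u (e2 u) = \<c> (E1 u) \<odot> Nf u \<odot> \<zeta>" unfolding Q.cE1 .
  have y: "E1 u \<bullet> y = 0" "E2 u \<bullet> y = 0" using x(2) nrm_iff[OF u] by (simp_all add: inner_commute)
  have tri: "(x \<odot> \<c> (E1 u) \<odot> z) \<bullet> y = 0" if "nrm u z" for z
    using Q.normal_triple[of x z] normal_iff[OF u] x that by (simp add: inner_add_left inner_diff_left E2_eq[OF u] y)
  have "(x \<odot> dir_deriv l u (e1 u)) \<bullet> y = 0" "(x \<odot> dir_deriv l u (e2 u)) \<bullet> y = 0"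
    unfolding d d2 using tri dl(2) nrm_lin(5)[OF u] by blast+
  moreover have "linear (\<lambda>v. (x \<odot> dir_deriv l u v) \<bullet> y)"
    using smooth_on_linear_deriv[OF smooth_l u] by (intro linearI) (simp_all add: linear_add linear_scale simps inner_add_left)
  ultimately show ?thesis
    using linear_eq_on_frame[OF u _ linear_zero, of "\<lambda>v. (x \<odot> dir_deriv l u v) \<bullet> y" v] by blast
qed

text \<open>The derivative of \<rho> drops out by orthogonality of the frame, and the inner product
  that would be linear in \<open>t\<close> is annihilated by \<open>tangent_of_normal\<close>. The
  remaining dependence on \<open>t\<close> is through its square.\<close>

lemma omega34_variation:
  assumes u: "u \<in> D" and sx: "smooth_on D x3" "smooth_on D x4" and x: "\<And>u. u \<in> D \<Longrightarrow> normal_frame F u (x3 u) (x4 u)"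
  shows "((\<lambda>t. omega34 (Ft t) (moved x3 t) (moved x4 t) u v) has_real_derivative 0) (at 0)"
proof -
  define K where "K = dir_deriv x3 u v \<bullet> x4 u"
  define B where "B = (x3 u \<odot> dir_deriv l u v) \<bullet> (x4 u \<odot> l u)"
  have xn: "nrm u (x3 u)" "nrm u (x4 u)" "x3 u \<bullet> x4 u = 0" using x[OF u] by (auto simp: normal_frame_def)
  have "omega34 (Ft t) (moved x3 t) (moved x4 t) u v = K + t\<^sup>2 * B / (1 + t\<^sup>2 * (l u \<bullet> l u))" for t
  proof -
    interpret R: framed_surf s "Ft t" D "\<lambda>u. \<rho> t u *\<^sub>R e1 u" "\<lambda>u. \<rho> t u *\<^sub>R e2 u" by (rule framed_Ft)
    have n4: "moved x4 t u \<in> normal_space (Ft t) u"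
      using normal_frame_moved[of u x3 x4 t, OF u x[OF u]] by (simp add: normal_frame_def)
    have dm: "dir_deriv (m t) u v = t *\<^sub>R dir_deriv l u v"
      unfolding m_def by (rule dir_deriv_eq) (auto intro!: derivative_eq_intros smooth_on_has_derivative[OF smooth_l u])
    have d: "dir_deriv (moved x3 t) u v = \<rho> t u *\<^sub>R (x3 u \<odot> t *\<^sub>R dir_deriv l u v + dir_deriv x3 u v \<odot> m t u) + dir_deriv (\<rho> t) u v *\<^sub>R (x3 u \<odot> m t u)"
      unfolding moved_def
      using dir_deriv_bilinear[OF bounded_bilinear_scaleR smooth_\<rho> smooth_prod[OF sx(1) smooth_m] u] deriv_prod[OF sx(1) smooth_m u]
      by (simp add: dm)
    have "omega34 (Ft t) (moved x3 t) (moved x4 t) u v = dir_deriv (moved x3 t) u v \<bullet> moved x4 t u"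
      unfolding omega34_def normal_conn_def by (rule tangent_frame.nproj_inner[OF R.at'(3)[OF u] n4])
    also have "\<dots> = (\<rho> t u * \<rho> t u) * (t * ((x3 u \<odot> dir_deriv l u v) \<bullet> (x4 u \<odot> m t u)) + (1 + t\<^sup>2 * (l u \<bullet> l u)) * K)"
      unfolding d moved_def
      by (simp add: inner_add_left inner_mult_mult m_norm[OF u] xn simps K_def algebra_simps)
    also have "(x3 u \<odot> dir_deriv l u v) \<bullet> (x4 u \<odot> m t u) = t * B"
      unfolding m_def B_def by (simp add: simps inner_add_right tangent_of_normal[OF u xn(1,2)])
    also have "(\<rho> t u * \<rho> t u) * (t * (t * B) + (1 + t\<^sup>2 * (l u \<bullet> l u)) * K) = K + t\<^sup>2 * B / (1 + t\<^sup>2 * (l u \<bullet> l u))"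
    proof -
      define d where "d = 1 + t\<^sup>2 * (l u \<bullet> l u)"
      have "d > 0" "\<rho> t u * \<rho> t u = 1 / d" using \<rho>(2)[of t u] pos[of t u] unfolding d_def[symmetric] by (auto simp: field_simps)
      then show ?thesis unfolding d_def[symmetric] by (simp add: field_simps power2_eq_square)
    qed
    finally show ?thesis .
  qed
  moreover have "((\<lambda>t. K + t\<^sup>2 * B / (1 + t\<^sup>2 * (l u \<bullet> l u))) has_real_derivative 0) (at 0)"
    by (auto intro!: derivative_eq_intros)
  ultimately show ?thesis by simp
qed

text \<open>The deformation adds to the trace of the second derivatives a multiple of E1 dl(e1) + E2
  dl(e2), which vanishes by the dual relation. The component of the mean curvature is therefore only
  rescaled by \<rho>, which is stationary at t = 0.\<close>

lemma mean_curv_variation: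
  assumes u: "u \<in> D" and x: "nrm u (x u)"
  shows "((\<lambda>t. mean_curv (Ft t) u \<bullet> moved x t u) has_real_derivative 0) (at 0)"
proof -
  interpret Q: quat_plane s "E1 u" "Nf u" by (rule plane[OF u])
  define S where "S = (hess F u (e1 u) (e1 u) + hess F u (e2 u) (e2 u)) \<bullet> x u"
  have sum0: "E1 u \<odot> dir_deriv l u (e1 u) + E2 u \<odot> dir_deriv l u (e2 u) = 0"
    using dual_map_pointwise(3)[OF dual u] by (simp add: E2_eq[OF u, symmetric] assoc Q.NNx)
  have hs: "hess (Ft t) u a b = hess F u a b \<odot> m t u + t *\<^sub>R (dir_deriv F u b \<odot> dir_deriv l u a)" for t a b
  proof -
    have dm: "dir_deriv (m t) u a = t *\<^sub>R dir_deriv l u a"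
      unfolding m_def by (rule dir_deriv_eq) (auto intro!: derivative_eq_intros smooth_on_has_derivative[OF smooth_l u])
    have "hess (Ft t) u a b = dir_deriv (\<lambda>y. dir_deriv F y b \<odot> m t y) u a"
      unfolding hess_def by (rule dir_deriv_eqI_open[OF open_D u]) (rule deriv_Ft)
    then show ?thesis
      using deriv_prod[OF smooth_on_dir_deriv[OF smooth_F] smooth_m u] by (simp add: dm simps hess_def)
  qed
  have "mean_curv (Ft t) u \<bullet> moved x t u = (S / 2) * \<rho> t u" for t
  proof -
    interpret R: framed_surf s "Ft t" D "\<lambda>u. \<rho> t u *\<^sub>R e1 u" "\<lambda>u. \<rho> t u *\<^sub>R e2 u" by (rule framed_Ft)
    interpret RA: surf_frame_at "Ft t" D u "\<rho> t u *\<^sub>R e1 u" "\<rho> t u *\<^sub>R e2 u" by (rule R.at'(1)[OF u])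
    have nm: "moved x t u \<in> normal_space (Ft t) u"
      unfolding moved_def by (rule R.nrm_lin(3)[OF u normal_Ft[OF u x]])
    have scl: "hess (Ft t) u (k *\<^sub>R a) (k *\<^sub>R a) = (k * k) *\<^sub>R hess (Ft t) u a a" for k a
      by (metis R.hess_lin1(2)[OF u] R.hess_sym[OF u] scaleR_scaleR)
    have "mean_curv (Ft t) u \<bullet> moved x t u = (1/2) * ((hess (Ft t) u (\<rho> t u *\<^sub>R e1 u) (\<rho> t u *\<^sub>R e1 u)
        + hess (Ft t) u (\<rho> t u *\<^sub>R e2 u) (\<rho> t u *\<^sub>R e2 u)) \<bullet> moved x t u)"
      unfolding RA.mean_curv R.second_ff_hess by (simp add: inner_add_left RA.nproj_inner[OF nm])
    also have "hess (Ft t) u (\<rho> t u *\<^sub>R e1 u) (\<rho> t u *\<^sub>R e1 u) + hess (Ft t) u (\<rho> t u *\<^sub>R e2 u) (\<rho> t u *\<^sub>R e2 u)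
        = (\<rho> t u * \<rho> t u) *\<^sub>R ((hess F u (e1 u) (e1 u) + hess F u (e2 u) (e2 u)) \<odot> m t u
          + t *\<^sub>R (E1 u \<odot> dir_deriv l u (e1 u) + E2 u \<odot> dir_deriv l u (e2 u)))"
      unfolding scl unfolding hs by (simp add: simps algebra_simps)
    also have "\<dots> = (\<rho> t u * \<rho> t u) *\<^sub>R ((hess F u (e1 u) (e1 u) + hess F u (e2 u) (e2 u)) \<odot> m t u)"
      unfolding sum0 by simp
    also have "(1/2) * (\<dots> \<bullet> moved x t u) = (S / 2) * ((\<rho> t u * \<rho> t u * (1 + t\<^sup>2 * (l u \<bullet> l u))) * \<rho> t u)"
      unfolding moved_def S_def by (simp add: inner_mult_mult m_norm[OF u])
    finally show ?thesis unfolding \<rho>(2) by simp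
  qed
  moreover have "((\<lambda>t. (S / 2) * \<rho> t u) has_real_derivative 0) (at 0)"
    unfolding \<rho>_def by (auto intro!: derivative_eq_intros)
  ultimately show ?thesis by (simp only:)
qed

end

context iso_surf
begin

text \<open>At the point \<open>u\<close>, the map \<open>C\<close>, the matrix \<open>B\<close>
  minus right multiplication by \<open>l u\<close>, is skew and kills the tangent plane, so on the
  normal plane it is \<open>k\<close> times left multiplication by \<open>Nf u\<close>.
  Differentiating the relation \<open>BF\<close> for the field \<open>E1\<close> gives C \<alpha>(v,
  e1) = E1 dl(v). The dual relation on the frame turns this into k H = 0.\<close>

lemma trivial_dual_constant:
  assumes l: "dual_map l" and dT: "\<And>u v. u \<in> D \<Longrightarrow> dir_deriv T u v = dir_deriv F u v \<odot> l u"
    and B: "transpose B = - (B :: real^4^4)" "\<And>x. x \<in> D \<Longrightarrow> T x = B *v F x + b" and u: "u \<in> D"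
  shows "dir_deriv l u v = 0"
proof -
  interpret Q: quat_plane s "E1 u" "Nf u" by (rule plane[OF u])
  have sl: "smooth_on D l" and iml: "l u \<bullet> quat_one = 0" using l u by (auto simp: dual_map_def)
  have blB: "bounded_linear (\<lambda>y. B *v y)" by (rule matrix_vector_mul_bounded_linear)
  have BF: "B *v dir_deriv F x v = dir_deriv F x v \<odot> l x" if x: "x \<in> D" for x v
  proof -
    have "dir_deriv T x v = dir_deriv (\<lambda>y. B *v F y + b) x v"
      by (rule dir_deriv_eqI_open[OF open_D x B(2)])
    also have "\<dots> = B *v dir_deriv F x v"
      by (rule dir_deriv_eq) (auto intro!: derivative_eq_intros bounded_linear.has_derivative[OF blB smooth_on_has_derivative[OF smooth_F x]])
    finally show ?thesis using dT[OF x] by simp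
  qed
  have BE: "B *v dir_deriv E1 u v = E1 u \<odot> dir_deriv l u v + dir_deriv E1 u v \<odot> l u" for v
  proof -
    have "dir_deriv (\<lambda>x. B *v E1 x) u v = dir_deriv (\<lambda>x. E1 x \<odot> l x) u v"
      by (rule dir_deriv_eqI_open[OF open_D u BF])
    then show ?thesis
      unfolding dir_deriv_bounded_linear[OF blB smooth_E(1) u] deriv_prod[OF smooth_E(1) sl u] .
  qed
  define C where "C y = B *v y - y \<odot> l u" for y
  have linC: "C (a + b) = C a + C b" "C (k *\<^sub>R a) = k *\<^sub>R C a" for a b k
    unfolding C_def by (simp_all add: matrix_vector_right_distrib matrix_vector_mult_scaleR simps algebra_simps)
  have skew: "C x \<bullet> y = - (x \<bullet> C y)" for x y
  proof -
    have "(B *v x) \<bullet> y = x \<bullet> (transpose B *v y)"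
      by (metis dot_lmul_matrix inner_commute transpose_matrix_vector)
    also have "transpose B *v y = - (B *v y)"
      unfolding B(1) by (simp add: vec_eq_iff matrix_vector_mult_def sum_negf)
    also have "x \<bullet> - (B *v y) = - (x \<bullet> (B *v y))" by simp
    finally have "(B *v x) \<bullet> y = - (x \<bullet> (B *v y))" .
    moreover have "(x \<odot> l u) \<bullet> y = - (x \<bullet> (y \<odot> l u))"
      using iml conj_imag[of "l u"] by (simp add: inner_right simps)
    ultimately show ?thesis by (simp add: C_def inner_diff_left inner_diff_right)
  qed
  have CE: "C (E1 u) = 0" "C (E2 u) = 0" using BF[OF u] by (simp_all add: C_def)
  have Cff: "C (second_ff F u v (e1 u)) = E1 u \<odot> dir_deriv l u v" for v
  proof -
    have "C (dir_deriv E1 u v) = E1 u \<odot> dir_deriv l u v" using BE[of v] by (simp add: C_def)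
    then show ?thesis unfolding deriv_E[OF u] linC CE by simp
  qed
  have Cn: "nrm u (C y)" for y using skew[of y] CE by (simp add: nrm_iff[OF u])
  define k where "k = C (E3 u) \<bullet> n3 u"
  have C3: "C (E3 u) = k *\<^sub>R n3 u"
    using normal_expand_E3[OF u Cn, of "E3 u"] skew[of "E3 u" "E3 u"] by (simp add: k_def n3_def inner_commute)
  have C4: "C (n3 u) = - k *\<^sub>R E3 u"
    using normal_expand_E3[OF u Cn, of "n3 u"] skew[of "n3 u" "E3 u"] skew[of "n3 u" "n3 u"]
    by (simp add: k_def n3_def inner_commute)
  have CN: "C y = k *\<^sub>R (Nf u \<odot> y)" if "nrm u y" for y
  proof -
    have y: "y = (y \<bullet> E3 u) *\<^sub>R E3 u + (y \<bullet> n3 u) *\<^sub>R n3 u" using normal_expand_E3[OF u that] by (simp add: n3_def)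
    show ?thesis
      by (subst (1 2) y) (simp add: linC C3 C4 simps n3[OF u], simp add: n3_def vec_eq_iff algebra_simps)
  qed
  have e1: "E1 u \<odot> dir_deriv l u (e1 u) = k *\<^sub>R (Nf u \<odot> \<alpha>11 u)"
    using Cff[of "e1 u"] CN[OF ff_nrm[OF u]] by simp
  have "E1 u \<odot> dir_deriv l u (e2 u) = k *\<^sub>R (Nf u \<odot> \<alpha>12 u)"
    using Cff[of "e2 u"] CN[OF ff_nrm[OF u]] surf_frame_at.\<alpha>21[OF at'(1)[OF u]] by simp
  then have "k *\<^sub>R (Nf u \<odot> \<alpha>12 u) = - (k *\<^sub>R \<alpha>11 u)"
    using dual_map_pointwise(3)[OF l u] e1 by (simp add: simps Q.NNx)
  moreover have "Nf u \<odot> \<alpha>12 u + \<alpha>11 u = H u"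
    unfolding iso[OF u] Q.NNx mean_curv_eq[OF u] by (simp add: vec_eq_iff field_simps)
  ultimately have "k *\<^sub>R H u = 0" by (metis add.left_inverse scaleR_add_right)
  then have "k = 0" using H0[OF u] by simp
  then have z: "E1 u \<odot> dir_deriv l u (e1 u) = 0" using e1 by simp
  then have "dir_deriv l u (e1 u) = 0" "dir_deriv l u (e2 u) = 0"
    using dual_map_pointwise(3)[OF l u] Q.cE1(1) by (metis simps(13))+
  then show ?thesis
    using linear_eq_on_frame[OF u smooth_on_linear_deriv[OF sl u] linear_zero] by blast
qed

end

section \<open>Change of charts\<close>

lemma det_matrix_2: "det (matrix L :: real^2^2) = L dx $ 1 * L dy $ 2 - L dx $ 2 * L dy $ 1"
  by (simp add: det_2 matrix_def mult.commute)

text \<open>\<open>G\<close> is the surface \<open>F\<close> in other coordinates. The definitions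
  are stated chart by chart, so the pointwise notions have to be transported along
  \<open>g\<close>.\<close>

locale reparam =
  fixes F :: psurf and T :: "(real^2) set" and G :: psurf and S :: "(real^2) set" and g :: "real^2 \<Rightarrow> real^2"
  assumes open_S: "open S" and open_T: "open T" and smooth_F: "smooth_on T F" and smooth_g: "smooth_on S g"
    and im: "g ` S \<subseteq> T" and G: "\<And>x. x \<in> S \<Longrightarrow> G x = F (g x)"
    and det_g: "\<And>u. u \<in> S \<Longrightarrow> 0 < det (matrix (frechet_derivative g (at u)))"
    and immersion: "\<And>u. u \<in> T \<Longrightarrow> inj (frechet_derivative F (at u))"
begin

lemma gT: "u \<in> S \<Longrightarrow> g u \<in> T" using im by blast

lemma smooth_comp:
  assumes "smooth_on T h" shows "smooth_on S (\<lambda>x. h (g x))"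
  by (rule smooth_on_compose[OF open_S open_T smooth_g assms im])

lemma smooth_G: "smooth_on S G"
  using smooth_comp[OF smooth_F] G smooth_on_cong[OF open_S, of G "\<lambda>x. F (g x)"] by simp

lemma deriv_comp:
  assumes "smooth_on T h" "u \<in> S"
  shows "dir_deriv (\<lambda>x. h (g x)) u v = dir_deriv h (g u) (dir_deriv g u v)"
  by (rule dir_deriv_compose[OF smooth_g assms(1,2) gT[OF assms(2)]])

lemma deriv_G:
  assumes u: "u \<in> S" shows "dir_deriv G u v = dir_deriv F (g u) (dir_deriv g u v)"
proof -
  have "dir_deriv G u v = dir_deriv (\<lambda>x. F (g x)) u v" by (rule dir_deriv_eqI_open[OF open_S u G])
  then show ?thesis by (simp only: deriv_comp[OF smooth_F u])
qed

lemma lin_g: "u \<in> S \<Longrightarrow> linear (frechet_derivative g (at u))"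
  by (rule smooth_on_linear_deriv[OF smooth_g])

lemma g_expand: "u \<in> S \<Longrightarrow> dir_deriv g u v = v$1 *\<^sub>R dir_deriv g u dx + v$2 *\<^sub>R dir_deriv g u dy"
  by (rule linear_vec2[OF lin_g])

lemma surj_g:
  assumes u: "u \<in> S" obtains v where "dir_deriv g u v = w"
proof -
  define a b where "a = dir_deriv g u dx" and "b = dir_deriv g u dy"
  define d where "d = a$1 * b$2 - a$2 * b$1"
  have d0: "d \<noteq> 0" using det_g[OF u] by (simp add: det_matrix_2 a_def b_def d_def)
  define v where "v = (vector [(w$1 * b$2 - w$2 * b$1) / d, (a$1 * w$2 - a$2 * w$1) / d] :: real^2)"
  have "w$1 * d = (w$1 * b$2 - w$2 * b$1) * a$1 + (a$1 * w$2 - a$2 * w$1) * b$1"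
    "w$2 * d = (w$1 * b$2 - w$2 * b$1) * a$2 + (a$1 * w$2 - a$2 * w$1) * b$2"
    unfolding d_def by algebra+
  then have "v$1 *\<^sub>R a + v$2 *\<^sub>R b = w"
    using d0 by (simp add: v_def vec_eq_iff forall_2 nonzero_divide_eq_eq flip: add_divide_distrib)
  then have "dir_deriv g u v = w" using g_expand[OF u, of v] by (simp add: a_def b_def)
  then show ?thesis by (rule that)
qed

lemma inj_g: assumes u: "u \<in> S" and "dir_deriv g u v = 0" shows "v = 0"
proof -
  define a b where "a = dir_deriv g u dx" and "b = dir_deriv g u dy"
  define d where "d = a$1 * b$2 - a$2 * b$1"
  have d0: "d \<noteq> 0" using det_g[OF u] by (simp add: det_matrix_2 a_def b_def d_def)
  have "v$1 * a$1 + v$2 * b$1 = 0" "v$1 * a$2 + v$2 * b$2 = 0"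
    using g_expand[OF u, of v] assms(2) by (simp_all add: a_def b_def vec_eq_iff forall_2)
  then have "v$1 * d = 0" "v$2 * d = 0" unfolding d_def by algebra+
  then show "v = 0" using d0 by (simp add: vec_eq_iff forall_2)
qed

lemma inj_G: assumes u: "u \<in> S" shows "inj (frechet_derivative G (at u))"
proof -
  have "linear (frechet_derivative F (at (g u)))" by (rule smooth_on_linear_deriv[OF smooth_F gT[OF u]])
  then have "v = 0" if "dir_deriv G u v = 0" for v
    using that immersion[OF gT[OF u]] inj_g[OF u] linear_injective_0 unfolding deriv_G[OF u] by metis
  then show ?thesis
    using smooth_on_linear_deriv[OF smooth_G u] linear_injective_0 by blast
qed

lemma metric_G: "u \<in> S \<Longrightarrow> metric G u v w = metric F (g u) (dir_deriv g u v) (dir_deriv g u w)"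
  by (simp add: metric_def deriv_G)

lemma normal_space_G: "u \<in> S \<Longrightarrow> normal_space G u = normal_space F (g u)"
  unfolding normal_space_def by (auto simp: deriv_G) (metis surj_g)

lemma nproj_G:
  assumes u: "u \<in> S" shows "nproj G u y = nproj F (g u) y"
proof -
  have "(\<exists>v. y = dir_deriv G u v + x) \<longleftrightarrow> (\<exists>v. y = dir_deriv F (g u) v + x)" for x
    unfolding deriv_G[OF u] using surj_g[OF u] by metis
  then show ?thesis unfolding nproj_def normal_space_G[OF u] by simp
qed

lemma det_rows: "u \<in> S \<Longrightarrow> det (vector [dir_deriv g u v, dir_deriv g u w] :: real^2^2) =
  det (matrix (frechet_derivative g (at u))) * det (vector [v, w] :: real^2^2)"
  unfolding det_2_rows det_matrix_2 g_expand[of u v] g_expand[of u w] by (simp add: algebra_simps)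

lemma frame_G:
  assumes u: "u \<in> S"
  shows "pos_tangent_frame G u a b \<longleftrightarrow> pos_tangent_frame F (g u) (dir_deriv g u a) (dir_deriv g u b)"
  unfolding pos_tangent_frame_def metric_G[OF u] det_rows[OF u] using det_g[OF u]
  by (simp add: zero_less_mult_iff)

text \<open>The second derivative of \<open>g\<close> contributes a tangent vector only, which the
  normal projection removes.\<close>

lemma second_ff_G:
  assumes u: "u \<in> S"
  shows "second_ff G u v w = second_ff F (g u) (dir_deriv g u v) (dir_deriv g u w)"
proof -
  interpret Sf: smooth_surf F T by (intro smooth_surf.intro open_T smooth_F)
  obtain e1 e2 where fr: "framed_surf 1 F T e1 e2"
    using immersion_frame[OF open_T smooth_F immersion] by (metis mult_1)
  interpret R: framed_surf 1 F T e1 e2 by (rule fr)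
  interpret P: tangent_frame F "g u" "e1 (g u)" "e2 (g u)" by (rule R.at'(3)[OF gT[OF u]])
  have "dir_deriv (\<lambda>x. dir_deriv G x w) u v = dir_deriv (\<lambda>x. dir_deriv F (g x) (dir_deriv g x w)) u v"
    by (rule dir_deriv_eqI_open[OF open_S u]) (rule deriv_G)
  also have "\<dots> = dir_deriv (\<lambda>x. (dir_deriv g x w $ 1) *\<^sub>R dir_deriv F (g x) dx + (dir_deriv g x w $ 2) *\<^sub>R dir_deriv F (g x) dy) u v"
    by (rule dir_deriv_eqI_open[OF open_S u]) (rule linear_vec2[OF smooth_on_linear_deriv[OF smooth_F gT]])
  also have "\<dots> = hess F (g u) (dir_deriv g u v) (dir_deriv g u w) + dir_deriv F (g u) (dir_deriv (\<lambda>x. dir_deriv g x w) u v)"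
  proof -
    have sg: "smooth_on S (\<lambda>x. dir_deriv g x w)" by (rule smooth_on_dir_deriv[OF smooth_g])
    have sF: "smooth_on S (\<lambda>x. dir_deriv F (g x) b)" for b by (rule smooth_comp[OF smooth_on_dir_deriv[OF smooth_F]])
    have i: "dir_deriv (\<lambda>x. (dir_deriv g x w $ i) *\<^sub>R dir_deriv F (g x) b) u v =
      (dir_deriv g u w $ i) *\<^sub>R hess F (g u) (dir_deriv g u v) b + (dir_deriv (\<lambda>x. dir_deriv g x w) u v $ i) *\<^sub>R dir_deriv F (g u) b" for i b
      using dir_deriv_bilinear[OF bounded_bilinear_scaleR smooth_on_nth[OF open_S sg] sF u]
        dir_deriv_bounded_linear[OF bounded_linear_vec_nth sg u] deriv_comp[OF smooth_on_dir_deriv[OF smooth_F] u]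
      by (simp add: hess_def)
    have h: "hess F (g u) a b = b$1 *\<^sub>R hess F (g u) a dx + b$2 *\<^sub>R hess F (g u) a dy" for a b
      unfolding Sf.hess_sym[OF gT[OF u], of a]
      by (rule linear_vec2) (auto intro!: linearI simp: Sf.hess_lin1[OF gT[OF u]])
    show ?thesis
      unfolding dir_deriv_add[OF smooth_on_scaleR[OF open_S smooth_on_nth[OF open_S sg] sF] smooth_on_scaleR[OF open_S smooth_on_nth[OF open_S sg] sF] u] i
        h[of _ "dir_deriv g u w"] linear_vec2[OF smooth_on_linear_deriv[OF smooth_F gT[OF u]], of "dir_deriv (\<lambda>x. dir_deriv g x w) u v"]
      by (simp add: algebra_simps)
  qed
  finally show ?thesis
    unfolding second_ff_def nproj_G[OF u] hess_def[symmetric] by (simp add: P.nproj_lin P.nproj_df)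
qed

text \<open>Frames of both parametrizations that correspond at the single point \<open>u\<close>;
  correspondence elsewhere is irrelevant for comparing pointwise quantities.\<close>

lemma pulled_frames:
  assumes u: "u \<in> S" and s: "s * s = 1"
  obtains a1 a2 b1 b2 where "framed_surf s G S a1 a2" "framed_surf s F T b1 b2"
    "b1 (g u) = dir_deriv g u (a1 u)" "b2 (g u) = dir_deriv g u (a2 u)"
proof -
  obtain a1 a2 where a: "framed_surf s G S a1 a2" using immersion_frame[OF open_S smooth_G inj_G s] .
  obtain e1 e2 where e: "framed_surf s F T e1 e2" using immersion_frame[OF open_T smooth_F immersion s] .
  interpret E: framed_surf s F T e1 e2 by (rule e)
  have "pos_tangent_frame F (g u) (dir_deriv g u (a1 u)) (dir_deriv g u (a2 u))"
    using frame_G[OF u] framed_surf.frames[OF a u] by blast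
  then show ?thesis using E.rotate_frame[OF gT[OF u]] that a by metis
qed

lemma mean_curv_G: assumes u: "u \<in> S" shows "mean_curv G u = mean_curv F (g u)"
proof -
  obtain a1 a2 b1 b2 where fr: "framed_surf 1 G S a1 a2" "framed_surf 1 F T b1 b2"
    and b: "b1 (g u) = dir_deriv g u (a1 u)" "b2 (g u) = dir_deriv g u (a2 u)"
    using pulled_frames[OF u mult_1[of 1]] by blast
  show ?thesis
    unfolding framed_surf.mean_curv_eq[OF fr(1) u] framed_surf.mean_curv_eq[OF fr(2) gT[OF u]] second_ff_G[OF u] b ..
qed

lemma holomorphic_G:
  assumes u: "u \<in> S" and s: "s * s = 1"
  shows "gauss_lift_holomorphic_at G s u \<longleftrightarrow> gauss_lift_holomorphic_at F s (g u)"
proof -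
  obtain a1 a2 b1 b2 where fr: "framed_surf s G S a1 a2" "framed_surf s F T b1 b2"
    and b: "b1 (g u) = dir_deriv g u (a1 u)" "b2 (g u) = dir_deriv g u (a2 u)"
    using pulled_frames[OF u s] by blast
  show ?thesis
    unfolding framed_surf.holomorphic_iff[OF fr(1) u] framed_surf.holomorphic_iff[OF fr(2) gT[OF u]]
      framed_surf.Nf_def[OF fr(1)] framed_surf.Nf_def[OF fr(2)] second_ff_G[OF u] deriv_G[OF u] b ..
qed

lemma umbilic_G: assumes u: "u \<in> S" shows "umbilic_at G u \<longleftrightarrow> umbilic_at F (g u)"
proof -
  have "curvature_ellipse G u = curvature_ellipse F (g u)"
    unfolding curvature_ellipse_def second_ff_G[OF u] metric_G[OF u] using surj_g[OF u] by (auto, metis)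
  then show ?thesis by (simp add: umbilic_at_def)
qed

end

section \<open>The sign of the normal curvature\<close>

context framed_surf
begin

lemma ellipse_point:
  assumes u: "u \<in> D" and cd: "c * c + d * d = 1"
  shows "mean_curv F u + (c * c - d * d) *\<^sub>R \<alpha>0 u + (2 * c * d) *\<^sub>R \<alpha>12 u \<in> curvature_ellipse F u"
proof -
  interpret P: surf_frame_at F D u "e1 u" "e2 u" by (rule at'(1)[OF u])
  define a where "a = c *\<^sub>R e1 u + d *\<^sub>R e2 u"
  have "metric F u a a = 1"
    using P.rotated_frame[OF cd] by (simp add: a_def pos_tangent_frame_def)
  moreover have "second_ff F u a a = mean_curv F u + (c * c - d * d) *\<^sub>R \<alpha>0 u + (2 * c * d) *\<^sub>R \<alpha>12 u"
  proof -
    have "mean_curv F u = (c * c + d * d) *\<^sub>R ((1/2) *\<^sub>R (\<alpha>11 u + \<alpha>22 u))" by (simp add: cd mean_curv_eq[OF u])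
    then show ?thesis
      unfolding P.second_ff_rotated(1)[OF a_def refl] by (simp add: vec_eq_iff field_simps)
  qed
  ultimately show ?thesis unfolding curvature_ellipse_def by force
qed

lemma ellipse_param:
  assumes u: "u \<in> D" and "x \<in> curvature_ellipse F u"
  obtains c d where "c * c + d * d = 1" "x = mean_curv F u + (c * c - d * d) *\<^sub>R \<alpha>0 u + (2 * c * d) *\<^sub>R \<alpha>12 u"
proof -
  interpret P: surf_frame_at F D u "e1 u" "e2 u" by (rule at'(1)[OF u])
  obtain a where a: "metric F u a a = 1" "x = second_ff F u a a" using assms(2) unfolding curvature_ellipse_def by blast
  define c d where "c = dir_deriv F u a \<bullet> E1 u" and "d = dir_deriv F u a \<bullet> E2 u"
  have ae: "a = c *\<^sub>R e1 u + d *\<^sub>R e2 u" unfolding c_def d_def by (rule expand[OF u])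
  have cd: "c * c + d * d = 1"
    using a(1) unfolding metric_def ae by (simp add: inner_add_left inner_add_right frame_inner[OF u])
  have "mean_curv F u = (c * c + d * d) *\<^sub>R ((1/2) *\<^sub>R (\<alpha>11 u + \<alpha>22 u))" by (simp add: cd mean_curv_eq[OF u])
  then have "x = mean_curv F u + (c * c - d * d) *\<^sub>R \<alpha>0 u + (2 * c * d) *\<^sub>R \<alpha>12 u"
    unfolding a(2) P.second_ff_rotated(1)[OF ae refl] by (simp add: vec_eq_iff field_simps)
  then show ?thesis using that cd by blast
qed

lemma umbilic_iff: assumes u: "u \<in> D" shows "umbilic_at F u \<longleftrightarrow> \<alpha>0 u = 0 \<and> \<alpha>12 u = 0"
proof
  assume "umbilic_at F u"
  then obtain z where z: "\<And>x. x \<in> curvature_ellipse F u \<Longrightarrow> x = z" unfolding umbilic_at_def by blast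
  define A B where "A = \<alpha>0 u" and "B = \<alpha>12 u"
  have A: "mean_curv F u + A = z" "mean_curv F u + - A = z"
    using z[OF ellipse_point[OF u, of 1 0]] z[OF ellipse_point[OF u, of 0 1]] unfolding A_def[symmetric] by simp_all
  \<comment> \<open>The point of the ellipse at angle \<pi>/4, where the coefficient of
    \<open>A\<close> is 0 and that of \<open>B\<close> is 1.\<close>
  have "mean_curv F u + B = z"
    using z[OF ellipse_point[OF u, of "sqrt (1/2)" "sqrt (1/2)"]] unfolding A_def[symmetric] B_def[symmetric]
    by (simp add: real_sqrt_divide)
  moreover have "A = - A" using A by (metis add_left_cancel)
  then have "A = 0" by (simp add: vec_eq_iff)
  ultimately have "A = 0 \<and> B = 0" using A(1) by simp
  then show "\<alpha>0 u = 0 \<and> \<alpha>12 u = 0" unfolding A_def B_def .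
next
  assume 0: "\<alpha>0 u = 0 \<and> \<alpha>12 u = 0"
  have "curvature_ellipse F u = {mean_curv F u}"
  proof (intro equalityI subsetI)
    fix x assume "x \<in> curvature_ellipse F u"
    then show "x \<in> {mean_curv F u}" by (rule ellipse_param[OF u]) (simp only: 0, simp)
  next
    fix x assume "x \<in> {mean_curv F u}"
    then show "x \<in> curvature_ellipse F u" using ellipse_point[OF u, of 1 0] by (simp only: 0) simp
  qed
  then show "umbilic_at F u" by (auto simp: umbilic_at_def)
qed

text \<open>Comparing opposite points of the ellipse shows that the offset \<open>h\<close> of the
  centre is perpendicular to the conjugate radii \<open>A\<close> and \<open>B\<close>. Equal
  distances at the ends of \<open>A\<close> and \<open>B\<close> and at one oblique point then make
  the radii equally long and orthogonal.\<close>

lemma pseudo_umbilic_circle: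
  assumes u: "u \<in> D" and "pseudo_umbilic_at F u"
  shows "\<alpha>0 u \<bullet> \<alpha>12 u = 0" "\<alpha>0 u \<bullet> \<alpha>0 u = \<alpha>12 u \<bullet> \<alpha>12 u"
proof -
  obtain z r where z: "\<And>x. x \<in> curvature_ellipse F u \<Longrightarrow> dist z x = r"
    using assms(2) unfolding pseudo_umbilic_at_def by blast
  define h A B where "h = mean_curv F u - z" and "A = \<alpha>0 u" and "B = \<alpha>12 u"
  have e: "(h + (c * c - d * d) *\<^sub>R A + (2 * c * d) *\<^sub>R B) \<bullet> (h + (c * c - d * d) *\<^sub>R A + (2 * c * d) *\<^sub>R B) = r\<^sup>2"
    if "c * c + d * d = 1" for c d
  proof -
    have "dist z (mean_curv F u + (c * c - d * d) *\<^sub>R A + (2 * c * d) *\<^sub>R B) = r"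
      using z[OF ellipse_point[OF u that]] unfolding A_def B_def .
    moreover have "h + (c * c - d * d) *\<^sub>R A + (2 * c * d) *\<^sub>R B = (mean_curv F u + (c * c - d * d) *\<^sub>R A + (2 * c * d) *\<^sub>R B) - z"
      by (simp add: h_def)
    ultimately have "norm (h + (c * c - d * d) *\<^sub>R A + (2 * c * d) *\<^sub>R B) = r"
      by (simp only: dist_norm norm_minus_commute)
    then show ?thesis by (simp add: dot_square_norm)
  qed
  have A: "(h + A) \<bullet> (h + A) = r\<^sup>2" "(h - A) \<bullet> (h - A) = r\<^sup>2"
    using e[of 1 0] e[of 0 1] by simp_all
  have B: "(h + B) \<bullet> (h + B) = r\<^sup>2" "(h - B) \<bullet> (h - B) = r\<^sup>2"
    using e[of "sqrt (1/2)" "sqrt (1/2)"] e[of "sqrt (1/2)" "- sqrt (1/2)"] by (simp_all add: real_sqrt_divide)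
  have hA: "h \<bullet> A = 0" "h \<bullet> B = 0"
    using A B by (simp_all add: inner_add_left inner_add_right inner_diff_left inner_diff_right inner_commute)
  have AB: "A \<bullet> A = B \<bullet> B" using A(1) B(1) hA by (simp add: inner_add_left inner_add_right inner_commute)
  \<comment> \<open>The oblique point: cosine 4/5 and sine 3/5 have the rational double angle values
    7/25 and 24/25.\<close>
  have "(h + (7/25) *\<^sub>R A + (24/25) *\<^sub>R B) \<bullet> (h + (7/25) *\<^sub>R A + (24/25) *\<^sub>R B) = r\<^sup>2"
    using e[of "4/5" "3/5"] by simp
  then have "h \<bullet> h + (49/625) * (A \<bullet> A) + (576/625) * (B \<bullet> B) + 2 * (168/625) * (A \<bullet> B) = r\<^sup>2"
    using hA by (simp add: inner_add_left inner_add_right inner_commute algebra_simps)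
  moreover have "h \<bullet> h + A \<bullet> A = r\<^sup>2" using A(1) hA by (simp add: inner_add_left inner_add_right inner_commute)
  ultimately show "\<alpha>0 u \<bullet> \<alpha>12 u = 0" using AB unfolding A_def[symmetric] B_def[symmetric] by (simp add: field_simps)
  show "\<alpha>0 u \<bullet> \<alpha>0 u = \<alpha>12 u \<bullet> \<alpha>12 u" using AB unfolding A_def B_def .
qed

lemma opposite: "framed_surf (- s) F D e1 e2"
  using framed_surf_axioms s by (simp add: framed_surf_def quat_def)

lemma rotN_eq: "u \<in> D \<Longrightarrow> nrm u x \<Longrightarrow> rotN F u x = s *\<^sub>R (Nf u \<odot> x)"
  using quat_frame.rotN[OF at'(2)] Nf by simp

lemma holomorphic_iff_rotN:
  assumes u: "u \<in> D" shows "gauss_lift_holomorphic_at F s u \<longleftrightarrow> \<alpha>12 u = s *\<^sub>R rotN F u (\<alpha>0 u)"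
  unfolding holomorphic_iff[OF u] rotN_eq[OF u \<alpha>0_nrm[OF u]] scaleR_scaleR s scaleR_one ..

text \<open>In the normal plane a vector orthogonal to \<alpha>0 and of the same length is plus or
  minus its rotation by N; the two cases are the two signs.\<close>

lemma pseudo_umbilic_holomorphic:
  assumes u: "u \<in> D" and "pseudo_umbilic_at F u"
  shows "gauss_lift_holomorphic_at F s u \<or> gauss_lift_holomorphic_at F (- s) u"
proof -
  interpret Q: quat_plane s "E1 u" "Nf u" by (rule plane[OF u])
  define A B where "A = \<alpha>0 u" and "B = \<alpha>12 u"
  have AB: "A \<bullet> B = 0" "A \<bullet> A = B \<bullet> B"
    using pseudo_umbilic_circle[OF assms] unfolding A_def B_def by blast+
  have n: "Q.normal A" "Q.normal B" using \<alpha>0_nrm[OF u] ff_nrm[OF u] normal_iff[OF u] unfolding A_def B_def by blast+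
  have "B = Nf u \<odot> A \<or> B = - (Nf u \<odot> A)"
  proof (cases "A = 0")
    case False
    define k where "k = B \<bullet> (Nf u \<odot> A)"
    have e: "(A \<bullet> A) *\<^sub>R B = k *\<^sub>R (Nf u \<odot> A)"
      using Q.normal_expand[OF n] AB(1) by (simp add: k_def inner_commute)
    then have "((A \<bullet> A) *\<^sub>R B) \<bullet> ((A \<bullet> A) *\<^sub>R B) = (k *\<^sub>R (Nf u \<odot> A)) \<bullet> (k *\<^sub>R (Nf u \<odot> A))" by simp
    then have "(A \<bullet> A)\<^sup>2 * (A \<bullet> A) = k\<^sup>2 * (A \<bullet> A)"
      by (simp add: Q.N_isometry AB(2)[symmetric] power2_eq_square)
    then have "k = A \<bullet> A \<or> k = - (A \<bullet> A)" using False by (auto simp: power2_eq_iff)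
    then have "(A \<bullet> A) *\<^sub>R B = (A \<bullet> A) *\<^sub>R (Nf u \<odot> A) \<or> (A \<bullet> A) *\<^sub>R B = (A \<bullet> A) *\<^sub>R (- (Nf u \<odot> A))"
      using e by auto
    then show ?thesis using False by (metis inner_eq_zero_iff scaleR_left_imp_eq)
  qed (use AB in \<open>simp add: simps\<close>)
  moreover have r: "s *\<^sub>R rotN F u A = Nf u \<odot> A"
    using rotN_eq[OF u \<alpha>0_nrm[OF u]] s unfolding A_def[symmetric] by simp
  ultimately show ?thesis
    unfolding holomorphic_iff_rotN[OF u] framed_surf.holomorphic_iff_rotN[OF opposite u] A_def[symmetric] B_def[symmetric]
    by (auto simp: scaleR_minus_left r)
qed

lemma holomorphic_sign_unique:
  assumes u: "u \<in> D" and "\<not> umbilic_at F u" "gauss_lift_holomorphic_at F s u" "gauss_lift_holomorphic_at F (- s) u"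
  shows False
proof -
  define A where "A = \<alpha>0 u"
  have r: "s *\<^sub>R rotN F u A = Nf u \<odot> A"
    using rotN_eq[OF u \<alpha>0_nrm[OF u]] s unfolding A_def[symmetric] by simp
  have "\<alpha>12 u = Nf u \<odot> A" "\<alpha>12 u = - (Nf u \<odot> A)"
    using assms(3,4) r unfolding holomorphic_iff_rotN[OF u] framed_surf.holomorphic_iff_rotN[OF opposite u] A_def[symmetric]
    by (simp_all add: scaleR_minus_left)
  then have "Nf u \<odot> A = - (Nf u \<odot> A)" by (rule trans[OF sym])
  then have "Nf u \<odot> A = 0" by (simp add: vec_eq_iff)
  then have "A = 0" "\<alpha>12 u = 0" using Nf_imag(2)[OF u] \<open>\<alpha>12 u = Nf u \<odot> A\<close> by (auto simp: mult_eq_0)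
  then show False using assms(2) unfolding umbilic_iff[OF u] A_def by simp
qed

lemma iso_surfI:
  assumes "\<And>u. u \<in> D \<Longrightarrow> gauss_lift_holomorphic_at F s u" "\<And>u. u \<in> D \<Longrightarrow> \<not> umbilic_at F u"
    "\<And>u. u \<in> D \<Longrightarrow> mean_curv F u \<noteq> 0"
  shows "iso_surf s F D e1 e2"
proof
  fix u assume u: "u \<in> D"
  show "\<alpha>12 u = Nf u \<odot> \<alpha>0 u" using assms(1)[OF u] holomorphic_iff[OF u] by blast
  then show "\<alpha>0 u \<noteq> 0" using assms(2)[OF u] umbilic_iff[OF u] by (metis simps(13))
  show "mean_curv F u \<noteq> 0" by (rule assms(3)[OF u])
qed

end

section \<open>Charts\<close>

lemma chart_props:
  assumes "is_chart c"
  shows "open (cdom c)" "open (cmap c ` cdom c)" "continuous_on (cdom c) (cmap c)" "inj_on (cmap c) (cdom c)"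
    "p \<in> cdom c \<Longrightarrow> cinv c (cmap c p) = p"
proof -
  have h: "homeomorphism (cdom c) (cmap c ` cdom c) (cmap c) (cinv c)" using assms by (simp add: is_chart_def)
  show "open (cdom c)" "open (cmap c ` cdom c)" using assms by (simp_all add: is_chart_def)
  show "continuous_on (cdom c) (cmap c)" using h by (simp add: homeomorphism_def)
  show "p \<in> cdom c \<Longrightarrow> cinv c (cmap c p) = p" for p using h by (simp add: homeomorphism_def)
  then show "inj_on (cmap c) (cdom c)" by (metis inj_onI)
qed

lemma chart_image_open:
  assumes "is_chart c" "open V" shows "open (cmap c ` (cdom c \<inter> V))"
proof -
  have "openin (top_of_set (cmap c ` cdom c)) (cmap c ` (cdom c \<inter> V))"
    using assms homeomorphism_imp_open_map[of "cdom c" "cmap c ` cdom c" "cmap c" "cinv c" "cdom c \<inter> V"]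
    by (simp add: is_chart_def openin_open_Int)
  then show ?thesis using chart_props(2)[OF assms(1)] openin_open_trans by blast
qed

lemma chart_preimage_open:
  assumes "is_chart c" "open D" shows "open {p \<in> cdom c. cmap c p \<in> D}"
  using continuous_open_preimage[OF chart_props(3,1)[OF assms(1)] assms(2)] by (simp add: vimage_def Int_def)

locale surface =
  fixes A :: "'a::{t2_space,second_countable_topology} chart set" and f :: "'a \<Rightarrow> real^4"
  assumes surf: "immersed_surface A f"
begin

lemma chart: "c \<in> A \<Longrightarrow> is_chart c"
  using surf by (simp add: immersed_surface_def oriented_atlas_def)

lemma F_smooth: assumes "c \<in> A" shows "smooth_on (cmap c ` cdom c) (in_chart c f)"
proof -
  have "cdom c \<inter> carrier A = cdom c" using assms by (auto simp: carrier_def)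
  then show ?thesis using surf assms by (metis immersed_surface_def smooth_map_on_def)
qed

lemma F_immersion: "c \<in> A \<Longrightarrow> u \<in> cmap c ` cdom c \<Longrightarrow> inj (frechet_derivative (in_chart c f) (at u))"
  using surf unfolding immersed_surface_def by blast

lemma transition:
  assumes z: "oriented_atlas (insert z A)" and c: "c \<in> A"
  shows "reparam (in_chart c f) (cmap c ` cdom c) (in_chart z f) (cmap z ` (cdom z \<inter> cdom c)) (in_chart z (cmap c))"
proof
  have iz: "is_chart z" using z by (simp add: oriented_atlas_def)
  have ic: "is_chart c" by (rule chart[OF c])
  show "open (cmap z ` (cdom z \<inter> cdom c))" by (rule chart_image_open[OF iz chart_props(1)[OF ic]])
  show "open (cmap c ` cdom c)" by (rule chart_props(2)[OF ic])
  show "smooth_on (cmap c ` cdom c) (in_chart c f)" by (rule F_smooth[OF c])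
  show "smooth_on (cmap z ` (cdom z \<inter> cdom c)) (in_chart z (cmap c))"
    using z c by (simp add: oriented_atlas_def)
  show "in_chart z (cmap c) ` cmap z ` (cdom z \<inter> cdom c) \<subseteq> cmap c ` cdom c"
    using chart_props(5)[OF iz] by auto
  show "in_chart z f x = in_chart c f (in_chart z (cmap c) x)" if "x \<in> cmap z ` (cdom z \<inter> cdom c)" for x
    using that chart_props(5)[OF iz] chart_props(5)[OF ic] by auto
  show "0 < det (matrix (frechet_derivative (in_chart z (cmap c)) (at u)))" if "u \<in> cmap z ` (cdom z \<inter> cdom c)" for u
    using z c that unfolding oriented_atlas_def by blast
  show "inj (frechet_derivative (in_chart c f) (at u))" if "u \<in> cmap c ` cdom c" for u
    by (rule F_immersion[OF c that])
qed

lemma atlas_self: "z \<in> A \<Longrightarrow> oriented_atlas (insert z A)"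
  using surf by (simp add: immersed_surface_def insert_absorb)

lemma carrierE: assumes "p \<in> carrier A" obtains c where "c \<in> A" "p \<in> cdom c"
  using assms by (auto simp: carrier_def)

lemma chart_frame:
  assumes c: "c \<in> A" and s: "s * s = 1"
  obtains e1 e2 where "framed_surf s (in_chart c f) (cmap c ` cdom c) e1 e2"
  using immersion_frame[OF chart_props(2)[OF chart[OF c]] F_smooth[OF c] F_immersion[OF c] s] by blast

end

section \<open>Constancy of the sign of the holomorphic Gauss lift\<close>

locale circle_surface = surface +
  assumes umb: "umbilic_free A f" and sup: "superconformal A f"
    and mean: "\<forall>c\<in>A. \<forall>p\<in>cdom c. mean_curv (in_chart c f) (cmap c p) \<noteq> 0"
begin

text \<open>Stated for all charts around the point; by \<open>hol_iff\<close> a single one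
  decides.\<close>

definition hol :: "real \<Rightarrow> 'a \<Rightarrow> bool"
  where "hol s p \<longleftrightarrow> (\<forall>c\<in>A. p \<in> cdom c \<longrightarrow> gauss_lift_holomorphic_at (in_chart c f) s (cmap c p))"

lemma nonumbilic: "c \<in> A \<Longrightarrow> u \<in> cmap c ` cdom c \<Longrightarrow> \<not> umbilic_at (in_chart c f) u"
  using umb by (auto simp: umbilic_free_def)

lemma holI:
  assumes s: "s * s = 1" and z: "oriented_atlas (insert z A)" and p: "p \<in> cdom z"
    and c: "c \<in> A" "p \<in> cdom c"
  shows "gauss_lift_holomorphic_at (in_chart z f) s (cmap z p) \<longleftrightarrow> gauss_lift_holomorphic_at (in_chart c f) s (cmap c p)"
proof -
  interpret R: reparam "in_chart c f" "cmap c ` cdom c" "in_chart z f" "cmap z ` (cdom z \<inter> cdom c)" "in_chart z (cmap c)"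
    by (rule transition[OF z c(1)])
  have iz: "is_chart z" using z by (simp add: oriented_atlas_def)
  show ?thesis using R.holomorphic_G[OF _ s, of "cmap z p"] chart_props(5)[OF iz p] p c by auto
qed

lemma hol_iff: "s * s = 1 \<Longrightarrow> c \<in> A \<Longrightarrow> p \<in> cdom c \<Longrightarrow> hol s p \<longleftrightarrow> gauss_lift_holomorphic_at (in_chart c f) s (cmap c p)"
  using holI[OF _ atlas_self] unfolding hol_def by blast

lemma hol_cases:
  assumes p: "p \<in> carrier A" shows "hol 1 p \<or> hol (- 1) p" "\<not> (hol 1 p \<and> hol (- 1) p)"
proof -
  obtain c where c: "c \<in> A" "p \<in> cdom c" "pseudo_umbilic_at (in_chart c f) (cmap c p)"
    using p sup unfolding superconformal_def M0_def by blast
  obtain e1 e2 where "framed_surf 1 (in_chart c f) (cmap c ` cdom c) e1 e2" by (rule chart_frame[OF c(1), of 1]) auto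
  then interpret R: framed_surf 1 "in_chart c f" "cmap c ` cdom c" e1 e2 .
  have u: "cmap c p \<in> cmap c ` cdom c" using c by blast
  show "hol 1 p \<or> hol (- 1) p"
    using R.pseudo_umbilic_holomorphic[OF u c(3)] c by (simp add: hol_iff)
  show "\<not> (hol 1 p \<and> hol (- 1) p)"
    using R.holomorphic_sign_unique[OF u nonumbilic[OF c(1) u]] c by (auto simp: hol_iff)
qed

lemma not_hol_open: assumes s: "s * s = 1" shows "open {p \<in> carrier A. \<not> hol s p}"
proof (subst open_subopen, intro ballI)
  fix p assume p: "p \<in> {p \<in> carrier A. \<not> hol s p}"
  then obtain c where c: "c \<in> A" "p \<in> cdom c" using carrierE by blast
  let ?D = "cmap c ` cdom c"
  obtain e1 e2 where "framed_surf s (in_chart c f) ?D e1 e2" by (rule chart_frame[OF c(1) s])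
  then interpret R: framed_surf s "in_chart c f" ?D e1 e2 .
  define h where "h u = R.\<alpha>12 u - R.Nf u \<odot> R.\<alpha>0 u" for u
  have "smooth_on ?D h" unfolding h_def
    by (intro smooth_on_diff R.smooth_\<alpha> R.smooth_prod R.smooth_Nf R.open_D)
  then have "continuous_on ?D h" by (rule smooth_on_continuous)
  then have o: "open (?D \<inter> h -` (- {0}))"
    using continuous_open_preimage[OF _ R.open_D, of h "- {0}"] by auto
  define W where "W = {q \<in> cdom c. cmap c q \<in> ?D \<inter> h -` (- {0})}"
  have hol: "hol s q \<longleftrightarrow> h (cmap c q) = 0" if "q \<in> cdom c" for q
    using hol_iff[OF s c(1) that] R.holomorphic_iff[of "cmap c q"] that by (simp add: h_def)
  have "open W" unfolding W_def by (rule chart_preimage_open[OF chart[OF c(1)] o])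
  moreover have "p \<in> W" using p c hol by (auto simp: W_def)
  moreover have "W \<subseteq> {p \<in> carrier A. \<not> hol s p}" using hol c(1) by (auto simp: W_def carrier_def)
  ultimately show "\<exists>T. open T \<and> p \<in> T \<and> T \<subseteq> {p \<in> carrier A. \<not> hol s p}" by blast
qed

text \<open>The two sets on which one of the signs fails are open. They cover the carrier, since
  without umbilics no point admits both signs, and they are disjoint, since every point admits one.
  Connectedness empties one of them.\<close>

lemma sign_exists: obtains s where "s = 1 \<or> s = - 1" "\<And>p. p \<in> carrier A \<Longrightarrow> hol s p"
proof -
  have "connected (carrier A)" using surf by (simp add: immersed_surface_def)
  moreover have "carrier A \<subseteq> {p \<in> carrier A. \<not> hol 1 p} \<union> {p \<in> carrier A. \<not> hol (- 1) p}"
    "{p \<in> carrier A. \<not> hol 1 p} \<inter> {p \<in> carrier A. \<not> hol (- 1) p} \<inter> carrier A = {}"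
    using hol_cases by blast+
  ultimately have "{p \<in> carrier A. \<not> hol 1 p} \<inter> carrier A = {} \<or> {p \<in> carrier A. \<not> hol (- 1) p} \<inter> carrier A = {}"
    using connectedD[OF _ not_hol_open[of 1] not_hol_open[of "- 1"]] by auto
  then show ?thesis using that[of 1] that[of "- 1"] by blast
qed

end

locale signed_surface = circle_surface + quat +
  assumes hol_s: "\<And>p. p \<in> carrier A \<Longrightarrow> hol s p"
begin

lemma s_cases: "s = 1 \<or> s = - 1"
  using s by (metis square_eq_1_iff)

lemma holomorphic_at:
  assumes z: "oriented_atlas (insert z A)" "cdom z \<subseteq> carrier A" and u: "u \<in> cmap z ` cdom z"
  shows "gauss_lift_holomorphic_at (in_chart z f) s u" "\<not> umbilic_at (in_chart z f) u" "mean_curv (in_chart z f) u \<noteq> 0"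
proof -
  obtain p where p: "p \<in> cdom z" "u = cmap z p" using u by blast
  then have pA: "p \<in> carrier A" using z by blast
  obtain c where c: "c \<in> A" "p \<in> cdom c" using carrierE[OF pA] .
  interpret R: reparam "in_chart c f" "cmap c ` cdom c" "in_chart z f" "cmap z ` (cdom z \<inter> cdom c)" "in_chart z (cmap c)"
    by (rule transition[OF z(1) c(1)])
  have iz: "is_chart z" using z by (simp add: oriented_atlas_def)
  have g: "in_chart z (cmap c) u = cmap c p" using chart_props(5)[OF iz p(1)] p by simp
  have uS: "u \<in> cmap z ` (cdom z \<inter> cdom c)" using p c by blast
  show "gauss_lift_holomorphic_at (in_chart z f) s u"
    using hol_s[OF pA] hol_iff[OF s c] holI[OF s z(1) p(1) c] p by blast
  show "\<not> umbilic_at (in_chart z f) u"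
    using R.umbilic_G[OF uS] nonumbilic[OF c(1), of "cmap c p"] c g by auto
  show "mean_curv (in_chart z f) u \<noteq> 0"
    using R.mean_curv_G[OF uS] mean c g by auto
qed

lemma chart_subset: "c \<in> A \<Longrightarrow> cdom c \<subseteq> carrier A" by (auto simp: carrier_def)

lemma iso:
  assumes "c \<in> A" "framed_surf s (in_chart c f) D e1 e2" "D \<subseteq> cmap c ` cdom c"
  shows "iso_surf s (in_chart c f) D e1 e2"
proof (rule framed_surf.iso_surfI[OF assms(2)])
  fix u assume "u \<in> D"
  then have u: "u \<in> cmap c ` cdom c" using assms(3) by (rule subsetD[rotated])
  note h = holomorphic_at[OF atlas_self[OF assms(1)] chart_subset[OF assms(1)] u]
  show "gauss_lift_holomorphic_at (in_chart c f) s u" by (rule h(1))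
  show "\<not> umbilic_at (in_chart c f) u" by (rule h(2))
  show "mean_curv (in_chart c f) u \<noteq> 0" by (rule h(3))
qed

lemma normal_curvature_sign:
  assumes c: "c \<in> A" and u: "u \<in> cmap c ` cdom c"
  shows "s * normal_curvature (in_chart c f) u > 0"
proof -
  obtain e1 e2 where "framed_surf s (in_chart c f) (cmap c ` cdom c) e1 e2" by (rule chart_frame[OF c s])
  then interpret R: iso_surf s "in_chart c f" "cmap c ` cdom c" e1 e2 by (intro iso c) auto
  have "normal_curvature (in_chart c f) u = 2 * s * (R.\<alpha>0 u \<bullet> R.\<alpha>0 u)"
    by (rule R.normal_curvature_holomorphic[OF u holomorphic_at(1)[OF atlas_self[OF c] chart_subset[OF c] u]])
  moreover have "R.\<alpha>0 u \<bullet> R.\<alpha>0 u > 0" using R.nonumbilic[OF u] by (simp only: inner_gt_zero_iff) simp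
  moreover have "s * (2 * s * a) = 2 * a" for a using s by algebra
  ultimately show ?thesis by (metis mult_pos_pos zero_less_numeral)
qed

lemma M0_signed_opposite: "M0_signed A f (- s) = {}"
proof -
  have False if "p \<in> M0_signed A f (- s)" for p
  proof -
    have "\<exists>c\<in>A. p \<in> cdom c \<and> 0 \<le> - s * normal_curvature (in_chart c f) (cmap c p)"
      using that unfolding M0_signed_def by blast
    then obtain c where "c \<in> A" "p \<in> cdom c" "0 \<le> - s * normal_curvature (in_chart c f) (cmap c p)" by blast
    then show False using normal_curvature_sign[of c "cmap c p"] by auto
  qed
  then show ?thesis by blast
qed

text \<open>Every point is pseudo-umbilic with normal curvature of the sign of \<open>s\<close>.
  Isothermicity with the sign \<open>s\<close> itself is thus confined to an empty surface, where
  local statements hold vacuously.\<close>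

lemma M0_signed_same: assumes "M0_signed A f s = {}" shows "carrier A = {}"
proof -
  have False if p: "p \<in> carrier A" for p
  proof -
    obtain c where c: "c \<in> A" "p \<in> cdom c" using carrierE[OF p] .
    then have "0 \<le> s * normal_curvature (in_chart c f) (cmap c p)" using normal_curvature_sign[of c "cmap c p"] by auto
    moreover have "p \<in> M0 A f" using p sup by (simp add: superconformal_def)
    ultimately have "p \<in> M0_signed A f s" using c by (auto simp: M0_signed_def)
    then show False using assms by blast
  qed
  then show ?thesis by blast
qed

text \<open>The middle term to which each of the three conditions is shown equivalent. It ranges
  over all frames because the definition of isothermicity does so.\<close>

definition closed_mixed_forms :: bool
  where "closed_mixed_forms \<longleftrightarrow> (\<forall>c\<in>A. \<forall>D e1 e2. iso_surf s (in_chart c f) D e1 e2 \<and> D \<subseteq> cmap c ` cdom c \<longrightarrow>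
    (\<forall>u\<in>D. \<forall>v w. ext_deriv (iso_surf.star\<Omega> s (in_chart c f) e1 e2) u v w = 0))"

lemma isothermic_sign_iff: "isotropically_isothermic_sign A f (- s) \<longleftrightarrow> closed_mixed_forms"
proof
  assume L: "isotropically_isothermic_sign A f (- s)"
  show closed_mixed_forms unfolding closed_mixed_forms_def
  proof (intro ballI allI impI, elim conjE)
    fix c D e1 e2 u v w
    assume c: "c \<in> A" and i: "iso_surf s (in_chart c f) D e1 e2" and D: "D \<subseteq> cmap c ` cdom c" and u: "u \<in> D"
    interpret R: iso_surf s "in_chart c f" D e1 e2 by (rule i)
    show "ext_deriv R.star\<Omega> u v w = 0"
      using L c D u R.open_D R.smooth_e R.frames R.ext_deriv_eq[OF u]
      unfolding isotropically_isothermic_sign_def Let_def by metis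
  qed
next
  assume closed: closed_mixed_forms
  show "isotropically_isothermic_sign A f (- s)"
    unfolding isotropically_isothermic_sign_def Let_def
  proof (intro conjI M0_signed_opposite ballI allI impI, elim conjE)
    fix c D e1 e2 u v w
    assume c: "c \<in> A" and D: "open D" "D \<subseteq> cmap c ` cdom c" and e: "smooth_on D e1" "smooth_on D e2"
      and fr: "\<forall>u\<in>D. pos_tangent_frame (in_chart c f) u (e1 u) (e2 u)" and u: "u \<in> D"
    have "framed_surf s (in_chart c f) D e1 e2"
      using s D e fr smooth_on_subset[OF F_smooth[OF c] D(2)]
      by (intro framed_surf.intro quat.intro smooth_surf.intro framed_surf_axioms.intro) auto
    then have i: "iso_surf s (in_chart c f) D e1 e2" by (rule iso[OF c _ D(2)])
    then interpret R: iso_surf s "in_chart c f" D e1 e2 .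
    show "ext_deriv (hodge_star (in_chart c f) (mixed_form (in_chart c f) (- s) e1 e2)) u v w = 0"
      unfolding R.ext_deriv_eq[OF u] using closed c D(2) u i unfolding closed_mixed_forms_def by blast
  qed
qed

lemma isothermic_iff: "isotropically_isothermic A f \<longleftrightarrow> closed_mixed_forms"
proof -
  have "isotropically_isothermic A f \<longleftrightarrow> isotropically_isothermic_sign A f s \<or> isotropically_isothermic_sign A f (- s)"
    using s_cases by (auto simp: isotropically_isothermic_def)
  moreover have closed_mixed_forms if "isotropically_isothermic_sign A f s"
  proof -
    have "carrier A = {}" using that M0_signed_same by (simp add: isotropically_isothermic_sign_def)
    then have "cdom c = {}" if "c \<in> A" for c using chart_subset[OF that] by blast
    then show ?thesis unfolding closed_mixed_forms_def by auto
  qed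
  ultimately show ?thesis using isothermic_sign_iff by blast
qed

lemma gauss_lift_holomorphic_iff:
  assumes "t = 1 \<or> t = - 1" "p \<in> carrier A" shows "gauss_lift_holomorphic A f t \<longleftrightarrow> t = s"
proof
  assume g: "gauss_lift_holomorphic A f t"
  then have "hol t p" by (auto simp: gauss_lift_holomorphic_def hol_def)
  then show "t = s" using assms s_cases hol_s[OF assms(2)] hol_cases(2)[OF assms(2)] by auto
next
  assume "t = s"
  then show "gauss_lift_holomorphic A f t"
    unfolding gauss_lift_holomorphic_def using holomorphic_at(1)[OF atlas_self chart_subset] by blast
qed

end

section \<open>From a deformation to closed mixed forms\<close>

context signed_surface
begin

lemma local_frame:
  assumes c: "c \<in> A" and D: "open D" "D \<subseteq> cmap c ` cdom c" and u: "u \<in> D"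
  obtains r e1 e2 where "r > 0" "ball u r \<subseteq> D" "iso_surf s (in_chart c f) (ball u r) e1 e2"
proof -
  obtain e1 e2 where fr: "framed_surf s (in_chart c f) (cmap c ` cdom c) e1 e2" by (rule chart_frame[OF c s])
  obtain r where r: "r > 0" "ball u r \<subseteq> D" using D(1) u by (rule openE)
  then have "ball u r \<subseteq> cmap c ` cdom c" using D(2) by (rule_tac order_trans)
  then have "iso_surf s (in_chart c f) (ball u r) e1 e2"
    by (intro iso c framed_surf.restrict[OF fr] open_ball)
  with r show ?thesis by (rule that)
qed

text \<open>The condition \<open>dual_map\<close> mentions no frame. A dual map found with a
  convenient frame therefore serves for an arbitrary frame on the common domain.\<close>

lemma closed_mixed_formsI:
  assumes "\<And>c u. c \<in> A \<Longrightarrow> u \<in> cmap c ` cdom c \<Longrightarrow> \<exists>D e1 e2 l. u \<in> D \<and> iso_surf s (in_chart c f) D e1 e2 \<and>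
    framed_surf.dual_map s (in_chart c f) D l \<and> (\<forall>W. open W \<and> W \<noteq> {} \<and> W \<subseteq> D \<longrightarrow> (\<exists>x\<in>W. \<exists>v. dir_deriv l x v \<noteq> 0))"
  shows closed_mixed_forms
  unfolding closed_mixed_forms_def
proof (intro ballI allI impI, elim conjE)
  fix c D e1 e2 u v w
  assume c: "c \<in> A" and i: "iso_surf s (in_chart c f) D e1 e2" and D: "D \<subseteq> cmap c ` cdom c" and u: "u \<in> D"
  interpret R: iso_surf s "in_chart c f" D e1 e2 by (rule i)
  obtain D1 a1 a2 l where u1: "u \<in> D1" and i1: "iso_surf s (in_chart c f) D1 a1 a2" and l: "framed_surf.dual_map s (in_chart c f) D1 l"
    and dense: "\<And>W. open W \<Longrightarrow> W \<noteq> {} \<Longrightarrow> W \<subseteq> D1 \<Longrightarrow> \<exists>x\<in>W. \<exists>v. dir_deriv l x v \<noteq> 0"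
    using assms[OF c subsetD[OF D u]] by (elim exE conjE) simp
  interpret R1: iso_surf s "in_chart c f" D1 a1 a2 by (rule i1)
  interpret S: iso_surf s "in_chart c f" "D \<inter> D1" e1 e2
    by (rule R.iso_restrict) (auto intro: R.open_D R1.open_D)
  have "S.dual_map l"
    using l smooth_on_subset[of D1 l "D \<inter> D1"] unfolding S.dual_map_def R1.dual_map_def by simp
  then show "ext_deriv R.star\<Omega> u v w = 0"
    by (rule S.dual_map_imp_closed) (use dense u u1 in auto)
qed

theorem closed_of_deformation:
  assumes iii: "\<And>p. p \<in> carrier A \<Longrightarrow> \<exists>V T. open V \<and> p \<in> V \<and> V \<subseteq> carrier A \<and>
    bending_field_on A f V T \<and> nontrivial_on f V T \<and> (\<exists>t\<in>{1, - 1}. preserves_gauss_lift_holomorphicity A f V T t)"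
  shows closed_mixed_forms
proof (rule closed_mixed_formsI)
  fix c u assume c: "c \<in> A" and u: "u \<in> cmap c ` cdom c"
  let ?F = "in_chart c f"
  obtain p where p: "p \<in> cdom c" "u = cmap c p" using u by blast
  have pA: "p \<in> carrier A" using p c by (auto simp: carrier_def)
  have ic: "is_chart c" by (rule chart[OF c])
  obtain V T t where V: "open V" "p \<in> V" and bend: "bending_field_on A f V T" and nt: "nontrivial_on f V T"
    and t: "t = 1 \<or> t = - 1" "preserves_gauss_lift_holomorphicity A f V T t"
    using iii[OF pA] by blast
  \<comment> \<open>Without umbilics only one Gauss lift is holomorphic, so the sign in the
    hypothesis is the sign \<open>s\<close> of the surface.\<close>
  have "t = s"
    using t(2) gauss_lift_holomorphic_iff[OF t(1) pA] by (simp add: preserves_gauss_lift_holomorphicity_def)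
  define S where "S = cmap c ` (cdom c \<inter> V)"
  have S: "open S" "S \<subseteq> cmap c ` cdom c" "u \<in> S"
    unfolding S_def using chart_image_open[OF ic V(1)] p V(2) by auto
  obtain r e1 e2 where r: "r > 0" "ball u r \<subseteq> S" and i: "iso_surf s ?F (ball u r) e1 e2"
    using local_frame[OF c S] by blast
  interpret R: iso_surf s ?F "ball u r" e1 e2 by (rule i)
  have sT: "smooth_on (ball u r) (in_chart c T)"
    using bend c r(2) smooth_on_subset[of S] unfolding bending_field_on_def smooth_map_on_def S_def by blast
  obtain w0 l where l: "R.dual_map l" "w0 \<bullet> quat_one = 0"
    and dT: "\<And>x v. x \<in> ball u r \<Longrightarrow> dir_deriv (in_chart c T) x v = w0 \<odot> dir_deriv ?F x v + dir_deriv ?F x v \<odot> l x"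
  proof (rule R.bending_rotation[OF convex_ball sT])
    fix x v w assume "x \<in> ball u r"
    then have x: "x \<in> cmap c ` (cdom c \<inter> V)" using r(2) unfolding S_def by (rule subsetD[rotated])
    show "dir_deriv (in_chart c T) x v \<bullet> dir_deriv ?F x w + dir_deriv ?F x v \<bullet> dir_deriv (in_chart c T) x w = 0"
      using bend c x unfolding bending_field_on_def by blast
    have "((\<lambda>t. gauss_lift_metric (in_chart c (deform f T t)) s 1 x v w) has_real_derivative 0) (at 0)"
      using t(2) c x unfolding preserves_gauss_lift_holomorphicity_def \<open>t = s\<close> by blast
    then show "((\<lambda>t. gauss_lift_metric (\<lambda>x. ?F x + t *\<^sub>R in_chart c T x) s 1 x v w) has_real_derivative 0) (at 0)"
      unfolding deform_def .
  qed blast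
  \<comment> \<open>If dl vanished on an open set, \<open>bending_trivial\<close> would make the
    bending field trivial on the preimage of a ball, against nontriviality.\<close>
  have "\<exists>x\<in>W. \<exists>v. dir_deriv l x v \<noteq> 0" if W: "open W" "W \<noteq> {}" "W \<subseteq> ball u r" for W
  proof (rule ccontr)
    assume "\<not> (\<exists>x\<in>W. \<exists>v. dir_deriv l x v \<noteq> 0)"
    then have z: "dir_deriv l x v = 0" if "x \<in> W" for x v using that by blast
    obtain x where x: "x \<in> W" using W(2) by blast
    obtain e where e: "e > 0" "ball x e \<subseteq> W" using W(1) x by (rule openE)
    have sub: "ball x e \<subseteq> ball u r" using e(2) W(3) by (rule order_trans)
    have "\<exists>(B::real^4^4) b. transpose B = - B \<and> (\<forall>y\<in>ball x e. in_chart c T y = B *v ?F y + b)"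
    proof (rule R.bending_trivial[OF open_ball convex_ball sub sT _ _ l(2) dT])
      show "smooth_on (ball u r) l" "\<And>y. y \<in> ball u r \<Longrightarrow> l y \<bullet> quat_one = 0" using l(1) by (simp_all add: R.dual_map_def)
      show "dir_deriv l y v = 0" if "y \<in> ball x e" for y v using z e(2) that by blast
    qed
    then obtain B :: "real^4^4" and b where B: "transpose B = - B" "\<And>y. y \<in> ball x e \<Longrightarrow> in_chart c T y = B *v ?F y + b"
      by blast
    define W' where "W' = {q \<in> cdom c. cmap c q \<in> ball x e}"
    have "open W'" unfolding W'_def by (rule chart_preimage_open[OF ic open_ball])
    have "x \<in> cmap c ` cdom c" using x W(3) r(2) S(2) by blast
    then have "W' \<noteq> {}" using e(1) unfolding W'_def by fastforce
    have "q \<in> V" if "q \<in> W'" for q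
    proof -
      have q: "q \<in> cdom c" "cmap c q \<in> cmap c ` (cdom c \<inter> V)" using that sub r(2) unfolding W'_def S_def by blast+
      then show ?thesis using chart_props(4)[OF ic] by (auto dest: inj_onD)
    qed
    then have "W' \<subseteq> V" by blast
    moreover have "trivial_on f W' T"
      unfolding trivial_on_def
    proof (intro exI conjI ballI)
      show "transpose B = - B" by (rule B(1))
      fix q assume "q \<in> W'"
      then have q: "q \<in> cdom c" "cmap c q \<in> ball x e" unfolding W'_def by blast+
      then show "T q = B *v f q + b" using B(2)[OF q(2)] unfolding chart_props(5)[OF ic q(1)] by blast
    qed
    ultimately show False using nt \<open>open W'\<close> \<open>W' \<noteq> {}\<close> unfolding nontrivial_on_def by blast
  qed
  then show "\<exists>D e1 e2 l. u \<in> D \<and> iso_surf s ?F D e1 e2 \<and> framed_surf.dual_map s ?F D l \<and>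
    (\<forall>W. open W \<and> W \<noteq> {} \<and> W \<subseteq> D \<longrightarrow> (\<exists>x\<in>W. \<exists>v. dir_deriv l x v \<noteq> 0))"
    using i l(1) r(1) by (intro exI[of _ "ball u r"] exI[of _ e1] exI[of _ e2] exI[of _ l]) simp
qed

end

section \<open>From mean-directional coordinates to closed mixed forms\<close>

context framed_surf
begin

lemma dual_map_reparam:
  assumes l: "dual_map l" and g: "reparam F D G S g" and fr: "framed_surf s G S a1 a2"
  shows "framed_surf.dual_map s G S (\<lambda>x. l (g x))"
proof -
  interpret Q: reparam F D G S g by (rule g)
  interpret R: framed_surf s G S a1 a2 by (rule fr)
  have sl: "smooth_on D l" using l by (simp add: dual_map_def)
  show ?thesis
    unfolding R.dual_map_def
  proof (intro conjI ballI allI)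
    show "smooth_on S (\<lambda>x. l (g x))" by (rule Q.smooth_comp[OF sl])
    fix x assume x: "x \<in> S"
    show "l (g x) \<bullet> quat_one = 0" using l Q.gT[OF x] by (simp add: dual_map_def)
    show "dir_deriv G x v \<odot> dir_deriv (\<lambda>x. l (g x)) x w = dir_deriv G x w \<odot> dir_deriv (\<lambda>x. l (g x)) x v" for v w
      using l Q.gT[OF x] by (simp add: Q.deriv_G[OF x] Q.deriv_comp[OF sl x] dual_map_def)
  qed
qed

end

context reparam
begin

lemma conformal_frame:
  assumes s: "s * s = 1" and conf: "\<And>u. u \<in> S \<Longrightarrow> metric G u dx dx = metric G u dy dy" "\<And>u. u \<in> S \<Longrightarrow> metric G u dx dy = 0"
  obtains \<kappa> where "smooth_on S \<kappa>" "\<And>u. u \<in> S \<Longrightarrow> \<kappa> u > 0" "framed_surf s G S (\<lambda>u. \<kappa> u *\<^sub>R dx) (\<lambda>u. \<kappa> u *\<^sub>R dy)"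
proof -
  define \<kappa> where "\<kappa> u = inverse (norm (dir_deriv G u dx))" for u
  have nz: "dir_deriv G u dx \<noteq> 0" if "u \<in> S" for u
  proof
    assume "dir_deriv G u dx = 0"
    then have "dx = (0 :: real^2)"
      using inj_G[OF that] smooth_on_linear_deriv[OF smooth_G that] by (metis linear_injective_0)
    then show False by (simp add: axis_eq_0_iff)
  qed
  have pos: "\<kappa> u > 0" if "u \<in> S" for u using nz[OF that] by (simp add: \<kappa>_def)
  have sm: "smooth_on S \<kappa>"
    unfolding \<kappa>_def
    by (intro smooth_on_inverse smooth_on_norm smooth_on_dir_deriv smooth_G open_S) (use nz in auto)
  have k2: "\<kappa> u * \<kappa> u * metric G u dx dx = 1" if "u \<in> S" for u
    using nz[OF that] by (simp add: \<kappa>_def metric_def dot_square_norm power2_eq_square field_simps)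
  have m: "metric G u (a *\<^sub>R v) (b *\<^sub>R w) = a * b * metric G u v w" if "u \<in> S" for u a b v w
    by (simp add: metric_def linear_scale[OF smooth_on_linear_deriv[OF smooth_G that]])
  have fr: "framed_surf s G S (\<lambda>u. \<kappa> u *\<^sub>R dx) (\<lambda>u. \<kappa> u *\<^sub>R dy)"
  proof (intro framed_surf.intro quat.intro smooth_surf.intro framed_surf_axioms.intro s open_S smooth_G)
    show "smooth_on S (\<lambda>u. \<kappa> u *\<^sub>R dx)" "smooth_on S (\<lambda>u. \<kappa> u *\<^sub>R dy)"
      by (intro smooth_on_scaleR sm smooth_on_const open_S)+
    fix u assume u: "u \<in> S"
    have "0 < det (vector [\<kappa> u *\<^sub>R dx, \<kappa> u *\<^sub>R dy] :: real^2^2)"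
      using pos[OF u] by (simp add: det_2_rows axis_def)
    then show "pos_tangent_frame G u (\<kappa> u *\<^sub>R dx) (\<kappa> u *\<^sub>R dy)"
      unfolding pos_tangent_frame_def m[OF u] using k2[OF u] conf[OF u] by simp
  qed
  show ?thesis by (rule that[OF sm pos fr])
qed

end

text \<open>The definition is read at parameter 0, where the velocity of the coordinate line is
  \<open>d\<close>; uniqueness of the derivative makes \<open>d\<close> a multiple of
  \<open>X\<close>.\<close>

lemma mean_directional_coordinate_line:
  assumes "mean_directional_curvature_line G (\<lambda>\<tau>. u + \<tau> *\<^sub>R d) {\<tau>. u + \<tau> *\<^sub>R d \<in> S}" "u \<in> S"
  obtains X k where "second_ff G u X X \<in> span {mean_curv G u}" "d = k *\<^sub>R X"
proof -
  have "(0::real) \<in> {\<tau>. u + \<tau> *\<^sub>R d \<in> S}" using assms(2) by simp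
  with assms(1) obtain X k where "second_ff G (u + 0 *\<^sub>R d) X X \<in> span {mean_curv G (u + 0 *\<^sub>R d)}"
    and d: "((\<lambda>\<tau>. u + \<tau> *\<^sub>R d) has_vector_derivative k *\<^sub>R X) (at 0)"
    unfolding mean_directional_curvature_line_def by blast
  then have X: "second_ff G u X X \<in> span {mean_curv G u}" by simp
  note d
  moreover have "((\<lambda>\<tau>. u + \<tau> *\<^sub>R d) has_vector_derivative d) (at 0)"
    by (auto intro!: derivative_eq_intros)
  ultimately have "d = k *\<^sub>R X" by (blast intro: vector_derivative_unique_at)
  with X show ?thesis by (rule that)
qed

context signed_surface
begin

text \<open>Both coordinate directions have normal curvature vectors parallel to \<open>H\<close>,
  hence so is \<alpha>0, and \<open>dual_map_of_mean_directional\<close> applies on a ball of the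
  chart \<open>z\<close>. The dual map found there is pulled back to the atlas chart
  \<open>c\<close>, in which closedness is claimed.\<close>

theorem closed_of_parametrization:
  assumes ii: "\<And>p. p \<in> carrier A \<Longrightarrow> \<exists>z. p \<in> cdom z \<and> conformal_mean_directional_parametrization A f z"
  shows closed_mixed_forms
proof (rule closed_mixed_formsI)
  fix c u assume c: "c \<in> A" and u: "u \<in> cmap c ` cdom c"
  let ?F = "in_chart c f"
  obtain p where p: "p \<in> cdom c" "u = cmap c p" using u by blast
  have pA: "p \<in> carrier A" using p c by (auto simp: carrier_def)
  have ic: "is_chart c" by (rule chart[OF c])
  obtain z where pz: "p \<in> cdom z" and z: "conformal_mean_directional_parametrization A f z" using ii[OF pA] by blast
  have zA: "cdom z \<subseteq> carrier A" "oriented_atlas (insert z A)"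
    and conf: "\<And>x. x \<in> cmap z ` cdom z \<Longrightarrow> metric (in_chart z f) x dx dx = metric (in_chart z f) x dy dy"
      "\<And>x. x \<in> cmap z ` cdom z \<Longrightarrow> metric (in_chart z f) x dx dy = 0"
    using z unfolding conformal_mean_directional_parametrization_def complex_chart_def by blast+
  have line: "mean_directional_curvature_line (in_chart z f) (\<lambda>\<tau>. x + \<tau> *\<^sub>R d) {\<tau>. x + \<tau> *\<^sub>R d \<in> cmap z ` cdom z}"
    if "x \<in> cmap z ` cdom z" "d = dx \<or> d = dy" for x d
    using z that unfolding conformal_mean_directional_parametrization_def by blast
  have iz: "is_chart z" using zA(2) by (simp add: oriented_atlas_def)
  let ?G = "in_chart z f"
  define S where "S = cmap z ` (cdom z \<inter> cdom c)"
  have Sz: "x \<in> cmap z ` cdom z" if "x \<in> S" for x using that unfolding S_def by blast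
  interpret R: reparam ?F "cmap c ` cdom c" ?G S "in_chart z (cmap c)"
    unfolding S_def by (rule transition[OF zA(2) c])
  obtain \<kappa> where \<kappa>: "smooth_on S \<kappa>" "\<And>u. u \<in> S \<Longrightarrow> \<kappa> u > 0" and fr: "framed_surf s ?G S (\<lambda>u. \<kappa> u *\<^sub>R dx) (\<lambda>u. \<kappa> u *\<^sub>R dy)"
    using R.conformal_frame[OF s conf[OF Sz]] by blast
  have "iso_surf s ?G S (\<lambda>u. \<kappa> u *\<^sub>R dx) (\<lambda>u. \<kappa> u *\<^sub>R dy)"
    by (rule framed_surf.iso_surfI[OF fr]) (erule holomorphic_at[OF zA(2,1) Sz])+
  then interpret I: iso_surf s ?G S "\<lambda>u. \<kappa> u *\<^sub>R dx" "\<lambda>u. \<kappa> u *\<^sub>R dy" .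
  have par: "\<exists>k. I.\<alpha>0 x = k *\<^sub>R I.H x" if x: "x \<in> S" for x
  proof -
    interpret P: surf_frame_at ?G S x "\<kappa> x *\<^sub>R dx" "\<kappa> x *\<^sub>R dy" by (rule I.at'(1)[OF x])
    have sp: "second_ff ?G x (\<kappa> x *\<^sub>R d) (\<kappa> x *\<^sub>R d) \<in> span {I.H x}" if d: "d = dx \<or> d = dy" for d
    proof -
      obtain X k where X: "second_ff ?G x X X \<in> span {I.H x}" and dX: "d = k *\<^sub>R X"
        using mean_directional_coordinate_line[OF line[OF Sz[OF x] d] Sz[OF x]] .
      show ?thesis unfolding dX P.second_ff_lin by (intro span_scale X)
    qed
    have "I.\<alpha>0 x \<in> span {I.H x}" by (intro span_scale span_diff sp) auto
    then show ?thesis by (auto simp: span_singleton)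
  qed
  have pS: "cmap z p \<in> S" unfolding S_def using p pz by blast
  obtain r where r: "r > 0" "ball (cmap z p) r \<subseteq> S" using R.open_S pS by (rule openE)
  let ?B = "ball (cmap z p) r"
  have iB: "iso_surf s ?G ?B (\<lambda>u. \<kappa> u *\<^sub>R dx) (\<lambda>u. \<kappa> u *\<^sub>R dy)"
    by (rule I.iso_restrict[OF open_ball r(2)])
  then interpret B: iso_surf s ?G ?B "\<lambda>u. \<kappa> u *\<^sub>R dx" "\<lambda>u. \<kappa> u *\<^sub>R dy" .
  have pB: "cmap z p \<in> ?B" using r(1) by simp
  obtain l where l: "B.dual_map l" "\<And>x. x \<in> ?B \<Longrightarrow> \<exists>v. dir_deriv l x v \<noteq> 0"
    using B.dual_map_of_mean_directional[OF convex_ball pB smooth_on_subset[OF \<kappa>(1) r(2)] \<kappa>(2)[OF subsetD[OF r(2)]] refl refl par[OF subsetD[OF r(2)]]]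
    by blast
  define V where "V = {q \<in> cdom z. cmap z q \<in> ?B}"
  define D where "D = cmap c ` (cdom c \<inter> V)"
  have oD: "open D" unfolding D_def V_def by (intro chart_image_open ic chart_preimage_open iz open_ball)
  have Dc: "D \<subseteq> cmap c ` (cdom c \<inter> cdom z)" unfolding D_def V_def by blast
  have uD: "u \<in> D" unfolding D_def V_def using p pz pB by blast
  have Dsub: "D \<subseteq> cmap c ` cdom c" using Dc by blast
  obtain e1 e2 where fr2: "framed_surf s ?F (cmap c ` cdom c) e1 e2" by (rule chart_frame[OF c s])
  have iD: "iso_surf s ?F D e1 e2" by (intro iso c framed_surf.restrict[OF fr2] oD Dsub)
  then interpret E: iso_surf s ?F D e1 e2 .
  have Q: "reparam ?G ?B ?F D (in_chart c (cmap z))"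
  proof
    show "open D" "open ?B" by (rule oD) (rule open_ball)
    show "smooth_on ?B ?G" by (rule smooth_on_subset[OF R.smooth_G r(2)])
    show "smooth_on D (in_chart c (cmap z))"
      using zA(2) c smooth_on_subset[OF _ Dc] unfolding oriented_atlas_def by blast
    show "in_chart c (cmap z) ` D \<subseteq> ?B"
      unfolding D_def V_def using chart_props(5)[OF ic] by auto
    show "?F x = ?G (in_chart c (cmap z) x)" if "x \<in> D" for x
      using that chart_props(5)[OF ic] chart_props(5)[OF iz] unfolding D_def V_def by auto
    show "0 < det (matrix (frechet_derivative (in_chart c (cmap z)) (at x)))" if "x \<in> D" for x
      using zA(2) c that Dc unfolding oriented_atlas_def by blast
    show "inj (frechet_derivative ?G (at x))" if "x \<in> ?B" for x
      by (rule R.inj_G[OF subsetD[OF r(2) that]])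
  qed
  then interpret Q: reparam ?G ?B ?F D "in_chart c (cmap z)" .
  have dl: "framed_surf.dual_map s ?F D (\<lambda>x. l (in_chart c (cmap z) x))"
    by (rule B.dual_map_reparam[OF l(1) Q E.framed_surf_axioms])
  have "\<exists>v. dir_deriv (\<lambda>x. l (in_chart c (cmap z) x)) x v \<noteq> 0" if x: "x \<in> D" for x
  proof -
    have sl: "smooth_on ?B l" using l(1) by (simp add: B.dual_map_def)
    obtain w where "dir_deriv l (in_chart c (cmap z) x) w \<noteq> 0" using l(2)[OF Q.gT[OF x]] by blast
    moreover obtain v where "dir_deriv (in_chart c (cmap z)) x v = w" by (rule Q.surj_g[OF x])
    ultimately show ?thesis using Q.deriv_comp[OF sl x] by metis
  qed
  then have "\<forall>W. open W \<and> W \<noteq> {} \<and> W \<subseteq> D \<longrightarrow> (\<exists>x\<in>W. \<exists>v. dir_deriv (\<lambda>x. l (in_chart c (cmap z) x)) x v \<noteq> 0)"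
    by (meson ex_in_conv subsetD)
  with uD iD dl show "\<exists>D e1 e2 l. u \<in> D \<and> iso_surf s ?F D e1 e2 \<and> framed_surf.dual_map s ?F D l \<and>
    (\<forall>W. open W \<and> W \<noteq> {} \<and> W \<subseteq> D \<longrightarrow> (\<exists>x\<in>W. \<exists>v. dir_deriv l x v \<noteq> 0))"
    by (intro exI conjI)
qed

end

section \<open>From closed mixed forms to mean-directional coordinates\<close>

context iso_surf
begin

text \<open>The curvature ellipse is a circle, so rotating a frame by \<open>\<theta>\<close> rotates \<open>\<alpha>0\<close> by \<open>2\<theta>\<close>.  With \<open>P = H \<bullet> \<alpha>0\<close>, \<open>Q = H \<bullet> \<alpha>12\<close>
  and \<open>M = sqrt (P\<^sup>2 + Q\<^sup>2)\<close> half the angle of \<open>P + i Q\<close> is that of \<open>M + P + i Q\<close>; passing to \<open>- P - i Q\<close> where necessary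
  keeps the latter away from \<open>0\<close>.\<close>

lemma mean_directional_frame:
  assumes u: "u \<in> D"
  obtains r a1 a2 where "r > 0" "ball u r \<subseteq> D" "iso_surf s F (ball u r) a1 a2"
    "\<And>x. x \<in> ball u r \<Longrightarrow> \<exists>k. (1/2) *\<^sub>R (second_ff F x (a1 x) (a1 x) - second_ff F x (a2 x) (a2 x)) = k *\<^sub>R H x"
proof -
  define A where "A x = \<alpha>0 x" for x
  define B where "B x = \<alpha>12 x" for x
  define P where "P x = H x \<bullet> A x" for x
  define Q where "Q x = H x \<bullet> B x" for x
  define M where "M x = sqrt (P x * P x + Q x * Q x)" for x
  define \<epsilon> :: real where "\<epsilon> = (if P u \<ge> 0 then 1 else - 1)"
  define X where "X x = M x + \<epsilon> * P x" for x
  define Y where "Y x = \<epsilon> * Q x" for x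
  define n where "n x = sqrt (X x * X x + Y x * Y x)" for x
  have \<epsilon>: "\<epsilon> * \<epsilon> = 1" "\<epsilon> * P u \<ge> 0" by (simp_all add: \<epsilon>_def)
  have Hexp: "(A x \<bullet> A x) *\<^sub>R H x = P x *\<^sub>R A x + Q x *\<^sub>R B x" and BN: "B x = Nf x \<odot> A x" and A0: "A x \<noteq> 0" if x: "x \<in> D" for x
  proof -
    interpret R: quat_plane s "E1 x" "Nf x" by (rule plane[OF x])
    show BN: "B x = Nf x \<odot> A x" unfolding A_def B_def by (rule iso[OF x])
    show "A x \<noteq> 0" unfolding A_def by (rule nonumbilic[OF x])
    have "R.normal (A x)" "R.normal (H x)" unfolding A_def using \<alpha>0_nrm[OF x] H_nrm[OF x] normal_iff[OF x] by blast+
    then show "(A x \<bullet> A x) *\<^sub>R H x = P x *\<^sub>R A x + Q x *\<^sub>R B x"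
      unfolding P_def Q_def BN by (rule R.normal_expand)
  qed
  have pos: "P x * P x + Q x * Q x > 0" if x: "x \<in> D" for x
  proof (rule ccontr)
    assume "\<not> ?thesis"
    then have "P x = 0 \<and> Q x = 0" using sum_squares_gt_zero_iff[of "P x" "Q x"] by blast
    then have "(A x \<bullet> A x) *\<^sub>R H x = 0" using Hexp[OF x] by simp
    then show False using A0[OF x] H0[OF x] by simp
  qed
  have M: "M x > 0" "M x * M x = P x * P x + Q x * Q x" if "x \<in> D" for x
    using pos[OF that] by (simp_all add: M_def)
  have sA: "smooth_on D A" "smooth_on D B" "smooth_on D H"
  proof -
    show "smooth_on D A" unfolding A_def by (intro smooth_on_scaleR smooth_on_diff smooth_on_const smooth_\<alpha> open_D)
    show "smooth_on D B" unfolding B_def by (rule smooth_\<alpha>)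
    have "smooth_on D (\<lambda>x. (1/2) *\<^sub>R (\<alpha>11 x + \<alpha>22 x))" by (intro smooth_on_scaleR smooth_on_add smooth_on_const smooth_\<alpha> open_D)
    then show "smooth_on D H" using smooth_on_cong[OF open_D, of H "\<lambda>x. (1/2) *\<^sub>R (\<alpha>11 x + \<alpha>22 x)", OF mean_curv_eq] by blast
  qed
  have sP: "smooth_on D P" "smooth_on D Q"
    unfolding P_def Q_def by (intro smooth_on_inner sA open_D)+
  have sM: "smooth_on D M"
    unfolding M_def by (intro smooth_on_sqrt smooth_on_add smooth_on_mult sP open_D pos)
  have sX: "smooth_on D X" "smooth_on D Y"
    unfolding X_def Y_def by (intro smooth_on_add smooth_on_mult smooth_on_const sP sM open_D)+
  have "open (D \<inter> X -` {0<..})"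
    by (rule continuous_open_preimage[OF smooth_on_continuous[OF sX(1)] open_D open_greaterThan])
  moreover have "u \<in> D \<inter> X -` {0<..}" using u M(1)[OF u] \<epsilon>(2) by (simp add: X_def)
  ultimately obtain r where r: "r > 0" "ball u r \<subseteq> D \<inter> X -` {0<..}" by (rule openE)
  let ?B = "ball u r"
  have BD: "?B \<subseteq> D" using r(2) by blast
  have X0: "X x > 0" if "x \<in> ?B" for x using r(2) that by blast
  have n: "n x > 0" "n x * n x = X x * X x + Y x * Y x" if "x \<in> ?B" for x
  proof -
    have "X x * X x + Y x * Y x > 0" using X0[OF that] by (simp add: add_pos_nonneg)
    then show "n x > 0" "n x * n x = X x * X x + Y x * Y x" by (simp_all add: n_def)
  qed
  define c where "c x = X x / n x" for x
  define d where "d x = Y x / n x" for x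
  have cd: "c x * c x + d x * d x = 1" if "x \<in> ?B" for x
  proof -
    have "c x * c x + d x * d x = (X x * X x + Y x * Y x) / (n x * n x)"
      by (simp add: c_def d_def add_divide_distrib)
    then show ?thesis using n[OF that] by (metis divide_self mult_pos_pos less_irrefl)
  qed
  have sn: "smooth_on ?B n"
    unfolding n_def
    by (intro smooth_on_sqrt smooth_on_add smooth_on_mult smooth_on_subset[OF sX(1) BD] smooth_on_subset[OF sX(2) BD] open_ball)
      (use X0 in \<open>simp add: add_pos_nonneg\<close>)
  have scd: "smooth_on ?B c" "smooth_on ?B d"
    unfolding c_def d_def
    by (intro smooth_on_divide smooth_on_subset[OF sX(1) BD] smooth_on_subset[OF sX(2) BD] sn open_ball; use n(1) in force)+
  define a1 where "a1 x = c x *\<^sub>R e1 x + d x *\<^sub>R e2 x" for x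
  define a2 where "a2 x = (- d x) *\<^sub>R e1 x + c x *\<^sub>R e2 x" for x
  interpret R: framed_surf s F ?B e1 e2 by (rule restrict[OF open_ball BD])
  have "framed_surf s F ?B a1 a2"
  proof (intro framed_surf.intro quat.intro smooth_surf.intro framed_surf_axioms.intro s open_ball R.smooth_F)
    show "smooth_on ?B a1" "smooth_on ?B a2"
      unfolding a1_def a2_def by (intro smooth_on_add smooth_on_scaleR smooth_on_minus scd R.smooth_e open_ball)+
    show "pos_tangent_frame F x (a1 x) (a2 x)" if "x \<in> ?B" for x
      unfolding a1_def a2_def by (rule tangent_frame.rotated_frame[OF R.at'(3)[OF that] cd[OF that]])
  qed
  moreover have "gauss_lift_holomorphic_at F s x" "\<not> umbilic_at F x" if "x \<in> D" for x
    using holomorphic_iff[OF that] iso[OF that] umbilic_iff[OF that] nonumbilic[OF that] by blast+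
  ultimately have i: "iso_surf s F ?B a1 a2"
    by (rule framed_surf.iso_surfI) (use BD H0 in blast)+
  have par: "\<exists>k. (1/2) *\<^sub>R (second_ff F x (a1 x) (a1 x) - second_ff F x (a2 x) (a2 x)) = k *\<^sub>R H x" if x: "x \<in> ?B" for x
  proof -
    have xD: "x \<in> D" using x BD by blast
    interpret S: surf_frame_at F D x "e1 x" "e2 x" by (rule at'(1)[OF xD])
    have "(1/2) *\<^sub>R (second_ff F x (a1 x) (a1 x) - second_ff F x (a2 x) (a2 x)) =
      (c x * c x - d x * d x) *\<^sub>R A x + (2 * c x * d x) *\<^sub>R B x"
      unfolding S.second_ff_rotated[OF a1_def a2_def] A_def B_def by (simp add: vec_eq_iff field_simps)
    \<comment> \<open>The half-angle identity: as M^2 = P^2 + Q^2, the complex square of X + i Y is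
      2 X times \<open>\<epsilon>\<close> (P + i Q).\<close>
    also have "c x * c x - d x * d x = (2 * \<epsilon> * X x / (n x * n x)) * P x"
    proof -
      have "X x * X x - Y x * Y x = M x * M x + 2 * \<epsilon> * M x * P x + (\<epsilon> * \<epsilon>) * (P x * P x) - (\<epsilon> * \<epsilon>) * (Q x * Q x)"
        unfolding X_def Y_def by algebra
      also have "\<dots> = 2 * (\<epsilon> * \<epsilon>) * (P x * P x) + 2 * \<epsilon> * M x * P x" unfolding M(2)[OF xD] \<epsilon>(1) by simp
      also have "\<dots> = 2 * \<epsilon> * X x * P x" unfolding X_def by algebra
      finally show ?thesis by (simp add: c_def d_def diff_divide_distrib[symmetric])
    qed
    also have "2 * c x * d x = (2 * \<epsilon> * X x / (n x * n x)) * Q x"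
      by (simp add: c_def d_def Y_def)
    also have "((2 * \<epsilon> * X x / (n x * n x)) * P x) *\<^sub>R A x + ((2 * \<epsilon> * X x / (n x * n x)) * Q x) *\<^sub>R B x
      = (2 * \<epsilon> * X x / (n x * n x)) *\<^sub>R (P x *\<^sub>R A x + Q x *\<^sub>R B x)" by (simp add: scaleR_add_right)
    also have "\<dots> = (2 * \<epsilon> * X x / (n x * n x) * (A x \<bullet> A x)) *\<^sub>R H x" unfolding Hexp[OF xD, symmetric] by simp
    finally show ?thesis by blast
  qed
  show ?thesis by (rule that[OF r(1) BD i par])
qed

end

lemma chart_compose:
  assumes c: "is_chart c" and U: "open U" "U \<subseteq> cmap c ` cdom c" and V: "open V" and h: "homeomorphism U V \<psi> g"
  defines "z \<equiv> ({p \<in> cdom c. cmap c p \<in> U}, \<lambda>p. \<psi> (cmap c p))"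
  shows "is_chart z" "cmap z ` cdom z = V" "\<And>v. v \<in> V \<Longrightarrow> cinv z v = cinv c (g v)"
proof -
  have P: "cdom z = {p \<in> cdom c. cmap c p \<in> U}" "cmap z = (\<lambda>p. \<psi> (cmap c p))" by (simp_all add: z_def)
  have gU: "g v \<in> U" "\<psi> (g v) = v" if "v \<in> V" for v using h that by (auto simp: homeomorphism_def)
  have gP: "cinv c (g v) \<in> cdom z" "cmap c (cinv c (g v)) = g v" if "v \<in> V" for v
  proof -
    have "g v \<in> cmap c ` cdom c" using gU(1)[OF that] U(2) by blast
    then show *: "cmap c (cinv c (g v)) = g v" by (rule f_inv_into_f)
    show "cinv c (g v) \<in> cdom z" unfolding P using inv_into_into[OF \<open>g v \<in> cmap c ` cdom c\<close>] gU(1)[OF that] * by simp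
  qed
  have im: "cmap z ` cdom z = V"
  proof (intro equalityI subsetI)
    fix v assume "v \<in> cmap z ` cdom z"
    then show "v \<in> V" using h unfolding P by (auto simp: homeomorphism_def)
  next
    fix v assume v: "v \<in> V"
    then have "v = cmap z (cinv c (g v))" using gP(2)[OF v] gU(2)[OF v] by (simp add: P)
    then show "v \<in> cmap z ` cdom z" using gP(1)[OF v] by (rule image_eqI)
  qed
  have inv: "cinv z (cmap z p) = p" if "p \<in> cdom z" for p
  proof (rule inv_into_f_f[OF inj_onI that])
    fix x y assume x: "x \<in> cdom z" "y \<in> cdom z" and "cmap z x = cmap z y"
    then have "g (\<psi> (cmap c x)) = g (\<psi> (cmap c y))" by (simp add: P)
    moreover have xc: "x \<in> cdom c" "y \<in> cdom c" "cmap c x \<in> U" "cmap c y \<in> U" using x by (simp_all add: P)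
    ultimately have "cmap c x = cmap c y" using h by (simp add: homeomorphism_def)
    then have "cinv c (cmap c x) = cinv c (cmap c y)" by (rule arg_cong)
    then show "x = y" by (simp only: chart_props(5)[OF c xc(1)] chart_props(5)[OF c xc(2)])
  qed
  show gi: "cinv z v = cinv c (g v)" if v: "v \<in> V" for v
    using inv[OF gP(1)[OF v]] gP(2)[OF v] gU(2)[OF v] by (simp add: P)
  have ci: "continuous_on (cmap c ` cdom c) (cinv c)" using c by (simp add: is_chart_def homeomorphism_def)
  have "homeomorphism (cdom z) V (cmap z) (cinv z)"
  proof (rule homeomorphismI)
    show "continuous_on (cdom z) (cmap z)"
      unfolding P
    proof (rule continuous_on_compose2[of U \<psi>])
      show "continuous_on U \<psi>" using h by (simp add: homeomorphism_def)
      show "continuous_on {p \<in> cdom c. cmap c p \<in> U} (cmap c)" by (rule continuous_on_subset[OF chart_props(3)[OF c]]) blast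
    qed blast
    have "continuous_on V (\<lambda>v. cinv c (g v))"
    proof (rule continuous_on_compose2[OF ci])
      show "continuous_on V g" using h by (simp add: homeomorphism_def)
      show "g ` V \<subseteq> cmap c ` cdom c" using gU(1) U(2) by (blast dest: subsetD)
    qed
    then show "continuous_on V (cinv z)" using gi by (simp cong: continuous_on_cong)
    show "cmap z ` cdom z \<subseteq> V" using im by blast
    show "cinv z ` V \<subseteq> cdom z" using gi gP(1) by auto
    show "cinv z (cmap z x) = x" if "x \<in> cdom z" for x by (rule inv[OF that])
    show "cmap z (cinv z v) = v" if "v \<in> V" for v using gi[OF that] gP(2)[OF that] gU(2)[OF that] by (simp add: P)
  qed
  moreover have "open (cdom z)" unfolding P by (rule chart_preimage_open[OF c U(1)])
  ultimately show "is_chart z" unfolding is_chart_def im using V by blast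
  show "cmap z ` cdom z = V" by (rule im)
qed

lemma det_compose:
  fixes g h :: "real^2 \<Rightarrow> real^2"
  assumes "smooth_on S g" "smooth_on T h" "u \<in> S" "g u \<in> T"
  shows "det (matrix (frechet_derivative (\<lambda>x. h (g x)) (at u))) =
    det (matrix (frechet_derivative h (at (g u)))) * det (matrix (frechet_derivative g (at u)))"
proof -
  have "frechet_derivative (\<lambda>x. h (g x)) (at u) = frechet_derivative h (at (g u)) \<circ> frechet_derivative g (at u)"
    using dir_deriv_compose[OF assms] by (simp add: fun_eq_iff)
  then show ?thesis
    using matrix_compose[OF smooth_on_linear_deriv[OF assms(1,3)] smooth_on_linear_deriv[OF assms(2,4)]]
    by (simp add: det_mul)
qed

lemma det_identity_on:
  assumes "open V" "v \<in> V" "\<And>x. x \<in> V \<Longrightarrow> h x = (x :: real^2)"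
  shows "det (matrix (frechet_derivative h (at v))) = 1"
proof -
  have "dir_deriv h v w = w" for w
    using dir_deriv_eqI_open[OF assms, where v = w] by (simp add: frechet_derivative_ident)
  then show ?thesis by (simp add: det_matrix_2 axis_def)
qed

context surface
begin

text \<open>Each transition between the new chart and an old one factors through the chart
  \<open>c\<close>, so smoothness and positive Jacobians come from the chain rule. The Jacobian of
  \<open>g\<close> is positive because \<psi> after \<open>g\<close> is the identity.\<close>

lemma atlas_insert:
  assumes c: "c \<in> A" and U: "open U" "U \<subseteq> cmap c ` cdom c" and V: "open V" and h: "homeomorphism U V \<psi> g"
    and sm: "smooth_on U \<psi>" "smooth_on V g" and dp: "\<And>x. x \<in> U \<Longrightarrow> det (matrix (frechet_derivative \<psi> (at x))) > 0"
  shows "oriented_atlas (insert ({p \<in> cdom c. cmap c p \<in> U}, \<lambda>p. \<psi> (cmap c p)) A)"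
proof -
  define z :: "'a chart" where "z = ({p \<in> cdom c. cmap c p \<in> U}, \<lambda>p. \<psi> (cmap c p))"
  have ic: "is_chart c" by (rule chart[OF c])
  note z = chart_compose[OF ic U V h, folded z_def]
  have P: "cdom z = {p \<in> cdom c. cmap c p \<in> U}" "cmap z = (\<lambda>p. \<psi> (cmap c p))" by (simp_all add: z_def)
  have gU: "g v \<in> U" "\<psi> (g v) = v" if "v \<in> V" for v using h that by (auto simp: homeomorphism_def)
  have cc: "cmap c (cinv c (g v)) = g v" if "v \<in> V" for v
    using gU(1)[OF that] U(2) by (intro f_inv_into_f) blast
  have dg: "det (matrix (frechet_derivative g (at v))) > 0" if v: "v \<in> V" for v
  proof -
    have "det (matrix (frechet_derivative (\<lambda>x. \<psi> (g x)) (at v))) = 1"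
      by (rule det_identity_on[OF V v gU(2)])
    then have "det (matrix (frechet_derivative \<psi> (at (g v)))) * det (matrix (frechet_derivative g (at v))) = 1"
      using det_compose[OF sm(2,1) v gU(1)[OF v]] by simp
    then show ?thesis using dp[OF gU(1)[OF v]] by (metis zero_less_mult_pos zero_less_one)
  qed
  have old: "smooth_on (cmap a ` (cdom a \<inter> cdom b)) (in_chart a (cmap b))"
    "\<And>u. u \<in> cmap a ` (cdom a \<inter> cdom b) \<Longrightarrow> 0 < det (matrix (frechet_derivative (in_chart a (cmap b)) (at u)))"
    if "a \<in> A" "b \<in> A" for a b
    using surf that unfolding immersed_surface_def oriented_atlas_def by blast+
  have zz: "smooth_on (cmap z ` (cdom z \<inter> cdom z)) (in_chart z (cmap z)) \<and>
    (\<forall>u\<in>cmap z ` (cdom z \<inter> cdom z). 0 < det (matrix (frechet_derivative (in_chart z (cmap z)) (at u))))"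
  proof -
    have "in_chart z (cmap z) v = v" if "v \<in> V" for v
      using z(3)[OF that] cc[OF that] gU(2)[OF that] by (simp add: P)
    then show ?thesis
      using smooth_on_cong[OF V, of "in_chart z (cmap z)" "\<lambda>x. x"] smooth_on_ident[OF V] det_identity_on[OF V, of _ "in_chart z (cmap z)"]
      by (simp add: z(2))
  qed
  have zd: "smooth_on (cmap z ` (cdom z \<inter> cdom d)) (in_chart z (cmap d)) \<and>
    (\<forall>u\<in>cmap z ` (cdom z \<inter> cdom d). 0 < det (matrix (frechet_derivative (in_chart z (cmap d)) (at u))))" if d: "d \<in> A" for d
  proof -
    let ?S = "cmap z ` (cdom z \<inter> cdom d)" and ?T = "cmap c ` (cdom c \<inter> cdom d)"
    have o: "open ?S" "open ?T" by (intro chart_image_open z ic chart_props(1) chart d)+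
    have SV: "?S \<subseteq> V" using z(2) by blast
    have im: "g ` ?S \<subseteq> ?T"
    proof safe
      fix p assume p: "p \<in> cdom z" "p \<in> cdom d"
      then have "g (cmap z p) = cmap c p" "p \<in> cdom c" using h unfolding P by (auto simp: homeomorphism_def)
      then show "g (cmap z p) \<in> ?T" using p by (metis IntI imageI)
    qed
    have e: "in_chart z (cmap d) v = in_chart c (cmap d) (g v)" if "v \<in> ?S" for v
      using z(3) SV that by auto
    have sg: "smooth_on ?S g" by (rule smooth_on_subset[OF sm(2) SV])
    have "smooth_on ?S (\<lambda>v. in_chart c (cmap d) (g v))" by (rule smooth_on_compose[OF o sg old(1)[OF c d] im])
    then have "smooth_on ?S (in_chart z (cmap d))" using smooth_on_cong[OF o(1), of "in_chart z (cmap d)" "\<lambda>v. in_chart c (cmap d) (g v)", OF e] by blast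
    moreover have "0 < det (matrix (frechet_derivative (in_chart z (cmap d)) (at u)))" if u: "u \<in> ?S" for u
    proof -
      have gu: "g u \<in> ?T" using im u by blast
      have "det (matrix (frechet_derivative (in_chart z (cmap d)) (at u))) =
        det (matrix (frechet_derivative (in_chart c (cmap d)) (at (g u)))) * det (matrix (frechet_derivative g (at u)))"
        using frechet_derivative_cong_open[OF o(1) u e] det_compose[OF sg old(1)[OF c d] u gu] by (simp only:)
      then show ?thesis using old(2)[OF c d gu] dg[OF subsetD[OF SV u]] by simp
    qed
    ultimately show ?thesis by blast
  qed
  have dz: "smooth_on (cmap d ` (cdom d \<inter> cdom z)) (in_chart d (cmap z)) \<and>
    (\<forall>u\<in>cmap d ` (cdom d \<inter> cdom z). 0 < det (matrix (frechet_derivative (in_chart d (cmap z)) (at u))))" if d: "d \<in> A" for d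
  proof -
    let ?S = "cmap d ` (cdom d \<inter> cdom z)"
    have id: "is_chart d" by (rule chart[OF d])
    have o: "open ?S" by (intro chart_image_open id chart_props(1) z)
    have S: "?S \<subseteq> cmap d ` (cdom d \<inter> cdom c)" unfolding P by blast
    have im: "in_chart d (cmap c) ` ?S \<subseteq> U" using chart_props(5)[OF id] unfolding P by auto
    have e: "in_chart d (cmap z) v = \<psi> (in_chart d (cmap c) v)" for v by (simp add: P)
    have sg: "smooth_on ?S (in_chart d (cmap c))" by (rule smooth_on_subset[OF old(1)[OF d c] S])
    have "smooth_on ?S (in_chart d (cmap z))" unfolding e by (rule smooth_on_compose[OF o U(1) sg sm(1) im])
    moreover have "0 < det (matrix (frechet_derivative (in_chart d (cmap z)) (at u)))" if u: "u \<in> ?S" for u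
    proof -
      have gu: "in_chart d (cmap c) u \<in> U" using im u by blast
      show ?thesis
        unfolding e det_compose[OF sg sm(1) u gu] using dp[OF gu] old(2)[OF d c subsetD[OF S u]] by simp
    qed
    ultimately show ?thesis by blast
  qed
  have "oriented_atlas (insert z A)"
    unfolding oriented_atlas_def
  proof (intro conjI ballI)
    fix a assume "a \<in> insert z A" then show "is_chart a" using z(1) chart by blast
  next
    fix a b assume ab: "a \<in> insert z A" "b \<in> insert z A"
    consider "a = z" "b = z" | "a = z" "b \<in> A" | "a \<in> A" "b = z" | "a \<in> A" "b \<in> A" using ab by blast
    then have "smooth_on (cmap a ` (cdom a \<inter> cdom b)) (in_chart a (cmap b)) \<and>
      (\<forall>u\<in>cmap a ` (cdom a \<inter> cdom b). 0 < det (matrix (frechet_derivative (in_chart a (cmap b)) (at u))))"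
    proof cases
      case 1 show ?thesis unfolding 1 by (rule zz)
    next
      case 2 show ?thesis unfolding 2(1) by (rule zd[OF 2(2)])
    next
      case 3 show ?thesis unfolding 3(2) by (rule dz[OF 3(1)])
    next
      case 4 show ?thesis using old[OF 4] by blast
    qed
    then show "smooth_on (cmap a ` (cdom a \<inter> cdom b)) (in_chart a (cmap b))"
      "\<And>u. u \<in> cmap a ` (cdom a \<inter> cdom b) \<Longrightarrow> 0 < det (matrix (frechet_derivative (in_chart a (cmap b)) (at u)))"
      by blast+
  qed
  then show ?thesis unfolding z_def .
qed

end

context signed_surface
begin

text \<open>A frame with \<alpha>0 parallel to \<open>H\<close> is chosen first. The map \<psi>
  integrates its rescaled coframe, so the coordinate lines of the new chart follow \<open>a1\<close>
  and \<open>a2\<close>, along which the second fundamental form is a multiple of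
  \<open>H\<close>.\<close>

theorem parametrization_of_closed:
  assumes closed: closed_mixed_forms and pA: "p \<in> carrier A"
  shows "\<exists>z. p \<in> cdom z \<and> conformal_mean_directional_parametrization A f z"
proof -
  obtain c where c: "c \<in> A" "p \<in> cdom c" using carrierE[OF pA] .
  let ?F = "in_chart c f" and ?u = "cmap c p"
  have ic: "is_chart c" by (rule chart[OF c(1)])
  obtain e1 e2 where "framed_surf s ?F (cmap c ` cdom c) e1 e2" by (rule chart_frame[OF c(1) s])
  then have "iso_surf s ?F (cmap c ` cdom c) e1 e2" by (intro iso c) auto
  then interpret C: iso_surf s ?F "cmap c ` cdom c" e1 e2 .
  have u: "?u \<in> cmap c ` cdom c" using c(2) by (rule imageI)
  obtain r a1 a2 where r: "r > 0" "ball ?u r \<subseteq> cmap c ` cdom c" and i: "iso_surf s ?F (ball ?u r) a1 a2"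
    and par: "\<And>x. x \<in> ball ?u r \<Longrightarrow> \<exists>k. (1/2) *\<^sub>R (second_ff ?F x (a1 x) (a1 x) - second_ff ?F x (a2 x) (a2 x)) = k *\<^sub>R mean_curv ?F x"
    by (rule C.mean_directional_frame[OF u]) blast
  let ?B = "ball ?u r"
  interpret R: iso_surf s ?F ?B a1 a2 by (rule i)
  have uB: "?u \<in> ?B" using r(1) by simp
  have cl: "ext_deriv R.star\<Omega> x v w = 0" if "x \<in> ?B" for x v w
    using closed c(1) i r(2) that unfolding closed_mixed_forms_def by blast
  obtain q where q: "smooth_on ?B q" "\<And>x. q x > 0" "\<And>x v. x \<in> ?B \<Longrightarrow> dir_deriv q x v = q x * R.star\<Omega> x v"
    using R.potential_exists[OF convex_ball uB cl] by blast
  obtain \<psi> \<kappa> where \<psi>: "smooth_on ?B (\<psi> :: real^2 \<Rightarrow> real^2)" and \<kappa>: "\<And>x. x \<in> ?B \<Longrightarrow> \<kappa> x > 0"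
    and d\<psi>: "\<And>x v. x \<in> ?B \<Longrightarrow> dir_deriv \<psi> x v = \<kappa> x *\<^sub>R vector [dir_deriv ?F x v \<bullet> R.E1 x, dir_deriv ?F x v \<bullet> R.E2 x]"
  proof (rule R.mean_directional_coordinates[OF convex_ball uB q(1,3,2) par])
    fix \<psi> \<kappa> assume *: "smooth_on ?B (\<psi> :: real^2 \<Rightarrow> real^2)" "\<And>x. x \<in> ?B \<Longrightarrow> \<kappa> x > 0"
      "\<And>x v. x \<in> ?B \<Longrightarrow> dir_deriv \<psi> x v = \<kappa> x *\<^sub>R vector [dir_deriv ?F x v \<bullet> R.E1 x, dir_deriv ?F x v \<bullet> R.E2 x]"
    show thesis by (rule that[OF *])
  qed
  \<comment> \<open>The derivative of \<psi> is \<kappa> times the coframe of a positive frame. This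
    makes the new chart compatible with the orientation.\<close>
  have det\<psi>: "det (matrix (frechet_derivative \<psi> (at x))) > 0" if x: "x \<in> ?B" for x
  proof -
    define p1 q1 p2 q2 where "p1 = dir_deriv ?F x dx \<bullet> R.E1 x" and "q1 = dir_deriv ?F x dx \<bullet> R.E2 x"
      and "p2 = dir_deriv ?F x dy \<bullet> R.E1 x" and "q2 = dir_deriv ?F x dy \<bullet> R.E2 x"
    have "dx = p1 *\<^sub>R a1 x + q1 *\<^sub>R a2 x" "dy = p2 *\<^sub>R a1 x + q2 *\<^sub>R a2 x"
      unfolding p1_def q1_def p2_def q2_def by (rule R.expand[OF x])+
    then have "det (vector [dx, dy] :: real^2^2) = (p1 * q2 - q1 * p2) * det (vector [a1 x, a2 x] :: real^2^2)"
      unfolding det_2_rows by (simp only:) (simp add: algebra_simps)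
    then have "(p1 * q2 - q1 * p2) * det (vector [a1 x, a2 x] :: real^2^2) = 1" by (simp add: det_2_rows axis_def)
    moreover have "det (vector [a1 x, a2 x] :: real^2^2) > 0" using R.frames[OF x] by (simp add: pos_tangent_frame_def)
    ultimately have "p1 * q2 - q1 * p2 > 0" by (metis zero_less_mult_pos2 zero_less_one)
    moreover have "det (matrix (frechet_derivative \<psi> (at x))) = \<kappa> x * \<kappa> x * (p1 * q2 - q1 * p2)"
      unfolding det_matrix_2 d\<psi>[OF x] p1_def q1_def p2_def q2_def by (simp add: algebra_simps)
    ultimately show ?thesis using \<kappa>[OF x] by simp
  qed
  have "det (vector [dir_deriv \<psi> ?u dx, dir_deriv \<psi> ?u dy] :: real^2^2) \<noteq> 0"
    using det\<psi>[OF uB] unfolding det_2_rows det_matrix_2 by simp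
  then obtain U V g where U: "open U" "?u \<in> U" "U \<subseteq> ?B" and V: "open V" and h: "homeomorphism U V \<psi> g" and sg: "smooth_on V g"
    by (rule smooth_inverse_function_theorem[OF open_ball \<psi> uB])
  have Uc: "U \<subseteq> cmap c ` cdom c" using U(3) r(2) by (rule order_trans)
  define z :: "'a chart" where "z = ({p \<in> cdom c. cmap c p \<in> U}, \<lambda>p. \<psi> (cmap c p))"
  note z = chart_compose[OF ic U(1) Uc V h, folded z_def]
  have zdom: "cdom z = {p \<in> cdom c. cmap c p \<in> U}" by (simp add: z_def)
  have atlas: "oriented_atlas (insert z A)"
    unfolding z_def by (rule atlas_insert[OF c(1) U(1) Uc V h smooth_on_subset[OF \<psi> U(3)] sg det\<psi>[OF subsetD[OF U(3)]]])
  let ?G = "in_chart z f"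
  have gB: "g v \<in> ?B" if "v \<in> V" for v using h U(3) that unfolding homeomorphism_def by blast
  have \<psi>g: "\<psi> (g v) = v" if "v \<in> V" for v using h that unfolding homeomorphism_def by blast
  have Q: "reparam ?F ?B ?G V g"
  proof
    show "open V" "open ?B" "smooth_on ?B ?F" "smooth_on V g" by (rule V open_ball R.smooth_F sg)+
    show "g ` V \<subseteq> ?B" using gB by blast
    show "?G x = ?F (g x)" if "x \<in> V" for x unfolding z(3)[OF that] ..
    show "inj (frechet_derivative ?F (at x))" if "x \<in> ?B" for x by (rule F_immersion[OF c(1) subsetD[OF r(2) that]])
    show "0 < det (matrix (frechet_derivative g (at v)))" if v: "v \<in> V" for v
    proof -
      have "det (matrix (frechet_derivative (\<lambda>x. \<psi> (g x)) (at v))) = 1" by (rule det_identity_on[OF V v \<psi>g])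
      then have "det (matrix (frechet_derivative \<psi> (at (g v)))) * det (matrix (frechet_derivative g (at v))) = 1"
        using det_compose[OF sg \<psi> v gB[OF v]] by simp
      then show ?thesis using det\<psi>[OF gB[OF v]] by (metis zero_less_mult_pos zero_less_one)
    qed
  qed
  then interpret Q: reparam ?F ?B ?G V g .
  \<comment> \<open>The inverse of the derivative of \<psi>: the coordinate fields are
    \<open>a1\<close> and \<open>a2\<close> divided by \<kappa>. Conformality and the
    mean-directional property are read off from this.\<close>
  have dg: "dir_deriv g v w = (w$1 / \<kappa> (g v)) *\<^sub>R a1 (g v) + (w$2 / \<kappa> (g v)) *\<^sub>R a2 (g v)" if v: "v \<in> V" for v w
  proof -
    have "dir_deriv \<psi> (g v) (dir_deriv g v w) = w"
      using dir_deriv_compose[OF sg \<psi> v gB[OF v], of w] dir_deriv_eqI_open[OF V v \<psi>g, where v = w] by (simp add: frechet_derivative_ident)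
    then have "\<kappa> (g v) * (dir_deriv ?F (g v) (dir_deriv g v w) \<bullet> R.E1 (g v)) = w$1"
      "\<kappa> (g v) * (dir_deriv ?F (g v) (dir_deriv g v w) \<bullet> R.E2 (g v)) = w$2"
      unfolding d\<psi>[OF gB[OF v]] by (auto simp: vec_eq_iff forall_2)
    then have "dir_deriv ?F (g v) (dir_deriv g v w) \<bullet> R.E1 (g v) = w$1 / \<kappa> (g v)"
      "dir_deriv ?F (g v) (dir_deriv g v w) \<bullet> R.E2 (g v) = w$2 / \<kappa> (g v)"
      using \<kappa>[OF gB[OF v]] by (auto simp: field_simps)
    then show ?thesis using R.expand[OF gB[OF v], of "dir_deriv g v w"] by simp
  qed
  have dgd: "dir_deriv g v dx = (1 / \<kappa> (g v)) *\<^sub>R a1 (g v)" "dir_deriv g v dy = (1 / \<kappa> (g v)) *\<^sub>R a2 (g v)"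
    "dir_deriv g v (\<kappa> (g v) *\<^sub>R dx) = a1 (g v)" "dir_deriv g v (\<kappa> (g v) *\<^sub>R dy) = a2 (g v)" if v: "v \<in> V" for v
    unfolding dg[OF v] using \<kappa>[OF gB[OF v]] by (simp_all add: axis_def)
  have fr: "metric ?F x (a1 x) (a1 x) = 1" "metric ?F x (a2 x) (a2 x) = 1" "metric ?F x (a1 x) (a2 x) = 0" if "x \<in> ?B" for x
    using R.frames[OF that] by (simp_all add: pos_tangent_frame_def)
  have msc: "metric ?F x (a *\<^sub>R v) (b *\<^sub>R w) = a * b * metric ?F x v w" if "x \<in> ?B" for x a b v w
    by (simp add: metric_def linear_scale[OF R.lin_df[OF that]])
  have "complex_chart A f z"
    unfolding complex_chart_def z(2)
  proof (intro conjI atlas ballI)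
    show "cdom z \<subseteq> carrier A" using zdom chart_subset[OF c(1)] by blast
    fix v assume v: "v \<in> V"
    show "metric ?G v dx dx = metric ?G v dy dy" "metric ?G v dx dy = 0"
      unfolding Q.metric_G[OF v] dgd[OF v] msc[OF gB[OF v]] fr[OF gB[OF v]] by simp_all
  qed
  moreover have "mean_directional_curvature_line ?G (\<lambda>\<tau>. v + \<tau> *\<^sub>R d) {\<tau>. v + \<tau> *\<^sub>R d \<in> V}" if d: "d = dx \<or> d = dy" for v d
    unfolding mean_directional_curvature_line_def
  proof (intro ballI)
    fix \<tau> assume "\<tau> \<in> {\<tau>. v + \<tau> *\<^sub>R d \<in> V}"
    then have w: "v + \<tau> *\<^sub>R d \<in> V" by blast
    define x where "x = g (v + \<tau> *\<^sub>R d)"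
    have x: "x \<in> ?B" unfolding x_def by (rule gB[OF w])
    define a where "a = (if d = dx then a1 x else a2 x)"
    have dga: "dir_deriv g (v + \<tau> *\<^sub>R d) (\<kappa> x *\<^sub>R d) = a"
      using dgd(3,4)[OF w] d unfolding a_def x_def by auto
    obtain k where k: "R.\<alpha>0 x = k *\<^sub>R R.H x" using par[OF x] by blast
    have "R.\<alpha>11 x = (1 + k) *\<^sub>R R.H x" "R.\<alpha>22 x = (1 - k) *\<^sub>R R.H x"
      using R.\<alpha>_H[OF x] unfolding k by (simp_all add: algebra_simps)
    then have "second_ff ?F x a a \<in> span {R.H x}" unfolding a_def by (auto simp: span_singleton)
    moreover have "metric ?F x a a = 1" unfolding a_def using fr[OF x] by simp
    ultimately have "metric ?G (v + \<tau> *\<^sub>R d) (\<kappa> x *\<^sub>R d) (\<kappa> x *\<^sub>R d) = 1"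
      "second_ff ?G (v + \<tau> *\<^sub>R d) (\<kappa> x *\<^sub>R d) (\<kappa> x *\<^sub>R d) \<in> span {mean_curv ?G (v + \<tau> *\<^sub>R d)}"
      unfolding Q.metric_G[OF w] Q.second_ff_G[OF w] Q.mean_curv_G[OF w] dga by (simp_all only: x_def[symmetric])
    moreover have "((\<lambda>\<tau>. v + \<tau> *\<^sub>R d) has_vector_derivative (1 / \<kappa> x) *\<^sub>R (\<kappa> x *\<^sub>R d)) (at \<tau>)"
      using \<kappa>[OF x] by (auto intro!: derivative_eq_intros)
    moreover have "1 / \<kappa> x \<noteq> 0" using \<kappa>[OF x] by simp
    ultimately show "\<exists>X k. metric ?G (v + \<tau> *\<^sub>R d) X X = 1 \<and> second_ff ?G (v + \<tau> *\<^sub>R d) X X \<in> span {mean_curv ?G (v + \<tau> *\<^sub>R d)} \<and>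
      k \<noteq> 0 \<and> ((\<lambda>\<tau>. v + \<tau> *\<^sub>R d) has_vector_derivative k *\<^sub>R X) (at \<tau>)" by (intro exI conjI)
  qed
  then have "\<forall>v\<in>V. \<forall>d\<in>{dx, dy}. mean_directional_curvature_line ?G (\<lambda>\<tau>. v + \<tau> *\<^sub>R d) {\<tau>. v + \<tau> *\<^sub>R d \<in> V}" by simp
  ultimately have "conformal_mean_directional_parametrization A f z"
    unfolding conformal_mean_directional_parametrization_def z(2) by blast
  moreover have "p \<in> cdom z" unfolding zdom using c(2) U(2) by blast
  ultimately show ?thesis by blast
qed

end

section \<open>From closed mixed forms to a deformation\<close>

lemma (in reparam) restrict:
  assumes "open S'" "S' \<subseteq> S" "open T'" "T' \<subseteq> T" "g ` S' \<subseteq> T'"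
  shows "reparam F T' G S' g"
proof
  show "smooth_on T' F" "smooth_on S' g" using smooth_on_subset smooth_F smooth_g assms by blast+
qed (use assms G det_g immersion in auto)

context signed_surface
begin

text \<open>The bending field is a primitive of the form df \<odot> l, closed by the dual relation.
  It is constructed in one chart, but the required properties are quantified over all charts; hence
  \<open>l\<close>, the field and the normal frame are carried to the surface, and every chart is
  checked to give a \<open>dual_deformation\<close>.\<close>

theorem deformation_of_closed:
  assumes closed: closed_mixed_forms and pA: "p \<in> carrier A"
  shows "\<exists>V T. open V \<and> p \<in> V \<and> V \<subseteq> carrier A \<and> bending_field_on A f V T \<and> nontrivial_on f V T \<and>
    preserves_mean_curv_parallelly A f V T \<and> (\<exists>t\<in>{1, - 1}. preserves_gauss_lift_holomorphicity A f V T t)"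
proof -
  obtain c where c: "c \<in> A" "p \<in> cdom c" using carrierE[OF pA] .
  let ?F = "in_chart c f" and ?u = "cmap c p"
  have ic: "is_chart c" by (rule chart[OF c(1)])
  obtain r e1 e2 where r: "r > 0" "ball ?u r \<subseteq> cmap c ` cdom c" and i: "iso_surf s ?F (ball ?u r) e1 e2"
    by (rule local_frame[OF c(1) chart_props(2)[OF ic] order_refl imageI[OF c(2)]])
  let ?B = "ball ?u r"
  interpret R: iso_surf s ?F ?B e1 e2 by (rule i)
  have uB: "?u \<in> ?B" using r(1) by simp
  have cl: "ext_deriv R.star\<Omega> x v w = 0" if "x \<in> ?B" for x v w
    using closed c(1) i r(2) that unfolding closed_mixed_forms_def by blast
  obtain q where q: "smooth_on ?B q" "\<And>x. q x > 0" "\<And>x v. x \<in> ?B \<Longrightarrow> dir_deriv q x v = q x * R.star\<Omega> x v"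
    using R.potential_exists[OF convex_ball uB cl] by blast
  obtain l where l: "R.dual_map l" and l0: "\<And>x. x \<in> ?B \<Longrightarrow> \<exists>v. dir_deriv l x v \<noteq> 0"
    using R.dual_map_of_potential[OF convex_ball uB q(1,3,2)] by blast
  have sl: "smooth_on ?B l" using l by (simp add: R.dual_map_def)
  obtain Tc where sT: "smooth_on ?B Tc" and hT: "\<And>x. x \<in> ?B \<Longrightarrow> (Tc has_derivative (\<lambda>v. dir_deriv ?F x v \<odot> l x)) (at x)"
  proof (rule poincare_lemma[OF open_ball convex_ball uB, of "\<lambda>x v. dir_deriv ?F x v \<odot> l x"])
    show "linear (\<lambda>v. dir_deriv ?F x v \<odot> l x)" if "x \<in> ?B" for x
      by (intro linearI) (simp_all add: linear_add[OF R.lin_df[OF that]] linear_scale[OF R.lin_df[OF that]] simps)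
    show "smooth_on ?B (\<lambda>x. dir_deriv ?F x v \<odot> l x)" for v
      by (intro R.smooth_prod smooth_on_dir_deriv R.smooth_F sl)
    fix x v w assume x: "x \<in> ?B"
    have "dir_deriv (\<lambda>x. dir_deriv ?F x w \<odot> l x) x v = dir_deriv ?F x w \<odot> dir_deriv l x v + hess ?F x v w \<odot> l x" for v w
      unfolding R.deriv_prod[OF smooth_on_dir_deriv[OF R.smooth_F] sl x] hess_def ..
    then show "dir_deriv (\<lambda>x. dir_deriv ?F x w \<odot> l x) x v = dir_deriv (\<lambda>x. dir_deriv ?F x v \<odot> l x) x w"
      using l x R.hess_sym[OF x, of v w] by (simp add: R.dual_map_def)
  qed blast
  have dT: "dir_deriv Tc x v = dir_deriv ?F x v \<odot> l x" if "x \<in> ?B" for x v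
    by (rule dir_deriv_eq[OF hT[OF that]])
  define V where "V = {q \<in> cdom c. cmap c q \<in> ?B}"
  define T where "T q = Tc (cmap c q)" for q
  define L where "L q = l (cmap c q)" for q
  define X3 where "X3 q = R.E3 (cmap c q)" for q
  define X4 where "X4 q = R.n3 (cmap c q)" for q
  define D where "D d = cmap d ` (cdom d \<inter> V)" for d :: "'a chart"
  have oV: "open V" unfolding V_def by (rule chart_preimage_open[OF ic open_ball])
  have rep: "reparam ?F ?B (in_chart d f) (D d) (in_chart d (cmap c))" if d: "d \<in> A" for d
  proof (rule reparam.restrict[OF transition[OF atlas_self[OF d] c(1)]])
    show "open (D d)" unfolding D_def by (rule chart_image_open[OF chart[OF d] oV])
    show "D d \<subseteq> cmap d ` (cdom d \<inter> cdom c)" unfolding D_def V_def by blast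
    show "open ?B" "?B \<subseteq> cmap c ` cdom c" by (rule open_ball r(2))+
    show "in_chart d (cmap c) ` D d \<subseteq> ?B" unfolding D_def V_def using chart_props(5)[OF chart[OF d]] by auto
  qed
  have chartwise: "\<exists>b1 b2. dual_deformation s (in_chart d f) (D d) b1 b2 (in_chart d L) (in_chart d T)" if d: "d \<in> A" for d
  proof -
    interpret Q: reparam ?F ?B "in_chart d f" "D d" "in_chart d (cmap c)" by (rule rep[OF d])
    obtain b1 b2 where fr: "framed_surf s (in_chart d f) (D d) b1 b2"
      using immersion_frame[OF Q.open_S Q.smooth_G Q.inj_G s] .
    interpret G: framed_surf s "in_chart d f" "D d" b1 b2 by (rule fr)
    have "G.dual_map (in_chart d L)" unfolding L_def by (rule R.dual_map_reparam[OF l rep[OF d] fr])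
    moreover have "smooth_on (D d) (in_chart d T)" unfolding T_def by (rule Q.smooth_comp[OF sT])
    moreover have "dir_deriv (in_chart d T) x v = dir_deriv (in_chart d f) x v \<odot> in_chart d L x" if x: "x \<in> D d" for x v
      unfolding T_def L_def Q.deriv_comp[OF sT x] Q.deriv_G[OF x] by (rule dT[OF Q.gT[OF x]])
    ultimately have "dual_deformation s (in_chart d f) (D d) b1 b2 (in_chart d L) (in_chart d T)"
      by (intro dual_deformation.intro dual_deformation_axioms.intro fr)
    then show ?thesis by blast
  qed
  \<comment> \<open>\<open>moved\<close> written out on the surface instead of in a chart, so that a
    single pair of fields serves all charts.\<close>
  define e3 where "e3 t q = inverse (sqrt (1 + t\<^sup>2 * (L q \<bullet> L q))) *\<^sub>R (X3 q \<odot> (quat_one + t *\<^sub>R L q))" for t q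
  define e4 where "e4 t q = inverse (sqrt (1 + t\<^sup>2 * (L q \<bullet> L q))) *\<^sub>R (X4 q \<odot> (quat_one + t *\<^sub>R L q))" for t q
  have ch: "smooth_on ({-1<..<1} \<times> D d) (\<lambda>(t, u). in_chart d (e3 t) u) \<and>
      smooth_on ({-1<..<1} \<times> D d) (\<lambda>(t, u). in_chart d (e4 t) u) \<and>
      (\<forall>t\<in>{-1<..<1}. \<forall>u\<in>D d. normal_frame (in_chart d (deform f T t)) u (in_chart d (e3 t) u) (in_chart d (e4 t) u)) \<and>
      (\<forall>u\<in>D d. (\<forall>v. ((\<lambda>t. omega34 (in_chart d (deform f T t)) (in_chart d (e3 t)) (in_chart d (e4 t)) u v) has_real_derivative 0) (at 0)) \<and>
          ((\<lambda>t. mean_curv (in_chart d (deform f T t)) u \<bullet> in_chart d (e3 t) u) has_real_derivative 0) (at 0) \<and>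
          ((\<lambda>t. mean_curv (in_chart d (deform f T t)) u \<bullet> in_chart d (e4 t) u) has_real_derivative 0) (at 0))" if d: "d \<in> A" for d
  proof -
    obtain b1 b2 where "dual_deformation s (in_chart d f) (D d) b1 b2 (in_chart d L) (in_chart d T)"
      using chartwise[OF d] by blast
    then interpret E: dual_deformation s "in_chart d f" "D d" b1 b2 "in_chart d L" "in_chart d T" .
    interpret Q: reparam ?F ?B "in_chart d f" "D d" "in_chart d (cmap c)" by (rule rep[OF d])
    have Ft: "in_chart d (deform f T t) = E.Ft t" for t by (simp add: fun_eq_iff deform_def E.Ft_def)
    have m3: "in_chart d (e3 t) u = E.moved (in_chart d X3) t u" "in_chart d (e4 t) u = E.moved (in_chart d X4) t u" for t u
      by (simp_all add: e3_def e4_def E.moved_def E.\<rho>_def E.m_def)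
    have sX: "smooth_on (D d) (in_chart d X3)" "smooth_on (D d) (in_chart d X4)"
      unfolding X3_def X4_def by (rule Q.smooth_comp[OF R.smooth_E3] Q.smooth_comp[OF R.smooth_n3])+
    have nf: "normal_frame (in_chart d f) u (in_chart d X3 u) (in_chart d X4 u)" if u: "u \<in> D d" for u
      unfolding normal_frame_def Q.normal_space_G[OF u] X3_def X4_def norm_eq_sqrt_inner
      using R.E3[OF Q.gT[OF u]] R.n3[OF Q.gT[OF u]] by simp
    then have nm: "in_chart d X3 u \<in> normal_space (in_chart d f) u" "in_chart d X4 u \<in> normal_space (in_chart d f) u"
      if "u \<in> D d" for u using that by (simp_all add: normal_frame_def)
    show ?thesis
      unfolding Ft m3
    proof (intro conjI ballI allI)
      show "smooth_on ({-1<..<1} \<times> D d) (\<lambda>(t, u). E.moved (in_chart d X3) t u)"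
        "smooth_on ({-1<..<1} \<times> D d) (\<lambda>(t, u). E.moved (in_chart d X4) t u)"
        by (rule E.smooth_moved[OF sX(1) open_greaterThanLessThan] E.smooth_moved[OF sX(2) open_greaterThanLessThan])+
      fix u assume u: "u \<in> D d"
      show "normal_frame (E.Ft t) u (E.moved (in_chart d X3) t u) (E.moved (in_chart d X4) t u)" for t
        by (rule E.normal_frame_moved[where ?x3.0 = "in_chart d X3" and ?x4.0 = "in_chart d X4", OF u nf[OF u]])
      show "((\<lambda>t. omega34 (E.Ft t) (E.moved (in_chart d X3) t) (E.moved (in_chart d X4) t) u v) has_real_derivative 0) (at 0)" for v
        by (rule E.omega34_variation[OF u sX nf])
      show "((\<lambda>t. mean_curv (E.Ft t) u \<bullet> E.moved (in_chart d X3) t u) has_real_derivative 0) (at 0)"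
        "((\<lambda>t. mean_curv (E.Ft t) u \<bullet> E.moved (in_chart d X4) t u) has_real_derivative 0) (at 0)"
        by (rule E.mean_curv_variation[where x = "in_chart d X3", OF u nm(1)[OF u]]
          E.mean_curv_variation[where x = "in_chart d X4", OF u nm(2)[OF u]])+
    qed
  qed
  have "bending_field_on A f V T"
    unfolding bending_field_on_def smooth_map_on_def
  proof (intro conjI ballI allI)
    fix d assume d: "d \<in> A"
    obtain b1 b2 where "dual_deformation s (in_chart d f) (D d) b1 b2 (in_chart d L) (in_chart d T)"
      using chartwise[OF d] by blast
    then interpret E: dual_deformation s "in_chart d f" "D d" b1 b2 "in_chart d L" "in_chart d T" .
    show "smooth_on (cmap d ` (cdom d \<inter> V)) (in_chart d T)" using E.smooth_T unfolding D_def .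
    show "dir_deriv (in_chart d T) u v \<bullet> dir_deriv (in_chart d f) u w + dir_deriv (in_chart d f) u v \<bullet> dir_deriv (in_chart d T) u w = 0"
      if "u \<in> cmap d ` (cdom d \<inter> V)" for u v w
      using E.bending[of u v w] that unfolding D_def .
  qed
  moreover have "nontrivial_on f V T"
    unfolding nontrivial_on_def
  proof (intro allI impI notI, elim conjE)
    fix W assume W: "open W" "W \<noteq> {}" "W \<subseteq> V" and "trivial_on f W T"
    then obtain B b where B: "transpose B = - (B::real^4^4)" "\<And>q. q \<in> W \<Longrightarrow> T q = B *v f q + b"
      unfolding trivial_on_def by blast
    define W0 where "W0 = cmap c ` (cdom c \<inter> W)"
    have W0: "open W0" "W0 \<subseteq> ?B"
      unfolding W0_def using chart_image_open[OF ic W(1)] W(3) by (auto simp: V_def)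
    interpret S: iso_surf s ?F W0 e1 e2 by (rule R.iso_restrict[OF W0])
    obtain x where x: "x \<in> W0" using W(2,3) unfolding W0_def V_def by blast
    have "S.dual_map l"
      using l smooth_on_subset[OF sl W0(2)] W0(2) unfolding S.dual_map_def R.dual_map_def by blast
    moreover have "Tc y = B *v ?F y + b" if "y \<in> W0" for y
    proof -
      obtain q where "q \<in> cdom c" "q \<in> W" "y = cmap c q" using \<open>y \<in> W0\<close> unfolding W0_def by blast
      then show ?thesis using B(2)[of q] chart_props(5)[OF ic, of q] by (simp add: T_def)
    qed
    ultimately have "dir_deriv l x v = 0" for v
      using S.trivial_dual_constant[OF _ dT[OF subsetD[OF W0(2)]] B(1) _ x] by blast
    then show False using l0[of x] W0(2) x by blast
  qed
  moreover have "preserves_mean_curv_parallelly A f V T"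
    unfolding preserves_mean_curv_parallelly_def Let_def
    by (rule ballI, rule exI[of _ V], intro conjI oV order_refl, assumption, rule exI[of _ "1::real"],
        rule conjI[OF zero_less_one], rule exI[of _ e3], rule exI[of _ e4], rule ballI, rule ch[unfolded D_def])
  moreover have "preserves_gauss_lift_holomorphicity A f V T s"
    unfolding preserves_gauss_lift_holomorphicity_def
  proof (intro conjI ballI allI)
    show "gauss_lift_holomorphic A f s" using gauss_lift_holomorphic_iff[OF s_cases pA] by blast
    fix d u v w assume d: "d \<in> A" and u: "u \<in> cmap d ` (cdom d \<inter> V)"
    obtain b1 b2 where "dual_deformation s (in_chart d f) (D d) b1 b2 (in_chart d L) (in_chart d T)"
      using chartwise[OF d] by blast
    then interpret E: dual_deformation s "in_chart d f" "D d" b1 b2 "in_chart d L" "in_chart d T" .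
    have "in_chart d (deform f T t) = E.Ft t" for t by (simp add: fun_eq_iff deform_def E.Ft_def)
    then show "((\<lambda>t. gauss_lift_metric (in_chart d (deform f T t)) s 1 u v w) has_real_derivative 0) (at 0)"
      using E.gauss_lift_metric_variation[of u v w] u unfolding D_def by simp
  qed
  moreover have "p \<in> V" "V \<subseteq> carrier A" unfolding V_def using c uB chart_subset[OF c(1)] by blast+
  ultimately show ?thesis using oV s_cases by (intro exI[of _ V] exI[of _ T]) auto
qed

end

theorem theorem2:
  fixes A :: "'a::{t2_space,second_countable_topology} chart set"
    and f :: "'a \<Rightarrow> real^4"
  assumes "immersed_surface A f"
    and "umbilic_free A f"
    and "superconformal A f"
    and "\<forall>c\<in>A. \<forall>p\<in>cdom c. mean_curv (in_chart c f) (cmap c p) \<noteq> 0"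
  defines "cond_i \<equiv> isotropically_isothermic A f"
    and "cond_ii \<equiv> (\<forall>p\<in>carrier A. \<exists>z. p \<in> cdom z \<and>
           conformal_mean_directional_parametrization A f z)"
    and "cond_iii \<equiv> (\<forall>p\<in>carrier A. \<exists>V T. open V \<and> p \<in> V \<and> V \<subseteq> carrier A \<and>
           bending_field_on A f V T \<and> nontrivial_on f V T \<and>
           preserves_mean_curv_parallelly A f V T \<and>
           (\<exists>s\<in>{1, - 1}. preserves_gauss_lift_holomorphicity A f V T s))"
  shows "(cond_i \<longleftrightarrow> cond_ii) \<and> (cond_ii \<longleftrightarrow> cond_iii)"
proof -
  interpret C: circle_surface A f
    by (intro circle_surface.intro surface.intro circle_surface_axioms.intro assms(1-4))
  obtain s where s: "s = 1 \<or> s = - 1" "\<And>p. p \<in> carrier A \<Longrightarrow> C.hol s p" by (rule C.sign_exists) (erule that, blast)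
  interpret S: signed_surface A f s
  proof
    show "s * s = 1" using s(1) by auto
    show "C.hol s p" if "p \<in> carrier A" for p by (rule s(2)[OF that])
  qed
  have "cond_i \<longleftrightarrow> S.closed_mixed_forms" unfolding cond_i_def by (rule S.isothermic_iff)
  moreover have "cond_ii \<longleftrightarrow> S.closed_mixed_forms"
    unfolding cond_ii_def by (meson S.closed_of_parametrization S.parametrization_of_closed)
  moreover have "cond_iii \<longleftrightarrow> S.closed_mixed_forms"
  proof
    assume iii: "cond_iii"
    show S.closed_mixed_forms
    proof (rule S.closed_of_deformation)
      fix p assume "p \<in> carrier A"
      from bspec[OF iii[unfolded cond_iii_def] this]
      show "\<exists>V T. open V \<and> p \<in> V \<and> V \<subseteq> carrier A \<and> bending_field_on A f V T \<and> nontrivial_on f V T \<and>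
        (\<exists>t\<in>{1, - 1}. preserves_gauss_lift_holomorphicity A f V T t)"
        by (elim exE conjE) (intro exI conjI)
    qed
  next
    assume S.closed_mixed_forms
    then show cond_iii unfolding cond_iii_def by (intro ballI S.deformation_of_closed)
  qed
  ultimately show ?thesis by blast
qed

end
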